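(* Let $\mathbb{F}$ be a perfect field of characteristic $p>0$ and let $L$ be a finite-dimensional $p$-nilpotent restricted Lie algebra over $\mathbb{F}$. Let $H$ be any restricted Lie algebra over $\mathbb{F}$ such that $u(L)\cong u(H)$ as associative $\mathbb{F}$-algebras. Then $L/(L'^p+\gamma_3(L))\cong H/(H'^p+\gamma_3(H))$ as restricted Lie algebras.
   Context: $u(L)$ denotes the restricted enveloping algebra of a restricted Lie algebra $L$; the $p$-map is written $x\mapsto x^p$. $L$ is $p$-nilpotent if every $x\in L$ satisfies $x^{p^s}=0$ for some $s$. $\gamma_i(L)$ is the $i$-th term of the lower central series ($\gamma_1(L)=L$, $\gamma_{i+1}(L)=[\gamma_i(L),L]$), and $L'=\gamma_2(L)$. For a Lie subalgebra $I\subseteq L$, $I^p$ denotes the restricted Lie subalgebra of $L$ generated by all $x^p$, $x\in I$; thus $L'^p=(L')^p$. *)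

theory Defs
  imports "Jordan_Normal_Form.Missing_VectorSpace" "HOL-Algebra.QuotRing"
begin

section \<open>Perfect fields of positive characteristic\<close>

text \<open>This is the library's \<open>CHAR\<close> (\<^const>\<open>semiring_char\<close>), for rings given as records.\<close>

definition ring_char :: "('k, 'm) ring_scheme \<Rightarrow> nat" where
  "ring_char F = Gcd {n::nat. [n] \<cdot>\<^bsub>F\<^esub> \<one>\<^bsub>F\<^esub> = \<zero>\<^bsub>F\<^esub>}"

text \<open>In characteristic \<open>p > 0\<close> a field is perfect iff every element has a \<open>p\<close>-th root;
  every field of characteristic \<open>0\<close> is perfect.\<close>

definition perfect_field :: "('k, 'm) ring_scheme \<Rightarrow> bool" where
  "perfect_field F \<longleftrightarrow> field F \<and>
     (ring_char F > 0 \<longrightarrow> (\<forall>a\<in>carrier F. \<exists>b\<in>carrier F. a = b [^]\<^bsub>F\<^esub> ring_char F))"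


section \<open>Restricted Lie algebras\<close>

text \<open>The field \<^const>\<open>mult\<close> of the underlying \<open>module\<close> record, on which the locale
  \<^locale>\<open>vectorspace\<close> imposes nothing, is the Lie bracket: \<open>x \<otimes>\<^bsub>L\<^esub> y\<close> is \<open>[x, y]\<close>.
  The field \<^const>\<open>one\<close> is not used.  \<open>pmap L x\<close> is the \<open>p\<close>-map \<open>x\<^sup>p\<close>.\<close>

record ('k, 'a) restricted_lie = "('k, 'a) module" +
  pmap :: "'a \<Rightarrow> 'a"

locale lie_algebra = vectorspace F L for F and L (structure) +
  assumes bracket_closed: "\<lbrakk>x \<in> carrier L; y \<in> carrier L\<rbrakk> \<Longrightarrow> x \<otimes> y \<in> carrier L"
    and bracket_add_left: "\<lbrakk>x \<in> carrier L; y \<in> carrier L; z \<in> carrier L\<rbrakk>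
          \<Longrightarrow> (x \<oplus> y) \<otimes> z = (x \<otimes> z) \<oplus> (y \<otimes> z)"
    and bracket_add_right: "\<lbrakk>x \<in> carrier L; y \<in> carrier L; z \<in> carrier L\<rbrakk>
          \<Longrightarrow> z \<otimes> (x \<oplus> y) = (z \<otimes> x) \<oplus> (z \<otimes> y)"
    and bracket_smult_left: "\<lbrakk>c \<in> carrier F; x \<in> carrier L; y \<in> carrier L\<rbrakk>
          \<Longrightarrow> (c \<odot> x) \<otimes> y = c \<odot> (x \<otimes> y)"
    and bracket_smult_right: "\<lbrakk>c \<in> carrier F; x \<in> carrier L; y \<in> carrier L\<rbrakk>
          \<Longrightarrow> x \<otimes> (c \<odot> y) = c \<odot> (x \<otimes> y)"
    and bracket_self: "x \<in> carrier L \<Longrightarrow> x \<otimes> x = \<zero>"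
    and jacobi: "\<lbrakk>x \<in> carrier L; y \<in> carrier L; z \<in> carrier L\<rbrakk>
          \<Longrightarrow> (x \<otimes> (y \<otimes> z)) \<oplus> (y \<otimes> (z \<otimes> x)) \<oplus> (z \<otimes> (x \<otimes> y)) = \<zero>"

text \<open>\<open>ad_coeff L x y n i\<close> is the coefficient of \<open>t\<^sup>i\<close> in \<open>ad(t x + y)\<^sup>n (x)\<close>, computed in
  \<open>L[t]\<close>; \<open>jacobson_term F L i x y\<close> is Jacobson's \<open>s\<^sub>i(x, y)\<close>, so that \<open>i s\<^sub>i(x, y)\<close> is the
  coefficient of \<open>t\<close> to the power \<open>i - 1\<close> in \<open>ad(t x + y)\<close> to the power \<open>p - 1\<close>
  applied to \<open>x\<close>.\<close>

primrec ad_coeff :: "('k, 'a, 'm) module_scheme \<Rightarrow> 'a \<Rightarrow> 'a \<Rightarrow> nat \<Rightarrow> nat \<Rightarrow> 'a" where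
  "ad_coeff L x y 0 = (\<lambda>i. if i = 0 then x else \<zero>\<^bsub>L\<^esub>)"
| "ad_coeff L x y (Suc n) = (\<lambda>i.
     (case i of 0 \<Rightarrow> \<zero>\<^bsub>L\<^esub> | Suc j \<Rightarrow> x \<otimes>\<^bsub>L\<^esub> ad_coeff L x y n j) \<oplus>\<^bsub>L\<^esub>
     (y \<otimes>\<^bsub>L\<^esub> ad_coeff L x y n i))"

definition jacobson_term ::
  "('k, 'c) ring_scheme \<Rightarrow> ('k, 'a, 'm) module_scheme \<Rightarrow> nat \<Rightarrow> 'a \<Rightarrow> 'a \<Rightarrow> 'a" where
  "jacobson_term F L i x y =
     inv\<^bsub>F\<^esub> ([i] \<cdot>\<^bsub>F\<^esub> \<one>\<^bsub>F\<^esub>) \<odot>\<^bsub>L\<^esub> ad_coeff L x y (ring_char F - 1) (i - 1)"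

locale restricted_lie_algebra = lie_algebra F L
  for F :: "('k, 'c) ring_scheme" and L :: "('k, 'a, 'm) restricted_lie_scheme" (structure) +
  assumes char_pos: "ring_char F > 0"
    and pmap_closed: "x \<in> carrier L \<Longrightarrow> pmap L x \<in> carrier L"
    and pmap_smult: "\<lbrakk>c \<in> carrier F; x \<in> carrier L\<rbrakk>
          \<Longrightarrow> pmap L (c \<odot> x) = (c [^]\<^bsub>F\<^esub> ring_char F) \<odot> pmap L x"
    and pmap_bracket: "\<lbrakk>x \<in> carrier L; y \<in> carrier L\<rbrakk>
          \<Longrightarrow> pmap L x \<otimes> y = ((\<lambda>z. x \<otimes> z) ^^ ring_char F) y"
    and pmap_add: "\<lbrakk>x \<in> carrier L; y \<in> carrier L\<rbrakk>
          \<Longrightarrow> pmap L (x \<oplus> y) = pmap L x \<oplus> pmap L y \<oplus>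
                (\<Oplus>i\<in>{1..<ring_char F}. jacobson_term F L i x y)"

definition p_nilpotent :: "('k, 'a, 'm) restricted_lie_scheme \<Rightarrow> bool" where
  "p_nilpotent L \<longleftrightarrow> (\<forall>x\<in>carrier L. \<exists>s. (pmap L ^^ s) x = \<zero>\<^bsub>L\<^esub>)"

definition bracket_space ::
  "('k, 'c) ring_scheme \<Rightarrow> ('k, 'a, 'm) module_scheme \<Rightarrow> 'a set \<Rightarrow> 'a set \<Rightarrow> 'a set" where
  "bracket_space F L A B = module.span F L {a \<otimes>\<^bsub>L\<^esub> b | a b. a \<in> A \<and> b \<in> B}"

text \<open>The lower central series is indexed from \<open>1\<close>; index \<open>0\<close> is a dummy value.\<close>

fun lower_central ::
  "('k, 'c) ring_scheme \<Rightarrow> ('k, 'a, 'm) module_scheme \<Rightarrow> nat \<Rightarrow> 'a set" where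
  "lower_central F L 0 = carrier L"
| "lower_central F L (Suc 0) = carrier L"
| "lower_central F L (Suc (Suc n)) = bracket_space F L (lower_central F L (Suc n)) (carrier L)"

definition restricted_subalgebra ::
  "('k, 'c) ring_scheme \<Rightarrow> ('k, 'a, 'm) restricted_lie_scheme \<Rightarrow> 'a set \<Rightarrow> bool" where
  "restricted_subalgebra F L S \<longleftrightarrow> subspace F S L \<and>
     (\<forall>x\<in>S. \<forall>y\<in>S. x \<otimes>\<^bsub>L\<^esub> y \<in> S) \<and> (\<forall>x\<in>S. pmap L x \<in> S)"

definition restricted_subalgebra_gen ::
  "('k, 'c) ring_scheme \<Rightarrow> ('k, 'a, 'm) restricted_lie_scheme \<Rightarrow> 'a set \<Rightarrow> 'a set" where
  "restricted_subalgebra_gen F L X = \<Inter>{S. restricted_subalgebra F L S \<and> X \<subseteq> S}"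

definition p_power_subalgebra ::
  "('k, 'c) ring_scheme \<Rightarrow> ('k, 'a, 'm) restricted_lie_scheme \<Rightarrow> 'a set \<Rightarrow> 'a set" where
  "p_power_subalgebra F L I = restricted_subalgebra_gen F L (pmap L ` I)"


section \<open>Quotients and isomorphisms\<close>

text \<open>\<^const>\<open>FactRing\<close> only refers to the carrier and the operations of its first argument, so it
  supplies the cosets, their sum and their product (associative product or Lie bracket);
  scalar multiplication and \<open>p\<close>-map are lifted to cosets in the same way as
  \<^const>\<open>rcoset_mult\<close>.\<close>

definition quot_module ::
  "('k, 'a, 'm) module_scheme \<Rightarrow> 'a set \<Rightarrow> ('k, 'a set) module" where
  "quot_module A I = ring.extend (A Quot I)
     (module.fields (\<lambda>c X. \<Union>x\<in>X. I +>\<^bsub>A\<^esub> (c \<odot>\<^bsub>A\<^esub> x)))"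

definition quot_lie ::
  "('k, 'a, 'm) restricted_lie_scheme \<Rightarrow> 'a set \<Rightarrow> ('k, 'a set) restricted_lie" where
  "quot_lie L I = module.extend (quot_module L I)
     (restricted_lie.fields (\<lambda>X. \<Union>x\<in>X. I +>\<^bsub>L\<^esub> pmap L x))"

definition algebra_iso ::
  "('k, 'c) ring_scheme \<Rightarrow> ('k, 'a, 'm) module_scheme \<Rightarrow> ('k, 'b, 'n) module_scheme \<Rightarrow>
    ('a \<Rightarrow> 'b) set" where
  "algebra_iso F A B = ring_iso A B \<inter> module_hom F A B"

definition restricted_lie_iso ::
  "('k, 'c) ring_scheme \<Rightarrow> ('k, 'a, 'm) restricted_lie_scheme \<Rightarrow>
    ('k, 'b, 'n) restricted_lie_scheme \<Rightarrow> ('a \<Rightarrow> 'b) set" where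
  "restricted_lie_iso F L H = {h \<in> module_hom F L H. bij_betw h (carrier L) (carrier H) \<and>
     (\<forall>x\<in>carrier L. \<forall>y\<in>carrier L. h (x \<otimes>\<^bsub>L\<^esub> y) = h x \<otimes>\<^bsub>H\<^esub> h y) \<and>
     (\<forall>x\<in>carrier L. h (pmap L x) = pmap H (h x))}"


section \<open>The restricted enveloping algebra\<close>

text \<open>The free associative unital algebra over \<open>F\<close> on the set \<open>X\<close>: finitely supported
  functions from words in \<open>X\<close> to \<open>F\<close>, with the convolution product.\<close>

definition free_algebra :: "('k, 'c) ring_scheme \<Rightarrow> 'x set \<Rightarrow> ('k, 'x list \<Rightarrow> 'k) module" where
  "free_algebra F X =
    \<lparr>carrier = {f. (\<forall>w. f w \<in> carrier F) \<and> finite {w. f w \<noteq> \<zero>\<^bsub>F\<^esub>} \<and>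
                   {w. f w \<noteq> \<zero>\<^bsub>F\<^esub>} \<subseteq> lists X},
     mult = (\<lambda>f g w. \<Oplus>\<^bsub>F\<^esub>i\<in>{..length w}. f (take i w) \<otimes>\<^bsub>F\<^esub> g (drop i w)),
     one = (\<lambda>w. if w = [] then \<one>\<^bsub>F\<^esub> else \<zero>\<^bsub>F\<^esub>),
     zero = (\<lambda>w. \<zero>\<^bsub>F\<^esub>),
     add = (\<lambda>f g w. f w \<oplus>\<^bsub>F\<^esub> g w),
     smult = (\<lambda>c f w. c \<otimes>\<^bsub>F\<^esub> f w)\<rparr>"

definition free_gen :: "('k, 'c) ring_scheme \<Rightarrow> 'x \<Rightarrow> 'x list \<Rightarrow> 'k" where
  "free_gen F x = (\<lambda>w. if w = [x] then \<one>\<^bsub>F\<^esub> else \<zero>\<^bsub>F\<^esub>)"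

text \<open>The first two sets of relations make \<^const>\<open>free_gen\<close> linear on \<open>L\<close>, i.e. cut the free
  algebra on the set \<open>carrier L\<close> down to the tensor algebra of the vector space \<open>L\<close>.\<close>

definition restricted_enveloping_relations ::
  "('k, 'c) ring_scheme \<Rightarrow> ('k, 'a, 'm) restricted_lie_scheme \<Rightarrow> ('a list \<Rightarrow> 'k) set" where
  "restricted_enveloping_relations F L =
    (let T = free_algebra F (carrier L); \<iota> = free_gen F in
      {\<iota> (x \<oplus>\<^bsub>L\<^esub> y) \<ominus>\<^bsub>T\<^esub> (\<iota> x \<oplus>\<^bsub>T\<^esub> \<iota> y) | x y. x \<in> carrier L \<and> y \<in> carrier L} \<union>
      {\<iota> (c \<odot>\<^bsub>L\<^esub> x) \<ominus>\<^bsub>T\<^esub> (c \<odot>\<^bsub>T\<^esub> \<iota> x) | c x. c \<in> carrier F \<and> x \<in> carrier L} \<union>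
      {(\<iota> x \<otimes>\<^bsub>T\<^esub> \<iota> y \<ominus>\<^bsub>T\<^esub> \<iota> y \<otimes>\<^bsub>T\<^esub> \<iota> x) \<ominus>\<^bsub>T\<^esub> \<iota> (x \<otimes>\<^bsub>L\<^esub> y) | x y.
         x \<in> carrier L \<and> y \<in> carrier L} \<union>
      {\<iota> x [^]\<^bsub>T\<^esub> ring_char F \<ominus>\<^bsub>T\<^esub> \<iota> (pmap L x) | x. x \<in> carrier L})"

definition restricted_enveloping_algebra ::
  "('k, 'c) ring_scheme \<Rightarrow> ('k, 'a, 'm) restricted_lie_scheme \<Rightarrow>
    ('k, ('a list \<Rightarrow> 'k) set) module" where
  "restricted_enveloping_algebra F L =
    (let T = free_algebra F (carrier L) in
      quot_module T (Idl\<^bsub>T\<^esub> (restricted_enveloping_relations F L)))"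

end

theory Submission
  imports Defs "HOL-Algebra.UnivPoly" "HOL-Computational_Algebra.Primes"
begin

text \<open>
  Let \<open>J = L'\<^sup>p + \<gamma>\<^sub>3(L)\<close> and \<open>Q = L'\<^sup>p + L'\<close>.  The point is to recover a restricted Lie algebra
  homomorphism \<open>L \<rightarrow> H/J\<close> from an isomorphism of enveloping algebras.  Since \<open>L/Q\<close> is nil, the
  isomorphism preserves augmentation; the abelian quotient \<open>H/Q\<close>, with its semilinear \<open>p\<close>-map, is
  then again nil, and finitely generated modulo \<open>p\<close>-th powers.  Over a perfect field
  such a module is a direct sum of cyclic ones (Jordan form), so \<open>u(H/Q)\<close> is a truncated polynomial
  algebra, and its coordinates define a linear map \<open>\<pi>\<close> from the augmentation ideal of \<open>u(H)\<close> onto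
  \<open>H/J\<close> which extends \<open>H \<rightarrow> H/J\<close>, sends commutators to brackets and \<open>p\<close>-th powers to \<open>p\<close>-th powers.
  The composite of \<open>L \<rightarrow> u(L) \<cong> u(H)\<close> with \<open>\<pi>\<close> is onto, because modulo products \<open>\<pi>\<close> only misses
  \<open>p\<close>-th powers and central elements.  It factors through \<open>L/J\<close>.  By symmetry there is also a
  surjection \<open>H/J \<rightarrow> L/J\<close>, and a dimension count shows that both are bijective.

  Enveloping algebras are handled through their free covers: an isomorphism \<open>u(L) \<cong> u(H)\<close> becomes a
  relation between the free algebras on \<open>L\<close> and on \<open>H\<close> that respects the two relation ideals.
\<close>

section \<open>Frobenius maps\<close>

text \<open>No PBW basis is used. A map out of \<open>u(H)\<close> is built on the free algebra and
  must kill the two-sided ideal of the relations. For a merely linear map this is more than killing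
  the relations, so its kernel is replaced by a smaller set that is visibly an ideal
  (\<open>NN\<close>; in the same spirit \<open>KK\<close>). A cyclic summand of \<open>H/Q\<close>
  of index n gets one variable t. Elements become additive polynomials with their coordinates at the
  degrees p^j, so the p-map becomes Frobenius below t^(p^n), and reading off these degrees retracts
  onto \<open>H/Q\<close>. Lifting to \<open>H/J\<close> meets two obstructions. The lifted
  generators no longer commute: a bilinear \<open>B\<close>, entering as a correction on words of
  length two, antisymmetrises to the bracket and also supplies the bracket in (x + y)^2 when p = 2.
  And their p^n-th powers are central rather than zero: the coefficient at t^(p^n) is kept as well,
  although the relations disturb it. \<open>H\<close> may be infinite-dimensional, and
  \<open>H/Q\<close> is not known to be nil at the outset. Its nilpotency is proved before any
  decomposition, with polynomials whose degree p^N grows, so that the error from the missing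
  nilpotency escapes.\<close>

lemma (in ring) add_pow_mult_one:
  "[(m * n::nat)] \<cdot> \<one> = ([m] \<cdot> \<one>) \<otimes> ([n] \<cdot> \<one>)"
  by (simp add: add_pow_ldistr add.nat_pow_pow mult.commute)

lemma (in ring) add_pow_eq_mult_one:
  "x \<in> carrier R \<Longrightarrow> [(n::nat)] \<cdot> x = ([n] \<cdot> \<one>) \<otimes> x"
  by (simp add: add_pow_ldistr)

text \<open>A gcd of a set of naturals need not belong to the set. Here it does: dividing by the
  least positive annihilator of one leaves a remainder that again annihilates, so this least element
  divides all others.\<close>

lemma (in ring) ring_char_least:
  assumes "ring_char R > 0"
  shows "[ring_char R] \<cdot> \<one> = \<zero>"
    and "\<And>n::nat. [n] \<cdot> \<one> = \<zero> \<Longrightarrow> ring_char R dvd n"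
proof -
  let ?S = "{n::nat. [n] \<cdot> \<one> = \<zero>}"
  have "\<exists>m\<in>?S. m > 0"
  proof (rule ccontr)
    assume "\<not> ?thesis"
    hence "?S \<subseteq> {0}" by auto
    hence "Gcd ?S = 0" by (simp only: Gcd_0_iff)
    thus False using assms unfolding ring_char_def by (metis less_irrefl)
  qed
  then obtain d where d: "d \<in> ?S" "d > 0" and least: "\<And>m. m \<in> ?S \<Longrightarrow> m > 0 \<Longrightarrow> d \<le> m"
    using exists_least_iff[of "\<lambda>m. m \<in> ?S \<and> m > 0"] by (metis linorder_not_le)
  have dvd: "d dvd n" if "n \<in> ?S" for n
  proof -
    have "[n] \<cdot> \<one> = [(d * (n div d))] \<cdot> \<one> \<oplus> [(n mod d)] \<cdot> \<one>"
      by (metis add.nat_pow_mult mult_div_mod_eq one_closed)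
    also have "\<dots> = [(n mod d)] \<cdot> \<one>" using d by (simp add: add_pow_mult_one)
    finally have "[n] \<cdot> \<one> = [(n mod d)] \<cdot> \<one>" .
    hence "n mod d \<in> ?S" using that by simp
    hence "n mod d = 0" using least[of "n mod d"] d(2) by (metis gr0I leD mod_less_divisor)
    thus ?thesis by auto
  qed
  have "Gcd ?S = d"
    using dvd d(1) by (intro dvd_antisym Gcd_dvd Gcd_greatest) auto
  thus "[ring_char R] \<cdot> \<one> = \<zero>" "\<And>n::nat. [n] \<cdot> \<one> = \<zero> \<Longrightarrow> ring_char R dvd n"
    using d(1) dvd unfolding ring_char_def by simp_all
qed

text \<open>Multiples of one multiply like integers, so in a domain a vanishing product has a
  vanishing factor, which is Euclid's property.\<close>

lemma (in "domain") prime_ring_char: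
  assumes "ring_char R > 0"
  shows "prime (ring_char R)"
proof -
  let ?p = "ring_char R"
  note p = ring_char_least[OF assms]
  have "?p \<noteq> 1" using p(1) by (metis add.nat_pow_eone one_closed zero_not_one)
  moreover have "?p dvd a \<or> ?p dvd b" if ab: "?p dvd a * b" for a b
  proof -
    obtain c where "a * b = ?p * c" using ab by auto
    hence "([a] \<cdot> \<one>) \<otimes> ([b] \<cdot> \<one>) = \<zero>"
      by (metis add_pow_mult_one p(1) add.nat_pow_closed l_null one_closed)
    hence "[a] \<cdot> \<one> = \<zero> \<or> [b] \<cdot> \<one> = \<zero>" by (simp add: integral_iff)
    thus ?thesis using p(2) by blast
  qed
  ultimately show ?thesis using assms by (intro primeI prime_elemI) auto
qed

lemma (in cring) binomial:
  assumes x: "x \<in> carrier R" and y: "y \<in> carrier R"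
  shows "(x \<oplus> y) [^] (n::nat) = (\<Oplus>k\<in>{..n}. [(n choose k)] \<cdot> (x [^] k \<otimes> y [^] (n - k)))"
proof (induction n)
  case 0
  then show ?case using assms by simp
next
  case (Suc n)
  let ?t = "\<lambda>n k. [(n choose k)] \<cdot> (x [^] k \<otimes> y [^] (n - k))"
  have tc: "?t m k \<in> carrier R" for m k using assms by simp
  have 1: "(\<Oplus>k\<in>{..n}. ?t n k) \<otimes> x = (\<Oplus>k\<in>{..n}. [(n choose k)] \<cdot> (x [^] Suc k \<otimes> y [^] (n - k)))"
    by (subst finsum_ldistr) (auto simp: assms add_pow_ldistr add_pow_rdistr m_ac intro!: finsum_cong')
  \<comment> \<open>The range is extended to \<open>Suc n\<close>, where the binomial coefficient is
    zero, to fit the sum for the next exponent.\<close>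
  have 2: "(\<Oplus>k\<in>{..n}. ?t n k) \<otimes> y = (\<Oplus>k\<in>{..Suc n}. [(n choose k)] \<cdot> (x [^] k \<otimes> y [^] (Suc n - k)))"
  proof -
    have "(\<Oplus>k\<in>{..n}. ?t n k) \<otimes> y = (\<Oplus>k\<in>{..n}. [(n choose k)] \<cdot> (x [^] k \<otimes> y [^] (Suc n - k)))"
      by (subst finsum_ldistr) (auto simp: assms add_pow_ldistr add_pow_rdistr m_ac Suc_diff_le intro!: finsum_cong')
    thus ?thesis using assms by (simp add: finsum_Suc binomial_eq_0)
  qed
  \<comment> \<open>Pascal's rule, split so that its two parts are the summands of the two sums
    above.\<close>
  have 3: "?t (Suc n) (Suc k) = [(n choose k)] \<cdot> (x [^] Suc k \<otimes> y [^] (n - k)) \<oplus>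
       [(n choose (Suc k))] \<cdot> (x [^] Suc k \<otimes> y [^] (Suc n - Suc k))" for k
    using assms by (simp add: add.nat_pow_mult)
  have "(x \<oplus> y) [^] Suc n = (\<Oplus>k\<in>{..n}. ?t n k) \<otimes> x \<oplus> (\<Oplus>k\<in>{..n}. ?t n k) \<otimes> y"
    using assms Suc by (simp add: r_distr)
  also have "\<dots> = (\<Oplus>k\<in>{..Suc n}. ?t (Suc n) k)"
  proof -
    let ?f = "\<lambda>k. [(n choose k)] \<cdot> (x [^] Suc k \<otimes> y [^] (n - k))"
    let ?g = "\<lambda>k. [(n choose k)] \<cdot> (x [^] k \<otimes> y [^] (Suc n - k))"
    have cl: "?f \<in> A \<rightarrow> carrier R" "?g \<in> A \<rightarrow> carrier R" "(\<lambda>k. ?g (Suc k)) \<in> A \<rightarrow> carrier R" for A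
      using assms by auto
    have "(\<Oplus>k\<in>{..Suc n}. ?t (Suc n) k) = (\<Oplus>k\<in>{..n}. ?f k \<oplus> ?g (Suc k)) \<oplus> ?g 0"
      unfolding finsum_Suc2[of "?t (Suc n)", OF funcsetI, OF tc] 3 by simp
    also have "\<dots> = (\<Oplus>k\<in>{..n}. ?f k) \<oplus> ((\<Oplus>k\<in>{..n}. ?g (Suc k)) \<oplus> ?g 0)"
      unfolding finsum_addf[OF cl(1) cl(3)] by (intro a_assoc finsum_closed cl) (use assms in auto)
    also have "\<dots> = (\<Oplus>k\<in>{..n}. ?f k) \<oplus> (\<Oplus>k\<in>{..Suc n}. ?g k)"
      unfolding finsum_Suc2[of ?g, OF cl(2)] ..
    finally show ?thesis unfolding 1 2 ..
  qed
  finally show ?case .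
qed

text \<open>The inner binomial coefficients of a prime exponent are multiples of p, so only the two
  end terms of the expansion survive.\<close>

lemma (in cring) frobenius_add:
  assumes p: "prime p" and char: "[(p::nat)] \<cdot> \<one> = \<zero>"
    and x: "x \<in> carrier R" and y: "y \<in> carrier R"
  shows "(x \<oplus> y) [^] p = x [^] p \<oplus> y [^] p"
proof -
  let ?t = "\<lambda>k. [(p choose k)] \<cdot> (x [^] k \<otimes> y [^] (p - k))"
  obtain q where q: "p = Suc q" "q > 0" using prime_gt_1_nat[OF p] by (cases p) auto
  have "?t k = \<zero>" if "k \<in> {1..q}" for k
  proof -
    have "p dvd (p choose k)" using that q p by (intro dvd_choose_prime) auto
    then obtain c where "(p choose k) = c * p" by (metis dvd_def mult.commute)
    thus ?thesis using assms
      by (subst add_pow_eq_mult_one) (auto simp: add_pow_mult_one simp del: mult_Suc_right)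
  qed
  moreover have "{..q} = insert 0 {1..q}" by auto
  moreover from calculation have "(\<Oplus>k\<in>{1..q}. ?t k) = \<zero>"
    by (intro add.finprod_one_eqI) auto
  ultimately have "(\<Oplus>k\<in>{..q}. ?t k) = ?t 0"
    using x y by simp
  thus ?thesis
    unfolding binomial[OF x y] using x y q by (simp add: finsum_Suc)
qed

text \<open>Only \<open>[p] \<cdot> \<one> = \<zero>\<close> is asked, so the zero ring qualifies.
  This lets the locale apply to a quotient of the free algebra whose nontriviality is never
  examined, besides the field and its polynomial ring.\<close>

locale char_p_cring = cring +
  fixes p :: nat
  assumes prime_p: "prime p" and char_p: "[p] \<cdot> \<one> = \<zero>"
begin

lemma p_pos: "p > 0" using prime_p by (rule prime_gt_0_nat)
lemma p_gt_1: "p > 1" using prime_p by (rule prime_gt_1_nat)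

lemma frob_add: "\<lbrakk>x \<in> carrier R; y \<in> carrier R\<rbrakk> \<Longrightarrow> (x \<oplus> y) [^] p = x [^] p \<oplus> y [^] p"
  by (rule frobenius_add[OF prime_p char_p])

lemma frob_zero [simp]: "\<zero> [^] p = \<zero>"
  using p_pos nat_pow_zero by blast

lemma frob_minus: "x \<in> carrier R \<Longrightarrow> (\<ominus> x) [^] p = \<ominus> (x [^] p)"
  using frob_add[of "\<ominus> x" x] by (intro minus_equality[symmetric]) (simp_all add: l_neg)

lemma frob_iter_add:
  "\<lbrakk>x \<in> carrier R; y \<in> carrier R\<rbrakk> \<Longrightarrow> (x \<oplus> y) [^] (p ^ k) = x [^] (p ^ k) \<oplus> y [^] (p ^ k)"
proof (induction k)
  case (Suc k)
  have *: "z [^] (p ^ Suc k) = (z [^] (p ^ k)) [^] p" if "z \<in> carrier R" for z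
    using that by (simp add: nat_pow_pow mult.commute)
  show ?case using Suc by (simp only: * a_closed frob_add nat_pow_closed)
qed simp

lemma frob_finsum:
  "\<lbrakk>finite A; f \<in> A \<rightarrow> carrier R\<rbrakk> \<Longrightarrow> (\<Oplus>i\<in>A. f i) [^] p = (\<Oplus>i\<in>A. f i [^] p)"
proof (induction A rule: finite_induct)
  case (insert a A)
  hence "f a \<in> carrier R" "f \<in> A \<rightarrow> carrier R" by auto
  thus ?case using insert by (simp add: frob_add Pi_def)
qed simp

end

section \<open>The Frobenius map of a polynomial ring\<close>

locale UP_char_p = UP_cring + char_p_cring R p for p
begin

lemma UP_natmult_one: "[(n::nat)] \<cdot>\<^bsub>P\<^esub> \<one>\<^bsub>P\<^esub> = monom P ([n] \<cdot> \<one>) 0"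
proof (induction n)
  case (Suc n)
  have "[Suc n] \<cdot>\<^bsub>P\<^esub> \<one>\<^bsub>P\<^esub> = monom P ([n] \<cdot> \<one>) 0 \<oplus>\<^bsub>P\<^esub> monom P \<one> 0"
    using Suc by simp
  thus ?case by (simp del: monom_one)
qed simp

sublocale P: char_p_cring P p
  by unfold_locales (simp_all add: prime_p UP_natmult_one char_p)

text \<open>By additivity of Frobenius each monomial is raised separately: coefficients to the p-th
  power, degrees times p. This is the shift that will imitate the p-map.\<close>

lemma coeff_frob:
  assumes f: "f \<in> carrier P"
  shows "coeff P (f [^]\<^bsub>P\<^esub> p) n = (if p dvd n then coeff P f (n div p) [^] p else \<zero>)"
proof -
  \<comment> \<open>The bound also dominates \<open>n\<close>, so \<open>n div p\<close> is a
    summation index even when it exceeds the degree.\<close>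
  let ?d = "max (deg R f) n"
  have mono: "monom P (coeff P f i) i \<in> carrier P" for i using f by simp
  have "f = (\<Oplus>\<^bsub>P\<^esub>i\<in>{..?d}. monom P (coeff P f i) i)"
    using up_repr_le[of f ?d] f by simp
  hence "f [^]\<^bsub>P\<^esub> p = (\<Oplus>\<^bsub>P\<^esub>i\<in>{..?d}. monom P (coeff P f i) i) [^]\<^bsub>P\<^esub> p"
    by simp
  also have "\<dots> = (\<Oplus>\<^bsub>P\<^esub>i\<in>{..?d}. monom P (coeff P f i [^] p) (i * p))"
    using f by (subst P.frob_finsum) (auto simp: monom_pow intro!: P.finsum_cong')
  finally have "coeff P (f [^]\<^bsub>P\<^esub> p) n = coeff P (\<Oplus>\<^bsub>P\<^esub>i\<in>{..?d}. monom P (coeff P f i [^] p) (i * p)) n"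
    by simp
  also have "\<dots> = (\<Oplus>i\<in>{..?d}. coeff P (monom P (coeff P f i [^] p) (i * p)) n)"
    using f by (intro coeff_finsum) auto
  also have "\<dots> = (\<Oplus>i\<in>{..?d}. if p dvd n \<and> n div p = i then coeff P f i [^] p else \<zero>)"
    using f p_pos by (intro R.finsum_cong') auto
  also have "\<dots> = (if p dvd n then coeff P f (n div p) [^] p else \<zero>)"
  proof (cases "p dvd n")
    case True
    have "n div p \<le> ?d" by (meson div_le_dividend max.coboundedI2)
    thus ?thesis using True f R.finsum_singleton[of "n div p" "{..?d}" "\<lambda>i. coeff P f i [^] p"]
      by simp
  qed simp
  finally show ?thesis .
qed

end

section \<open>Roots in a perfect field\<close>

locale perfect_char_p = field F for F :: "('k, 'c) ring_scheme" (structure) +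
  fixes p :: nat
  assumes char_eq: "ring_char F = p" and char_pos: "p > 0"
    and root: "a \<in> carrier F \<Longrightarrow> \<exists>b\<in>carrier F. a = b [^] p"

sublocale perfect_char_p \<subseteq> char_p_cring F p
  using prime_ring_char ring_char_least(1) char_eq char_pos by unfold_locales auto

context perfect_char_p
begin

text \<open>Frobenius is injective on a field, so the chosen root is the only one, and
  \<open>frt\<close> is the inverse automorphism.\<close>

definition frt :: "'k \<Rightarrow> 'k" where
  "frt a = (SOME b. b \<in> carrier F \<and> b [^] p = a)"

lemma frt: assumes "a \<in> carrier F" shows "frt a \<in> carrier F" "frt a [^] p = a"
proof -
  have "\<exists>b. b \<in> carrier F \<and> b [^] p = a" using root[OF assms] by auto
  from someI_ex[OF this] show "frt a \<in> carrier F" "frt a [^] p = a" unfolding frt_def by auto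
qed

lemma pow_eq_zero: "\<lbrakk>a \<in> carrier F; a [^] (n::nat) = \<zero>\<rbrakk> \<Longrightarrow> a = \<zero>"
  by (induction n) (auto simp: integral_iff)

lemma frob_inj:
  assumes "a \<in> carrier F" "b \<in> carrier F" "a [^] p = b [^] p" shows "a = b"
proof -
  have "(a \<oplus> \<ominus> b) [^] p = a [^] p \<oplus> \<ominus> (b [^] p)"
    using assms(1,2) by (simp only: frob_add frob_minus a_inv_closed)
  also have "\<dots> = \<zero>" unfolding assms(3) using assms(2) by (intro r_neg nat_pow_closed)
  finally have "(a \<oplus> \<ominus> b) [^] p = \<zero>" .
  hence "a \<oplus> \<ominus> b = \<zero>"
    by (rule pow_eq_zero[rotated]) (simp only: assms(1,2) a_closed a_inv_closed)
  hence "a \<ominus> b = \<zero>" by (simp only: minus_eq)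
  thus ?thesis using minus_other_side[OF assms(1,2)] by blast
qed

lemma frt_pow: "a \<in> carrier F \<Longrightarrow> frt (a [^] p) = a"
  by (rule frob_inj) (auto simp: frt)

lemma frt_add: "\<lbrakk>a \<in> carrier F; b \<in> carrier F\<rbrakk> \<Longrightarrow> frt (a \<oplus> b) = frt a \<oplus> frt b"
  by (rule frob_inj) (auto simp: frt frob_add)

lemma frt_mult: "\<lbrakk>a \<in> carrier F; b \<in> carrier F\<rbrakk> \<Longrightarrow> frt (a \<otimes> b) = frt a \<otimes> frt b"
  by (rule frob_inj) (auto simp: frt nat_pow_distrib)

lemma frt_zero [simp]: "frt \<zero> = \<zero>"
  by (metis frob_zero frt_pow zero_closed)

lemma frt_iter:
  shows frt_iter_closed: "a \<in> carrier F \<Longrightarrow> (frt ^^ k) a \<in> carrier F"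
    and frt_iter_add: "\<lbrakk>a \<in> carrier F; b \<in> carrier F\<rbrakk> \<Longrightarrow> (frt ^^ k) (a \<oplus> b) = (frt ^^ k) a \<oplus> (frt ^^ k) b"
    and frt_iter_mult: "\<lbrakk>a \<in> carrier F; b \<in> carrier F\<rbrakk> \<Longrightarrow> (frt ^^ k) (a \<otimes> b) = (frt ^^ k) a \<otimes> (frt ^^ k) b"
    and frt_iter_zero: "(frt ^^ k) \<zero> = \<zero>"
    and frt_iter_pow: "a \<in> carrier F \<Longrightarrow> (frt ^^ k) (a [^] (p ^ k)) = a"
    and frt_iter_frt: "a \<in> carrier F \<Longrightarrow> (frt ^^ k) a [^] (p ^ k) = a"
proof -
  have c: "(frt ^^ k) a \<in> carrier F" if "a \<in> carrier F" for a k
    using that by (induction k) (auto simp: frt)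
  show "a \<in> carrier F \<Longrightarrow> (frt ^^ k) a \<in> carrier F" by (rule c)
  show "\<lbrakk>a \<in> carrier F; b \<in> carrier F\<rbrakk> \<Longrightarrow> (frt ^^ k) (a \<oplus> b) = (frt ^^ k) a \<oplus> (frt ^^ k) b"
    by (induction k) (auto simp: frt_add c)
  show "\<lbrakk>a \<in> carrier F; b \<in> carrier F\<rbrakk> \<Longrightarrow> (frt ^^ k) (a \<otimes> b) = (frt ^^ k) a \<otimes> (frt ^^ k) b"
    by (induction k) (auto simp: frt_mult c)
  show "(frt ^^ k) \<zero> = \<zero>" by (induction k) auto
  show "a \<in> carrier F \<Longrightarrow> (frt ^^ k) (a [^] (p ^ k)) = a"
  proof (induction k)
    case (Suc k)
    have "a [^] (p ^ Suc k) = (a [^] (p ^ k)) [^] p" using Suc.prems by (simp add: nat_pow_pow mult.commute)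
    thus ?case using Suc by (simp add: funpow_swap1 frt_pow)
  qed simp
  show "a \<in> carrier F \<Longrightarrow> (frt ^^ k) a [^] (p ^ k) = a"
  proof (induction k)
    case (Suc k)
    have "(frt ^^ Suc k) a [^] (p ^ Suc k) = (frt ((frt ^^ k) a) [^] p) [^] (p ^ k)"
      using Suc.prems by (simp add: nat_pow_pow frt(1) c)
    thus ?case using Suc by (simp add: frt c)
  qed simp
qed

end

section \<open>Free algebras\<close>

locale free_alg = cring F for F :: "('k, 'c) ring_scheme" (structure) +
  fixes X :: "'x set"
begin

abbreviation T :: "('k, 'x list \<Rightarrow> 'k) module" where "T \<equiv> free_algebra F X"

definition sd :: "'k \<Rightarrow> 'x list \<Rightarrow> 'x list \<Rightarrow> 'k" where
  "sd c w = (\<lambda>v. if v = w then c else \<zero>)"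

lemma T_carrier: "f \<in> carrier T \<longleftrightarrow> (\<forall>w. f w \<in> carrier F) \<and> finite {w. f w \<noteq> \<zero>} \<and> {w. f w \<noteq> \<zero>} \<subseteq> lists X"
  by (simp add: free_algebra_def)

lemma T_simps:
  "f \<otimes>\<^bsub>T\<^esub> g = (\<lambda>w. \<Oplus>i\<in>{..length w}. f (take i w) \<otimes> g (drop i w))"
  "\<one>\<^bsub>T\<^esub> = sd \<one> []" "\<zero>\<^bsub>T\<^esub> = (\<lambda>w. \<zero>)" "f \<oplus>\<^bsub>T\<^esub> g = (\<lambda>w. f w \<oplus> g w)" "c \<odot>\<^bsub>T\<^esub> f = (\<lambda>w. c \<otimes> f w)"
  by (simp_all add: free_algebra_def sd_def)

lemma T_val: "f \<in> carrier T \<Longrightarrow> f w \<in> carrier F"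
  by (simp add: T_carrier)

lemma free_gen_sd: "free_gen F x = sd \<one> [x]"
  by (simp add: free_gen_def sd_def)

lemma sd_closed: "\<lbrakk>c \<in> carrier F; w \<in> lists X\<rbrakk> \<Longrightarrow> sd c w \<in> carrier T"
  by (auto simp: T_carrier sd_def intro: finite_subset[of _ "{w}"])

lemma T_add_closed: assumes f: "f \<in> carrier T" and g: "g \<in> carrier T" shows "f \<oplus>\<^bsub>T\<^esub> g \<in> carrier T"
proof -
  have *: "{w. f w \<oplus> g w \<noteq> \<zero>} \<subseteq> {w. f w \<noteq> \<zero>} \<union> {w. g w \<noteq> \<zero>}"
    using T_val[OF f] by auto
  have "finite ({w. f w \<noteq> \<zero>} \<union> {w. g w \<noteq> \<zero>})" "{w. f w \<noteq> \<zero>} \<union> {w. g w \<noteq> \<zero>} \<subseteq> lists X"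
    using f g unfolding T_carrier by blast+
  thus ?thesis using * finite_subset[OF *] T_val[OF f] T_val[OF g]
    unfolding T_carrier T_simps by (meson a_closed subset_trans)
qed

lemma T_smult_closed: assumes c: "c \<in> carrier F" and f: "f \<in> carrier T" shows "c \<odot>\<^bsub>T\<^esub> f \<in> carrier T"
proof -
  have *: "{w. c \<otimes> f w \<noteq> \<zero>} \<subseteq> {w. f w \<noteq> \<zero>}"
    using c by auto
  have "finite {w. f w \<noteq> \<zero>}" "{w. f w \<noteq> \<zero>} \<subseteq> lists X"
    using f unfolding T_carrier by blast+
  thus ?thesis using * finite_subset[OF *] T_val[OF f] c
    unfolding T_carrier T_simps by (meson m_closed subset_trans)
qed

lemma T_mult_closed: assumes f: "f \<in> carrier T" and g: "g \<in> carrier T" shows "f \<otimes>\<^bsub>T\<^esub> g \<in> carrier T"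
proof -
  let ?A = "{w. f w \<noteq> \<zero>}" and ?B = "{w. g w \<noteq> \<zero>}"
  have *: "{w. (f \<otimes>\<^bsub>T\<^esub> g) w \<noteq> \<zero>} \<subseteq> (\<lambda>(u, v). u @ v) ` (?A \<times> ?B)"
  proof
    fix w assume "w \<in> {w. (f \<otimes>\<^bsub>T\<^esub> g) w \<noteq> \<zero>}"
    hence "\<exists>i\<le>length w. f (take i w) \<otimes> g (drop i w) \<noteq> \<zero>"
      using add.finprod_one_eqI[of "{..length w}" "\<lambda>i. f (take i w) \<otimes> g (drop i w)"]
      unfolding T_simps by auto
    then obtain i where "f (take i w) \<noteq> \<zero>" "g (drop i w) \<noteq> \<zero>"
      by (metis T_val f g l_null r_null)
    thus "w \<in> (\<lambda>(u, v). u @ v) ` (?A \<times> ?B)"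
      by (intro image_eqI[of _ _ "(take i w, drop i w)"]) auto
  qed
  have fin: "finite ((\<lambda>(u, v). u @ v) ` (?A \<times> ?B))" using f g unfolding T_carrier by blast
  have sub: "(\<lambda>(u, v). u @ v) ` (?A \<times> ?B) \<subseteq> lists X"
  proof -
    have "?A \<subseteq> lists X" "?B \<subseteq> lists X" using f g unfolding T_carrier by blast+
    thus ?thesis by fastforce
  qed
  have "(f \<otimes>\<^bsub>T\<^esub> g) w \<in> carrier F" for w
    unfolding T_simps using T_val[OF f] T_val[OF g] by (intro finsum_closed) auto
  thus ?thesis using * finite_subset[OF * fin] sub unfolding T_carrier by blast
qed

lemma T_module: "module F T"
proof (rule module_criteria)
  show "cring F" ..
  show "\<zero>\<^bsub>T\<^esub> \<in> carrier T" by (simp add: T_carrier T_simps)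
  show "\<forall>v\<in>carrier T. \<exists>neg_v\<in>carrier T. v \<oplus>\<^bsub>T\<^esub> neg_v = \<zero>\<^bsub>T\<^esub>"
  proof
    fix v assume v: "v \<in> carrier T"
    have "v w \<oplus> (\<ominus> \<one> \<otimes> v w) = \<zero>" for w
      using T_val[OF v, of w] by (simp add: l_minus r_neg)
    hence "v \<oplus>\<^bsub>T\<^esub> ((\<ominus> \<one>) \<odot>\<^bsub>T\<^esub> v) = \<zero>\<^bsub>T\<^esub>" unfolding T_simps by simp
    thus "\<exists>neg_v\<in>carrier T. v \<oplus>\<^bsub>T\<^esub> neg_v = \<zero>\<^bsub>T\<^esub>"
      using T_smult_closed[OF _ v, of "\<ominus> \<one>"] by blast
  qed
next
  show "\<forall>v w. v \<in> carrier T \<and> w \<in> carrier T \<longrightarrow> v \<oplus>\<^bsub>T\<^esub> w \<in> carrier T"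
    "\<forall>c v. c \<in> carrier F \<and> v \<in> carrier T \<longrightarrow> c \<odot>\<^bsub>T\<^esub> v \<in> carrier T"
    using T_add_closed T_smult_closed by blast+
qed (auto simp: T_val T_simps a_ac m_ac l_distr r_distr)

text \<open>Among the splittings of \<open>u @ v\<close> only the one at \<open>length u\<close> has
  both factors nonzero, and no other word has a contributing splitting.\<close>

lemma sd_mult:
  assumes c: "c \<in> carrier F" and d: "d \<in> carrier F"
  shows "sd c u \<otimes>\<^bsub>T\<^esub> sd d v = sd (c \<otimes> d) (u @ v)"
proof
  fix w
  let ?t = "\<lambda>i. sd c u (take i w) \<otimes> sd d v (drop i w)"
  show "(sd c u \<otimes>\<^bsub>T\<^esub> sd d v) w = sd (c \<otimes> d) (u @ v) w"
  proof (cases "w = u @ v")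
    case True
    have "?t i = (if length u = i then c \<otimes> d else \<zero>)" if i: "i \<le> length w" for i
    proof (cases "length u = i")
      case False
      hence "take i w \<noteq> u" using i by auto
      thus ?thesis using False d by (simp add: sd_def)
    qed (use True c d in \<open>simp add: sd_def\<close>)
    hence "(\<Oplus>i\<in>{..length w}. ?t i) = (\<Oplus>i\<in>{..length w}. if length u = i then c \<otimes> d else \<zero>)"
      using c d by (intro finsum_cong') auto
    also have "\<dots> = c \<otimes> d"
      using finsum_singleton[of "length u" "{..length w}" "\<lambda>_. c \<otimes> d"] c d True by simp
    finally show ?thesis using True unfolding T_simps by (simp add: sd_def)
  next
    case False
    have "?t i = \<zero>" for i
      using c d False unfolding sd_def by (auto dest: sym)
    thus ?thesis using False unfolding T_simps by (simp add: sd_def)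
  qed
qed

text \<open>The support is finite and is removed one word at a time. Multilinear identities in the
  free algebra thereby reduce to monomials.\<close>

lemma T_induct [consumes 1, case_names zero sd add]:
  assumes f: "f \<in> carrier T" and z: "P \<zero>\<^bsub>T\<^esub>"
    and s: "\<And>c w. \<lbrakk>c \<in> carrier F; w \<in> lists X\<rbrakk> \<Longrightarrow> P (sd c w)"
    and a: "\<And>f g. \<lbrakk>f \<in> carrier T; g \<in> carrier T; P f; P g\<rbrakk> \<Longrightarrow> P (f \<oplus>\<^bsub>T\<^esub> g)"
  shows "P f"
proof -
  have "\<forall>f. f \<in> carrier T \<longrightarrow> {w. f w \<noteq> \<zero>} \<subseteq> S \<longrightarrow> P f" if "finite S" for S
    using that
  proof (induction S rule: finite_induct)
    case empty
    have "f = \<zero>\<^bsub>T\<^esub>" if "{w. f w \<noteq> \<zero>} \<subseteq> {}" for f :: "'x list \<Rightarrow> 'k"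
      using that unfolding T_simps by auto
    thus ?case using z by blast
  next
    case (insert w S)
    show ?case
    proof (intro allI impI)
      fix f assume f: "f \<in> carrier T" and supp: "{v. f v \<noteq> \<zero>} \<subseteq> insert w S"
      let ?g = "f(w := \<zero>)"
      have sub: "{v. ?g v \<noteq> \<zero>} \<subseteq> {v. f v \<noteq> \<zero>}" by auto
      have g: "?g \<in> carrier T"
        using f finite_subset[OF sub] sub unfolding T_carrier by auto
      have "{v. ?g v \<noteq> \<zero>} \<subseteq> S" using supp by auto
      hence Pg: "P ?g" using insert.IH g by blast
      show "P f"
      proof (cases "f w = \<zero>")
        case True
        hence "?g = f" by auto
        thus ?thesis using Pg by simp
      next
        case False
        hence w: "w \<in> lists X" using f unfolding T_carrier by auto
        have "f = sd (f w) w \<oplus>\<^bsub>T\<^esub> ?g"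
          using T_val[OF f] unfolding T_simps sd_def by auto
        thus ?thesis using a[OF sd_closed[OF T_val[OF f, of w] w] g s[OF T_val[OF f, of w] w] Pg] by simp
      qed
    qed
  qed
  thus ?thesis using f unfolding T_carrier by blast
qed

lemma T_l_distr: "\<lbrakk>f \<in> carrier T; g \<in> carrier T; h \<in> carrier T\<rbrakk> \<Longrightarrow> (f \<oplus>\<^bsub>T\<^esub> g) \<otimes>\<^bsub>T\<^esub> h = f \<otimes>\<^bsub>T\<^esub> h \<oplus>\<^bsub>T\<^esub> g \<otimes>\<^bsub>T\<^esub> h"
  unfolding T_simps by (rule ext) (subst finsum_addf[symmetric], auto simp: T_val l_distr intro!: finsum_cong')

lemma T_r_distr: "\<lbrakk>f \<in> carrier T; g \<in> carrier T; h \<in> carrier T\<rbrakk> \<Longrightarrow> h \<otimes>\<^bsub>T\<^esub> (f \<oplus>\<^bsub>T\<^esub> g) = h \<otimes>\<^bsub>T\<^esub> f \<oplus>\<^bsub>T\<^esub> h \<otimes>\<^bsub>T\<^esub> g"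
  unfolding T_simps by (rule ext) (subst finsum_addf[symmetric], auto simp: T_val r_distr intro!: finsum_cong')

lemma T_smult_l: "\<lbrakk>c \<in> carrier F; f \<in> carrier T; g \<in> carrier T\<rbrakk> \<Longrightarrow> (c \<odot>\<^bsub>T\<^esub> f) \<otimes>\<^bsub>T\<^esub> g = c \<odot>\<^bsub>T\<^esub> (f \<otimes>\<^bsub>T\<^esub> g)"
  unfolding T_simps by (rule ext) (subst finsum_rdistr, auto simp: T_val m_assoc intro!: finsum_cong')

lemma T_smult_r: "\<lbrakk>c \<in> carrier F; f \<in> carrier T; g \<in> carrier T\<rbrakk> \<Longrightarrow> f \<otimes>\<^bsub>T\<^esub> (c \<odot>\<^bsub>T\<^esub> g) = c \<odot>\<^bsub>T\<^esub> (f \<otimes>\<^bsub>T\<^esub> g)"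
  unfolding T_simps by (rule ext) (subst finsum_rdistr, auto simp: T_val m_lcomm intro!: finsum_cong')

lemma T_zero_mult:
  "f \<in> carrier T \<Longrightarrow> \<zero>\<^bsub>T\<^esub> \<otimes>\<^bsub>T\<^esub> f = \<zero>\<^bsub>T\<^esub>" "f \<in> carrier T \<Longrightarrow> f \<otimes>\<^bsub>T\<^esub> \<zero>\<^bsub>T\<^esub> = \<zero>\<^bsub>T\<^esub>"
  unfolding T_simps by (auto simp: T_val intro!: add.finprod_one_eqI)

text \<open>The ring laws are multilinear, and on monomials they are the laws of word
  concatenation.\<close>

lemma T_ring: "ring T"
proof (rule ringI)
  interpret M: module F T by (rule T_module)
  show "abelian_group T" ..
  note closed = T_mult_closed T_add_closed sd_closed M.M.zero_closed
  have one: "\<one>\<^bsub>T\<^esub> \<in> carrier T" unfolding T_simps by (rule sd_closed) auto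
  have assoc: "f \<otimes>\<^bsub>T\<^esub> g \<otimes>\<^bsub>T\<^esub> h = f \<otimes>\<^bsub>T\<^esub> (g \<otimes>\<^bsub>T\<^esub> h)"
    if f: "f \<in> carrier T" and g: "g \<in> carrier T" and h: "h \<in> carrier T" for f g h
    using f
  proof (induction f rule: T_induct)
    case (sd c u)
    show ?case using g
    proof (induction g rule: T_induct)
      case (sd d v)
      show ?case using h
      proof (induction h rule: T_induct)
        case (sd e w)
        then show ?case using \<open>c \<in> carrier F\<close> \<open>d \<in> carrier F\<close> by (simp add: sd_mult m_assoc)
      next
        case (add f g)
        then show ?case using \<open>c \<in> carrier F\<close> \<open>d \<in> carrier F\<close> \<open>u \<in> lists X\<close> \<open>v \<in> lists X\<close>
          by (simp only: T_r_distr closed)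
      qed (use \<open>c \<in> carrier F\<close> \<open>d \<in> carrier F\<close> \<open>u \<in> lists X\<close> \<open>v \<in> lists X\<close> in \<open>simp only: T_zero_mult closed\<close>)
    next
      case (add f g)
      then show ?case using h \<open>c \<in> carrier F\<close> \<open>u \<in> lists X\<close> by (simp only: T_r_distr T_l_distr closed)
    qed (use h \<open>c \<in> carrier F\<close> \<open>u \<in> lists X\<close> in \<open>simp only: T_zero_mult closed\<close>)
  next
    case (add f1 f2)
    then show ?case using g h by (simp only: T_l_distr closed)
  qed (use g h in \<open>simp only: T_zero_mult closed\<close>)
  have l_one: "\<one>\<^bsub>T\<^esub> \<otimes>\<^bsub>T\<^esub> f = f" if f: "f \<in> carrier T" for f
    using f
  proof (induction f rule: T_induct)
    case (sd c w) thus ?case unfolding T_simps(2) by (simp add: sd_mult)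
  next
    case (add f g) thus ?case using one by (simp only: T_r_distr)
  qed (use one in \<open>simp only: T_zero_mult\<close>)
  have r_one: "f \<otimes>\<^bsub>T\<^esub> \<one>\<^bsub>T\<^esub> = f" if f: "f \<in> carrier T" for f
    using f
  proof (induction f rule: T_induct)
    case (sd c w) thus ?case unfolding T_simps(2) by (simp add: sd_mult)
  next
    case (add f g) thus ?case using one by (simp only: T_l_distr)
  qed (use one in \<open>simp only: T_zero_mult\<close>)
  show "monoid T"
    by (rule monoidI) (fact T_mult_closed one assoc l_one r_one)+
qed (simp_all add: T_l_distr T_r_distr)

end

sublocale free_alg \<subseteq> T: ring "free_algebra F X" by (rule T_ring)
sublocale free_alg \<subseteq> T: module F "free_algebra F X" by (rule T_module)

text \<open>Linear extension from words. It serves twice: with \<open>v\<close> multiplicative it is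
  an algebra homomorphism, with a table on short words it is a linear map of derivation
  type.\<close>

definition word_ext ::
  "('k, 'c) ring_scheme \<Rightarrow> ('k, 'n, 'm) module_scheme \<Rightarrow> ('x list \<Rightarrow> 'n) \<Rightarrow> ('x list \<Rightarrow> 'k) \<Rightarrow> 'n" where
  "word_ext F N v f = (\<Oplus>\<^bsub>N\<^esub>w\<in>{w. f w \<noteq> \<zero>\<^bsub>F\<^esub>}. f w \<odot>\<^bsub>N\<^esub> v w)"

locale word_ext_module = free_alg F X + N: module F N
  for F :: "('k, 'c) ring_scheme" (structure) and X :: "'x set"
    and N :: "('k, 'n, 'm) module_scheme" +
  fixes v :: "'x list \<Rightarrow> 'n"
  assumes v_closed: "w \<in> lists X \<Longrightarrow> v w \<in> carrier N"
begin

abbreviation "E \<equiv> word_ext F N v"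

lemma supp_X: "\<lbrakk>f \<in> carrier T; f w \<noteq> \<zero>\<rbrakk> \<Longrightarrow> v w \<in> carrier N"
  using v_closed unfolding T_carrier by auto

lemma E_superset:
  assumes f: "f \<in> carrier T" and S: "finite S" "S \<subseteq> lists X" "{w. f w \<noteq> \<zero>} \<subseteq> S"
  shows "E f = (\<Oplus>\<^bsub>N\<^esub>w\<in>S. f w \<odot>\<^bsub>N\<^esub> v w)"
  unfolding word_ext_def
proof (rule N.M.add.finprod_mono_neutral_cong_left)
  fix w assume w: "w \<in> S - {w. f w \<noteq> \<zero>}"
  hence "v w \<in> carrier N" using S v_closed by blast
  thus "f w \<odot>\<^bsub>N\<^esub> v w = \<zero>\<^bsub>N\<^esub>" using w by simp
next
  show "(\<lambda>w. f w \<odot>\<^bsub>N\<^esub> v w) \<in> S \<rightarrow> carrier N"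
    using S(2) T_val[OF f] v_closed by blast
qed (use S in auto)

lemma E_add: assumes f: "f \<in> carrier T" and g: "g \<in> carrier T"
  shows "E (f \<oplus>\<^bsub>T\<^esub> g) = E f \<oplus>\<^bsub>N\<^esub> E g"
proof -
  let ?S = "{w. f w \<noteq> \<zero>} \<union> {w. g w \<noteq> \<zero>}"
  have S: "finite ?S" "?S \<subseteq> lists X" using f g unfolding T_carrier by auto
  have "{w. (f \<oplus>\<^bsub>T\<^esub> g) w \<noteq> \<zero>} \<subseteq> ?S" unfolding T_simps using T_val[OF f] by auto
  hence "E (f \<oplus>\<^bsub>T\<^esub> g) = (\<Oplus>\<^bsub>N\<^esub>w\<in>?S. (f \<oplus>\<^bsub>T\<^esub> g) w \<odot>\<^bsub>N\<^esub> v w)"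
    using S T_add_closed[OF f g] by (intro E_superset)
  also have "\<dots> = (\<Oplus>\<^bsub>N\<^esub>w\<in>?S. f w \<odot>\<^bsub>N\<^esub> v w \<oplus>\<^bsub>N\<^esub> g w \<odot>\<^bsub>N\<^esub> v w)"
    using T_val[OF f] T_val[OF g] supp_X[OF f] supp_X[OF g] unfolding T_simps
    by (intro N.M.finsum_cong') (auto simp: N.smult_l_distr)
  also have "\<dots> = (\<Oplus>\<^bsub>N\<^esub>w\<in>?S. f w \<odot>\<^bsub>N\<^esub> v w) \<oplus>\<^bsub>N\<^esub> (\<Oplus>\<^bsub>N\<^esub>w\<in>?S. g w \<odot>\<^bsub>N\<^esub> v w)"
    using T_val[OF f] T_val[OF g] supp_X[OF f] supp_X[OF g]
    by (intro N.M.finsum_addf) auto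
  also have "\<dots> = E f \<oplus>\<^bsub>N\<^esub> E g"
    using E_superset[OF f S] E_superset[OF g S] by auto
  finally show ?thesis .
qed

lemma E_sd: assumes c: "c \<in> carrier F" and w: "w \<in> lists X" shows "E (sd c w) = c \<odot>\<^bsub>N\<^esub> v w"
proof -
  have "E (sd c w) = (\<Oplus>\<^bsub>N\<^esub>u\<in>{w}. sd c w u \<odot>\<^bsub>N\<^esub> v u)"
    using w sd_closed[OF c w] by (intro E_superset) (auto simp: sd_def)
  thus ?thesis using c w v_closed by (simp add: sd_def)
qed

lemma E_closed: "f \<in> carrier T \<Longrightarrow> E f \<in> carrier N"
  unfolding word_ext_def by (intro N.M.finsum_closed funcsetI N.smult_closed) (auto simp: supp_X T_val)

lemma E_smult: assumes c: "c \<in> carrier F" and f: "f \<in> carrier T"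
  shows "E (c \<odot>\<^bsub>T\<^esub> f) = c \<odot>\<^bsub>N\<^esub> E f"
proof -
  let ?S = "{w. f w \<noteq> \<zero>}"
  have S: "finite ?S" "?S \<subseteq> lists X" using f unfolding T_carrier by auto
  have "E (c \<odot>\<^bsub>T\<^esub> f) = (\<Oplus>\<^bsub>N\<^esub>w\<in>?S. (c \<odot>\<^bsub>T\<^esub> f) w \<odot>\<^bsub>N\<^esub> v w)"
    using S T_smult_closed[OF c f] c unfolding T_simps by (intro E_superset) (auto simp: T_simps)
  also have "\<dots> = (\<Oplus>\<^bsub>N\<^esub>w\<in>?S. c \<odot>\<^bsub>N\<^esub> (f w \<odot>\<^bsub>N\<^esub> v w))"
    using T_val[OF f] supp_X[OF f] c unfolding T_simps
    by (intro N.M.finsum_cong') (auto simp: N.smult_assoc1)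
  also have "\<dots> = c \<odot>\<^bsub>N\<^esub> E f"
    unfolding word_ext_def using T_val[OF f] supp_X[OF f] c by (intro N.finsum_smult[symmetric]) auto
  finally show ?thesis .
qed

lemma E_zero: "E \<zero>\<^bsub>T\<^esub> = \<zero>\<^bsub>N\<^esub>"
  by (simp add: word_ext_def T_simps)

end

text \<open>In the locale \<open>algebra\<close> the target is commutative, so these homomorphisms
  send all commutators of the free algebra to zero.\<close>

locale word_ext_algebra = free_alg F X + P: algebra F P
  for F :: "('k, 'c) ring_scheme" (structure) and X :: "'x set"
    and P :: "('k, 'n, 'm) module_scheme" +
  fixes \<theta> :: "'x \<Rightarrow> 'n"
  assumes \<theta>_closed: "x \<in> X \<Longrightarrow> \<theta> x \<in> carrier P"
begin

definition wprod :: "'x list \<Rightarrow> 'n" where "wprod w = foldr (\<lambda>x a. \<theta> x \<otimes>\<^bsub>P\<^esub> a) w \<one>\<^bsub>P\<^esub>"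

interpretation P: cring P by (rule P.M_cring)

lemma wprod_simps [simp]: "wprod [] = \<one>\<^bsub>P\<^esub>" "wprod (x # w) = \<theta> x \<otimes>\<^bsub>P\<^esub> wprod w"
  by (simp_all add: wprod_def)

lemma wprod_closed: "w \<in> lists X \<Longrightarrow> wprod w \<in> carrier P"
  by (induction w) (auto simp: \<theta>_closed)

lemma wprod_append: "\<lbrakk>u \<in> lists X; w \<in> lists X\<rbrakk> \<Longrightarrow> wprod (u @ w) = wprod u \<otimes>\<^bsub>P\<^esub> wprod w"
  by (induction u) (auto simp: \<theta>_closed wprod_closed P.m_assoc)

sublocale word_ext_module F X P wprod
  by unfold_locales (rule wprod_closed)

lemma E_gen: "x \<in> X \<Longrightarrow> E (free_gen F x) = \<theta> x"
  by (simp add: free_gen_sd E_sd \<theta>_closed)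

lemma E_one: "E \<one>\<^bsub>T\<^esub> = \<one>\<^bsub>P\<^esub>"
  by (simp add: T_simps E_sd)

lemma E_mult: assumes f: "f \<in> carrier T" and g: "g \<in> carrier T"
  shows "E (f \<otimes>\<^bsub>T\<^esub> g) = E f \<otimes>\<^bsub>P\<^esub> E g"
  using f
proof (induction f rule: T_induct)
  case zero
  show ?case using g by (simp add: E_zero E_closed)
next
  case (sd c u)
  show ?case using g
  proof (induction g rule: T_induct)
    case zero
    show ?case using sd by (simp add: E_zero E_closed sd_closed)
  next
    case (sd d w)
    have "E (sd c u \<otimes>\<^bsub>T\<^esub> sd d w) = (c \<otimes> d) \<odot>\<^bsub>P\<^esub> (wprod u \<otimes>\<^bsub>P\<^esub> wprod w)"
      using sd \<open>c \<in> carrier F\<close> \<open>u \<in> lists X\<close> by (simp add: sd_mult E_sd wprod_append)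
    also have "\<dots> = (c \<odot>\<^bsub>P\<^esub> wprod u) \<otimes>\<^bsub>P\<^esub> (d \<odot>\<^bsub>P\<^esub> wprod w)"
      using sd \<open>c \<in> carrier F\<close> \<open>u \<in> lists X\<close> wprod_closed
      by (simp add: P.smult_assoc2 P.smult_assoc1 P.m_comm[of "wprod u"])
    finally show ?case using sd \<open>c \<in> carrier F\<close> \<open>u \<in> lists X\<close> by (simp add: E_sd)
  next
    case (add f g)
    thus ?case using sd by (simp add: T_r_distr E_add E_closed sd_closed P.r_distr)
  qed
next
  case (add f1 f2)
  thus ?case using g by (simp add: T_l_distr E_add E_closed P.l_distr)
qed

end

section \<open>Restricted ideals and quotients\<close>

lemma subspace_iff:
  assumes "vectorspace F V"
  shows "subspace F S V \<longleftrightarrow> S \<subseteq> carrier V \<and> \<zero>\<^bsub>V\<^esub> \<in> S \<and> (\<forall>x\<in>S. \<forall>y\<in>S. x \<oplus>\<^bsub>V\<^esub> y \<in> S) \<and>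
    (\<forall>c\<in>carrier F. \<forall>x\<in>S. c \<odot>\<^bsub>V\<^esub> x \<in> S)"
  using assms vectorspace.axioms(1)[OF assms]
  unfolding subspace_def submodule_def by blast

lemma subspaceD:
  assumes "subspace F S V"
  shows "S \<subseteq> carrier V" "\<zero>\<^bsub>V\<^esub> \<in> S" "\<And>x y. \<lbrakk>x \<in> S; y \<in> S\<rbrakk> \<Longrightarrow> x \<oplus>\<^bsub>V\<^esub> y \<in> S"
    "\<And>c x. \<lbrakk>c \<in> carrier F; x \<in> S\<rbrakk> \<Longrightarrow> c \<odot>\<^bsub>V\<^esub> x \<in> S" "\<And>x. x \<in> S \<Longrightarrow> \<ominus>\<^bsub>V\<^esub> x \<in> S"
    "\<And>x y. \<lbrakk>x \<in> S; y \<in> S\<rbrakk> \<Longrightarrow> x \<ominus>\<^bsub>V\<^esub> y \<in> S"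
proof -
  interpret vectorspace F V using assms unfolding subspace_def by blast
  show 1: "S \<subseteq> carrier V" "\<zero>\<^bsub>V\<^esub> \<in> S" "\<And>x y. \<lbrakk>x \<in> S; y \<in> S\<rbrakk> \<Longrightarrow> x \<oplus>\<^bsub>V\<^esub> y \<in> S"
    "\<And>c x. \<lbrakk>c \<in> carrier F; x \<in> S\<rbrakk> \<Longrightarrow> c \<odot>\<^bsub>V\<^esub> x \<in> S"
    using assms unfolding subspace_def submodule_def by blast+
  show 2: "\<ominus>\<^bsub>V\<^esub> x \<in> S" if "x \<in> S" for x
  proof -
    have "\<ominus>\<^bsub>V\<^esub> x = (\<ominus>\<^bsub>F\<^esub> \<one>\<^bsub>F\<^esub>) \<odot>\<^bsub>V\<^esub> x" using that 1(1) smult_minus_1 by auto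
    thus ?thesis using 1(4)[OF _ that] by simp
  qed
  show "\<And>x y. \<lbrakk>x \<in> S; y \<in> S\<rbrakk> \<Longrightarrow> x \<ominus>\<^bsub>V\<^esub> y \<in> S" unfolding a_minus_def using 1 2 by blast
qed

lemma subspace_finsum:
  assumes "subspace F S V" and "finite A" and "\<And>i. i \<in> A \<Longrightarrow> f i \<in> S"
  shows "finsum V f A \<in> S"
proof -
  interpret vectorspace F V using assms(1) unfolding subspace_def by blast
  note S = subspaceD[OF assms(1)]
  show ?thesis using assms(2,3)
  proof (induction A rule: finite_induct)
    case (insert a A)
    have "f \<in> A \<rightarrow> carrier V" "f a \<in> carrier V" using insert S(1) by auto
    hence "finsum V f (insert a A) = f a \<oplus>\<^bsub>V\<^esub> finsum V f A" using insert.hyps by simp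
    thus ?case using S(3) insert by simp
  qed (simp add: S)
qed

lemma subspace_span_le:
  assumes "vectorspace F V" "subspace F S V" "X \<subseteq> S"
  shows "module.span F V X \<subseteq> S"
proof -
  interpret vectorspace F V by fact
  show ?thesis using span_is_subset[OF assms(3)] assms(2) is_module by blast
qed

context lie_algebra
begin

lemma vs: "vectorspace F L" ..

lemma bracket_zero_left [simp]: "x \<in> carrier L \<Longrightarrow> \<zero> \<otimes> x = \<zero>"
  using bracket_smult_left[of "\<zero>\<^bsub>F\<^esub>" \<zero> x] bracket_closed[of \<zero> x] by simp

lemma bracket_zero_right [simp]: "x \<in> carrier L \<Longrightarrow> x \<otimes> \<zero> = \<zero>"
  using bracket_smult_right[of "\<zero>\<^bsub>F\<^esub>" x \<zero>] bracket_closed[of x \<zero>] by simp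

lemma bracket_antisym:
  assumes "x \<in> carrier L" "y \<in> carrier L" shows "x \<otimes> y = \<ominus> (y \<otimes> x)"
proof -
  have "\<zero> = (x \<oplus> y) \<otimes> (x \<oplus> y)" using assms by (simp add: bracket_self)
  also have "\<dots> = x \<otimes> y \<oplus> y \<otimes> x"
    unfolding bracket_add_left[OF assms M.a_closed[OF assms]]
      bracket_add_right[OF assms assms(1)] bracket_add_right[OF assms assms(2)]
    using assms by (simp add: bracket_self bracket_closed)
  finally have "x \<otimes> y \<oplus> y \<otimes> x = \<zero>" by simp
  thus ?thesis using assms bracket_closed M.minus_equality by metis
qed

lemma bracket_finsum_left:
  assumes "finite A" "f \<in> A \<rightarrow> carrier L" "y \<in> carrier L"
  shows "finsum L f A \<otimes> y = finsum L (\<lambda>i. f i \<otimes> y) A"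
  using assms
proof (induction A rule: finite_induct)
  case (insert a A)
  have *: "f \<in> A \<rightarrow> carrier L" "f a \<in> carrier L" using insert by auto
  have **: "(\<lambda>i. f i \<otimes> y) \<in> A \<rightarrow> carrier L" "f a \<otimes> y \<in> carrier L"
    using * insert.prems bracket_closed by auto
  show ?case using insert * ** by (simp add: bracket_add_left)
qed simp

text \<open>Absorption is asked on one side only; antisymmetry gives the other.\<close>

definition lie_ideal :: "'c set \<Rightarrow> bool" where
  "lie_ideal S \<longleftrightarrow> subspace F S L \<and> (\<forall>x\<in>S. \<forall>y\<in>carrier L. x \<otimes> y \<in> S)"

lemma lie_idealD:
  assumes "lie_ideal S"
  shows "subspace F S L" "\<And>x y. \<lbrakk>x \<in> S; y \<in> carrier L\<rbrakk> \<Longrightarrow> x \<otimes> y \<in> S"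
    "\<And>x y. \<lbrakk>x \<in> S; y \<in> carrier L\<rbrakk> \<Longrightarrow> y \<otimes> x \<in> S"
proof -
  show 1: "subspace F S L" "\<And>x y. \<lbrakk>x \<in> S; y \<in> carrier L\<rbrakk> \<Longrightarrow> x \<otimes> y \<in> S"
    using assms unfolding lie_ideal_def by auto
  fix x y assume xy: "x \<in> S" "y \<in> carrier L"
  hence "y \<otimes> x = \<ominus> (x \<otimes> y)" using bracket_antisym subspaceD(1)[OF 1(1)] by blast
  thus "y \<otimes> x \<in> S" using subspaceD(5)[OF 1(1)] 1(2)[OF xy] by simp
qed

lemma ad_coeff_closed:
  "\<lbrakk>x \<in> carrier L; y \<in> carrier L\<rbrakk> \<Longrightarrow> ad_coeff L x y n i \<in> carrier L"
  by (induction n arbitrary: i) (auto split: nat.split simp: bracket_closed)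

text \<open>The start of the recursion is \<open>x\<close> itself, outside \<open>S\<close>. One
  application of ad(t x + y) kills the term [x, x] and leaves [y, x] in \<open>S\<close>, and
  further brackets stay there. Hence the index \<open>Suc n\<close>.\<close>

lemma ad_coeff_mem_ideal:
  assumes S: "lie_ideal S" and x: "x \<in> carrier L" and y: "y \<in> S"
  shows "ad_coeff L x y (Suc n) i \<in> S"
proof (induction n arbitrary: i)
  note I = lie_idealD[OF S] note V = subspaceD[OF I(1)]
  have yL: "y \<in> carrier L" using y V(1) by auto
  case 0
  show ?case using x y yL V I by (auto split: nat.split simp: bracket_self)
next
  note I = lie_idealD[OF S] note V = subspaceD[OF I(1)]
  have yL: "y \<in> carrier L" using y V(1) by auto
  case (Suc n)
  show ?case
    unfolding ad_coeff.simps(2)[of L x y "Suc n"]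
    using Suc V I x y yL V(1) by (auto split: nat.split simp del: ad_coeff.simps)
qed

lemma ad_coeff_commuting:
  assumes x: "x \<in> carrier L" and y: "y \<in> carrier L" and c: "y \<otimes> x = \<zero>"
  shows "ad_coeff L x y (Suc n) i = \<zero>"
proof (induction n arbitrary: i)
  case 0
  show ?case using x y c by (auto split: nat.split simp: bracket_self)
next
  case (Suc n)
  show ?case
    unfolding ad_coeff.simps(2)[of L x y "Suc n"]
    using Suc x y by (auto split: nat.split simp del: ad_coeff.simps)
qed

end

section \<open>The p-map, ideals, and the subalgebras J and Q\<close>

context restricted_lie_algebra
begin

abbreviation "p \<equiv> ring_char F"

lemma prime_p: "prime p" by (rule prime_ring_char[OF char_pos])

lemma jacobson_coeff_closed:
  assumes "i \<in> {1..<p}" shows "inv\<^bsub>F\<^esub> ([i] \<cdot>\<^bsub>F\<^esub> \<one>\<^bsub>F\<^esub>) \<in> carrier F"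
proof -
  have "\<not> p dvd i" using assms nat_dvd_not_less by auto
  hence "[i] \<cdot>\<^bsub>F\<^esub> \<one>\<^bsub>F\<^esub> \<noteq> \<zero>\<^bsub>F\<^esub>" using R.ring_char_least(2)[OF char_pos] by blast
  hence "[i] \<cdot>\<^bsub>F\<^esub> \<one>\<^bsub>F\<^esub> \<in> Units F" by (simp add: field_Units)
  thus ?thesis by (rule R.Units_inv_closed)
qed

lemma jacobson_term_closed:
  "\<lbrakk>i \<in> {1..<p}; x \<in> carrier L; y \<in> carrier L\<rbrakk> \<Longrightarrow> jacobson_term F L i x y \<in> carrier L"
  unfolding jacobson_term_def by (intro smult_closed jacobson_coeff_closed ad_coeff_closed)

lemma p_minus_1: "p - 1 = Suc (p - 2)"
  using prime_gt_1_nat[OF prime_p] by linarith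

text \<open>Each Jacobson term involves at least one bracket because p - 1 is positive, so it lies
  in the ideal. The summand \<open>pmap L y\<close> is kept apart, since \<open>S\<close> is only a
  Lie ideal and need not be closed under the p-map.\<close>

lemma pmap_add_ideal:
  assumes S: "lie_ideal S" and x: "x \<in> carrier L" and y: "y \<in> S"
  shows "\<exists>s\<in>S. pmap L (x \<oplus> y) = pmap L x \<oplus> pmap L y \<oplus> s"
proof -
  note V = subspaceD[OF lie_idealD(1)[OF S]]
  have "jacobson_term F L i x y \<in> S" if "i \<in> {1..<p}" for i
    unfolding jacobson_term_def p_minus_1
    by (intro V(4) jacobson_coeff_closed ad_coeff_mem_ideal[OF S x y] that)
  hence "(\<Oplus>i\<in>{1..<p}. jacobson_term F L i x y) \<in> S"
    by (intro subspace_finsum[OF lie_idealD(1)[OF S]]) auto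
  thus ?thesis using pmap_add[OF x] y V(1) by blast
qed

lemma pmap_add_commuting:
  assumes x: "x \<in> carrier L" and y: "y \<in> carrier L" and c: "y \<otimes> x = \<zero>"
  shows "pmap L (x \<oplus> y) = pmap L x \<oplus> pmap L y"
proof -
  have "jacobson_term F L i x y = \<zero>" if "i \<in> {1..<p}" for i
    unfolding jacobson_term_def p_minus_1
    using jacobson_coeff_closed[OF that] by (simp add: ad_coeff_commuting[OF x y c] del: ad_coeff.simps)
  hence "(\<Oplus>i\<in>{1..<p}. jacobson_term F L i x y) = \<zero>"
    by (intro M.add.finprod_one_eqI)
  thus ?thesis using pmap_add[OF x y] x y pmap_closed by simp
qed

lemma pmap_zero [simp]: "pmap L \<zero> = \<zero>"
proof -
  have "pmap L (\<zero>\<^bsub>F\<^esub> \<odot> \<zero>) = (\<zero>\<^bsub>F\<^esub> [^]\<^bsub>F\<^esub> p) \<odot> pmap L \<zero>"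
    by (rule pmap_smult) auto
  thus ?thesis using char_pos R.nat_pow_zero[of p] pmap_closed[of \<zero>] by simp
qed

lemma ad_pow_mem:
  assumes "lie_ideal S" "x \<in> carrier L" "y \<in> S"
  shows "((\<lambda>z. x \<otimes> z) ^^ n) y \<in> S"
  using assms lie_idealD(3)[OF assms(1)] by (induction n) auto

lemma ad_pow_Suc: "((\<lambda>z. x \<otimes> z) ^^ Suc n) y = ((\<lambda>z. x \<otimes> z) ^^ n) (x \<otimes> y)"
  by (simp add: funpow_swap1)

lemma p_eq_Suc: "p = Suc (p - 1)" using char_pos by simp

text \<open>Bracketing with the p-th power is a p-fold bracketing with \<open>x\<close>, whose
  innermost step already lies in \<open>S\<close>.\<close>

lemma pmap_bracket_mem:
  assumes S: "lie_ideal S" and x: "x \<in> carrier L" and y: "y \<in> carrier L" and "x \<otimes> y \<in> S"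
  shows "pmap L x \<otimes> y \<in> S"
proof -
  have "pmap L x \<otimes> y = ((\<lambda>z. x \<otimes> z) ^^ Suc (p - 1)) y"
    using pmap_bracket[OF x y] p_eq_Suc by simp
  thus ?thesis unfolding ad_pow_Suc using ad_pow_mem[OF S x assms(4)] by simp
qed

definition restricted_ideal :: "'a set \<Rightarrow> bool" where
  "restricted_ideal S \<longleftrightarrow> lie_ideal S \<and> (\<forall>x\<in>S. pmap L x \<in> S)"

lemma restricted_subalgebraD:
  assumes "restricted_subalgebra F L S"
  shows "subspace F S L" "\<And>x y. \<lbrakk>x \<in> S; y \<in> S\<rbrakk> \<Longrightarrow> x \<otimes> y \<in> S" "\<And>x. x \<in> S \<Longrightarrow> pmap L x \<in> S"
  using assms unfolding restricted_subalgebra_def by auto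

lemma restricted_subalgebra_gen_le:
  "\<lbrakk>restricted_subalgebra F L S; X \<subseteq> S\<rbrakk> \<Longrightarrow> restricted_subalgebra_gen F L X \<subseteq> S"
  unfolding restricted_subalgebra_gen_def by blast

lemma restricted_subalgebra_gen:
  assumes "X \<subseteq> carrier L"
  shows "restricted_subalgebra F L (restricted_subalgebra_gen F L X)" "X \<subseteq> restricted_subalgebra_gen F L X"
proof -
  have "restricted_subalgebra F L (carrier L)"
    unfolding restricted_subalgebra_def subspace_iff[OF vs]
    by (auto simp: bracket_closed pmap_closed)
  hence ne: "\<Inter>{S. restricted_subalgebra F L S \<and> X \<subseteq> S} \<subseteq> carrier L" using assms by blast
  show "restricted_subalgebra F L (restricted_subalgebra_gen F L X)"
    using ne unfolding restricted_subalgebra_gen_def restricted_subalgebra_def subspace_iff[OF vs]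
    by blast
  show "X \<subseteq> restricted_subalgebra_gen F L X" unfolding restricted_subalgebra_gen_def by blast
qed

abbreviation "\<gamma>2 \<equiv> lower_central F L 2"
abbreviation "\<gamma>3 \<equiv> lower_central F L 3"
abbreviation "P2 \<equiv> p_power_subalgebra F L \<gamma>2"

lemma \<gamma>2_eq: "\<gamma>2 = span {a \<otimes> b | a b. a \<in> carrier L \<and> b \<in> carrier L}"
  by (simp add: numeral_2_eq_2 bracket_space_def)

lemma \<gamma>3_eq: "\<gamma>3 = span {a \<otimes> b | a b. a \<in> \<gamma>2 \<and> b \<in> carrier L}"
  by (simp add: numeral_2_eq_2 numeral_3_eq_3 bracket_space_def)

lemma \<gamma>2_subspace: "subspace F \<gamma>2 L"
  unfolding \<gamma>2_eq by (rule span_is_subspace) (auto simp: bracket_closed)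

lemma bracket_in_\<gamma>2: "\<lbrakk>x \<in> carrier L; y \<in> carrier L\<rbrakk> \<Longrightarrow> x \<otimes> y \<in> \<gamma>2"
  unfolding \<gamma>2_eq by (rule subsetD[OF in_own_span]) (auto simp: bracket_closed)

lemma \<gamma>2_carrier: "\<gamma>2 \<subseteq> carrier L"
  by (rule subspaceD(1)[OF \<gamma>2_subspace])

lemma \<gamma>2_ideal: "lie_ideal \<gamma>2"
  unfolding lie_ideal_def using \<gamma>2_subspace \<gamma>2_carrier bracket_in_\<gamma>2 by blast

lemma \<gamma>3_subspace: "subspace F \<gamma>3 L"
  unfolding \<gamma>3_eq by (rule span_is_subspace) (use \<gamma>2_carrier bracket_closed in blast)

lemma bracket_in_\<gamma>3: "\<lbrakk>x \<in> \<gamma>2; y \<in> carrier L\<rbrakk> \<Longrightarrow> x \<otimes> y \<in> \<gamma>3"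
  unfolding \<gamma>3_eq by (rule subsetD[OF in_own_span]) (use \<gamma>2_carrier bracket_closed in blast)+

lemma \<gamma>3_le: "\<gamma>3 \<subseteq> \<gamma>2"
  unfolding \<gamma>3_eq
  by (rule subspace_span_le[OF vs \<gamma>2_subspace]) (use lie_idealD(2)[OF \<gamma>2_ideal] in blast)

lemma \<gamma>3_ideal: "lie_ideal \<gamma>3"
  unfolding lie_ideal_def using \<gamma>3_subspace \<gamma>3_le bracket_in_\<gamma>3 by blast

lemma P2_subalgebra: "restricted_subalgebra F L P2" and pmap_in_P2: "x \<in> \<gamma>2 \<Longrightarrow> pmap L x \<in> P2"
proof -
  have sub: "pmap L ` \<gamma>2 \<subseteq> carrier L" using \<gamma>2_carrier pmap_closed by auto
  show "restricted_subalgebra F L P2" "x \<in> \<gamma>2 \<Longrightarrow> pmap L x \<in> P2"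
    using restricted_subalgebra_gen[OF sub] unfolding p_power_subalgebra_def by auto
qed

lemma P2_le: "\<lbrakk>restricted_subalgebra F L S; \<And>x. x \<in> \<gamma>2 \<Longrightarrow> pmap L x \<in> S\<rbrakk> \<Longrightarrow> P2 \<subseteq> S"
  unfolding p_power_subalgebra_def by (intro restricted_subalgebra_gen_le) auto

lemma P2_carrier: "P2 \<subseteq> carrier L"
  using restricted_subalgebraD(1)[OF P2_subalgebra] by (rule subspaceD(1))

text \<open>The elements that bracket everything into \<open>\<gamma>3\<close> form a restricted
  subalgebra, and it contains the p-th powers of \<open>\<gamma>2\<close>. Since \<open>P2\<close>
  is only a generated subalgebra, this closure argument replaces a computation with its
  elements.\<close>

lemma P2_bracket: assumes x: "x \<in> P2" and y: "y \<in> carrier L" shows "x \<otimes> y \<in> \<gamma>3"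
proof -
  let ?N = "{x \<in> carrier L. \<forall>y\<in>carrier L. x \<otimes> y \<in> \<gamma>3}"
  note V = subspaceD[OF \<gamma>3_subspace] note I = lie_idealD[OF \<gamma>3_ideal]
  have "restricted_subalgebra F L ?N"
    unfolding restricted_subalgebra_def subspace_iff[OF vs]
  proof (intro conjI ballI)
    show "\<And>x y. x \<in> ?N \<Longrightarrow> y \<in> ?N \<Longrightarrow> x \<oplus> y \<in> ?N" using V by (auto simp: bracket_add_left)
    show "\<And>c x. c \<in> carrier F \<Longrightarrow> x \<in> ?N \<Longrightarrow> c \<odot> x \<in> ?N" using V by (auto simp: bracket_smult_left)
    show "\<And>x y. x \<in> ?N \<Longrightarrow> y \<in> ?N \<Longrightarrow> x \<otimes> y \<in> ?N" using I bracket_closed by auto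
    show "\<And>x. x \<in> ?N \<Longrightarrow> pmap L x \<in> ?N"
      using pmap_bracket_mem[OF \<gamma>3_ideal] pmap_closed by auto
  qed (use V in auto)
  hence "P2 \<subseteq> ?N"
  proof (rule P2_le)
    fix x assume x: "x \<in> \<gamma>2"
    hence xL: "x \<in> carrier L" using \<gamma>2_carrier by auto
    show "pmap L x \<in> ?N"
      using pmap_bracket_mem[OF \<gamma>3_ideal xL] bracket_in_\<gamma>3[OF x] pmap_closed[OF xL] by auto
  qed
  thus ?thesis using x y by auto
qed

lemma set_add_iff: "x \<in> A <+>\<^bsub>L\<^esub> B \<longleftrightarrow> (\<exists>a\<in>A. \<exists>b\<in>B. x = a \<oplus> b)"
  unfolding set_add_def' by auto

text \<open>The parameter \<open>C\<close> covers both J and Q. Closure under the p-map: in the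
  power of a + c the Jacobson terms fall into \<open>C\<close>, the power of a stays in
  \<open>P2\<close>, and that of c is in \<open>P2\<close> because c lies in
  \<open>\<gamma>2\<close>.\<close>

lemma P2_sum_restricted_ideal:
  assumes C: "lie_ideal C" and "\<gamma>3 \<subseteq> C" "C \<subseteq> \<gamma>2"
  shows "restricted_ideal (P2 <+>\<^bsub>L\<^esub> C)"
proof -
  note V = subspaceD[OF lie_idealD(1)[OF C]]
  note W = subspaceD[OF restricted_subalgebraD(1)[OF P2_subalgebra]]
  have C_le: "x \<in> C \<Longrightarrow> x \<in> P2 <+>\<^bsub>L\<^esub> C" for x
    unfolding set_add_iff using W(2) V(1) by (metis M.l_zero subset_iff)
  have "subspace F (P2 <+>\<^bsub>L\<^esub> C) L"
    unfolding subspace_iff[OF vs]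
  proof (intro conjI ballI subsetI)
    fix x assume "x \<in> P2 <+>\<^bsub>L\<^esub> C"
    then obtain a c where x: "a \<in> P2" "c \<in> C" "x = a \<oplus> c" unfolding set_add_iff by auto
    hence ac: "a \<in> carrier L" "c \<in> carrier L" using V(1) W(1) by auto
    show "x \<in> carrier L" using x ac by simp
    show "k \<odot> x \<in> P2 <+>\<^bsub>L\<^esub> C" if k: "k \<in> carrier F" for k
      unfolding set_add_iff using x ac k V(4)[OF k x(2)] W(4)[OF k x(1)] by (auto simp: smult_r_distr)
    fix y assume "y \<in> P2 <+>\<^bsub>L\<^esub> C"
    then obtain b d where y: "b \<in> P2" "d \<in> C" "y = b \<oplus> d" unfolding set_add_iff by auto
    hence bd: "b \<in> carrier L" "d \<in> carrier L" using V(1) W(1) by auto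
    have "x \<oplus> y = (a \<oplus> b) \<oplus> (c \<oplus> d)" using x y ac bd by (simp add: M.a_ac)
    thus "x \<oplus> y \<in> P2 <+>\<^bsub>L\<^esub> C"
      unfolding set_add_iff using V(3)[OF x(2) y(2)] W(3)[OF x(1) y(1)] by blast
  qed (rule C_le[OF V(2)])
  moreover have "x \<otimes> y \<in> P2 <+>\<^bsub>L\<^esub> C" if "x \<in> P2 <+>\<^bsub>L\<^esub> C" and y: "y \<in> carrier L" for x y
  proof -
    obtain a c where x: "a \<in> P2" "c \<in> C" "x = a \<oplus> c" using \<open>x \<in> _\<close> unfolding set_add_iff by auto
    hence ac: "a \<in> carrier L" "c \<in> carrier L" using V(1) W(1) by auto
    have "a \<otimes> y \<in> C" using P2_bracket[OF x(1) y] assms(2) by auto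
    moreover have "c \<otimes> y \<in> C" using lie_idealD(2)[OF C x(2) y] .
    moreover have "x \<otimes> y = a \<otimes> y \<oplus> c \<otimes> y" using x ac y by (simp add: bracket_add_left)
    ultimately show ?thesis using V(3) C_le by auto
  qed
  moreover have "pmap L x \<in> P2 <+>\<^bsub>L\<^esub> C" if "x \<in> P2 <+>\<^bsub>L\<^esub> C" for x
  proof -
    obtain a c where x: "a \<in> P2" "c \<in> C" "x = a \<oplus> c" using \<open>x \<in> _\<close> unfolding set_add_iff by auto
    hence ac: "a \<in> carrier L" "c \<in> carrier L" using V(1) W(1) by auto
    obtain s where s: "s \<in> C" "pmap L x = pmap L a \<oplus> pmap L c \<oplus> s"
      using pmap_add_ideal[OF C ac(1) x(2)] x(3) by auto
    have "pmap L a \<in> P2" using restricted_subalgebraD(3)[OF P2_subalgebra x(1)] .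
    moreover have "pmap L c \<in> P2" using x(2) assms(3) pmap_in_P2 by auto
    ultimately show ?thesis using s W(3) unfolding set_add_iff by blast
  qed
  ultimately show ?thesis unfolding restricted_ideal_def lie_ideal_def by blast
qed

abbreviation "JJ \<equiv> P2 <+>\<^bsub>L\<^esub> \<gamma>3"
abbreviation "QQ \<equiv> P2 <+>\<^bsub>L\<^esub> \<gamma>2"

lemma JJ_ideal: "restricted_ideal JJ"
  using P2_sum_restricted_ideal[OF \<gamma>3_ideal subset_refl \<gamma>3_le] .

lemma QQ_ideal: "restricted_ideal QQ"
  using P2_sum_restricted_ideal[OF \<gamma>2_ideal \<gamma>3_le subset_refl] .

end

definition restricted_lie_hom where
  "restricted_lie_hom F L M = {h \<in> module_hom F L M.
     (\<forall>x\<in>carrier L. \<forall>y\<in>carrier L. h (x \<otimes>\<^bsub>L\<^esub> y) = h x \<otimes>\<^bsub>M\<^esub> h y) \<and>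
     (\<forall>x\<in>carrier L. h (pmap L x) = pmap M (h x))}"

lemma restricted_lie_homD:
  assumes "h \<in> restricted_lie_hom F L M"
  shows "\<And>x. x \<in> carrier L \<Longrightarrow> h x \<in> carrier M"
    "\<And>x y. \<lbrakk>x \<in> carrier L; y \<in> carrier L\<rbrakk> \<Longrightarrow> h (x \<oplus>\<^bsub>L\<^esub> y) = h x \<oplus>\<^bsub>M\<^esub> h y"
    "\<And>c x. \<lbrakk>c \<in> carrier F; x \<in> carrier L\<rbrakk> \<Longrightarrow> h (c \<odot>\<^bsub>L\<^esub> x) = c \<odot>\<^bsub>M\<^esub> h x"
    "\<And>x y. \<lbrakk>x \<in> carrier L; y \<in> carrier L\<rbrakk> \<Longrightarrow> h (x \<otimes>\<^bsub>L\<^esub> y) = h x \<otimes>\<^bsub>M\<^esub> h y"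
    "\<And>x. x \<in> carrier L \<Longrightarrow> h (pmap L x) = pmap M (h x)"
  using assms unfolding restricted_lie_hom_def module_hom_def by auto

text \<open>\<open>M\<close> is a bare record here, because this lemma helps to prove that it is a
  restricted Lie algebra.\<close>

lemma ad_coeff_hom:
  assumes L: "lie_algebra F L" and x: "x \<in> carrier L" and y: "y \<in> carrier L"
    and add: "\<And>x y. \<lbrakk>x \<in> carrier L; y \<in> carrier L\<rbrakk> \<Longrightarrow> h (x \<oplus>\<^bsub>L\<^esub> y) = h x \<oplus>\<^bsub>M\<^esub> h y"
    and br: "\<And>x y. \<lbrakk>x \<in> carrier L; y \<in> carrier L\<rbrakk> \<Longrightarrow> h (x \<otimes>\<^bsub>L\<^esub> y) = h x \<otimes>\<^bsub>M\<^esub> h y"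
    and z: "h \<zero>\<^bsub>L\<^esub> = \<zero>\<^bsub>M\<^esub>"
  shows "h (ad_coeff L x y n i) = ad_coeff M (h x) (h y) n i"
proof (induction n arbitrary: i)
  interpret lie_algebra F L by (rule L)
  case 0 show ?case by (simp add: z)
next
  interpret lie_algebra F L by (rule L)
  case (Suc n)
  have "(case i of 0 \<Rightarrow> \<zero>\<^bsub>L\<^esub> | Suc j \<Rightarrow> x \<otimes>\<^bsub>L\<^esub> ad_coeff L x y n j) \<in> carrier L"
    using x y by (auto split: nat.split simp: bracket_closed ad_coeff_closed)
  thus ?case using x y Suc
    by (auto split: nat.split simp: add br z bracket_closed ad_coeff_closed)
qed

text \<open>Apart from closure and the existence of negatives the axioms are identities, and all of
  them pass along a surjection preserving the operations. Preservation of zero is a separate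
  hypothesis, since before the group laws of \<open>M\<close> are known it does not follow from
  additivity.\<close>

lemma restricted_lie_algebra_image:
  assumes L: "restricted_lie_algebra F L" and surj: "q ` carrier L = carrier M"
    and z: "q \<zero>\<^bsub>L\<^esub> = \<zero>\<^bsub>M\<^esub>" and q: "q \<in> restricted_lie_hom F L M"
  shows "restricted_lie_algebra F M"
proof -
  interpret restricted_lie_algebra F L by (rule L)
  note h = restricted_lie_homD[OF q]
  have el: "\<exists>a\<in>carrier L. x = q a" if "x \<in> carrier M" for x using that surj by auto
  have "module F M"
  proof (rule module_criteria)
    show "cring F" ..
    show "\<zero>\<^bsub>M\<^esub> \<in> carrier M" using z h(1) by (metis M.zero_closed)
    show "\<forall>v w. v \<in> carrier M \<and> w \<in> carrier M \<longrightarrow> v \<oplus>\<^bsub>M\<^esub> w \<in> carrier M"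
      using el h(1,2) by (metis M.a_closed)
    show "\<forall>v\<in>carrier M. \<exists>w\<in>carrier M. v \<oplus>\<^bsub>M\<^esub> w = \<zero>\<^bsub>M\<^esub>"
      using el h(1,2) z by (metis M.a_inv_closed M.r_neg)
    show "\<forall>c v. c \<in> carrier F \<and> v \<in> carrier M \<longrightarrow> c \<odot>\<^bsub>M\<^esub> v \<in> carrier M"
      using el h(1,3) by (metis smult_closed)
    show "\<forall>v w. v \<in> carrier M \<and> w \<in> carrier M \<longrightarrow> v \<oplus>\<^bsub>M\<^esub> w = w \<oplus>\<^bsub>M\<^esub> v"
      using el h(2) by (metis M.a_comm)
    show "\<forall>v w x. v \<in> carrier M \<and> w \<in> carrier M \<and> x \<in> carrier M \<longrightarrow> v \<oplus>\<^bsub>M\<^esub> w \<oplus>\<^bsub>M\<^esub> x = v \<oplus>\<^bsub>M\<^esub> (w \<oplus>\<^bsub>M\<^esub> x)"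
    proof (intro allI impI, elim conjE)
      fix u v w assume "u \<in> carrier M" "v \<in> carrier M" "w \<in> carrier M"
      then obtain a b c where "a \<in> carrier L" "b \<in> carrier L" "c \<in> carrier L" "u = q a" "v = q b" "w = q c"
        using el by metis
      thus "u \<oplus>\<^bsub>M\<^esub> v \<oplus>\<^bsub>M\<^esub> w = u \<oplus>\<^bsub>M\<^esub> (v \<oplus>\<^bsub>M\<^esub> w)"
        by (simp add: h(2)[symmetric] M.a_assoc)
    qed
    show "\<forall>v\<in>carrier M. v \<oplus>\<^bsub>M\<^esub> \<zero>\<^bsub>M\<^esub> = v"
      using el h(2) z by (metis M.r_zero M.zero_closed)
    show "\<forall>a b v. a \<in> carrier F \<and> b \<in> carrier F \<and> v \<in> carrier M \<longrightarrow> (a \<otimes>\<^bsub>F\<^esub> b) \<odot>\<^bsub>M\<^esub> v = a \<odot>\<^bsub>M\<^esub> (b \<odot>\<^bsub>M\<^esub> v)"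
      using el h(3) by (metis smult_assoc1 smult_closed R.m_closed)
    show "\<forall>v\<in>carrier M. \<one>\<^bsub>F\<^esub> \<odot>\<^bsub>M\<^esub> v = v"
      using el h(3) by (metis smult_one R.one_closed)
    show "\<forall>a b v. a \<in> carrier F \<and> b \<in> carrier F \<and> v \<in> carrier M \<longrightarrow> (a \<oplus>\<^bsub>F\<^esub> b) \<odot>\<^bsub>M\<^esub> v = a \<odot>\<^bsub>M\<^esub> v \<oplus>\<^bsub>M\<^esub> b \<odot>\<^bsub>M\<^esub> v"
    proof (intro allI impI, elim conjE)
      fix a b v assume *: "a \<in> carrier F" "b \<in> carrier F" "v \<in> carrier M"
      then obtain x where "x \<in> carrier L" "v = q x" using el by metis
      thus "(a \<oplus>\<^bsub>F\<^esub> b) \<odot>\<^bsub>M\<^esub> v = a \<odot>\<^bsub>M\<^esub> v \<oplus>\<^bsub>M\<^esub> b \<odot>\<^bsub>M\<^esub> v"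
        using * by (simp add: h(2,3)[symmetric] smult_l_distr)
    qed
    show "\<forall>a v w. a \<in> carrier F \<and> v \<in> carrier M \<and> w \<in> carrier M \<longrightarrow> a \<odot>\<^bsub>M\<^esub> (v \<oplus>\<^bsub>M\<^esub> w) = a \<odot>\<^bsub>M\<^esub> v \<oplus>\<^bsub>M\<^esub> a \<odot>\<^bsub>M\<^esub> w"
    proof (intro allI impI, elim conjE)
      fix a v w assume *: "a \<in> carrier F" "v \<in> carrier M" "w \<in> carrier M"
      then obtain x y where "x \<in> carrier L" "v = q x" "y \<in> carrier L" "w = q y" using el by metis
      thus "a \<odot>\<^bsub>M\<^esub> (v \<oplus>\<^bsub>M\<^esub> w) = a \<odot>\<^bsub>M\<^esub> v \<oplus>\<^bsub>M\<^esub> a \<odot>\<^bsub>M\<^esub> w"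
        using * by (simp add: h(2,3)[symmetric] smult_r_distr)
    qed
  qed
  then interpret N: module F M .
  have lie: "lie_algebra F M"
  proof (intro lie_algebra.intro lie_algebra_axioms.intro vectorspace.intro)
    show "module F M" ..
    show "field F" ..
    fix x y z c assume "x \<in> carrier M"
    then obtain a where x: "a \<in> carrier L" "x = q a" using el by metis
    show "x \<otimes>\<^bsub>M\<^esub> x = \<zero>\<^bsub>M\<^esub>" using x by (simp add: h(4)[symmetric] bracket_self z)
    assume "y \<in> carrier M"
    then obtain b where y: "b \<in> carrier L" "y = q b" using el by metis
    show "x \<otimes>\<^bsub>M\<^esub> y \<in> carrier M" using x y by (simp add: h(4)[symmetric] h(1) bracket_closed)
    assume "z \<in> carrier M"
    then obtain d where z': "d \<in> carrier L" "z = q d" using el by metis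
    show "(x \<oplus>\<^bsub>M\<^esub> y) \<otimes>\<^bsub>M\<^esub> z = x \<otimes>\<^bsub>M\<^esub> z \<oplus>\<^bsub>M\<^esub> y \<otimes>\<^bsub>M\<^esub> z"
      using x y z' by (simp add: h(2,4)[symmetric] bracket_add_left bracket_closed)
    show "z \<otimes>\<^bsub>M\<^esub> (x \<oplus>\<^bsub>M\<^esub> y) = z \<otimes>\<^bsub>M\<^esub> x \<oplus>\<^bsub>M\<^esub> z \<otimes>\<^bsub>M\<^esub> y"
      using x y z' by (simp add: h(2,4)[symmetric] bracket_add_right bracket_closed)
    show "x \<otimes>\<^bsub>M\<^esub> (y \<otimes>\<^bsub>M\<^esub> z) \<oplus>\<^bsub>M\<^esub> y \<otimes>\<^bsub>M\<^esub> (z \<otimes>\<^bsub>M\<^esub> x) \<oplus>\<^bsub>M\<^esub> z \<otimes>\<^bsub>M\<^esub> (x \<otimes>\<^bsub>M\<^esub> y) = \<zero>\<^bsub>M\<^esub>"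
      using x y z' by (simp add: h(2,4)[symmetric] jacobi bracket_closed z)
  next
    fix c x y assume "x \<in> carrier M" "y \<in> carrier M" and c: "c \<in> carrier F"
    then obtain a b where x: "a \<in> carrier L" "x = q a" "b \<in> carrier L" "y = q b" using el by metis
    show "(c \<odot>\<^bsub>M\<^esub> x) \<otimes>\<^bsub>M\<^esub> y = c \<odot>\<^bsub>M\<^esub> (x \<otimes>\<^bsub>M\<^esub> y)"
      using x c by (simp add: h(3,4)[symmetric] bracket_smult_left bracket_closed)
    show "x \<otimes>\<^bsub>M\<^esub> (c \<odot>\<^bsub>M\<^esub> y) = c \<odot>\<^bsub>M\<^esub> (x \<otimes>\<^bsub>M\<^esub> y)"
      using x c by (simp add: h(3,4)[symmetric] bracket_smult_right bracket_closed)
  qed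
  have jac: "q (jacobson_term F L i x y) = jacobson_term F M i (q x) (q y)"
    if "i \<in> {1..<p}" "x \<in> carrier L" "y \<in> carrier L" for i x y
    unfolding jacobson_term_def
    using that by (simp add: h(3) jacobson_coeff_closed ad_coeff_closed
        ad_coeff_hom[OF lie_algebra_axioms that(2,3) h(2,4) z])
  have fs: "q (finsum L f A) = finsum M (\<lambda>i. q (f i)) A" if "finite A" "f \<in> A \<rightarrow> carrier L" for f and A :: "nat set"
    using that
  proof (induction A rule: finite_induct)
    case (insert a A)
    have *: "f \<in> A \<rightarrow> carrier L" "f a \<in> carrier L" using insert by auto
    hence **: "(\<lambda>i. q (f i)) \<in> A \<rightarrow> carrier M" "q (f a) \<in> carrier M" using h(1) by auto
    show ?case using insert * ** by (simp add: h(2))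
  qed (simp add: z)
  show ?thesis
  proof (intro restricted_lie_algebra.intro lie restricted_lie_algebra_axioms.intro)
    show "p > 0" by (rule char_pos)
    fix x y c assume "x \<in> carrier M"
    then obtain a where x: "a \<in> carrier L" "x = q a" using el by metis
    show "pmap M x \<in> carrier M" using x by (simp add: h(5)[symmetric] h(1) pmap_closed)
    show "pmap M (c \<odot>\<^bsub>M\<^esub> x) = c [^]\<^bsub>F\<^esub> p \<odot>\<^bsub>M\<^esub> pmap M x" if "c \<in> carrier F"
      using that x by (simp add: h(3,5)[symmetric] pmap_smult pmap_closed)
    assume "y \<in> carrier M"
    then obtain b where y: "b \<in> carrier L" "y = q b" using el by metis
    have "((\<lambda>z. x \<otimes>\<^bsub>M\<^esub> z) ^^ n) y = q (((\<lambda>z. a \<otimes>\<^bsub>L\<^esub> z) ^^ n) b) \<and> ((\<lambda>z. a \<otimes>\<^bsub>L\<^esub> z) ^^ n) b \<in> carrier L" for n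
      using x y by (induction n) (auto simp: h(4) bracket_closed)
    thus "pmap M x \<otimes>\<^bsub>M\<^esub> y = ((\<lambda>z. x \<otimes>\<^bsub>M\<^esub> z) ^^ p) y"
      using x y by (simp add: h(4,5)[symmetric] pmap_bracket pmap_closed)
    have jc: "jacobson_term F L i a b \<in> carrier L" if "i \<in> {1..<p}" for i
      using jacobson_term_closed[OF that x(1) y(1)] .
    have "pmap M (x \<oplus>\<^bsub>M\<^esub> y) = q (pmap L a \<oplus>\<^bsub>L\<^esub> pmap L b \<oplus>\<^bsub>L\<^esub> (\<Oplus>\<^bsub>L\<^esub>i\<in>{1..<p}. jacobson_term F L i a b))"
      using x y by (simp add: h(2)[symmetric] h(5)[symmetric] pmap_add)
    also have "\<dots> = q (pmap L a) \<oplus>\<^bsub>M\<^esub> q (pmap L b) \<oplus>\<^bsub>M\<^esub> q (\<Oplus>\<^bsub>L\<^esub>i\<in>{1..<p}. jacobson_term F L i a b)"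
    proof -
      have "(\<Oplus>\<^bsub>L\<^esub>i\<in>{1..<p}. jacobson_term F L i a b) \<in> carrier L"
        using jc by (intro M.finsum_closed) auto
      thus ?thesis using x y by (simp add: h(2) pmap_closed)
    qed
    also have "q (\<Oplus>\<^bsub>L\<^esub>i\<in>{1..<p}. jacobson_term F L i a b) = (\<Oplus>\<^bsub>M\<^esub>i\<in>{1..<p}. q (jacobson_term F L i a b))"
      using jc by (intro fs) auto
    also have "\<dots> = (\<Oplus>\<^bsub>M\<^esub>i\<in>{1..<p}. jacobson_term F M i x y)"
    proof (intro N.M.finsum_cong' refl)
      show "q (jacobson_term F L i a b) = jacobson_term F M i x y" if "i \<in> {1..<p}" for i
        using jac[OF that x(1) y(1)] x y by simp
      show "(\<lambda>i. jacobson_term F M i x y) \<in> {1..<p} \<rightarrow> carrier M"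
        using jac[OF _ x(1) y(1)] h(1)[OF jc] x y by auto
    qed
    finally show "pmap M (x \<oplus>\<^bsub>M\<^esub> y) = pmap M x \<oplus>\<^bsub>M\<^esub> pmap M y \<oplus>\<^bsub>M\<^esub> (\<Oplus>\<^bsub>M\<^esub>i\<in>{1..<p}. jacobson_term F M i x y)"
      using x y by (simp add: h(5))
  qed
qed

section \<open>Quotients by restricted ideals\<close>

context restricted_lie_algebra
begin

lemma quot_abelian_subgroup:
  assumes "subspace F S L" shows "abelian_subgroup S L"
proof (rule abelian_subgroupI3)
  note V = subspaceD[OF assms]
  show "additive_subgroup S L"
    unfolding additive_subgroup_def subgroup_def
    using V by (auto simp: a_inv_def[symmetric])
qed (rule M.abelian_group_axioms)

text \<open>The quotient operations are unions of cosets over all representatives. A map that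
  respects congruence gives the same coset each time, so the union is that coset.\<close>

lemma coset_UN_eq:
  assumes S: "subspace F S L" and x: "x \<in> carrier L"
    and g: "\<And>y. \<lbrakk>y \<in> carrier L; y \<ominus> x \<in> S\<rbrakk> \<Longrightarrow> g y \<in> carrier L \<and> g y \<ominus> g x \<in> S"
    and gx: "g x \<in> carrier L"
  shows "(\<Union>y\<in>S +>\<^bsub>L\<^esub> x. S +>\<^bsub>L\<^esub> g y) = S +>\<^bsub>L\<^esub> g x"
proof -
  interpret S: abelian_subgroup S L by (rule quot_abelian_subgroup[OF S])
  have "S +>\<^bsub>L\<^esub> g y = S +>\<^bsub>L\<^esub> g x" if "y \<in> S +>\<^bsub>L\<^esub> x" for y
  proof -
    have "y \<in> carrier L" using S.a_elemrcos_carrier[OF x that] .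
    moreover from this have "y \<ominus> x \<in> S" using S.a_rcos_module x that unfolding M.minus_eq by blast
    ultimately have "g y \<in> carrier L" "g y \<ominus> g x \<in> S" using g by auto
    hence "g y \<in> S +>\<^bsub>L\<^esub> g x"
      using S.a_rcos_module gx unfolding M.minus_eq by blast
    thus ?thesis using S.a_repr_independence' gx by blast
  qed
  moreover have "x \<in> S +>\<^bsub>L\<^esub> x" using S.a_rcos_self[OF x] .
  ultimately show ?thesis by blast
qed

lemma coset_eq_iff:
  assumes S: "subspace F S L" and x: "x \<in> carrier L" and y: "y \<in> carrier L"
  shows "S +>\<^bsub>L\<^esub> x = S +>\<^bsub>L\<^esub> y \<longleftrightarrow> x \<ominus> y \<in> S"
proof -
  interpret S: abelian_subgroup S L by (rule quot_abelian_subgroup[OF S])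
  show ?thesis using S.a_rcos_module[OF y x] S.a_repr_independence'[of x y] S.a_rcos_self[OF x] y unfolding M.minus_eq by blast
qed

lemma quot_lie_simps:
  "carrier (quot_lie L S) = (\<lambda>x. S +>\<^bsub>L\<^esub> x) ` carrier L"
  "\<zero>\<^bsub>quot_lie L S\<^esub> = S"
  "X \<oplus>\<^bsub>quot_lie L S\<^esub> Y = X <+>\<^bsub>L\<^esub> Y"
  "X \<otimes>\<^bsub>quot_lie L S\<^esub> Y = (\<Union>a\<in>X. \<Union>b\<in>Y. S +>\<^bsub>L\<^esub> (a \<otimes> b))"
  "c \<odot>\<^bsub>quot_lie L S\<^esub> X = (\<Union>x\<in>X. S +>\<^bsub>L\<^esub> (c \<odot> x))"
  "pmap (quot_lie L S) X = (\<Union>x\<in>X. S +>\<^bsub>L\<^esub> pmap L x)"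
  unfolding quot_lie_def quot_module_def FactRing_def rcoset_mult_def A_RCOSETS_def'
  by (auto simp: ring.defs module.defs restricted_lie.defs a_r_coset_def' r_coset_def)

lemma quot_lie:
  assumes S: "restricted_ideal S"
  defines "q \<equiv> \<lambda>x. S +>\<^bsub>L\<^esub> x"
  shows "q \<in> restricted_lie_hom F L (quot_lie L S)"
    and "restricted_lie_algebra F (quot_lie L S)"
    and "carrier (quot_lie L S) = q ` carrier L"
    and "\<And>x. x \<in> carrier L \<Longrightarrow> q x = \<zero>\<^bsub>quot_lie L S\<^esub> \<longleftrightarrow> x \<in> S"
proof -
  have I: "lie_ideal S" and pm: "\<And>x. x \<in> S \<Longrightarrow> pmap L x \<in> S" using S unfolding restricted_ideal_def by auto
  note ss = lie_idealD(1)[OF I]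
  note V = subspaceD[OF ss]
  interpret S: abelian_subgroup S L by (rule quot_abelian_subgroup[OF ss])
  show car: "carrier (quot_lie L S) = q ` carrier L" unfolding quot_lie_simps q_def ..
  have diff: "y = x \<oplus> (y \<ominus> x)" if "x \<in> carrier L" "y \<in> carrier L" for x y
    using that by (simp add: M.minus_eq M.a_lcomm[of x y] M.r_neg)
  have mult: "q (x \<otimes> y) = q x \<otimes>\<^bsub>quot_lie L S\<^esub> q y" if x: "x \<in> carrier L" and y: "y \<in> carrier L" for x y
  proof -
    \<comment> \<open>The bracket of two cosets is a double union: the inner one collapses for each
      fixed a, afterwards the outer one.\<close>
    have "(\<Union>b\<in>q y. S +>\<^bsub>L\<^esub> (a \<otimes> b)) = S +>\<^bsub>L\<^esub> (a \<otimes> y)" if a: "a \<in> carrier L" for a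
      unfolding q_def
    proof (rule coset_UN_eq[OF ss y])
      fix b assume b: "b \<in> carrier L" "b \<ominus> y \<in> S"
      have "a \<otimes> b = a \<otimes> y \<oplus> a \<otimes> (b \<ominus> y)"
        using diff[OF y b(1)] bracket_add_right[of y "b \<ominus> y" a] a b y by simp
      hence "a \<otimes> b \<ominus> a \<otimes> y = a \<otimes> (b \<ominus> y)"
        using a b y bracket_closed by (simp add: M.minus_eq M.a_ac M.r_neg1 M.r_neg2)
      thus "a \<otimes> b \<in> carrier L \<and> a \<otimes> b \<ominus> a \<otimes> y \<in> S"
        using lie_idealD(3)[OF I b(2) a] a b bracket_closed by simp
    qed (use a y bracket_closed in auto)
    moreover have "q x \<subseteq> carrier L" using S.a_elemrcos_carrier[OF x] unfolding q_def by blast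
    ultimately have "q x \<otimes>\<^bsub>quot_lie L S\<^esub> q y = (\<Union>a\<in>q x. S +>\<^bsub>L\<^esub> (a \<otimes> y))"
      unfolding quot_lie_simps by (intro SUP_cong) auto
    also have "\<dots> = S +>\<^bsub>L\<^esub> (x \<otimes> y)"
      unfolding q_def
    proof (rule coset_UN_eq[OF ss x])
      fix a assume a: "a \<in> carrier L" "a \<ominus> x \<in> S"
      have "a \<otimes> y = x \<otimes> y \<oplus> (a \<ominus> x) \<otimes> y"
        using diff[OF x a(1)] bracket_add_left[of x "a \<ominus> x" y] a x y by simp
      hence "a \<otimes> y \<ominus> x \<otimes> y = (a \<ominus> x) \<otimes> y"
        using a x y bracket_closed by (simp add: M.minus_eq M.a_ac M.r_neg1 M.r_neg2)
      thus "a \<otimes> y \<in> carrier L \<and> a \<otimes> y \<ominus> x \<otimes> y \<in> S"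
        using lie_idealD(2)[OF I a(2) y] a y bracket_closed by simp
    qed (use x y bracket_closed in auto)
    finally show ?thesis unfolding q_def by simp
  qed
  have add: "q (x \<oplus> y) = q x \<oplus>\<^bsub>quot_lie L S\<^esub> q y" if x: "x \<in> carrier L" and y: "y \<in> carrier L" for x y
    unfolding quot_lie_simps q_def using S.a_rcos_sum[OF x y] by simp
  have smult: "q (c \<odot> x) = c \<odot>\<^bsub>quot_lie L S\<^esub> q x" if x: "x \<in> carrier L" and c: "c \<in> carrier F" for x c
    unfolding quot_lie_simps q_def
  proof (rule coset_UN_eq[OF ss x, symmetric])
    fix y assume y: "y \<in> carrier L" "y \<ominus> x \<in> S"
    have "c \<odot> y \<ominus> c \<odot> x = c \<odot> (y \<ominus> x)"
      using x y c by (simp add: M.minus_eq smult_r_distr smult_r_minus)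
    thus "c \<odot> y \<in> carrier L \<and> c \<odot> y \<ominus> c \<odot> x \<in> S" using V(4)[OF c y(2)] c y by simp
  qed (use x c in auto)
  have pmapq: "q (pmap L x) = pmap (quot_lie L S) (q x)" if x: "x \<in> carrier L" for x
    unfolding quot_lie_simps q_def
  proof (rule coset_UN_eq[OF ss x, symmetric])
    fix y assume y: "y \<in> carrier L" "y \<ominus> x \<in> S"
    \<comment> \<open>Jacobson's formula for y = x + (y - x): the p-th power of the difference and
      the mixed terms both lie in \<open>S\<close>.\<close>
    obtain s where s: "s \<in> S" "pmap L y = pmap L x \<oplus> pmap L (y \<ominus> x) \<oplus> s"
      using pmap_add_ideal[OF I x y(2)] diff[OF x y(1)] by auto
    have "s \<in> carrier L" using s V(1) by auto
    hence "pmap L y \<ominus> pmap L x = pmap L (y \<ominus> x) \<oplus> s"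
      unfolding s(2) using pmap_closed x y by (simp add: M.minus_eq M.a_ac M.r_neg1 M.r_neg2)
    thus "pmap L y \<in> carrier L \<and> pmap L y \<ominus> pmap L x \<in> S"
      using V(3)[OF pm[OF y(2)] s(1)] pmap_closed y by simp
  qed (use x pmap_closed in auto)
  show hom: "q \<in> restricted_lie_hom F L (quot_lie L S)"
    unfolding restricted_lie_hom_def module_hom_def
    using mult add smult pmapq car by auto
  have zero: "q \<zero> = \<zero>\<^bsub>quot_lie L S\<^esub>"
    unfolding quot_lie_simps q_def using V(1) by simp
  show "restricted_lie_algebra F (quot_lie L S)"
    using restricted_lie_algebra_image[OF restricted_lie_algebra_axioms _ zero hom] car by simp
  show "\<And>x. x \<in> carrier L \<Longrightarrow> q x = \<zero>\<^bsub>quot_lie L S\<^esub> \<longleftrightarrow> x \<in> S"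
    unfolding q_def by (metis S.a_rcos_const S.a_rcos_self quot_lie_simps(2))
qed

end

section \<open>Nilpotent semilinear maps\<close>

definition lin_functional :: "('k, 'c) ring_scheme \<Rightarrow> ('k, 'a, 'm) module_scheme \<Rightarrow> ('a \<Rightarrow> 'k) \<Rightarrow> bool" where
  "lin_functional F A l \<longleftrightarrow> (\<forall>x\<in>carrier A. l x \<in> carrier F) \<and>
     (\<forall>x\<in>carrier A. \<forall>y\<in>carrier A. l (x \<oplus>\<^bsub>A\<^esub> y) = l x \<oplus>\<^bsub>F\<^esub> l y) \<and>
     (\<forall>c\<in>carrier F. \<forall>x\<in>carrier A. l (c \<odot>\<^bsub>A\<^esub> x) = c \<otimes>\<^bsub>F\<^esub> l x)"

lemma lin_functionalD:
  assumes "lin_functional F A l"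
  shows "\<And>x. x \<in> carrier A \<Longrightarrow> l x \<in> carrier F"
    "\<And>x y. \<lbrakk>x \<in> carrier A; y \<in> carrier A\<rbrakk> \<Longrightarrow> l (x \<oplus>\<^bsub>A\<^esub> y) = l x \<oplus>\<^bsub>F\<^esub> l y"
    "\<And>c x. \<lbrakk>c \<in> carrier F; x \<in> carrier A\<rbrakk> \<Longrightarrow> l (c \<odot>\<^bsub>A\<^esub> x) = c \<otimes>\<^bsub>F\<^esub> l x"
  using assms unfolding lin_functional_def by auto

lemma (in abelian_group) minus_zero_simps [simp]:
  "\<ominus> \<zero> = \<zero>" "x \<in> carrier G \<Longrightarrow> x \<ominus> \<zero> = x"
proof -
  show *: "\<ominus> \<zero> = \<zero>" by (rule minus_equality) auto
  show "x \<in> carrier G \<Longrightarrow> x \<ominus> \<zero> = x" by (simp add: minus_eq *)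
qed

text \<open>By Zorn's lemma there is a maximal subspace that contains \<open>S\<close> and misses
  \<open>v\<close>. It is a hyperplane complementary to \<open>v\<close>, and the functional is the
  coordinate along \<open>v\<close>. The spaces to which this is applied may be
  infinite-dimensional.\<close>

lemma (in vectorspace) separating_functional:
  assumes S: "subspace K S V" and v: "v \<in> carrier V" "v \<notin> S"
  shows "\<exists>l. lin_functional K V l \<and> (\<forall>x\<in>S. l x = \<zero>\<^bsub>K\<^esub>) \<and> l v = \<one>\<^bsub>K\<^esub>"
proof -
  have vs: "vectorspace K V" ..
  let ?A = "{W. subspace K W V \<and> S \<subseteq> W \<and> v \<notin> W}"
  have "\<exists>W\<in>?A. \<forall>X\<in>?A. W \<subseteq> X \<longrightarrow> X = W"
  proof (rule subset_Zorn_nonempty)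
    show "?A \<noteq> {}" using S v by blast
    fix C assume ne: "C \<noteq> {}" and ch: "subset.chain ?A C"
    have CA: "C \<subseteq> ?A" and tot: "\<And>X Y. \<lbrakk>X \<in> C; Y \<in> C\<rbrakk> \<Longrightarrow> X \<subseteq> Y \<or> Y \<subseteq> X"
      using ch unfolding subset.chain_def by auto
    have sub: "subspace K X V" if "X \<in> C" for X using CA that by auto
    have "subspace K (\<Union>C) V"
      unfolding subspace_iff[OF vs]
    proof (intro conjI ballI)
      show "\<Union>C \<subseteq> carrier V" using sub subspaceD(1) by blast
      show "\<zero>\<^bsub>V\<^esub> \<in> \<Union>C" using ne sub subspaceD(2) by blast
      show "c \<odot>\<^bsub>V\<^esub> x \<in> \<Union>C" if c: "c \<in> carrier K" and x: "x \<in> \<Union>C" for c x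
      proof -
        obtain X where X: "X \<in> C" "x \<in> X" using x by auto
        show ?thesis using subspaceD(4)[OF sub[OF X(1)] c X(2)] X(1) by auto
      qed
      fix x y assume "x \<in> \<Union>C" "y \<in> \<Union>C"
      then obtain X Y where XY: "X \<in> C" "Y \<in> C" "x \<in> X" "y \<in> Y" by blast
      then obtain Z where Z: "Z \<in> C" "x \<in> Z" "y \<in> Z" using tot[OF XY(1,2)] by auto
      show "x \<oplus>\<^bsub>V\<^esub> y \<in> \<Union>C" using subspaceD(3)[OF sub[OF Z(1)] Z(2,3)] Z(1) by auto
    qed
    thus "\<Union>C \<in> ?A" using ne CA by blast
  qed
  then obtain W where W0: "W \<in> ?A" and max0: "\<forall>X\<in>?A. W \<subseteq> X \<longrightarrow> X = W" by (rule bexE)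
  have W: "subspace K W V" "S \<subseteq> W" "v \<notin> W" using W0 by auto
  have max: "X = W" if "subspace K X V" "S \<subseteq> X" "v \<notin> X" "W \<subseteq> X" for X
    using max0 that by simp
  note D = subspaceD[OF W(1)]
  have ex: "\<exists>c\<in>carrier K. x \<ominus>\<^bsub>V\<^esub> c \<odot>\<^bsub>V\<^esub> v \<in> W" if x: "x \<in> carrier V" for x
  proof (cases "x \<in> W")
    case True
    thus ?thesis using x v by (intro bexI[of _ "\<zero>\<^bsub>K\<^esub>"]) (simp_all add: M.minus_eq)
  next
    case False
    \<comment> \<open>By maximality, adjoining \<open>x\<close> to \<open>W\<close> must capture
      \<open>v\<close>; solving that equation for \<open>x\<close> gives the coordinate.\<close>
    let ?X = "{w \<oplus>\<^bsub>V\<^esub> d \<odot>\<^bsub>V\<^esub> x | w d. w \<in> W \<and> d \<in> carrier K}"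
    have WX: "W \<subseteq> ?X"
    proof
      fix w assume w: "w \<in> W"
      hence "w = w \<oplus>\<^bsub>V\<^esub> \<zero>\<^bsub>K\<^esub> \<odot>\<^bsub>V\<^esub> x" using D(1) x by auto
      thus "w \<in> ?X" using w by blast
    qed
    have "subspace K ?X V"
      unfolding subspace_iff[OF vs]
    proof (intro conjI ballI)
      show "?X \<subseteq> carrier V" using D(1) x by auto
      show "\<zero>\<^bsub>V\<^esub> \<in> ?X" using WX D(2) by blast
      fix y assume "y \<in> ?X"
      then obtain w d where y: "w \<in> W" "d \<in> carrier K" "y = w \<oplus>\<^bsub>V\<^esub> d \<odot>\<^bsub>V\<^esub> x" by auto
      have wc: "w \<in> carrier V" using y D(1) by auto
      show "c \<odot>\<^bsub>V\<^esub> y \<in> ?X" if c: "c \<in> carrier K" for c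
      proof -
        have "c \<odot>\<^bsub>V\<^esub> y = c \<odot>\<^bsub>V\<^esub> w \<oplus>\<^bsub>V\<^esub> (c \<otimes>\<^bsub>K\<^esub> d) \<odot>\<^bsub>V\<^esub> x"
          using y wc x c by (simp add: smult_r_distr smult_assoc1)
        thus ?thesis using D(4)[OF c y(1)] c y(2) by blast
      qed
      fix z assume "z \<in> ?X"
      then obtain w' d' where z: "w' \<in> W" "d' \<in> carrier K" "z = w' \<oplus>\<^bsub>V\<^esub> d' \<odot>\<^bsub>V\<^esub> x" by auto
      have wc': "w' \<in> carrier V" using z D(1) by auto
      have "y \<oplus>\<^bsub>V\<^esub> z = (w \<oplus>\<^bsub>V\<^esub> w') \<oplus>\<^bsub>V\<^esub> (d \<oplus>\<^bsub>K\<^esub> d') \<odot>\<^bsub>V\<^esub> x"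
        using y z wc wc' x by (simp add: smult_l_distr M.a_ac)
      moreover have "d \<oplus>\<^bsub>K\<^esub> d' \<in> carrier K" using y z by simp
      ultimately show "y \<oplus>\<^bsub>V\<^esub> z \<in> ?X" using D(3)[OF y(1) z(1)] by blast
    qed
    moreover have "x \<in> ?X"
    proof -
      have "x = \<zero>\<^bsub>V\<^esub> \<oplus>\<^bsub>V\<^esub> \<one>\<^bsub>K\<^esub> \<odot>\<^bsub>V\<^esub> x" using x by simp
      thus ?thesis using D(2) R.one_closed by blast
    qed
    ultimately have "v \<in> ?X" using max[of ?X] WX W(2) False by blast
    then obtain w d where wd: "w \<in> W" "d \<in> carrier K" "v = w \<oplus>\<^bsub>V\<^esub> d \<odot>\<^bsub>V\<^esub> x" by auto
    have wc: "w \<in> carrier V" using wd D(1) by auto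
    \<comment> \<open>Otherwise \<open>v\<close> would be \<open>w\<close> and lie in
      \<open>W\<close>.\<close>
    have "d \<noteq> \<zero>\<^bsub>K\<^esub>" using wd wc x W(3) by auto
    hence u: "d \<in> Units K" using wd field_Units by auto
    let ?i = "inv\<^bsub>K\<^esub> d"
    have i: "?i \<in> carrier K" using u by simp
    have "?i \<odot>\<^bsub>V\<^esub> v = ?i \<odot>\<^bsub>V\<^esub> w \<oplus>\<^bsub>V\<^esub> (?i \<otimes>\<^bsub>K\<^esub> d) \<odot>\<^bsub>V\<^esub> x"
      using wd wc x i by (simp add: smult_r_distr smult_assoc1)
    also have "\<dots> = ?i \<odot>\<^bsub>V\<^esub> w \<oplus>\<^bsub>V\<^esub> x" using u x by (simp add: R.Units_l_inv)
    finally have "x \<ominus>\<^bsub>V\<^esub> ?i \<odot>\<^bsub>V\<^esub> v = \<ominus>\<^bsub>V\<^esub> (?i \<odot>\<^bsub>V\<^esub> w)"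
      using x wc i by (simp add: M.minus_eq M.minus_add M.a_lcomm[of x] M.r_neg)
    thus ?thesis using D(5)[OF D(4)[OF i wd(1)]] i by (intro bexI[of _ ?i]) simp_all
  qed
  have uniq: "c = d" if c: "c \<in> carrier K" "d \<in> carrier K" "x \<in> carrier V"
    and m: "x \<ominus>\<^bsub>V\<^esub> c \<odot>\<^bsub>V\<^esub> v \<in> W" "x \<ominus>\<^bsub>V\<^esub> d \<odot>\<^bsub>V\<^esub> v \<in> W" for x c d
  proof (rule ccontr)
    assume "c \<noteq> d"
    hence "d \<ominus>\<^bsub>K\<^esub> c \<noteq> \<zero>\<^bsub>K\<^esub>" using c by (metis R.minus_other_side)
    hence u: "d \<ominus>\<^bsub>K\<^esub> c \<in> Units K" using c field_Units by auto
    have "(x \<ominus>\<^bsub>V\<^esub> c \<odot>\<^bsub>V\<^esub> v) \<ominus>\<^bsub>V\<^esub> (x \<ominus>\<^bsub>V\<^esub> d \<odot>\<^bsub>V\<^esub> v) = (d \<ominus>\<^bsub>K\<^esub> c) \<odot>\<^bsub>V\<^esub> v"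
      using c v by (simp add: M.minus_eq M.minus_add R.minus_eq smult_l_distr smult_l_minus M.a_ac M.r_neg1 M.r_neg2 M.r_neg)
    hence dv: "(d \<ominus>\<^bsub>K\<^esub> c) \<odot>\<^bsub>V\<^esub> v \<in> W" using D(6)[OF m] by simp
    have "inv\<^bsub>K\<^esub> (d \<ominus>\<^bsub>K\<^esub> c) \<odot>\<^bsub>V\<^esub> ((d \<ominus>\<^bsub>K\<^esub> c) \<odot>\<^bsub>V\<^esub> v) \<in> W"
      by (rule D(4)[OF R.Units_inv_closed[OF u] dv])
    moreover have "inv\<^bsub>K\<^esub> (d \<ominus>\<^bsub>K\<^esub> c) \<odot>\<^bsub>V\<^esub> ((d \<ominus>\<^bsub>K\<^esub> c) \<odot>\<^bsub>V\<^esub> v) = v"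
      using u c v by (simp add: smult_assoc1[symmetric] R.Units_l_inv)
    ultimately show False using W(3) by simp
  qed
  define l where "l x = (THE c. c \<in> carrier K \<and> x \<ominus>\<^bsub>V\<^esub> c \<odot>\<^bsub>V\<^esub> v \<in> W)" for x
  have l: "l x = c" if "x \<in> carrier V" "c \<in> carrier K" "x \<ominus>\<^bsub>V\<^esub> c \<odot>\<^bsub>V\<^esub> v \<in> W" for x c
    unfolding l_def using that uniq by blast
  have l': "l x \<in> carrier K \<and> x \<ominus>\<^bsub>V\<^esub> l x \<odot>\<^bsub>V\<^esub> v \<in> W" if "x \<in> carrier V" for x
    using ex[OF that] l[OF that] by auto
  have "lin_functional K V l"
    unfolding lin_functional_def
  proof (intro conjI ballI)
    fix x assume x: "x \<in> carrier V"
    note lx = conjunct1[OF l'[OF x]] conjunct2[OF l'[OF x]]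
    show "l x \<in> carrier K" by (rule lx)
    show "l (c \<odot>\<^bsub>V\<^esub> x) = c \<otimes>\<^bsub>K\<^esub> l x" if c: "c \<in> carrier K" for c
    proof (rule l)
      have "c \<odot>\<^bsub>V\<^esub> x \<ominus>\<^bsub>V\<^esub> (c \<otimes>\<^bsub>K\<^esub> l x) \<odot>\<^bsub>V\<^esub> v = c \<odot>\<^bsub>V\<^esub> (x \<ominus>\<^bsub>V\<^esub> l x \<odot>\<^bsub>V\<^esub> v)"
        using x c lx v by (simp add: M.minus_eq smult_r_distr smult_assoc1 smult_r_minus)
      thus "c \<odot>\<^bsub>V\<^esub> x \<ominus>\<^bsub>V\<^esub> (c \<otimes>\<^bsub>K\<^esub> l x) \<odot>\<^bsub>V\<^esub> v \<in> W" using D(4)[OF c lx(2)] by simp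
    qed (use x c lx in auto)
    fix y assume y: "y \<in> carrier V"
    note ly = conjunct1[OF l'[OF y]] conjunct2[OF l'[OF y]]
    show "l (x \<oplus>\<^bsub>V\<^esub> y) = l x \<oplus>\<^bsub>K\<^esub> l y"
    proof (rule l)
      have "(x \<oplus>\<^bsub>V\<^esub> y) \<ominus>\<^bsub>V\<^esub> (l x \<oplus>\<^bsub>K\<^esub> l y) \<odot>\<^bsub>V\<^esub> v = (x \<ominus>\<^bsub>V\<^esub> l x \<odot>\<^bsub>V\<^esub> v) \<oplus>\<^bsub>V\<^esub> (y \<ominus>\<^bsub>V\<^esub> l y \<odot>\<^bsub>V\<^esub> v)"
        using x y lx(1) ly(1) v by (simp add: M.minus_eq smult_l_distr M.minus_add M.a_ac)
      thus "(x \<oplus>\<^bsub>V\<^esub> y) \<ominus>\<^bsub>V\<^esub> (l x \<oplus>\<^bsub>K\<^esub> l y) \<odot>\<^bsub>V\<^esub> v \<in> W" using D(3)[OF lx(2) ly(2)] by simp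
    qed (use x y lx(1) ly(1) in auto)
  qed
  moreover have "l x = \<zero>\<^bsub>K\<^esub>" if "x \<in> S" for x
  proof -
    have x: "x \<in> W" "x \<in> carrier V" using that W(2) D(1) by auto
    show ?thesis using x v by (intro l) simp_all
  qed
  moreover have "l v = \<one>\<^bsub>K\<^esub>"
    using v D(2) by (intro l) (auto simp: M.minus_eq M.r_neg)
  ultimately show ?thesis by blast
qed

lemma (in abelian_monoid) finsum_lessThan_Suc:
  assumes "\<And>i. i \<le> (n::nat) \<Longrightarrow> f i \<in> carrier G"
  shows "finsum G f {..<Suc n} = finsum G f {..<n} \<oplus> f n"
proof -
  have "f \<in> {..<n} \<rightarrow> carrier G" "f n \<in> carrier G" using assms by auto
  thus ?thesis unfolding lessThan_Suc by (simp add: a_comm)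
qed

lemma (in abelian_monoid) finsum_lessThan_Suc_shift:
  assumes "\<And>i. i \<le> (n::nat) \<Longrightarrow> f i \<in> carrier G"
  shows "finsum G f {..<Suc n} = f 0 \<oplus> finsum G (\<lambda>i. f (Suc i)) {..<n}"
  using assms
proof (induction n)
  case 0 thus ?case by (simp add: lessThan_Suc)
next
  case (Suc n)
  have 1: "f (Suc i) \<in> carrier G" if "i \<le> n" for i using Suc.prems that by simp
  have 2: "(\<lambda>i. f (Suc i)) \<in> {..<n} \<rightarrow> carrier G" using 1 by auto
  have "finsum G f {..<Suc (Suc n)} = finsum G f {..<Suc n} \<oplus> f (Suc n)"
    by (rule finsum_lessThan_Suc[OF Suc.prems])
  also have "\<dots> = f 0 \<oplus> finsum G (\<lambda>i. f (Suc i)) {..<n} \<oplus> f (Suc n)"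
    using Suc by simp
  also have "\<dots> = f 0 \<oplus> finsum G (\<lambda>i. f (Suc i)) {..<Suc n}"
  proof -
    have "finsum G (\<lambda>i. f (Suc i)) {..<Suc n} = finsum G (\<lambda>i. f (Suc i)) {..<n} \<oplus> f (Suc n)"
      by (rule finsum_lessThan_Suc[OF 1])
    thus ?thesis using 2 1[of n] Suc.prems[of 0] by (simp add: a_assoc del: lessThan_Suc)
  qed
  finally show ?case .
qed

text \<open>A module over the skew polynomial ring in which \<open>\<phi>\<close> moves past a
  scalar by raising it to the p-th power. The instance is an abelian quotient with its p-map, which
  is additive because all Jacobson terms vanish.\<close>

locale frob_space = perfect_char_p F p + A: vectorspace F A
  for F :: "('k, 'c) ring_scheme" (structure) and p :: nat and A :: "('k, 'a, 'm) module_scheme" +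
  fixes \<phi> :: "'a \<Rightarrow> 'a"
  assumes \<phi>_closed: "x \<in> carrier A \<Longrightarrow> \<phi> x \<in> carrier A"
    and \<phi>_add: "\<lbrakk>x \<in> carrier A; y \<in> carrier A\<rbrakk> \<Longrightarrow> \<phi> (x \<oplus>\<^bsub>A\<^esub> y) = \<phi> x \<oplus>\<^bsub>A\<^esub> \<phi> y"
    and \<phi>_smult: "\<lbrakk>c \<in> carrier F; x \<in> carrier A\<rbrakk> \<Longrightarrow> \<phi> (c \<odot>\<^bsub>A\<^esub> x) = (c [^] p) \<odot>\<^bsub>A\<^esub> \<phi> x"
begin

lemma \<phi>_zero [simp]: "\<phi> \<zero>\<^bsub>A\<^esub> = \<zero>\<^bsub>A\<^esub>"
  using \<phi>_smult[of \<zero> "\<zero>\<^bsub>A\<^esub>"] \<phi>_closed[of "\<zero>\<^bsub>A\<^esub>"] by simp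

lemma \<phi>_minus: "x \<in> carrier A \<Longrightarrow> \<phi> (\<ominus>\<^bsub>A\<^esub> x) = \<ominus>\<^bsub>A\<^esub> \<phi> x"
  using \<phi>_add[of "\<ominus>\<^bsub>A\<^esub> x" x] \<phi>_closed by (intro A.M.minus_equality[symmetric]) (simp_all add: A.M.l_neg)

lemma \<phi>_pow_closed: "x \<in> carrier A \<Longrightarrow> (\<phi> ^^ k) x \<in> carrier A"
  by (induction k) (auto simp: \<phi>_closed)

lemma \<phi>_pow_add: "\<lbrakk>x \<in> carrier A; y \<in> carrier A\<rbrakk> \<Longrightarrow> (\<phi> ^^ k) (x \<oplus>\<^bsub>A\<^esub> y) = (\<phi> ^^ k) x \<oplus>\<^bsub>A\<^esub> (\<phi> ^^ k) y"
  by (induction k) (auto simp: \<phi>_add \<phi>_pow_closed)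

lemma \<phi>_pow_zero [simp]: "(\<phi> ^^ k) \<zero>\<^bsub>A\<^esub> = \<zero>\<^bsub>A\<^esub>"
  by (induction k) auto

lemma \<phi>_pow_minus: "x \<in> carrier A \<Longrightarrow> (\<phi> ^^ k) (\<ominus>\<^bsub>A\<^esub> x) = \<ominus>\<^bsub>A\<^esub> (\<phi> ^^ k) x"
  by (induction k) (auto simp: \<phi>_minus \<phi>_pow_closed)

lemma \<phi>_pow_smult: "\<lbrakk>c \<in> carrier F; x \<in> carrier A\<rbrakk> \<Longrightarrow> (\<phi> ^^ k) (c \<odot>\<^bsub>A\<^esub> x) = (c [^] (p ^ k)) \<odot>\<^bsub>A\<^esub> (\<phi> ^^ k) x"
  by (induction k) (auto simp: \<phi>_smult \<phi>_pow_closed nat_pow_pow mult.commute)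

lemma \<phi>_finsum:
  assumes "finite I" "f \<in> I \<rightarrow> carrier A"
  shows "\<phi> (finsum A f I) = finsum A (\<lambda>i. \<phi> (f i)) I"
  using assms
proof (induction I rule: finite_induct)
  case (insert a I)
  have *: "f \<in> I \<rightarrow> carrier A" "f a \<in> carrier A" "(\<lambda>i. \<phi> (f i)) \<in> I \<rightarrow> carrier A"
    using insert \<phi>_closed by auto
  thus ?case using insert \<phi>_closed by (simp add: \<phi>_add)
qed simp

text \<open>The \<open>p\<close>-th roots are chosen so that the additive polynomial in \<open>t\<close> whose coefficient in degree \<open>k\<close>
  is \<open>addc l n k a\<close> depends on \<open>a\<close> in such a way that \<open>\<phi>\<close> becomes the Frobenius map of \<open>F[t]\<close>,
  except for the coefficient of \<open>t\<close>.\<close>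

definition addc :: "('a \<Rightarrow> 'k) \<Rightarrow> nat \<Rightarrow> nat \<Rightarrow> 'a \<Rightarrow> 'k" where
  "addc l n k a = (if \<exists>j<n. k = p ^ j
     then (frt ^^ (n - 1 - (LEAST j. k = p ^ j))) (l ((\<phi> ^^ (n - 1 - (LEAST j. k = p ^ j))) a)) else \<zero>)"

lemma addc_pow: "j < n \<Longrightarrow> addc l n (p ^ j) a = (frt ^^ (n - 1 - j)) (l ((\<phi> ^^ (n - 1 - j)) a))"
proof -
  assume j: "j < n"
  have "(LEAST i. p ^ j = p ^ i) = j"
    using p_gt_1 by (intro Least_equality) auto
  thus ?thesis using j unfolding addc_def by auto
qed

lemma addc_eq_zero: "(\<And>j. j < n \<Longrightarrow> k \<noteq> p ^ j) \<Longrightarrow> addc l n k a = \<zero>"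
  unfolding addc_def by auto

lemma addc_functional:
  assumes l: "lin_functional F A l"
  shows "lin_functional F A (addc l n k)"
proof (cases "\<exists>j<n. k = p ^ j")
  case True
  then obtain j where j: "j < n" "k = p ^ j" by auto
  note D = lin_functionalD[OF l]
  show ?thesis
    unfolding lin_functional_def j(2)
    using D \<phi>_pow_closed
    by (auto simp: addc_pow[OF j(1)] frt_iter_closed \<phi>_pow_add frt_iter_add \<phi>_pow_smult frt_iter_mult frt_iter_pow)
next
  case False
  thus ?thesis unfolding lin_functional_def by (auto simp: addc_def)
qed

text \<open>Passing from \<open>a\<close> to \<open>\<phi> a\<close> lowers the index j by one and
  takes one root less, which is Frobenius. Degree 1 has no predecessor, so there \<open>l\<close>
  must vanish on \<open>(\<phi> ^^ n) a\<close>. Degree \<open>p ^ n\<close> is excluded: the left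
  side is zero, the right side would be the p-th power of \<open>l a\<close>.\<close>

lemma addc_\<phi>:
  assumes l: "lin_functional F A l" and k: "k < p ^ n" and a: "a \<in> carrier A"
    and k1: "k \<noteq> 1 \<or> l ((\<phi> ^^ n) a) = \<zero>"
  shows "addc l n k (\<phi> a) = (if p dvd k then addc l n (k div p) a [^] p else \<zero>)"
proof (cases "\<exists>j<n. k = p ^ j")
  case True
  then obtain j where j: "j < n" "k = p ^ j" by auto
  note D = lin_functionalD[OF l]
  show ?thesis
  proof (cases j)
    case 0
    have "Suc (n - 1) = n" using j by simp
    hence "(\<phi> ^^ (n - 1)) (\<phi> a) = (\<phi> ^^ n) a" by (metis comp_apply funpow_Suc_right)
    hence "addc l n k (\<phi> a) = \<zero>" using addc_pow[of 0 n l "\<phi> a"] j 0 k1 by (simp add: frt_iter_zero)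
    moreover have "\<not> p dvd k" using j 0 p_gt_1 by simp
    ultimately show ?thesis by simp
  next
    case (Suc i)
    define m where "m = n - 1 - j"
    have m: "n - 1 - i = Suc m" using j Suc unfolding m_def by simp
    have kd: "k div p = p ^ i" "p dvd k" using j Suc p_pos by auto
    have la: "l ((\<phi> ^^ Suc m) a) \<in> carrier F" using D(1) \<phi>_pow_closed a by blast
    have "addc l n k (\<phi> a) = (frt ^^ m) (l ((\<phi> ^^ Suc m) a))"
      unfolding j(2) addc_pow[OF j(1)] m_def[symmetric] by (simp add: funpow_swap1)
    also have "\<dots> = ((frt ^^ Suc m) (l ((\<phi> ^^ Suc m) a))) [^] p"
      using frt(2)[OF frt_iter_closed[OF la]] by simp
    also have "\<dots> = addc l n (k div p) a [^] p"
    proof -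
      have "n - Suc i = Suc m" using m by simp
      thus ?thesis using addc_pow[of i n l a] j Suc p_pos by (simp add: kd del: funpow.simps)
    qed
    finally show ?thesis using kd by simp
  qed
next
  case False
  have "addc l n (k div p) a [^] p = \<zero>" if dv: "p dvd k"
  proof -
    \<comment> \<open>A quotient equal to a power of p would make \<open>k\<close> the next power,
      and the bound on \<open>k\<close> would put it among the special degrees.\<close>
    have "k div p \<noteq> p ^ j" if "j < n" for j
    proof
      assume "k div p = p ^ j"
      hence kk: "k = p ^ Suc j" using dv by (metis dvd_mult_div_cancel power_Suc)
      hence "Suc j < n" using k p_gt_1 power_less_imp_less_exp by blast
      thus False using False kk by blast
    qed
    hence "addc l n (k div p) a = \<zero>" by (rule addc_eq_zero)
    thus ?thesis by simp
  qed
  thus ?thesis using False addc_eq_zero[of n k l "\<phi> a"] by auto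
qed

text \<open>For \<open>e = id\<close> this is a decomposition of \<open>A\<close> into cyclic summands with generators \<open>x i\<close> of
  nilpotency index \<open>n i\<close>; the coordinate at \<open>\<phi>\<^sup>j (x i)\<close> is \<open>c i (p\<^sup>j)\<close>.  The endomorphism \<open>e\<close>
  is there for the induction, which splits off a cyclic summand of maximal length.\<close>

definition jordan_data where
  "jordan_data e r x n c \<longleftrightarrow>
    (\<forall>i<r. x i \<in> carrier A \<and> n i > (0::nat) \<and> (\<phi> ^^ n i) (x i) = \<zero>\<^bsub>A\<^esub> \<and>
      (\<forall>k. lin_functional F A (c i k)) \<and> (\<forall>k a. (\<forall>j<n i. k \<noteq> p ^ j) \<longrightarrow> c i k a = \<zero>) \<and>
      (\<forall>k<p ^ n i. \<forall>a\<in>carrier A. c i k (\<phi> a) = (if p dvd k then c i (k div p) a [^] p else \<zero>))) \<and>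
    (\<forall>a\<in>carrier A. e a = (\<Oplus>\<^bsub>A\<^esub>i\<in>{..<r::nat}. \<Oplus>\<^bsub>A\<^esub>j\<in>{..<n i}. c i (p ^ j) a \<odot>\<^bsub>A\<^esub> (\<phi> ^^ j) (x i)))"

definition endo where
  "endo e \<longleftrightarrow> (\<forall>x\<in>carrier A. e x \<in> carrier A \<and> e (\<phi> x) = \<phi> (e x)) \<and>
     (\<forall>x\<in>carrier A. \<forall>y\<in>carrier A. e (x \<oplus>\<^bsub>A\<^esub> y) = e x \<oplus>\<^bsub>A\<^esub> e y) \<and>
     (\<forall>c\<in>carrier F. \<forall>x\<in>carrier A. e (c \<odot>\<^bsub>A\<^esub> x) = c \<odot>\<^bsub>A\<^esub> e x)"

lemma endoD:
  assumes "endo e"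
  shows "\<And>x. x \<in> carrier A \<Longrightarrow> e x \<in> carrier A" "\<And>x. x \<in> carrier A \<Longrightarrow> e (\<phi> x) = \<phi> (e x)"
    "\<And>x y. \<lbrakk>x \<in> carrier A; y \<in> carrier A\<rbrakk> \<Longrightarrow> e (x \<oplus>\<^bsub>A\<^esub> y) = e x \<oplus>\<^bsub>A\<^esub> e y"
    "\<And>c x. \<lbrakk>c \<in> carrier F; x \<in> carrier A\<rbrakk> \<Longrightarrow> e (c \<odot>\<^bsub>A\<^esub> x) = c \<odot>\<^bsub>A\<^esub> e x"
  using assms unfolding endo_def by auto

end

text \<open>\<open>G\<close> spans only modulo the image of \<open>\<phi>\<close>. With the uniform
  exponent \<open>s\<close> this amounts, as in Nakayama's lemma, to generation over the skew
  polynomial ring.\<close>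

locale frob_space_generated = frob_space +
  fixes s :: nat and G
  assumes nil: "a \<in> carrier A \<Longrightarrow> (\<phi> ^^ s) a = \<zero>\<^bsub>A\<^esub>"
    and G: "finite G" "G \<subseteq> carrier A"
    and gen: "a \<in> carrier A \<Longrightarrow> \<exists>b\<in>carrier A. a \<ominus>\<^bsub>A\<^esub> \<phi> b \<in> A.span G"
begin

text \<open>Nakayama: modulo the span of \<open>G\<close> every element is some
  \<open>\<phi> b\<close>, so the values of \<open>h\<close> are values of
  \<open>\<phi> \<circ> h\<close>; after \<open>s\<close> rounds they vanish. Of scalars only the
  preservation of zeros is asked, so that \<open>h\<close> may be semilinear, as
  \<open>(\<phi> ^^ n) \<circ> e\<close> is.\<close>

lemma vanish:
  assumes h: "\<And>x. x \<in> carrier A \<Longrightarrow> h x \<in> carrier A" "\<And>x. x \<in> carrier A \<Longrightarrow> h (\<phi> x) = \<phi> (h x)"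
    "\<And>x y. \<lbrakk>x \<in> carrier A; y \<in> carrier A\<rbrakk> \<Longrightarrow> h (x \<oplus>\<^bsub>A\<^esub> y) = h x \<oplus>\<^bsub>A\<^esub> h y"
    "\<And>c x. \<lbrakk>c \<in> carrier F; x \<in> carrier A; h x = \<zero>\<^bsub>A\<^esub>\<rbrakk> \<Longrightarrow> h (c \<odot>\<^bsub>A\<^esub> x) = \<zero>\<^bsub>A\<^esub>"
    and g: "\<And>g. g \<in> G \<Longrightarrow> h g = \<zero>\<^bsub>A\<^esub>" and a: "a \<in> carrier A"
  shows "h a = \<zero>\<^bsub>A\<^esub>"
proof -
  have vsA: "vectorspace F A" ..
  let ?K = "{x \<in> carrier A. h x = \<zero>\<^bsub>A\<^esub>}"
  have "h \<zero>\<^bsub>A\<^esub> \<oplus>\<^bsub>A\<^esub> h \<zero>\<^bsub>A\<^esub> = h \<zero>\<^bsub>A\<^esub>" using h(3)[of "\<zero>\<^bsub>A\<^esub>" "\<zero>\<^bsub>A\<^esub>"] by simp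
  hence h0: "h \<zero>\<^bsub>A\<^esub> = \<zero>\<^bsub>A\<^esub>" using h(1) by (simp add: A.M.add.l_cancel_one)
  have "subspace F ?K A" unfolding subspace_iff[OF vsA] using h h0 by auto
  hence K: "A.span G \<subseteq> ?K" using G g by (intro subspace_span_le[OF vsA]) auto
  have step: "\<exists>b\<in>carrier A. h a = \<phi> (h b)" if a: "a \<in> carrier A" for a
  proof -
    obtain b where b: "b \<in> carrier A" "a \<ominus>\<^bsub>A\<^esub> \<phi> b \<in> A.span G" using gen[OF a] by auto
    have "a = (a \<ominus>\<^bsub>A\<^esub> \<phi> b) \<oplus>\<^bsub>A\<^esub> \<phi> b"
      using a b \<phi>_closed by (simp add: A.M.minus_eq A.M.a_assoc A.M.l_neg)
    moreover have "h ((a \<ominus>\<^bsub>A\<^esub> \<phi> b) \<oplus>\<^bsub>A\<^esub> \<phi> b) = h (a \<ominus>\<^bsub>A\<^esub> \<phi> b) \<oplus>\<^bsub>A\<^esub> h (\<phi> b)"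
      using a b \<phi>_closed by (intro h(3)) auto
    ultimately have "h a = \<phi> (h b)" using K b h \<phi>_closed by auto
    thus ?thesis using b by blast
  qed
  have "\<exists>b\<in>carrier A. h a = (\<phi> ^^ m) (h b)" for m
  proof (induction m)
    case (Suc m)
    then obtain b where b: "b \<in> carrier A" "h a = (\<phi> ^^ m) (h b)" by auto
    obtain b' where "b' \<in> carrier A" "h b = \<phi> (h b')" using step[OF b(1)] by auto
    thus ?case using b by (intro bexI[of _ b']) (auto simp: funpow_swap1)
  qed (use a in auto)
  from this[of s] show ?thesis using nil h(1) by auto
qed

text \<open>The nilpotency index of a single vector.\<close>

definition ex where "ex v = (LEAST m. (\<phi> ^^ m) v = \<zero>\<^bsub>A\<^esub>)"

lemma ex: "v \<in> carrier A \<Longrightarrow> (\<phi> ^^ ex v) v = \<zero>\<^bsub>A\<^esub>"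
  unfolding ex_def using nil by (rule LeastI)

lemma ex_le: "(\<phi> ^^ m) v = \<zero>\<^bsub>A\<^esub> \<Longrightarrow> ex v \<le> m"
  unfolding ex_def by (rule Least_le)

lemma \<phi>_pow_ge_ex:
  assumes v: "v \<in> carrier A" and m: "ex v \<le> m" shows "(\<phi> ^^ m) v = \<zero>\<^bsub>A\<^esub>"
proof -
  have "(\<phi> ^^ m) v = (\<phi> ^^ (m - ex v)) ((\<phi> ^^ ex v) v)"
    using m by (simp flip: funpow_add[THEN fun_cong, unfolded comp_def])
  thus ?thesis using ex[OF v] by simp
qed

text \<open>The measure is the sum of the nilpotency indices of the images of the generators.
  Subtracting from \<open>e\<close> its component along a longest cyclic summand raises none of
  these indices and lowers the one of the chosen generator.\<close>

lemma jordan_exists_endo: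
  assumes "endo e"
  shows "\<exists>r x n c. jordan_data e r x n c"
  using assms
proof (induction "\<Sum>g\<in>G. ex (e g)" arbitrary: e rule: less_induct)
  case less
  note e = endoD[OF less.prems]
  have gA: "g \<in> carrier A" if "g \<in> G" for g using G that by auto
  show ?case
  proof (cases "\<forall>g\<in>G. e g = \<zero>\<^bsub>A\<^esub>")
    case True
    have "e a = \<zero>\<^bsub>A\<^esub>" if "a \<in> carrier A" for a
      by (rule vanish[of e]) (simp_all add: e True that)
    hence "jordan_data e 0 (\<lambda>_. \<zero>\<^bsub>A\<^esub>) (\<lambda>_. 1) (\<lambda>_ _ _. \<zero>)" unfolding jordan_data_def by simp
    thus ?thesis by blast
  next
    case False
    \<comment> \<open>Maximality of \<open>n\<close> makes \<open>(\<phi> ^^ n) \<circ> e\<close>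
      vanish, which is the hypothesis that \<open>addc_\<phi>\<close> needs in degree 1.\<close>
    define n where "n = Max ((\<lambda>g. ex (e g)) ` G)"
    have Gne: "G \<noteq> {}" using False by auto
    have fin: "finite ((\<lambda>g. ex (e g)) ` G)" "(\<lambda>g. ex (e g)) ` G \<noteq> {}" using G Gne by auto
    obtain g0 where g0: "g0 \<in> G" "ex (e g0) = n"
      using Max_in[OF fin] unfolding n_def by auto
    have exn: "ex (e g) \<le> n" if "g \<in> G" for g unfolding n_def using fin that by auto
    obtain g1 where g1: "g1 \<in> G" "e g1 \<noteq> \<zero>\<^bsub>A\<^esub>" using False by auto
    have "ex (e g1) > 0" using ex[OF e(1)[OF gA[OF g1(1)]]] g1(2) by (cases "ex (e g1)") auto
    hence n0: "n > 0" using exn[OF g1(1)] by simp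
    define x where "x = e g0"
    have x: "x \<in> carrier A" unfolding x_def using e(1) gA g0 by auto
    have phin: "(\<phi> ^^ n) (e a) = \<zero>\<^bsub>A\<^esub>" if a: "a \<in> carrier A" for a
    proof (rule vanish[of "\<lambda>a. (\<phi> ^^ n) (e a)"])
      show "(\<phi> ^^ n) (e g) = \<zero>\<^bsub>A\<^esub>" if "g \<in> G" for g
        using \<phi>_pow_ge_ex[OF e(1)[OF gA[OF that]] exn[OF that]] .
    qed (use a e in \<open>auto simp: \<phi>_pow_closed \<phi>_pow_add \<phi>_pow_smult funpow_swap1\<close>)
    have "(\<phi> ^^ (n - 1)) x \<noteq> \<zero>\<^bsub>A\<^esub>"
    proof
      assume "(\<phi> ^^ (n - 1)) x = \<zero>\<^bsub>A\<^esub>"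
      hence "ex x \<le> n - 1" by (rule ex_le)
      thus False using g0 n0 unfolding x_def by simp
    qed
    moreover have "subspace F {\<zero>\<^bsub>A\<^esub>} A"
    proof -
      have "vectorspace F A" ..
      thus ?thesis unfolding subspace_iff[OF \<open>vectorspace F A\<close>] by simp
    qed
    \<comment> \<open>Normalised on the last nonzero vector of the chain of \<open>x\<close>, so
      that the coordinates recognise this chain.\<close>
    ultimately obtain l where l: "lin_functional F A l" and l1: "l ((\<phi> ^^ (n - 1)) x) = \<one>"
      using A.separating_functional[of "{\<zero>\<^bsub>A\<^esub>}" "(\<phi> ^^ (n - 1)) x"] \<phi>_pow_closed[OF x] by auto
    define c where "c k a = addc l n k (e a)" for k a
    have cl: "lin_functional F A (c k)" for k
      using lin_functionalD[OF addc_functional[OF l, of n k]] e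
      unfolding lin_functional_def c_def by auto
    note cD = lin_functionalD[OF cl]
    have c\<phi>: "c k (\<phi> a) = (if p dvd k then c (k div p) a [^] p else \<zero>)"
      if "k < p ^ n" "a \<in> carrier A" for k a
      unfolding c_def using that e(1)[of a] e(2)[of a] phin[of a] lin_functionalD(3)[OF l, of \<zero> "\<zero>\<^bsub>A\<^esub>"]
        lin_functionalD(1)[OF l, of "\<zero>\<^bsub>A\<^esub>"]
      by (simp add: addc_\<phi>[OF l])
    \<comment> \<open>The component along the cyclic submodule generated by
      \<open>x\<close>.\<close>
    define \<Lambda> where "\<Lambda> a = (\<Oplus>\<^bsub>A\<^esub>j\<in>{..<n}. c (p ^ j) a \<odot>\<^bsub>A\<^esub> (\<phi> ^^ j) x)" for a
    have tc: "c k a \<odot>\<^bsub>A\<^esub> (\<phi> ^^ j) x \<in> carrier A" if "a \<in> carrier A" for a k j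
      using that cD(1) \<phi>_pow_closed[OF x] by auto
    have \<Lambda>c: "\<Lambda> a \<in> carrier A" if "a \<in> carrier A" for a
      unfolding \<Lambda>_def using tc[OF that] by (intro A.M.finsum_closed) auto
    have \<Lambda>_add: "\<Lambda> (a \<oplus>\<^bsub>A\<^esub> b) = \<Lambda> a \<oplus>\<^bsub>A\<^esub> \<Lambda> b" if ab: "a \<in> carrier A" "b \<in> carrier A" for a b
    proof -
      have "\<Lambda> (a \<oplus>\<^bsub>A\<^esub> b) = (\<Oplus>\<^bsub>A\<^esub>j\<in>{..<n}. c (p ^ j) a \<odot>\<^bsub>A\<^esub> (\<phi> ^^ j) x \<oplus>\<^bsub>A\<^esub> c (p ^ j) b \<odot>\<^bsub>A\<^esub> (\<phi> ^^ j) x)"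
        unfolding \<Lambda>_def using ab cD tc \<phi>_pow_closed[OF x]
        by (intro A.M.finsum_cong') (auto simp: A.smult_l_distr)
      also have "\<dots> = \<Lambda> a \<oplus>\<^bsub>A\<^esub> \<Lambda> b"
        unfolding \<Lambda>_def using tc ab by (intro A.M.finsum_addf) auto
      finally show ?thesis .
    qed
    have \<Lambda>_smult: "\<Lambda> (d \<odot>\<^bsub>A\<^esub> a) = d \<odot>\<^bsub>A\<^esub> \<Lambda> a" if a: "a \<in> carrier A" and d: "d \<in> carrier F" for a d
    proof -
      have "\<Lambda> (d \<odot>\<^bsub>A\<^esub> a) = (\<Oplus>\<^bsub>A\<^esub>j\<in>{..<n}. d \<odot>\<^bsub>A\<^esub> (c (p ^ j) a \<odot>\<^bsub>A\<^esub> (\<phi> ^^ j) x))"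
        unfolding \<Lambda>_def using a d cD tc \<phi>_pow_closed[OF x]
        by (intro A.M.finsum_cong') (auto simp: A.smult_assoc1)
      also have "\<dots> = d \<odot>\<^bsub>A\<^esub> \<Lambda> a"
        unfolding \<Lambda>_def using tc[OF a] d by (intro A.finsum_smult[symmetric]) auto
      finally show ?thesis .
    qed
    have xn: "(\<phi> ^^ n) x = \<zero>\<^bsub>A\<^esub>" unfolding x_def using phin gA g0 by auto
    obtain m where nm: "n = Suc m" using n0 by (cases n) auto
    \<comment> \<open>Applying \<open>\<phi>\<close> shifts the coordinates by one place. The
      coordinate at degree 1 becomes zero, and the term pushed off the end is a multiple of
      \<open>(\<phi> ^^ n) x\<close>, hence zero too.\<close>
    have \<Lambda>_\<phi>: "\<Lambda> (\<phi> a) = \<phi> (\<Lambda> a)" if a: "a \<in> carrier A" for a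
    proof -
      have pn: "p ^ j < p ^ n" if "j \<le> m" for j
        using that nm p_gt_1 by (intro power_strict_increasing) auto
      have \<phi>a: "\<phi> a \<in> carrier A" using \<phi>_closed a .
      have pw: "c (p ^ j) a [^] p \<odot>\<^bsub>A\<^esub> (\<phi> ^^ i) x \<in> carrier A" for i j
        using cD(1)[OF a] \<phi>_pow_closed[OF x] by auto
      have "\<Lambda> (\<phi> a) = c (p ^ 0) (\<phi> a) \<odot>\<^bsub>A\<^esub> (\<phi> ^^ 0) x \<oplus>\<^bsub>A\<^esub>
          (\<Oplus>\<^bsub>A\<^esub>j\<in>{..<m}. c (p ^ Suc j) (\<phi> a) \<odot>\<^bsub>A\<^esub> (\<phi> ^^ Suc j) x)"
        unfolding \<Lambda>_def nm by (intro A.M.finsum_lessThan_Suc_shift tc[OF \<phi>a])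
      also have "c (p ^ 0) (\<phi> a) = \<zero>" using c\<phi>[OF pn[of 0] a] p_gt_1 by simp
      also have "(\<Oplus>\<^bsub>A\<^esub>j\<in>{..<m}. c (p ^ Suc j) (\<phi> a) \<odot>\<^bsub>A\<^esub> (\<phi> ^^ Suc j) x) =
          (\<Oplus>\<^bsub>A\<^esub>j\<in>{..<m}. c (p ^ j) a [^] p \<odot>\<^bsub>A\<^esub> (\<phi> ^^ Suc j) x)"
      proof (intro A.M.finsum_cong' refl funcsetI pw)
        fix j assume "j \<in> {..<m}"
        hence "c (p ^ Suc j) (\<phi> a) = c (p ^ j) a [^] p" using c\<phi>[OF pn[of "Suc j"] a] p_pos by simp
        thus "c (p ^ Suc j) (\<phi> a) \<odot>\<^bsub>A\<^esub> (\<phi> ^^ Suc j) x = c (p ^ j) a [^] p \<odot>\<^bsub>A\<^esub> (\<phi> ^^ Suc j) x" by simp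
      qed
      also have "\<zero> \<odot>\<^bsub>A\<^esub> (\<phi> ^^ 0) x \<oplus>\<^bsub>A\<^esub> (\<Oplus>\<^bsub>A\<^esub>j\<in>{..<m}. c (p ^ j) a [^] p \<odot>\<^bsub>A\<^esub> (\<phi> ^^ Suc j) x) =
          (\<Oplus>\<^bsub>A\<^esub>j\<in>{..<m}. c (p ^ j) a [^] p \<odot>\<^bsub>A\<^esub> (\<phi> ^^ Suc j) x) \<oplus>\<^bsub>A\<^esub> c (p ^ m) a [^] p \<odot>\<^bsub>A\<^esub> (\<phi> ^^ Suc m) x"
      proof -
        have "(\<Oplus>\<^bsub>A\<^esub>j\<in>{..<m}. c (p ^ j) a [^] p \<odot>\<^bsub>A\<^esub> (\<phi> ^^ Suc j) x) \<in> carrier A"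
          using pw[of _ "Suc _"] by (intro A.M.finsum_closed funcsetI pw)
        thus ?thesis using xn cD(1)[OF a] x unfolding nm by (simp del: funpow.simps(2))
      qed
      also have "\<dots> = (\<Oplus>\<^bsub>A\<^esub>j\<in>{..<n}. c (p ^ j) a [^] p \<odot>\<^bsub>A\<^esub> (\<phi> ^^ Suc j) x)"
        unfolding nm by (intro A.M.finsum_lessThan_Suc[symmetric] pw)
      also have "\<dots> = (\<Oplus>\<^bsub>A\<^esub>j\<in>{..<n}. \<phi> (c (p ^ j) a \<odot>\<^bsub>A\<^esub> (\<phi> ^^ j) x))"
        using cD(1)[OF a] \<phi>_pow_closed[OF x] \<phi>_closed[OF tc[OF a]]
        by (intro A.M.finsum_cong') (auto simp: \<phi>_smult)
      also have "\<dots> = \<phi> (\<Lambda> a)"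
        unfolding \<Lambda>_def using tc[OF a] by (intro \<phi>_finsum[symmetric]) auto
      finally show ?thesis .
    qed
    define e' where "e' a = e a \<ominus>\<^bsub>A\<^esub> \<Lambda> a" for a
    have e'c: "e' a \<in> carrier A" if "a \<in> carrier A" for a
      unfolding e'_def using e(1) \<Lambda>c that by simp
    have endo': "endo e'"
      unfolding endo_def
    proof (intro conjI ballI)
      fix a assume a: "a \<in> carrier A"
      show "e' a \<in> carrier A" by (rule e'c[OF a])
      show "e' (\<phi> a) = \<phi> (e' a)"
        unfolding e'_def using a e(1,2) \<Lambda>c \<Lambda>_\<phi> by (simp add: A.M.minus_eq \<phi>_add \<phi>_minus)
      show "e' (d \<odot>\<^bsub>A\<^esub> a) = d \<odot>\<^bsub>A\<^esub> e' a" if d: "d \<in> carrier F" for d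
        unfolding e'_def using a d e(1,4) \<Lambda>c \<Lambda>_smult by (simp add: A.M.minus_eq A.smult_r_distr A.smult_r_minus)
      fix b assume b: "b \<in> carrier A"
      show "e' (a \<oplus>\<^bsub>A\<^esub> b) = e' a \<oplus>\<^bsub>A\<^esub> e' b"
        unfolding e'_def using a b e(1,3) \<Lambda>c \<Lambda>_add by (simp add: A.M.minus_eq A.M.minus_add A.M.a_ac)
    qed
    have pow\<Lambda>: "(\<phi> ^^ k) (\<Lambda> a) = \<Lambda> ((\<phi> ^^ k) a)" if "a \<in> carrier A" for a k
      using that by (induction k) (auto simp: \<Lambda>_\<phi> \<phi>_pow_closed)
    have powe: "(\<phi> ^^ k) (e a) = e ((\<phi> ^^ k) a)" if "a \<in> carrier A" for a k
      using that by (induction k) (auto simp: e(2) \<phi>_pow_closed)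
    have pow': "(\<phi> ^^ k) (e' a) = (\<phi> ^^ k) (e a) \<ominus>\<^bsub>A\<^esub> (\<phi> ^^ k) (\<Lambda> a)" if "a \<in> carrier A" for a k
      unfolding e'_def using that e(1) \<Lambda>c by (simp add: A.M.minus_eq \<phi>_pow_add \<phi>_pow_minus)
    \<comment> \<open>The coordinates of \<open>a\<close> depend only on \<open>e a\<close>, so
      \<open>\<Lambda>\<close> vanishes wherever \<open>e\<close> does, and the power of
      \<open>\<phi>\<close> that kills \<open>e g\<close> also kills \<open>e' g\<close>.\<close>
    have ex': "ex (e' g) \<le> ex (e g)" if g: "g \<in> G" for g
    proof (rule ex_le)
      let ?k = "ex (e g)"
      have 1: "(\<phi> ^^ ?k) (e g) = \<zero>\<^bsub>A\<^esub>" using ex e(1) gA[OF g] by auto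
      have 2: "(\<phi> ^^ ?k) g \<in> carrier A" using \<phi>_pow_closed gA[OF g] .
      have "e ((\<phi> ^^ ?k) g) = \<zero>\<^bsub>A\<^esub>" using 1 powe gA[OF g] by simp
      hence "c k ((\<phi> ^^ ?k) g) = \<zero>" for k
        unfolding c_def using lin_functionalD(3)[OF addc_functional[OF l], of \<zero> "\<zero>\<^bsub>A\<^esub>" n k]
          lin_functionalD(1)[OF addc_functional[OF l], of "\<zero>\<^bsub>A\<^esub>" n k] by simp
      hence "\<Lambda> ((\<phi> ^^ ?k) g) = \<zero>\<^bsub>A\<^esub>" unfolding \<Lambda>_def using \<phi>_pow_closed[OF x] by simp
      thus "(\<phi> ^^ ?k) (e' g) = \<zero>\<^bsub>A\<^esub>"
        using pow'[OF gA[OF g]] 1 pow\<Lambda>[OF gA[OF g]] by (simp add: A.M.minus_eq)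
    qed
    \<comment> \<open>All coordinates of \<open>(\<phi> ^^ m) g0\<close> involve powers of
      \<open>\<phi>\<close> beyond the index of \<open>x\<close>, except the last one, which is 1 by
      the choice of \<open>l\<close>. So \<open>\<Lambda>\<close> and \<open>e\<close> agree
      there.\<close>
    have "ex (e' g0) \<le> m"
    proof (rule ex_le)
      have g0A: "g0 \<in> carrier A" using gA g0 by auto
      have pg: "(\<phi> ^^ m) g0 \<in> carrier A" using \<phi>_pow_closed g0A .
      have eq: "e ((\<phi> ^^ m) g0) = (\<phi> ^^ m) x" using powe[OF g0A] unfolding x_def by simp
      have z: "(\<phi> ^^ (n - 1 - j)) ((\<phi> ^^ m) x) = \<zero>\<^bsub>A\<^esub>" if "j < m" for j
      proof -
        have "(\<phi> ^^ (n - 1 - j)) ((\<phi> ^^ m) x) = (\<phi> ^^ (n - 1 - j + m)) x" by (simp add: funpow_add)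
        moreover have "ex x \<le> n - 1 - j + m" using g0 that nm unfolding x_def by simp
        ultimately show ?thesis using \<phi>_pow_ge_ex[OF x] by simp
      qed
      have l0: "l \<zero>\<^bsub>A\<^esub> = \<zero>" using lin_functionalD(3)[OF l, of \<zero> "\<zero>\<^bsub>A\<^esub>"] lin_functionalD(1)[OF l, of "\<zero>\<^bsub>A\<^esub>"] by simp
      have c0: "c (p ^ j) ((\<phi> ^^ m) g0) = (if j = m then \<one> else \<zero>)" if "j < n" for j
      proof (cases "j = m")
        case True
        show ?thesis unfolding c_def eq addc_pow[OF that] using True nm l1 by simp
      next
        case False
        hence "j < m" using that nm by simp
        thus ?thesis unfolding c_def eq addc_pow[OF that] using False z l0 by (simp add: frt_iter_zero)
      qed
      have "(\<phi> ^^ m) (\<Lambda> g0) = (\<phi> ^^ m) x"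
      proof -
        have "(\<phi> ^^ m) (\<Lambda> g0) = \<Lambda> ((\<phi> ^^ m) g0)" by (rule pow\<Lambda>[OF g0A])
        also have "\<dots> = (\<Oplus>\<^bsub>A\<^esub>j\<in>{..<n}. if m = j then (\<phi> ^^ j) x else \<zero>\<^bsub>A\<^esub>)"
          unfolding \<Lambda>_def using c0 \<phi>_pow_closed[OF x]
          by (intro A.M.finsum_cong') auto
        also have "\<dots> = (\<phi> ^^ m) x"
          using A.M.finsum_singleton[of m "{..<n}" "\<lambda>j. (\<phi> ^^ j) x"] nm \<phi>_pow_closed[OF x] by auto
        finally show ?thesis .
      qed
      thus "(\<phi> ^^ m) (e' g0) = \<zero>\<^bsub>A\<^esub>"
        using pow'[OF g0A] \<phi>_pow_closed[OF x] unfolding x_def[symmetric] by simp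
    qed
    hence "ex (e' g0) < ex (e g0)" using g0 nm by simp
    hence "(\<Sum>g\<in>G. ex (e' g)) < (\<Sum>g\<in>G. ex (e g))"
      using G g0 ex' by (intro sum_strict_mono_ex1) auto
    from less.hyps[OF this endo'] obtain r x' n' c' where jd: "jordan_data e' r x' n' c'" by blast
    \<comment> \<open>The new summand takes the index \<open>r\<close> behind the data of
      \<open>e'\<close>, whose lower indices stay unchanged.\<close>
    have "jordan_data e (Suc r) (x'(r := x)) (n'(r := n)) (c'(r := c))"
    proof -
      have eq: "e a = (\<Oplus>\<^bsub>A\<^esub>i\<in>{..<Suc r}. \<Oplus>\<^bsub>A\<^esub>j\<in>{..<(n'(r := n)) i}. (c'(r := c)) i (p ^ j) a \<odot>\<^bsub>A\<^esub> (\<phi> ^^ j) ((x'(r := x)) i))"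
        if a: "a \<in> carrier A" for a
      proof -
        let ?t = "\<lambda>i. \<Oplus>\<^bsub>A\<^esub>j\<in>{..<n' i}. c' i (p ^ j) a \<odot>\<^bsub>A\<^esub> (\<phi> ^^ j) (x' i)"
        let ?t' = "\<lambda>i. \<Oplus>\<^bsub>A\<^esub>j\<in>{..<(n'(r := n)) i}. (c'(r := c)) i (p ^ j) a \<odot>\<^bsub>A\<^esub> (\<phi> ^^ j) ((x'(r := x)) i)"
        have tcl: "?t i \<in> carrier A" if "i < r" for i
        proof (intro A.M.finsum_closed funcsetI)
          fix j
          have lf: "lin_functional F A (c' i (p ^ j))" and xi: "x' i \<in> carrier A"
            using jd that unfolding jordan_data_def by auto
          show "c' i (p ^ j) a \<odot>\<^bsub>A\<^esub> (\<phi> ^^ j) (x' i) \<in> carrier A"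
            by (rule A.smult_closed[OF lin_functionalD(1)[OF lf a] \<phi>_pow_closed[OF xi]])
        qed
        have t'r: "?t' r = \<Lambda> a" unfolding \<Lambda>_def by simp
        have t't: "?t' i = ?t i" if "i < r" for i using that by simp
        have "(\<Oplus>\<^bsub>A\<^esub>i\<in>{..<Suc r}. ?t' i) = (\<Oplus>\<^bsub>A\<^esub>i\<in>{..<r}. ?t' i) \<oplus>\<^bsub>A\<^esub> ?t' r"
        proof (rule A.M.finsum_lessThan_Suc)
          fix i assume "i \<le> r"
          thus "?t' i \<in> carrier A" using t'r t't[of i] tcl[of i] \<Lambda>c[OF a] by (cases "i = r") (simp_all only: le_neq_implies_less)
        qed
        also have "(\<Oplus>\<^bsub>A\<^esub>i\<in>{..<r}. ?t' i) = (\<Oplus>\<^bsub>A\<^esub>i\<in>{..<r}. ?t i)"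
        proof (rule A.M.finsum_cong'[OF refl])
          show "?t \<in> {..<r} \<rightarrow> carrier A" using tcl by blast
          show "?t' i = ?t i" if "i \<in> {..<r}" for i using that by simp
        qed
        also have "\<dots> = e' a" using jd a unfolding jordan_data_def by simp
        also have "e' a \<oplus>\<^bsub>A\<^esub> ?t' r = e a"
          unfolding t'r e'_def using a e(1) \<Lambda>c by (simp add: A.M.minus_eq A.M.a_assoc A.M.l_neg)
        finally show ?thesis by simp
      qed
      have cz: "c k a = \<zero>" if "\<forall>j<n. k \<noteq> p ^ j" for k a
        unfolding c_def using that by (intro addc_eq_zero) auto
      show ?thesis
        unfolding jordan_data_def
      proof (intro conjI allI impI ballI)
        fix i assume "i < Suc r"
        hence i: "i = r \<or> (i \<noteq> r \<and> i < r)" by auto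
        show "(x'(r := x)) i \<in> carrier A" "0 < (n'(r := n)) i" "(\<phi> ^^ (n'(r := n)) i) ((x'(r := x)) i) = \<zero>\<^bsub>A\<^esub>"
          "\<And>k. lin_functional F A ((c'(r := c)) i k)"
          using i x n0 xn cl jd unfolding jordan_data_def by auto
        show "(c'(r := c)) i k a = \<zero>" if "\<forall>j<(n'(r := n)) i. k \<noteq> p ^ j" for k a
          using i that cz jd unfolding jordan_data_def by auto
        show "(c'(r := c)) i k (\<phi> a) = (if p dvd k then (c'(r := c)) i (k div p) a [^] p else \<zero>)"
          if "k < p ^ (n'(r := n)) i" "a \<in> carrier A" for k a
          using i that c\<phi> jd unfolding jordan_data_def by auto
      qed (rule eq)
    qed
    thus ?thesis by blast
  qed
qed

lemma jordan_exists: "\<exists>r x n c. jordan_data (\<lambda>a. a) r x n c"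
  by (rule jordan_exists_endo) (simp add: endo_def)

end

section \<open>Restricted Lie algebras of class two\<close>

text \<open>The abstract form of \<open>H/J\<close> with \<open>Z\<close> the image of the derived
  algebra: dividing by \<open>\<gamma>3\<close> makes \<open>Z\<close> central, dividing by the p-th
  powers of \<open>\<gamma>2\<close> kills its p-map.\<close>

locale class2_lie = restricted_lie_algebra F M
  for F :: "('k, 'c) ring_scheme" and M :: "('k, 'a, 'm) restricted_lie_scheme" (structure) +
  fixes Z :: "'a set"
  assumes Z_subspace: "subspace F Z M"
    and Z_central: "\<lbrakk>z \<in> Z; x \<in> carrier M\<rbrakk> \<Longrightarrow> z \<otimes> x = \<zero>"
    and bracket_Z: "\<lbrakk>x \<in> carrier M; y \<in> carrier M\<rbrakk> \<Longrightarrow> x \<otimes> y \<in> Z"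
    and pmap_Z: "z \<in> Z \<Longrightarrow> pmap M z = \<zero>"
begin

lemma Z_carrier: "z \<in> Z \<Longrightarrow> z \<in> carrier M"
  using subspaceD(1)[OF Z_subspace] by auto

lemma Z_central': "\<lbrakk>z \<in> Z; x \<in> carrier M\<rbrakk> \<Longrightarrow> x \<otimes> z = \<zero>"
  using bracket_antisym[of x z] Z_central[of z x] Z_carrier by simp

text \<open>One bracket lands in \<open>Z\<close>, a second one kills.\<close>

lemma ad_coeff_class2:
  assumes x: "x \<in> carrier M" and y: "y \<in> carrier M"
  shows "ad_coeff M x y (Suc n) i \<in> Z" "ad_coeff M x y (Suc (Suc n)) i = \<zero>"
proof -
  note V = subspaceD[OF Z_subspace]
  have 1: "ad_coeff M x y (Suc n) i \<in> Z" for n i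
    unfolding ad_coeff.simps(2)
    using x y bracket_Z ad_coeff_closed[OF x y] V
    by (auto split: nat.split simp del: ad_coeff.simps)
  show "ad_coeff M x y (Suc n) i \<in> Z" by (rule 1)
  show "ad_coeff M x y (Suc (Suc n)) i = \<zero>"
    unfolding ad_coeff.simps(2)[of M x y "Suc n"]
    using x y Z_central'[OF 1] by (auto split: nat.split simp del: ad_coeff.simps)
qed

text \<open>Jacobson's terms contain p - 1 brackets, and two already vanish. Only p = 2 leaves
  something, the single term with one bracket. This exceptional bracket has to be carried through
  all later p-th power computations.\<close>

lemma pmap_class2:
  assumes x: "x \<in> carrier M" and y: "y \<in> carrier M"
  shows "pmap M (x \<oplus> y) = pmap M x \<oplus> pmap M y \<oplus> (if p = 2 then y \<otimes> x else \<zero>)"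
proof (cases "p = 2")
  case True
  have "jacobson_term F M 1 x y = y \<otimes> x"
  proof -
    have "[(1::nat)] \<cdot>\<^bsub>F\<^esub> \<one>\<^bsub>F\<^esub> = \<one>\<^bsub>F\<^esub>" by simp
    thus ?thesis unfolding jacobson_term_def True using x y bracket_closed by simp
  qed
  moreover have "{1..<p} = {1}" using True by auto
  ultimately have "(\<Oplus>i\<in>{1..<p}. jacobson_term F M i x y) = y \<otimes> x"
    using x y bracket_closed by simp
  thus ?thesis using pmap_add[OF x y] True by simp
next
  case False
  hence "p > 2" using prime_gt_1_nat[OF prime_p] by simp
  then obtain m where m: "p - 1 = Suc (Suc m)" using that[of "p - 3"] by simp
  have "jacobson_term F M i x y = \<zero>" if "i \<in> {1..<p}" for i
    unfolding jacobson_term_def m ad_coeff_class2(2)[OF x y] using jacobson_coeff_closed[OF that] by simp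
  hence "(\<Oplus>i\<in>{1..<p}. jacobson_term F M i x y) = \<zero>" by (intro M.add.finprod_one_eqI)
  thus ?thesis using pmap_add[OF x y] False x y pmap_closed by simp
qed

lemma pmap_add_central: "\<lbrakk>x \<in> carrier M; z \<in> Z\<rbrakk> \<Longrightarrow> pmap M (x \<oplus> z) = pmap M x"
  using pmap_add_commuting[of x z] Z_central[of z x] pmap_Z[of z] Z_carrier pmap_closed by simp

text \<open>Since p is at least 2, the p-fold bracketing contains two brackets.\<close>

lemma pmap_central:
  assumes x: "x \<in> carrier M" and y: "y \<in> carrier M" shows "pmap M x \<otimes> y = \<zero>"
proof -
  obtain m where m: "p = Suc (Suc m)" using prime_gt_1_nat[OF prime_p]
    by (metis One_nat_def less_imp_Suc_add add_Suc_right plus_1_eq_Suc)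
  have "((\<lambda>z. x \<otimes> z) ^^ m) \<zero> = \<zero>" using x by (induction m) auto
  hence "((\<lambda>z. x \<otimes> z) ^^ p) y = \<zero>"
    unfolding m ad_pow_Suc using Z_central'[OF bracket_Z[OF x y] x] by simp
  thus ?thesis using pmap_bracket[OF x y] by simp
qed

lemma pmap_finsum:
  assumes "finite I" and "\<And>i. i \<in> I \<Longrightarrow> f i \<in> carrier M"
    and "\<And>i j. \<lbrakk>i \<in> I; j \<in> I\<rbrakk> \<Longrightarrow> f i \<otimes> f j = \<zero>"
  shows "pmap M (finsum M f I) = finsum M (\<lambda>i. pmap M (f i)) I"
  using assms
proof (induction I rule: finite_induct)
  case (insert a I)
  have *: "f \<in> I \<rightarrow> carrier M" "f a \<in> carrier M" "(\<lambda>i. pmap M (f i)) \<in> I \<rightarrow> carrier M"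
    using insert.prems pmap_closed by auto
  have "finsum M f I \<otimes> f a = finsum M (\<lambda>i. f i \<otimes> f a) I"
    by (rule bracket_finsum_left[OF insert.hyps(1) *(1,2)])
  also have "\<dots> = \<zero>" using insert.prems(2) by (intro M.add.finprod_one_eqI) auto
  finally have c: "finsum M f I \<otimes> f a = \<zero>" .
  have "pmap M (finsum M f (insert a I)) = pmap M (f a \<oplus> finsum M f I)"
    using * insert.hyps by simp
  also have "\<dots> = pmap M (f a) \<oplus> pmap M (finsum M f I)"
    using * by (intro pmap_add_commuting c) auto
  also have "\<dots> = finsum M (\<lambda>i. pmap M (f i)) (insert a I)"
    using insert * pmap_closed by simp
  finally show ?case .
qed simp

text \<open>The part of \<open>M\<close> that the retraction reaches from products. The p-th powers
  alone need not be closed under addition when p = 2, so \<open>Z\<close> is added.\<close>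

definition PZ :: "'a set" where
  "PZ = {pmap M m \<oplus> z | m z. m \<in> carrier M \<and> z \<in> Z}"

lemma Z_PZ: assumes "z \<in> Z" shows "z \<in> PZ"
proof -
  have "z = pmap M \<zero> \<oplus> z" using Z_carrier[OF assms] by simp
  thus ?thesis unfolding PZ_def using assms by blast
qed

lemma pmap_PZ: assumes "m \<in> carrier M" shows "pmap M m \<in> PZ"
proof -
  have "pmap M m = pmap M m \<oplus> \<zero>" using pmap_closed[OF assms] by simp
  thus ?thesis unfolding PZ_def using assms subspaceD(2)[OF Z_subspace] by blast
qed

end

section \<open>The retraction of the augmentation ideal\<close>

text \<open>\<open>M\<close> stands for \<open>H/J\<close>, and \<open>c i k h\<close> is the
  coefficient of t^k in the additive polynomial of \<open>h\<close> in the i-th cyclic summand of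
  \<open>H/Q\<close>. The \<open>x i\<close> are lifts to \<open>M\<close> of the cyclic generators,
  so their nilpotency and the expansion of \<open>q h\<close> hold only modulo
  \<open>Z\<close>.\<close>

locale lie_retraction =
  perfect_char_p F p + H: restricted_lie_algebra F H + M: class2_lie F M Z
  for F :: "('k, 'c) ring_scheme" (structure) and p :: nat
    and H :: "('k, 'b, 'n) restricted_lie_scheme"
    and M :: "('k, 'a, 'm) restricted_lie_scheme" and Z :: "'a set" +
  fixes q :: "'b \<Rightarrow> 'a" and r :: nat and x :: "nat \<Rightarrow> 'a" and n :: "nat \<Rightarrow> nat"
    and c :: "nat \<Rightarrow> nat \<Rightarrow> 'b \<Rightarrow> 'k"
  assumes q: "q \<in> restricted_lie_hom F H M"
    and x_closed: "i < r \<Longrightarrow> x i \<in> carrier M"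
    and n_pos: "i < r \<Longrightarrow> n i > 0"
    and x_nil: "i < r \<Longrightarrow> (pmap M ^^ n i) (x i) \<in> Z"
    and c_functional: "i < r \<Longrightarrow> lin_functional F H (c i k)"
    and c_supp: "\<lbrakk>i < r; \<And>j. j < n i \<Longrightarrow> k \<noteq> p ^ j\<rbrakk> \<Longrightarrow> c i k h = \<zero>"
    and c_bracket: "\<lbrakk>i < r; h \<in> carrier H; h' \<in> carrier H\<rbrakk> \<Longrightarrow> c i k (h \<otimes>\<^bsub>H\<^esub> h') = \<zero>"
    and c_pmap: "\<lbrakk>i < r; k < p ^ n i; h \<in> carrier H\<rbrakk> \<Longrightarrow>
      c i k (pmap H h) = (if p dvd k then c i (k div p) h [^] p else \<zero>)"
    and q_repr: "h \<in> carrier H \<Longrightarrow>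
      q h \<ominus>\<^bsub>M\<^esub> (\<Oplus>\<^bsub>M\<^esub>i\<in>{..<r}. \<Oplus>\<^bsub>M\<^esub>j\<in>{..<n i}. c i (p ^ j) h \<odot>\<^bsub>M\<^esub> (pmap M ^^ j) (x i)) \<in> Z"
begin

sublocale FA: free_alg F "carrier H" ..

text \<open>Scalars are absorbed by p-th roots, which is where perfectness enters. Sums of p-th
  powers are p-th powers up to a bracket, which is absorbed by \<open>Z\<close>.\<close>

lemma PZ_subspace: "subspace F M.PZ M"
  unfolding subspace_iff[OF M.vs]
proof (intro conjI ballI)
  note V = subspaceD[OF M.Z_subspace]
  show "M.PZ \<subseteq> carrier M" unfolding M.PZ_def using M.pmap_closed M.Z_carrier by auto
  show "\<zero>\<^bsub>M\<^esub> \<in> M.PZ" by (rule M.Z_PZ[OF V(2)])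
  fix u assume "u \<in> M.PZ"
  then obtain m z where u: "m \<in> carrier M" "z \<in> Z" "u = pmap M m \<oplus>\<^bsub>M\<^esub> z" unfolding M.PZ_def by auto
  have zc: "z \<in> carrier M" using M.Z_carrier u by auto
  show "d \<odot>\<^bsub>M\<^esub> u \<in> M.PZ" if d: "d \<in> carrier F" for d
  proof -
    have "d \<odot>\<^bsub>M\<^esub> u = pmap M (frt d \<odot>\<^bsub>M\<^esub> m) \<oplus>\<^bsub>M\<^esub> d \<odot>\<^bsub>M\<^esub> z"
      using u zc d frt[OF d] M.pmap_smult[of "frt d" m] M.pmap_closed
      by (simp add: M.smult_r_distr char_eq)
    thus ?thesis unfolding M.PZ_def using u frt[OF d] V(4)[OF d u(2)] M.smult_closed by blast
  qed
  fix u' assume "u' \<in> M.PZ"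
  then obtain m' z' where u': "m' \<in> carrier M" "z' \<in> Z" "u' = pmap M m' \<oplus>\<^bsub>M\<^esub> z'" unfolding M.PZ_def by auto
  have zc': "z' \<in> carrier M" using M.Z_carrier u' by auto
  let ?b = "if M.p = 2 then m' \<otimes>\<^bsub>M\<^esub> m else \<zero>\<^bsub>M\<^esub>"
  have b: "?b \<in> Z" using M.bracket_Z u u' V(2) by simp
  hence bc: "?b \<in> carrier M" by (rule M.Z_carrier)
  have "pmap M (m \<oplus>\<^bsub>M\<^esub> m') \<oplus>\<^bsub>M\<^esub> (z \<oplus>\<^bsub>M\<^esub> z' \<oplus>\<^bsub>M\<^esub> \<ominus>\<^bsub>M\<^esub> ?b) =
      pmap M m \<oplus>\<^bsub>M\<^esub> pmap M m' \<oplus>\<^bsub>M\<^esub> ?b \<oplus>\<^bsub>M\<^esub> (z \<oplus>\<^bsub>M\<^esub> z' \<oplus>\<^bsub>M\<^esub> \<ominus>\<^bsub>M\<^esub> ?b)"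
    using M.pmap_class2[OF u(1) u'(1)] by simp
  also have "\<dots> = u \<oplus>\<^bsub>M\<^esub> u'"
  proof -
    have "a \<oplus>\<^bsub>M\<^esub> a' \<oplus>\<^bsub>M\<^esub> b \<oplus>\<^bsub>M\<^esub> (z \<oplus>\<^bsub>M\<^esub> z' \<oplus>\<^bsub>M\<^esub> \<ominus>\<^bsub>M\<^esub> b) = a \<oplus>\<^bsub>M\<^esub> z \<oplus>\<^bsub>M\<^esub> (a' \<oplus>\<^bsub>M\<^esub> z')"
      if "a \<in> carrier M" "a' \<in> carrier M" "b \<in> carrier M" for a a' b
      using that zc zc' by (simp add: M.M.a_ac M.M.r_neg M.M.r_neg1 M.M.r_neg2)
    from this[OF M.pmap_closed[OF u(1)] M.pmap_closed[OF u'(1)] bc] show ?thesis unfolding u u' .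
  qed
  finally have "u \<oplus>\<^bsub>M\<^esub> u' = pmap M (m \<oplus>\<^bsub>M\<^esub> m') \<oplus>\<^bsub>M\<^esub> (z \<oplus>\<^bsub>M\<^esub> z' \<oplus>\<^bsub>M\<^esub> \<ominus>\<^bsub>M\<^esub> ?b)" by simp
  moreover have "z \<oplus>\<^bsub>M\<^esub> z' \<oplus>\<^bsub>M\<^esub> \<ominus>\<^bsub>M\<^esub> ?b \<in> Z" using V(3,5) u u' b by blast
  ultimately show "u \<oplus>\<^bsub>M\<^esub> u' \<in> M.PZ" unfolding M.PZ_def using u u' M.M.a_closed by blast
qed

sublocale U: UP_char_p F "UP F" p
  by unfold_locales

section \<open>Polynomial coordinates on the free algebra\<close>

definition \<theta> :: "nat \<Rightarrow> 'b \<Rightarrow> nat \<Rightarrow> 'k" where "\<theta> i h = (\<lambda>k. c i k h)"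

lemma \<theta>_closed: assumes i: "i < r" and h: "h \<in> carrier H" shows "\<theta> i h \<in> carrier (UP F)"
proof -
  have "\<theta> i h k = \<zero>" if "k \<ge> p ^ n i" for k
    unfolding \<theta>_def
  proof (rule c_supp[OF i])
    fix j assume "j < n i"
    hence "p ^ j < p ^ n i" using p_gt_1 by simp
    thus "k \<noteq> p ^ j" using that by simp
  qed
  hence "bound \<zero> (p ^ n i) (\<theta> i h)" by (intro bound.intro) simp
  thus ?thesis using lin_functionalD(1)[OF c_functional[OF i] h]
    unfolding UP_def up_def \<theta>_def by auto
qed

text \<open>Modulo t^(p^n) with n = \<open>n i\<close> this is the projection of \<open>u(H)\<close>
  to the enveloping algebra of the i-th cyclic summand. It is not truncated, because the coefficient
  at exactly that degree is read off as well.\<close>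

definition \<Theta> :: "nat \<Rightarrow> ('b list \<Rightarrow> 'k) \<Rightarrow> nat \<Rightarrow> 'k" where
  "\<Theta> i = word_ext F (UP F) (word_ext_algebra.wprod (UP F) (\<theta> i))"

definition a :: "nat \<Rightarrow> nat \<Rightarrow> ('b list \<Rightarrow> 'k) \<Rightarrow> 'k" where
  "a i k f = coeff (UP F) (\<Theta> i f) k"

definition \<epsilon> :: "('b list \<Rightarrow> 'k) \<Rightarrow> 'k" where "\<epsilon> f = f []"

lemma wea: "i < r \<Longrightarrow> word_ext_algebra F (carrier H) (UP F) (\<theta> i)"
  using \<theta>_closed by unfold_locales auto

lemma \<Theta>_simps:
  assumes i: "i < r"
  shows "f \<in> carrier FA.T \<Longrightarrow> \<Theta> i f \<in> carrier (UP F)"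
    and "\<lbrakk>f \<in> carrier FA.T; g \<in> carrier FA.T\<rbrakk> \<Longrightarrow> \<Theta> i (f \<oplus>\<^bsub>FA.T\<^esub> g) = \<Theta> i f \<oplus>\<^bsub>UP F\<^esub> \<Theta> i g"
    and "\<lbrakk>f \<in> carrier FA.T; g \<in> carrier FA.T\<rbrakk> \<Longrightarrow> \<Theta> i (f \<otimes>\<^bsub>FA.T\<^esub> g) = \<Theta> i f \<otimes>\<^bsub>UP F\<^esub> \<Theta> i g"
    and "\<lbrakk>d \<in> carrier F; f \<in> carrier FA.T\<rbrakk> \<Longrightarrow> \<Theta> i (d \<odot>\<^bsub>FA.T\<^esub> f) = d \<odot>\<^bsub>UP F\<^esub> \<Theta> i f"
    and "h \<in> carrier H \<Longrightarrow> \<Theta> i (free_gen F h) = \<theta> i h"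
    and "\<Theta> i \<one>\<^bsub>FA.T\<^esub> = \<one>\<^bsub>UP F\<^esub>"
    and "\<lbrakk>d \<in> carrier F; w \<in> lists (carrier H)\<rbrakk> \<Longrightarrow> \<Theta> i (FA.sd d w) = d \<odot>\<^bsub>UP F\<^esub> word_ext_algebra.wprod (UP F) (\<theta> i) w"
proof -
  interpret W: word_ext_algebra F "carrier H" "UP F" "\<theta> i" by (rule wea[OF i])
  show "f \<in> carrier FA.T \<Longrightarrow> \<Theta> i f \<in> carrier (UP F)"
    "\<lbrakk>f \<in> carrier FA.T; g \<in> carrier FA.T\<rbrakk> \<Longrightarrow> \<Theta> i (f \<oplus>\<^bsub>FA.T\<^esub> g) = \<Theta> i f \<oplus>\<^bsub>UP F\<^esub> \<Theta> i g"
    "\<lbrakk>f \<in> carrier FA.T; g \<in> carrier FA.T\<rbrakk> \<Longrightarrow> \<Theta> i (f \<otimes>\<^bsub>FA.T\<^esub> g) = \<Theta> i f \<otimes>\<^bsub>UP F\<^esub> \<Theta> i g"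
    "\<lbrakk>d \<in> carrier F; f \<in> carrier FA.T\<rbrakk> \<Longrightarrow> \<Theta> i (d \<odot>\<^bsub>FA.T\<^esub> f) = d \<odot>\<^bsub>UP F\<^esub> \<Theta> i f"
    "h \<in> carrier H \<Longrightarrow> \<Theta> i (free_gen F h) = \<theta> i h"
    "\<Theta> i \<one>\<^bsub>FA.T\<^esub> = \<one>\<^bsub>UP F\<^esub>"
    "\<lbrakk>d \<in> carrier F; w \<in> lists (carrier H)\<rbrakk> \<Longrightarrow> \<Theta> i (FA.sd d w) = d \<odot>\<^bsub>UP F\<^esub> word_ext_algebra.wprod (UP F) (\<theta> i) w"
    unfolding \<Theta>_def by (simp_all add: W.E_closed W.E_add W.E_mult W.E_smult W.E_gen W.E_one W.E_sd)
qed

lemma coeff_\<theta>: "\<lbrakk>i < r; h \<in> carrier H\<rbrakk> \<Longrightarrow> coeff (UP F) (\<theta> i h) k = c i k h"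
  using \<theta>_closed[of i h] unfolding UP_def \<theta>_def by simp

lemma c_zero: "i < r \<Longrightarrow> c i 0 h = \<zero>"
  using p_pos by (intro c_supp) auto

lemma a_simps:
  assumes i: "i < r"
  shows a_closed': "f \<in> carrier FA.T \<Longrightarrow> a i k f \<in> carrier F"
    and a_add: "\<lbrakk>f \<in> carrier FA.T; g \<in> carrier FA.T\<rbrakk> \<Longrightarrow> a i k (f \<oplus>\<^bsub>FA.T\<^esub> g) = a i k f \<oplus> a i k g"
    and a_mult: "\<lbrakk>f \<in> carrier FA.T; g \<in> carrier FA.T\<rbrakk> \<Longrightarrow> a i k (f \<otimes>\<^bsub>FA.T\<^esub> g) = (\<Oplus>l\<in>{..k}. a i l f \<otimes> a i (k - l) g)"
    and a_comm': "\<lbrakk>f \<in> carrier FA.T; g \<in> carrier FA.T\<rbrakk> \<Longrightarrow> a i k (f \<otimes>\<^bsub>FA.T\<^esub> g) = a i k (g \<otimes>\<^bsub>FA.T\<^esub> f)"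
    and a_smult: "\<lbrakk>d \<in> carrier F; f \<in> carrier FA.T\<rbrakk> \<Longrightarrow> a i k (d \<odot>\<^bsub>FA.T\<^esub> f) = d \<otimes> a i k f"
    and a_gen: "h \<in> carrier H \<Longrightarrow> a i k (free_gen F h) = c i k h"
    and a_one: "a i k \<one>\<^bsub>FA.T\<^esub> = (if k = 0 then \<one> else \<zero>)"
  unfolding a_def using \<Theta>_simps[OF i] by (simp_all add: coeff_\<theta> i U.P.m_comm)

lemma T_pow_closed: "f \<in> carrier FA.T \<Longrightarrow> f [^]\<^bsub>FA.T\<^esub> (m::nat) \<in> carrier FA.T"
  by (rule FA.T.nat_pow_closed)

lemma \<Theta>_pow: "\<lbrakk>i < r; f \<in> carrier FA.T\<rbrakk> \<Longrightarrow> \<Theta> i (f [^]\<^bsub>FA.T\<^esub> (m::nat)) = \<Theta> i f [^]\<^bsub>UP F\<^esub> m"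
  by (induction m) (simp_all add: \<Theta>_simps T_pow_closed)

lemma a_frob:
  assumes i: "i < r" and f: "f \<in> carrier FA.T"
  shows "a i k (f [^]\<^bsub>FA.T\<^esub> p) = (if p dvd k then a i (k div p) f [^] p else \<zero>)"
  unfolding a_def \<Theta>_pow[OF i f] by (rule U.coeff_frob[OF \<Theta>_simps(1)[OF i f]])

lemma \<epsilon>_simps:
  shows \<epsilon>_closed: "f \<in> carrier FA.T \<Longrightarrow> \<epsilon> f \<in> carrier F"
    and \<epsilon>_add: "\<epsilon> (f \<oplus>\<^bsub>FA.T\<^esub> g) = \<epsilon> f \<oplus> \<epsilon> g"
    and \<epsilon>_smult: "\<epsilon> (d \<odot>\<^bsub>FA.T\<^esub> f) = d \<otimes> \<epsilon> f"
    and \<epsilon>_mult: "\<lbrakk>f \<in> carrier FA.T; g \<in> carrier FA.T\<rbrakk> \<Longrightarrow> \<epsilon> (f \<otimes>\<^bsub>FA.T\<^esub> g) = \<epsilon> f \<otimes> \<epsilon> g"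
    and \<epsilon>_zero: "\<epsilon> \<zero>\<^bsub>FA.T\<^esub> = \<zero>" and \<epsilon>_one: "\<epsilon> \<one>\<^bsub>FA.T\<^esub> = \<one>"
    and \<epsilon>_sd: "\<epsilon> (FA.sd d w) = (if w = [] then d else \<zero>)"
  unfolding \<epsilon>_def by (simp_all add: FA.T_val FA.T_simps FA.sd_def)

lemma a_zero: "i < r \<Longrightarrow> a i k \<zero>\<^bsub>FA.T\<^esub> = \<zero>"
  using a_smult[of i \<zero> "\<zero>\<^bsub>FA.T\<^esub>" k] a_closed'[of i "\<zero>\<^bsub>FA.T\<^esub>" k] by simp

lemma a_sd_Cons:
  assumes i: "i < r" and d: "d \<in> carrier F" and h: "h \<in> carrier H" and w: "w \<in> lists (carrier H)"
  shows "a i k (FA.sd d (h # w)) = (\<Oplus>l\<in>{..k}. c i l h \<otimes> a i (k - l) (FA.sd d w))"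
proof -
  have "FA.sd d (h # w) = free_gen F h \<otimes>\<^bsub>FA.T\<^esub> FA.sd d w"
    using d by (simp add: FA.free_gen_sd FA.sd_mult)
  moreover have "free_gen F h \<in> carrier FA.T" using h by (simp add: FA.free_gen_sd FA.sd_closed)
  ultimately show ?thesis using a_mult[OF i, of "free_gen F h" "FA.sd d w" k] d w h
    by (simp add: FA.sd_closed a_gen i)
qed

text \<open>Zero is not a power of p, so the additive polynomials have no constant term, and every
  nonempty word contributes nothing in degree 0.\<close>

lemma a_0:
  assumes i: "i < r" and f: "f \<in> carrier FA.T" shows "a i 0 f = \<epsilon> f"
  using f
proof (induction f rule: FA.T_induct)
  case zero show ?case using i by (simp add: a_zero \<epsilon>_zero)
next
  case (sd d w)
  show ?case
  proof (cases w)
    case Nil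
    have "FA.sd d [] = d \<odot>\<^bsub>FA.T\<^esub> \<one>\<^bsub>FA.T\<^esub>" using sd by (auto simp: FA.T_simps FA.sd_def)
    hence "a i 0 (FA.sd d []) = d \<otimes> \<one>" using a_smult[OF i sd(1), of "\<one>\<^bsub>FA.T\<^esub>" 0] by (simp add: a_one i)
    thus ?thesis using Nil sd by (simp add: \<epsilon>_sd)
  next
    case (Cons h v)
    hence *: "h \<in> carrier H" "v \<in> lists (carrier H)" using sd by auto
    show ?thesis using a_sd_Cons[OF i sd(1) *, of 0] a_closed'[OF i FA.sd_closed[OF sd(1) *(2)], of 0]
      by (simp add: Cons c_zero[OF i] \<epsilon>_sd)
  qed
next
  case (add f g) thus ?case using i by (simp add: a_add \<epsilon>_add)
qed

text \<open>With constant terms equal to the augmentation, the linear coefficient is a point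
  derivation. It therefore vanishes on products of augmentation-zero elements.\<close>

lemma a_1_mult:
  assumes i: "i < r" and f: "f \<in> carrier FA.T" and g: "g \<in> carrier FA.T"
  shows "a i 1 (f \<otimes>\<^bsub>FA.T\<^esub> g) = \<epsilon> f \<otimes> a i 1 g \<oplus> a i 1 f \<otimes> \<epsilon> g"
proof -
  have "(\<lambda>l. a i l f \<otimes> a i (Suc 0 - l) g) \<in> {..Suc 0} \<rightarrow> carrier F"
    by (intro funcsetI m_closed a_closed'[OF i] f g)
  from finsum_Suc[OF this] show ?thesis
    using a_mult[OF i f g, of 1] a_closed'[OF i f] a_closed'[OF i g] a_0[OF i f] a_0[OF i g]
      \<epsilon>_closed[OF f] \<epsilon>_closed[OF g]
    by (simp add: a_comm)
qed

section \<open>Lifting the coordinates to the class-two quotient\<close>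

definition X :: "nat \<Rightarrow> nat \<Rightarrow> 'a" where "X i j = (pmap M ^^ j) (x i)"

lemma X_closed: "i < r \<Longrightarrow> X i j \<in> carrier M"
  unfolding X_def by (induction j) (auto simp: x_closed M.pmap_closed)

lemma X_Suc: "X i (Suc j) = pmap M (X i j)" unfolding X_def by simp

text \<open>The sum runs up to j = \<open>n i\<close> inclusive: \<open>X i (n i)\<close> lies in
  \<open>Z\<close> but may be nonzero, and the p-th power of the preceding term produces it.\<close>

definition Pc :: "nat \<Rightarrow> ('b list \<Rightarrow> 'k) \<Rightarrow> 'a" where
  "Pc i f = (\<Oplus>\<^bsub>M\<^esub>j\<in>{..<Suc (n i)}. a i (p ^ j) f \<odot>\<^bsub>M\<^esub> X i j)"

lemma Pc_term: "\<lbrakk>i < r; f \<in> carrier FA.T\<rbrakk> \<Longrightarrow> a i k f \<odot>\<^bsub>M\<^esub> X i j \<in> carrier M"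
  by (intro M.smult_closed a_closed' X_closed)

lemma Pc_closed: "\<lbrakk>i < r; f \<in> carrier FA.T\<rbrakk> \<Longrightarrow> Pc i f \<in> carrier M"
  unfolding Pc_def by (intro M.M.finsum_closed funcsetI Pc_term)

lemma Pc_add: assumes i: "i < r" and f: "f \<in> carrier FA.T" and g: "g \<in> carrier FA.T"
  shows "Pc i (f \<oplus>\<^bsub>FA.T\<^esub> g) = Pc i f \<oplus>\<^bsub>M\<^esub> Pc i g"
proof -
  have "Pc i (f \<oplus>\<^bsub>FA.T\<^esub> g) = (\<Oplus>\<^bsub>M\<^esub>j\<in>{..<Suc (n i)}. a i (p ^ j) f \<odot>\<^bsub>M\<^esub> X i j \<oplus>\<^bsub>M\<^esub> a i (p ^ j) g \<odot>\<^bsub>M\<^esub> X i j)"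
    unfolding Pc_def using Pc_term[OF i] f g X_closed[OF i] a_closed'[OF i]
    by (intro M.M.finsum_cong') (simp_all add: a_add[OF i] M.smult_l_distr)
  thus ?thesis unfolding Pc_def using Pc_term[OF i] f g by (subst M.M.finsum_addf[symmetric]) auto
qed

lemma Pc_smult: assumes i: "i < r" and f: "f \<in> carrier FA.T" and d: "d \<in> carrier F"
  shows "Pc i (d \<odot>\<^bsub>FA.T\<^esub> f) = d \<odot>\<^bsub>M\<^esub> Pc i f"
proof -
  have "Pc i (d \<odot>\<^bsub>FA.T\<^esub> f) = (\<Oplus>\<^bsub>M\<^esub>j\<in>{..<Suc (n i)}. d \<odot>\<^bsub>M\<^esub> (a i (p ^ j) f \<odot>\<^bsub>M\<^esub> X i j))"
    unfolding Pc_def using Pc_term[OF i f] d f X_closed[OF i] a_closed'[OF i f]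
    by (intro M.M.finsum_cong') (simp_all add: a_smult[OF i] M.smult_assoc1)
  also have "\<dots> = d \<odot>\<^bsub>M\<^esub> Pc i f"
    unfolding Pc_def using Pc_term[OF i f] d by (intro M.finsum_smult[symmetric]) auto
  finally show ?thesis .
qed

lemma Pc_split: assumes i: "i < r" and f: "f \<in> carrier FA.T"
  shows "Pc i f = a i 1 f \<odot>\<^bsub>M\<^esub> x i \<oplus>\<^bsub>M\<^esub> (\<Oplus>\<^bsub>M\<^esub>j\<in>{..<n i}. a i (p ^ Suc j) f \<odot>\<^bsub>M\<^esub> X i (Suc j))"
  unfolding Pc_def using M.M.finsum_lessThan_Suc_shift[of "n i" "\<lambda>j. a i (p ^ j) f \<odot>\<^bsub>M\<^esub> X i j", OF Pc_term[OF i f]]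
  by (simp add: X_def)

text \<open>All terms after the first are multiples of p-th powers, hence central. Brackets thus see
  only the linear coefficient.\<close>

lemma Pc_bracket:
  assumes i: "i < r" and f: "f \<in> carrier FA.T" and y: "y \<in> carrier M"
  shows "Pc i f \<otimes>\<^bsub>M\<^esub> y = a i 1 f \<odot>\<^bsub>M\<^esub> (x i \<otimes>\<^bsub>M\<^esub> y)"
proof -
  let ?s = "\<Oplus>\<^bsub>M\<^esub>j\<in>{..<n i}. a i (p ^ Suc j) f \<odot>\<^bsub>M\<^esub> X i (Suc j)"
  have s: "?s \<in> carrier M" by (intro M.M.finsum_closed funcsetI Pc_term[OF i f])
  have "?s \<otimes>\<^bsub>M\<^esub> y = (\<Oplus>\<^bsub>M\<^esub>j\<in>{..<n i}. (a i (p ^ Suc j) f \<odot>\<^bsub>M\<^esub> X i (Suc j)) \<otimes>\<^bsub>M\<^esub> y)"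
    by (intro M.bracket_finsum_left funcsetI Pc_term[OF i f] y) simp
  also have "\<dots> = \<zero>\<^bsub>M\<^esub>"
    using a_closed'[OF i f] X_closed[OF i] y
    by (intro M.M.add.finprod_one_eqI) (simp add: M.bracket_smult_left X_Suc M.pmap_central M.pmap_closed)
  finally have s0: "?s \<otimes>\<^bsub>M\<^esub> y = \<zero>\<^bsub>M\<^esub>" .
  show ?thesis
    unfolding Pc_split[OF i f] using s s0 y x_closed[OF i] a_closed'[OF i f]
    by (simp add: M.bracket_add_left M.bracket_smult_left M.bracket_closed)
qed

lemma Pc_comm:
  assumes i: "i < r" and f: "f \<in> carrier FA.T" and g: "g \<in> carrier FA.T"
  shows "Pc i f \<otimes>\<^bsub>M\<^esub> Pc i g = \<zero>\<^bsub>M\<^esub>"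
proof -
  have "x i \<otimes>\<^bsub>M\<^esub> Pc i g = \<ominus>\<^bsub>M\<^esub> (Pc i g \<otimes>\<^bsub>M\<^esub> x i)"
    using M.bracket_antisym x_closed[OF i] Pc_closed[OF i g] by blast
  also have "\<dots> = \<zero>\<^bsub>M\<^esub>"
    using Pc_bracket[OF i g x_closed[OF i]] M.bracket_self[OF x_closed[OF i]] a_closed'[OF i g] by simp
  finally show ?thesis using Pc_bracket[OF i f Pc_closed[OF i g]] a_closed'[OF i f] by simp
qed

definition S :: "nat \<Rightarrow> ('b list \<Rightarrow> 'k) \<Rightarrow> 'a" where "S m f = (\<Oplus>\<^bsub>M\<^esub>i\<in>{..<m}. Pc i f)"

text \<open>Half of a bracket, with the indices in decreasing order: \<open>[S f, S g]\<close> is \<open>B f g - B g f\<close>.\<close>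

definition B :: "nat \<Rightarrow> ('b list \<Rightarrow> 'k) \<Rightarrow> ('b list \<Rightarrow> 'k) \<Rightarrow> 'a" where
  "B m f g = (\<Oplus>\<^bsub>M\<^esub>i\<in>{..<m}. Pc i f \<otimes>\<^bsub>M\<^esub> S i g)"

lemma S_0 [simp]: "S 0 f = \<zero>\<^bsub>M\<^esub>" and B_0 [simp]: "B 0 f g = \<zero>\<^bsub>M\<^esub>"
  unfolding S_def B_def by simp_all

lemma S_closed: "\<lbrakk>m \<le> r; f \<in> carrier FA.T\<rbrakk> \<Longrightarrow> S m f \<in> carrier M"
  unfolding S_def by (intro M.M.finsum_closed funcsetI Pc_closed) auto

lemma S_Suc: "\<lbrakk>Suc m \<le> r; f \<in> carrier FA.T\<rbrakk> \<Longrightarrow> S (Suc m) f = S m f \<oplus>\<^bsub>M\<^esub> Pc m f"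
  unfolding S_def by (intro M.M.finsum_lessThan_Suc Pc_closed) auto

lemma B_closed: "\<lbrakk>m \<le> r; f \<in> carrier FA.T; g \<in> carrier FA.T\<rbrakk> \<Longrightarrow> B m f g \<in> carrier M"
  unfolding B_def by (intro M.M.finsum_closed funcsetI M.bracket_closed Pc_closed S_closed) auto

lemma B_Suc: "\<lbrakk>Suc m \<le> r; f \<in> carrier FA.T; g \<in> carrier FA.T\<rbrakk> \<Longrightarrow> B (Suc m) f g = B m f g \<oplus>\<^bsub>M\<^esub> Pc m f \<otimes>\<^bsub>M\<^esub> S m g"
  unfolding B_def by (intro M.M.finsum_lessThan_Suc M.bracket_closed Pc_closed S_closed) auto

lemma S_add: "\<lbrakk>m \<le> r; f \<in> carrier FA.T; g \<in> carrier FA.T\<rbrakk> \<Longrightarrow> S m (f \<oplus>\<^bsub>FA.T\<^esub> g) = S m f \<oplus>\<^bsub>M\<^esub> S m g"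
proof (induction m)
  case (Suc m)
  thus ?case using Pc_closed[of m] S_closed[of m] by (simp add: S_Suc Pc_add M.M.a_ac)
qed simp

lemma S_smult: "\<lbrakk>m \<le> r; f \<in> carrier FA.T; d \<in> carrier F\<rbrakk> \<Longrightarrow> S m (d \<odot>\<^bsub>FA.T\<^esub> f) = d \<odot>\<^bsub>M\<^esub> S m f"
proof (induction m)
  case (Suc m)
  thus ?case using Pc_closed[of m] S_closed[of m] by (simp add: S_Suc Pc_smult M.smult_r_distr)
qed simp

lemma B_add_left: "\<lbrakk>m \<le> r; f \<in> carrier FA.T; f' \<in> carrier FA.T; g \<in> carrier FA.T\<rbrakk> \<Longrightarrow>
    B m (f \<oplus>\<^bsub>FA.T\<^esub> f') g = B m f g \<oplus>\<^bsub>M\<^esub> B m f' g"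
proof (induction m)
  case (Suc m)
  thus ?case using Pc_closed[of m] S_closed[of m] B_closed[of m] M.bracket_closed
    by (simp add: B_Suc Pc_add M.bracket_add_left M.M.a_ac)
qed simp

lemma B_add_right: "\<lbrakk>m \<le> r; f \<in> carrier FA.T; g' \<in> carrier FA.T; g \<in> carrier FA.T\<rbrakk> \<Longrightarrow>
    B m f (g \<oplus>\<^bsub>FA.T\<^esub> g') = B m f g \<oplus>\<^bsub>M\<^esub> B m f g'"
proof (induction m)
  case (Suc m)
  thus ?case using Pc_closed[of m] S_closed[of m] B_closed[of m] M.bracket_closed
    by (simp add: B_Suc S_add M.bracket_add_right M.M.a_ac)
qed simp

lemma B_smult_left: "\<lbrakk>m \<le> r; f \<in> carrier FA.T; d \<in> carrier F; g \<in> carrier FA.T\<rbrakk> \<Longrightarrow>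
    B m (d \<odot>\<^bsub>FA.T\<^esub> f) g = d \<odot>\<^bsub>M\<^esub> B m f g"
proof (induction m)
  case (Suc m)
  thus ?case using Pc_closed[of m] S_closed[of m] B_closed[of m] M.bracket_closed
    by (simp add: B_Suc Pc_smult M.bracket_smult_left M.smult_r_distr)
qed simp

lemma B_smult_right: "\<lbrakk>m \<le> r; f \<in> carrier FA.T; d \<in> carrier F; g \<in> carrier FA.T\<rbrakk> \<Longrightarrow>
    B m f (d \<odot>\<^bsub>FA.T\<^esub> g) = d \<odot>\<^bsub>M\<^esub> B m f g"
proof (induction m)
  case (Suc m)
  thus ?case using Pc_closed[of m] S_closed[of m] B_closed[of m] M.bracket_closed
    by (simp add: B_Suc S_smult M.bracket_smult_right M.smult_r_distr)
qed simp

lemma B_Z: "\<lbrakk>m \<le> r; f \<in> carrier FA.T; g \<in> carrier FA.T\<rbrakk> \<Longrightarrow> B m f g \<in> Z"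
  unfolding B_def by (rule subspace_finsum[OF M.Z_subspace]) (auto intro!: M.bracket_Z Pc_closed S_closed)

text \<open>\<open>B\<close> depends on its arguments only through their linear coefficients, so it
  vanishes when these do.\<close>

lemma B_linear_part_left:
  "\<lbrakk>m \<le> r; f \<in> carrier FA.T; g \<in> carrier FA.T; \<And>i. i < r \<Longrightarrow> a i 1 f = \<zero>\<rbrakk> \<Longrightarrow> B m f g = \<zero>\<^bsub>M\<^esub>"
proof (induction m)
  case (Suc m)
  have "Pc m f \<otimes>\<^bsub>M\<^esub> S m g = \<zero>\<^bsub>M\<^esub>"
    using Suc.prems Pc_bracket[of m f "S m g"] S_closed[of m g] x_closed[of m] M.bracket_closed by simp
  thus ?case using Suc by (simp add: B_Suc)
qed simp

lemma S_central:
  "\<lbrakk>m \<le> r; g \<in> carrier FA.T; \<And>i. i < r \<Longrightarrow> a i 1 g = \<zero>; y \<in> carrier M\<rbrakk> \<Longrightarrow> S m g \<otimes>\<^bsub>M\<^esub> y = \<zero>\<^bsub>M\<^esub>"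
proof (induction m)
  case (Suc m)
  have "Pc m g \<otimes>\<^bsub>M\<^esub> y = \<zero>\<^bsub>M\<^esub>"
    using Suc.prems Pc_bracket[of m g y] x_closed[of m] M.bracket_closed by simp
  thus ?case using Suc Pc_closed[of m] S_closed[of m] by (simp add: S_Suc M.bracket_add_left)
qed simp

lemma B_linear_part_right:
  "\<lbrakk>m \<le> r; f \<in> carrier FA.T; g \<in> carrier FA.T; \<And>i. i < r \<Longrightarrow> a i 1 g = \<zero>\<rbrakk> \<Longrightarrow> B m f g = \<zero>\<^bsub>M\<^esub>"
proof (induction m)
  case (Suc m)
  have "S m g \<otimes>\<^bsub>M\<^esub> Pc m f = \<zero>\<^bsub>M\<^esub>" using Suc.prems by (intro S_central Pc_closed) auto
  hence "Pc m f \<otimes>\<^bsub>M\<^esub> S m g = \<zero>\<^bsub>M\<^esub>"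
    using M.bracket_antisym[of "Pc m f" "S m g"] Suc.prems Pc_closed[of m f] S_closed[of m g] by simp
  thus ?case using Suc by (simp add: B_Suc)
qed simp

text \<open>Expanding the bracket of the two sums, the diagonal terms vanish by
  \<open>Pc_comm\<close>; antisymmetry brings the larger index of each mixed term to the
  left.\<close>

lemma B_antisym:
  "\<lbrakk>m \<le> r; f \<in> carrier FA.T; g \<in> carrier FA.T\<rbrakk> \<Longrightarrow> B m f g \<ominus>\<^bsub>M\<^esub> B m g f = S m f \<otimes>\<^bsub>M\<^esub> S m g"
proof (induction m)
  case 0 thus ?case by (simp add: M.M.minus_eq)
next
  case (Suc m)
  have m: "m \<le> r" "m < r" using Suc.prems by auto
  note cl = Pc_closed[OF m(2) Suc.prems(2)] Pc_closed[OF m(2) Suc.prems(3)]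
    S_closed[OF m(1) Suc.prems(2)] S_closed[OF m(1) Suc.prems(3)]
    B_closed[OF m(1) Suc.prems(2,3)] B_closed[OF m(1) Suc.prems(3,2)]
  note br = M.bracket_closed[OF cl(1) cl(4)] M.bracket_closed[OF cl(2) cl(3)] M.bracket_closed[OF cl(3) cl(4)]
    M.bracket_closed[OF cl(3) cl(2)]
  have "S (Suc m) f \<otimes>\<^bsub>M\<^esub> S (Suc m) g = S m f \<otimes>\<^bsub>M\<^esub> S m g \<oplus>\<^bsub>M\<^esub> S m f \<otimes>\<^bsub>M\<^esub> Pc m g \<oplus>\<^bsub>M\<^esub> Pc m f \<otimes>\<^bsub>M\<^esub> S m g"
    using Suc.prems cl br Pc_comm[OF m(2) Suc.prems(2,3)]
    by (simp add: S_Suc M.bracket_add_left M.bracket_add_right M.M.a_ac)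
  also have "S m f \<otimes>\<^bsub>M\<^esub> Pc m g = \<ominus>\<^bsub>M\<^esub> (Pc m g \<otimes>\<^bsub>M\<^esub> S m f)" using M.bracket_antisym cl by blast
  also have "S m f \<otimes>\<^bsub>M\<^esub> S m g = B m f g \<ominus>\<^bsub>M\<^esub> B m g f" using Suc m by simp
  finally show ?case
    using Suc.prems cl br by (simp add: B_Suc M.M.minus_eq M.M.minus_add M.M.a_ac)
qed

text \<open>The corrections that make \<open>S\<close> agree with \<open>q\<close> on generators and turn commutators into brackets.\<close>

definition qz :: "'b list \<Rightarrow> 'a" where
  "qz w = (case w of [h] \<Rightarrow> q h \<ominus>\<^bsub>M\<^esub> S r (free_gen F h)
     | [h, h'] \<Rightarrow> B r (free_gen F h) (free_gen F h') | _ \<Rightarrow> \<zero>\<^bsub>M\<^esub>)"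

lemma gen_closed: "h \<in> carrier H \<Longrightarrow> free_gen F h \<in> carrier FA.T"
  by (simp add: FA.free_gen_sd FA.sd_closed)

text \<open>On a generator the extra coefficient at degree \<open>p ^ n i\<close> vanishes, and
  \<open>S\<close> becomes the lifted cyclic expansion, which is correct modulo
  \<open>Z\<close>.\<close>

lemma S_gen_repr:
  assumes h: "h \<in> carrier H" shows "q h \<ominus>\<^bsub>M\<^esub> S r (free_gen F h) \<in> Z"
proof -
  have "Pc i (free_gen F h) = (\<Oplus>\<^bsub>M\<^esub>j\<in>{..<n i}. c i (p ^ j) h \<odot>\<^bsub>M\<^esub> (pmap M ^^ j) (x i))" if i: "i < r" for i
  proof -
    have cl: "c i k h \<odot>\<^bsub>M\<^esub> X i j \<in> carrier M" for j k
      using lin_functionalD(1)[OF c_functional[OF i] h] X_closed[OF i] by simp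
    have "c i (p ^ n i) h = \<zero>" using p_gt_1 by (intro c_supp[OF i]) simp
    hence "c i (p ^ n i) h \<odot>\<^bsub>M\<^esub> X i (n i) = \<zero>\<^bsub>M\<^esub>" using X_closed[OF i] by simp
    moreover have "(\<Oplus>\<^bsub>M\<^esub>j\<in>{..<n i}. c i (p ^ j) h \<odot>\<^bsub>M\<^esub> X i j) \<in> carrier M"
      using cl by (intro M.M.finsum_closed) auto
    ultimately show ?thesis
      unfolding Pc_def a_gen[OF i h] M.M.finsum_lessThan_Suc[of "n i" "\<lambda>j. c i (p ^ j) h \<odot>\<^bsub>M\<^esub> X i j", OF cl]
      by (simp add: X_def)
  qed
  hence "S r (free_gen F h) = (\<Oplus>\<^bsub>M\<^esub>i\<in>{..<r}. \<Oplus>\<^bsub>M\<^esub>j\<in>{..<n i}. c i (p ^ j) h \<odot>\<^bsub>M\<^esub> (pmap M ^^ j) (x i))"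
    unfolding S_def using Pc_closed[OF _ gen_closed[OF h]]
    by (intro M.M.finsum_cong') auto
  thus ?thesis using q_repr[OF h] by simp
qed

lemma qz_Z: "w \<in> lists (carrier H) \<Longrightarrow> qz w \<in> Z"
  unfolding qz_def using subspaceD(2)[OF M.Z_subspace] S_gen_repr gen_closed B_Z
  by (auto split: list.split)

sublocale Q: word_ext_module F "carrier H" M qz
  by unfold_locales (rule M.Z_carrier[OF qz_Z])

lemma Q_Z: assumes f: "f \<in> carrier FA.T" shows "Q.E f \<in> Z"
  unfolding word_ext_def
proof (rule subspace_finsum[OF M.Z_subspace])
  show "finite {w. f w \<noteq> \<zero>}" using f unfolding FA.T_carrier by blast
  fix w assume "w \<in> {w. f w \<noteq> \<zero>}"
  hence "w \<in> lists (carrier H)" using f unfolding FA.T_carrier by blast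
  thus "f w \<odot>\<^bsub>M\<^esub> qz w \<in> Z" using qz_Z FA.T_val[OF f] subspaceD(4)[OF M.Z_subspace] by blast
qed

text \<open>A word of length two or more is a product of augmentation-zero elements, and the empty
  word is a constant.\<close>

lemma a_1_long:
  assumes i: "i < r" and d: "d \<in> carrier F" and w: "w \<in> lists (carrier H)" and len: "length w \<noteq> 1"
  shows "a i 1 (FA.sd d w) = \<zero>"
proof (cases w)
  case Nil
  have "FA.sd d [] = d \<odot>\<^bsub>FA.T\<^esub> \<one>\<^bsub>FA.T\<^esub>" using d by (auto simp: FA.T_simps FA.sd_def)
  thus ?thesis using Nil a_smult[OF i d, of "\<one>\<^bsub>FA.T\<^esub>" 1] d by (simp add: a_one i)
next
  case (Cons h v)
  hence *: "h \<in> carrier H" "v \<in> lists (carrier H)" "v \<noteq> []" using w len by auto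
  have g: "free_gen F h \<in> carrier FA.T" "FA.sd d v \<in> carrier FA.T" using * d gen_closed FA.sd_closed by auto
  have eq: "FA.sd d w = free_gen F h \<otimes>\<^bsub>FA.T\<^esub> FA.sd d v"
    using d Cons by (simp add: FA.free_gen_sd FA.sd_mult)
  show ?thesis
    unfolding eq a_1_mult[OF i g] using * a_closed'[OF i g(1)] a_closed'[OF i g(2)]
    by (simp add: \<epsilon>_sd FA.free_gen_sd)
qed

text \<open>A derivation along the augmentation, up to the bilinear term \<open>B\<close>. By
  bilinearity it is checked on words, and it is the value of \<open>qz\<close> on words of length
  two that produces \<open>B\<close>.\<close>

lemma Q_mult:
  assumes f: "f \<in> carrier FA.T" and g: "g \<in> carrier FA.T"
  shows "Q.E (f \<otimes>\<^bsub>FA.T\<^esub> g) = \<epsilon> f \<odot>\<^bsub>M\<^esub> Q.E g \<oplus>\<^bsub>M\<^esub> \<epsilon> g \<odot>\<^bsub>M\<^esub> Q.E f \<oplus>\<^bsub>M\<^esub> B r f g"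
  using f
proof (induction f rule: FA.T_induct)
  have z: "a i 1 \<zero>\<^bsub>FA.T\<^esub> = \<zero>" if "i < r" for i using a_zero[OF that] .
  case zero
  show ?case using g B_linear_part_left[OF order_refl _ g z] 
    by (simp add: Q.E_zero \<epsilon>_zero Q.E_closed \<epsilon>_closed)
next
  case (sd d u)
  note du = this
  have sdu: "FA.sd d u \<in> carrier FA.T" using FA.sd_closed du by auto
  show ?case using g
  proof (induction g rule: FA.T_induct)
    have z: "a i 1 \<zero>\<^bsub>FA.T\<^esub> = \<zero>" if "i < r" for i using a_zero[OF that] .
    case zero
    show ?case using sdu B_linear_part_right[OF order_refl sdu _ z] 
      by (simp add: Q.E_zero \<epsilon>_zero Q.E_closed \<epsilon>_closed)
  next
    case (sd d' v)
    have sdv: "FA.sd d' v \<in> carrier FA.T" using FA.sd_closed sd by auto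
    have qc: "qz u \<in> carrier M" "qz v \<in> carrier M" using qz_Z M.Z_carrier du sd by blast+
    have lhs: "Q.E (FA.sd d u \<otimes>\<^bsub>FA.T\<^esub> FA.sd d' v) = (d \<otimes> d') \<odot>\<^bsub>M\<^esub> qz (u @ v)"
      using du sd by (simp add: FA.sd_mult Q.E_sd)
    show ?case
    proof (cases "length u = 1 \<and> length v = 1")
      case True
      then obtain h h' where w: "u = [h]" "v = [h']" by (metis One_nat_def length_0_conv length_Suc_conv)
      hence hh: "h \<in> carrier H" "h' \<in> carrier H" using du sd by auto
      have eq: "FA.sd d u = d \<odot>\<^bsub>FA.T\<^esub> free_gen F h" "FA.sd d' v = d' \<odot>\<^bsub>FA.T\<^esub> free_gen F h'"
        unfolding w using du sd by (auto simp: FA.T_simps FA.sd_def free_gen_def)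
      have "B r (FA.sd d u) (FA.sd d' v) = d \<odot>\<^bsub>M\<^esub> (d' \<odot>\<^bsub>M\<^esub> B r (free_gen F h) (free_gen F h'))"
        unfolding eq using du sd hh gen_closed FA.T_smult_closed
        by (subst B_smult_left, simp_all, subst B_smult_right, simp_all)
      moreover have "B r (free_gen F h) (free_gen F h') \<in> carrier M" using B_closed gen_closed hh by blast
      moreover have "qz (u @ v) = B r (free_gen F h) (free_gen F h')" unfolding w qz_def by simp
      moreover have "\<epsilon> (FA.sd d u) = \<zero>" "\<epsilon> (FA.sd d' v) = \<zero>" unfolding w by (simp_all add: \<epsilon>_sd)
      ultimately show ?thesis unfolding lhs using du(1) sd(1) Q.E_closed[OF sdu] Q.E_closed[OF sdv]
        by (simp add: M.smult_assoc1)
    next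
      case False
      have B0: "B r (FA.sd d u) (FA.sd d' v) = \<zero>\<^bsub>M\<^esub>"
      proof (cases "length u = 1")
        case True
        hence "length v \<noteq> 1" using False by simp
        thus ?thesis using sd a_1_long by (intro B_linear_part_right sdu sdv) auto
      next
        case False
        thus ?thesis using du a_1_long by (intro B_linear_part_left sdu sdv) auto
      qed
      \<comment> \<open>Two nonempty words, not both of length one, concatenate to length at least
        three, where \<open>qz\<close> is zero.\<close>
      have "qz (u @ v) = (if u = [] then qz v else if v = [] then qz u else \<zero>\<^bsub>M\<^esub>)"
        using False unfolding qz_def by (auto split: list.split simp: append_eq_Cons_conv)
      moreover have "qz [] = \<zero>\<^bsub>M\<^esub>" unfolding qz_def by simp
      moreover have "d' \<odot>\<^bsub>M\<^esub> (d \<odot>\<^bsub>M\<^esub> y) = d \<odot>\<^bsub>M\<^esub> (d' \<odot>\<^bsub>M\<^esub> y)" if "y \<in> carrier M" for y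
        using du(1) sd(1) that by (simp add: M.smult_assoc1[symmetric] m_comm)
      ultimately show ?thesis unfolding lhs B0 using du sd qc
        by (auto simp: Q.E_sd \<epsilon>_sd M.smult_assoc1)
    qed
  next
    case (add g1 g2)
    have e: "\<epsilon> (FA.sd d u) \<in> carrier F" "\<epsilon> g1 \<in> carrier F" "\<epsilon> g2 \<in> carrier F" using \<epsilon>_closed sdu add by auto
    have Qc: "Q.E (FA.sd d u) \<in> carrier M" "Q.E g1 \<in> carrier M" "Q.E g2 \<in> carrier M" using Q.E_closed sdu add by auto
    have Bc: "B r (FA.sd d u) g1 \<in> carrier M" "B r (FA.sd d u) g2 \<in> carrier M" using B_closed sdu add by auto
    have "Q.E (FA.sd d u \<otimes>\<^bsub>FA.T\<^esub> (g1 \<oplus>\<^bsub>FA.T\<^esub> g2)) = Q.E (FA.sd d u \<otimes>\<^bsub>FA.T\<^esub> g1) \<oplus>\<^bsub>M\<^esub> Q.E (FA.sd d u \<otimes>\<^bsub>FA.T\<^esub> g2)"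
      using add sdu by (simp add: FA.T_r_distr Q.E_add FA.T_mult_closed)
    thus ?case using add e Qc Bc sdu
      by (simp add: Q.E_add \<epsilon>_add B_add_right M.smult_l_distr M.smult_r_distr M.M.a_ac)
  qed
next
  case (add f1 f2)
  have e: "\<epsilon> g \<in> carrier F" "\<epsilon> f1 \<in> carrier F" "\<epsilon> f2 \<in> carrier F" using \<epsilon>_closed g add by auto
  have Qc: "Q.E g \<in> carrier M" "Q.E f1 \<in> carrier M" "Q.E f2 \<in> carrier M" using Q.E_closed g add by auto
  have Bc: "B r f1 g \<in> carrier M" "B r f2 g \<in> carrier M" using B_closed g add by auto
  have "Q.E ((f1 \<oplus>\<^bsub>FA.T\<^esub> f2) \<otimes>\<^bsub>FA.T\<^esub> g) = Q.E (f1 \<otimes>\<^bsub>FA.T\<^esub> g) \<oplus>\<^bsub>M\<^esub> Q.E (f2 \<otimes>\<^bsub>FA.T\<^esub> g)"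
    using add g by (simp add: FA.T_l_distr Q.E_add FA.T_mult_closed)
  thus ?case using add e Qc Bc g
    by (simp add: Q.E_add \<epsilon>_add B_add_left M.smult_l_distr M.smult_r_distr M.M.a_ac)
qed

section \<open>The retraction on commutators, p-th powers and products\<close>

definition \<pi> :: "('b list \<Rightarrow> 'k) \<Rightarrow> 'a" where "\<pi> f = S r f \<oplus>\<^bsub>M\<^esub> Q.E f"

lemma \<pi>_closed: "f \<in> carrier FA.T \<Longrightarrow> \<pi> f \<in> carrier M"
  unfolding \<pi>_def using S_closed Q.E_closed by simp

lemma \<pi>_add: "\<lbrakk>f \<in> carrier FA.T; g \<in> carrier FA.T\<rbrakk> \<Longrightarrow> \<pi> (f \<oplus>\<^bsub>FA.T\<^esub> g) = \<pi> f \<oplus>\<^bsub>M\<^esub> \<pi> g"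
  unfolding \<pi>_def using S_closed Q.E_closed by (simp add: S_add Q.E_add M.M.a_ac)

lemma \<pi>_smult: "\<lbrakk>d \<in> carrier F; f \<in> carrier FA.T\<rbrakk> \<Longrightarrow> \<pi> (d \<odot>\<^bsub>FA.T\<^esub> f) = d \<odot>\<^bsub>M\<^esub> \<pi> f"
  unfolding \<pi>_def using S_closed Q.E_closed by (simp add: S_smult Q.E_smult M.smult_r_distr)

lemma \<pi>_gen: assumes h: "h \<in> carrier H" shows "\<pi> (free_gen F h) = q h"
proof -
  have qh: "q h \<in> carrier M" using restricted_lie_homD(1)[OF q h] .
  have Sh: "S r (free_gen F h) \<in> carrier M" using S_closed gen_closed h by auto
  have "Q.E (free_gen F h) = qz [h]"
    unfolding FA.free_gen_sd using h qz_Z[of "[h]"] M.Z_carrier by (simp add: Q.E_sd)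
  also have "\<dots> = q h \<ominus>\<^bsub>M\<^esub> S r (free_gen F h)" unfolding qz_def by simp
  finally show ?thesis unfolding \<pi>_def using qh Sh by (simp add: M.M.minus_eq M.M.a_lcomm[of "S r (free_gen F h)"] M.M.r_neg)
qed

lemma S_swap: "\<lbrakk>m \<le> r; f \<in> carrier FA.T; g \<in> carrier FA.T\<rbrakk> \<Longrightarrow> S m (f \<otimes>\<^bsub>FA.T\<^esub> g) = S m (g \<otimes>\<^bsub>FA.T\<^esub> f)"
  unfolding S_def Pc_def using a_comm'
  by (intro M.M.finsum_cong' funcsetI) (auto intro!: M.M.finsum_cong' M.M.finsum_closed Pc_term simp: FA.T_mult_closed)

text \<open>The \<open>S\<close> parts cancel because polynomials commute, the derivation parts
  vanish with the augmentation, and the antisymmetrised \<open>B\<close> is the bracket. Adding the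
  central values of \<open>Q.E\<close> does not change that bracket.\<close>

lemma \<pi>_commutator:
  assumes f: "f \<in> carrier FA.T" "\<epsilon> f = \<zero>" and g: "g \<in> carrier FA.T" "\<epsilon> g = \<zero>"
  shows "\<pi> (f \<otimes>\<^bsub>FA.T\<^esub> g) \<ominus>\<^bsub>M\<^esub> \<pi> (g \<otimes>\<^bsub>FA.T\<^esub> f) = \<pi> f \<otimes>\<^bsub>M\<^esub> \<pi> g"
proof -
  note cl = S_closed[OF order_refl f(1)] S_closed[OF order_refl g(1)] Q.E_closed[OF f(1)] Q.E_closed[OF g(1)]
    B_closed[OF order_refl f(1) g(1)] B_closed[OF order_refl g(1) f(1)]
    S_closed[OF order_refl FA.T_mult_closed[OF g(1) f(1)]]
  have "\<pi> (f \<otimes>\<^bsub>FA.T\<^esub> g) \<ominus>\<^bsub>M\<^esub> \<pi> (g \<otimes>\<^bsub>FA.T\<^esub> f) = B r f g \<ominus>\<^bsub>M\<^esub> B r g f"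
    unfolding \<pi>_def S_swap[OF order_refl f(1) g(1)] Q_mult[OF f(1) g(1)] Q_mult[OF g(1) f(1)] f(2) g(2)
    using cl by (simp add: M.M.minus_eq M.M.minus_add M.M.a_ac M.M.r_neg1 M.M.r_neg2 M.M.r_neg)
  also have "\<dots> = S r f \<otimes>\<^bsub>M\<^esub> S r g" by (rule B_antisym[OF order_refl f(1) g(1)])
  also have "\<dots> = \<pi> f \<otimes>\<^bsub>M\<^esub> \<pi> g"
    unfolding \<pi>_def using cl M.Z_central[OF Q_Z[OF f(1)]] M.Z_central'[OF Q_Z[OF g(1)]] M.bracket_closed
    by (simp add: M.bracket_add_left M.bracket_add_right)
  finally show ?thesis .
qed

text \<open>Within one summand everything commutes, so the p-map is additive there and acts as the
  degree shift of Frobenius. The inclusive upper end of \<open>Pc\<close> makes the shifted sum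
  match exactly.\<close>

lemma pmap_Pc:
  assumes i: "i < r" and f: "f \<in> carrier FA.T"
  shows "pmap M (Pc i f) = Pc i (f [^]\<^bsub>FA.T\<^esub> p)"
proof -
  have fp: "f [^]\<^bsub>FA.T\<^esub> p \<in> carrier FA.T" by (rule T_pow_closed[OF f])
  have ac: "a i k f \<in> carrier F" for k using a_closed'[OF i f] .
  \<comment> \<open>Iterates with positive index are p-th powers and central; only
    \<open>X i 0\<close> with itself remains.\<close>
  have XX: "X i j \<otimes>\<^bsub>M\<^esub> X i k = \<zero>\<^bsub>M\<^esub>" for j k
  proof (cases j)
    case (Suc j')
    thus ?thesis using M.pmap_central X_closed[OF i] by (simp add: X_Suc)
  next
    case 0
    show ?thesis
    proof (cases k)
      case (Suc k')
      have "X i j \<otimes>\<^bsub>M\<^esub> X i k = \<ominus>\<^bsub>M\<^esub> (X i k \<otimes>\<^bsub>M\<^esub> X i j)" by (intro M.bracket_antisym X_closed i)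
      also have "X i k \<otimes>\<^bsub>M\<^esub> X i j = \<zero>\<^bsub>M\<^esub>" unfolding Suc X_Suc by (intro M.pmap_central X_closed i)
      finally show ?thesis by simp
    qed (use 0 M.bracket_self X_closed[OF i] in auto)
  qed
  have "pmap M (Pc i f) = (\<Oplus>\<^bsub>M\<^esub>j\<in>{..<Suc (n i)}. pmap M (a i (p ^ j) f \<odot>\<^bsub>M\<^esub> X i j))"
    unfolding Pc_def
    by (rule M.pmap_finsum) (use Pc_term[OF i f] ac X_closed[OF i] XX in \<open>auto simp: M.bracket_smult_left M.bracket_smult_right\<close>)
  also have "\<dots> = (\<Oplus>\<^bsub>M\<^esub>j\<in>{..<Suc (n i)}. a i (p ^ j) f [^] p \<odot>\<^bsub>M\<^esub> X i (Suc j))"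
    using ac X_closed[OF i] by (intro M.M.finsum_cong') (auto simp: M.pmap_smult char_eq X_Suc M.pmap_closed)
  also have "\<dots> = (\<Oplus>\<^bsub>M\<^esub>j\<in>{..<n i}. a i (p ^ j) f [^] p \<odot>\<^bsub>M\<^esub> X i (Suc j)) \<oplus>\<^bsub>M\<^esub> a i (p ^ n i) f [^] p \<odot>\<^bsub>M\<^esub> X i (Suc (n i))"
    using ac X_closed[OF i] by (intro M.M.finsum_lessThan_Suc) auto
  \<comment> \<open>Nilpotency holds modulo \<open>Z\<close>, and one more p-th power kills
    \<open>Z\<close>.\<close>
  also have "X i (Suc (n i)) = \<zero>\<^bsub>M\<^esub>"
    unfolding X_Suc unfolding X_def using x_nil[OF i] by (rule M.pmap_Z)
  also have "(\<Oplus>\<^bsub>M\<^esub>j\<in>{..<n i}. a i (p ^ j) f [^] p \<odot>\<^bsub>M\<^esub> X i (Suc j)) =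
      (\<Oplus>\<^bsub>M\<^esub>j\<in>{..<n i}. a i (p ^ Suc j) (f [^]\<^bsub>FA.T\<^esub> p) \<odot>\<^bsub>M\<^esub> X i (Suc j))"
    using ac X_closed[OF i] p_pos Pc_term[OF i fp] by (intro M.M.finsum_cong') (auto simp: a_frob[OF i f])
  also have "\<dots> \<oplus>\<^bsub>M\<^esub> a i (p ^ n i) f [^] p \<odot>\<^bsub>M\<^esub> \<zero>\<^bsub>M\<^esub> = Pc i (f [^]\<^bsub>FA.T\<^esub> p)"
  proof -
    have "(\<Oplus>\<^bsub>M\<^esub>j\<in>{..<n i}. a i (p ^ Suc j) (f [^]\<^bsub>FA.T\<^esub> p) \<odot>\<^bsub>M\<^esub> X i (Suc j)) \<in> carrier M"
      using Pc_term[OF i fp] by (intro M.M.finsum_closed) auto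
    moreover have "a i 1 (f [^]\<^bsub>FA.T\<^esub> p) = \<zero>" using a_frob[OF i f, of 1] p_gt_1 by simp
    ultimately show ?thesis unfolding Pc_split[OF i fp] using ac x_closed[OF i] by simp
  qed
  finally show ?thesis .
qed

text \<open>Adding the summands one by one, p = 2 yields a bracket of the new component with the
  partial sum at each stage; these accumulate to \<open>B m f f\<close>.\<close>

lemma pmap_S:
  "\<lbrakk>m \<le> r; f \<in> carrier FA.T\<rbrakk> \<Longrightarrow> pmap M (S m f) = S m (f [^]\<^bsub>FA.T\<^esub> p) \<oplus>\<^bsub>M\<^esub> (if p = 2 then B m f f else \<zero>\<^bsub>M\<^esub>)"
proof (induction m)
  case (Suc m)
  have m: "m \<le> r" "m < r" using Suc.prems by auto
  have fp: "f [^]\<^bsub>FA.T\<^esub> p \<in> carrier FA.T" by (rule T_pow_closed[OF Suc.prems(2)])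
  note cl = Pc_closed[OF m(2) Suc.prems(2)] S_closed[OF m(1) Suc.prems(2)] B_closed[OF m(1) Suc.prems(2) Suc.prems(2)]
    Pc_closed[OF m(2) fp] S_closed[OF m(1) fp]
  note IH = Suc.IH[OF m(1) Suc.prems(2)] and br = M.bracket_closed[OF cl(1,2)]
  note add = M.pmap_class2[OF cl(2,1), unfolded char_eq pmap_Pc[OF m(2) Suc.prems(2)] IH]
  show ?case
    unfolding S_Suc[OF Suc.prems] S_Suc[OF Suc.prems(1) fp] B_Suc[OF Suc.prems Suc.prems(2)] add
  proof (cases "p = 2")
    case True
    show "S m (f [^]\<^bsub>FA.T\<^esub> p) \<oplus>\<^bsub>M\<^esub> (if p = 2 then B m f f else \<zero>\<^bsub>M\<^esub>) \<oplus>\<^bsub>M\<^esub> Pc m (f [^]\<^bsub>FA.T\<^esub> p) \<oplus>\<^bsub>M\<^esub>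
        (if p = 2 then Pc m f \<otimes>\<^bsub>M\<^esub> S m f else \<zero>\<^bsub>M\<^esub>) = S m (f [^]\<^bsub>FA.T\<^esub> p) \<oplus>\<^bsub>M\<^esub> Pc m (f [^]\<^bsub>FA.T\<^esub> p) \<oplus>\<^bsub>M\<^esub>
        (if p = 2 then B m f f \<oplus>\<^bsub>M\<^esub> Pc m f \<otimes>\<^bsub>M\<^esub> S m f else \<zero>\<^bsub>M\<^esub>)"
      unfolding if_P[OF True] using cl br by (simp add: M.M.a_ac)
  next
    case False
    show "S m (f [^]\<^bsub>FA.T\<^esub> p) \<oplus>\<^bsub>M\<^esub> (if p = 2 then B m f f else \<zero>\<^bsub>M\<^esub>) \<oplus>\<^bsub>M\<^esub> Pc m (f [^]\<^bsub>FA.T\<^esub> p) \<oplus>\<^bsub>M\<^esub>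
        (if p = 2 then Pc m f \<otimes>\<^bsub>M\<^esub> S m f else \<zero>\<^bsub>M\<^esub>) = S m (f [^]\<^bsub>FA.T\<^esub> p) \<oplus>\<^bsub>M\<^esub> Pc m (f [^]\<^bsub>FA.T\<^esub> p) \<oplus>\<^bsub>M\<^esub>
        (if p = 2 then B m f f \<oplus>\<^bsub>M\<^esub> Pc m f \<otimes>\<^bsub>M\<^esub> S m f else \<zero>\<^bsub>M\<^esub>)"
      unfolding if_not_P[OF False] using cl by simp
  qed
next
  case 0
  show ?case unfolding S_0 B_0 by simp
qed

text \<open>Split off one factor of the power: both factors have augmentation zero, so only
  \<open>B\<close> remains. For odd p the first factor is itself a product of such elements and has
  no linear part; for p = 2 it is \<open>f\<close>.\<close>

lemma Q_frob:
  assumes f: "f \<in> carrier FA.T" "\<epsilon> f = \<zero>"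
  shows "Q.E (f [^]\<^bsub>FA.T\<^esub> p) = (if p = 2 then B r f f else \<zero>\<^bsub>M\<^esub>)"
proof -
  obtain m where m: "p = Suc (Suc m)" using p_gt_1 by (metis One_nat_def less_imp_Suc_add add_Suc_right plus_1_eq_Suc)
  let ?g = "f [^]\<^bsub>FA.T\<^esub> Suc m"
  have g: "?g \<in> carrier FA.T" "f [^]\<^bsub>FA.T\<^esub> m \<in> carrier FA.T" using T_pow_closed f by auto
  have eg: "\<epsilon> ?g = \<zero>" using \<epsilon>_mult[OF g(2) f(1)] f \<epsilon>_closed[OF g(2)] by simp
  have "f [^]\<^bsub>FA.T\<^esub> p = ?g \<otimes>\<^bsub>FA.T\<^esub> f" unfolding m by simp
  hence "Q.E (f [^]\<^bsub>FA.T\<^esub> p) = B r ?g f"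
    using Q_mult[OF g(1) f(1)] eg f Q.E_closed[OF f(1)] Q.E_closed[OF g(1)] B_closed[OF order_refl g(1) f(1)] by simp
  moreover have "B r ?g f = \<zero>\<^bsub>M\<^esub>" if p2: "p \<noteq> 2"
  proof -
    obtain k where k: "m = Suc k" using p2 m by (cases m) auto
    have fk: "f [^]\<^bsub>FA.T\<^esub> k \<in> carrier FA.T" using T_pow_closed f by auto
    have "\<epsilon> (f [^]\<^bsub>FA.T\<^esub> m) = \<zero>" unfolding k using \<epsilon>_mult[OF fk f(1)] f \<epsilon>_closed[OF fk] by simp
    hence "a i 1 ?g = \<zero>" if "i < r" for i
      using a_1_mult[OF that g(2) f(1)] f a_closed'[OF that f(1)] a_closed'[OF that g(2)] by simp
    thus ?thesis by (intro B_linear_part_left g f) auto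
  qed
  moreover have "?g = f" if "p = 2" using that m f by simp
  ultimately show ?thesis by auto
qed

text \<open>The term \<open>B r f f\<close> that \<open>pmap_S\<close> leaves for p = 2 is exactly
  what the correction contributes.\<close>

lemma \<pi>_frob:
  assumes f: "f \<in> carrier FA.T" "\<epsilon> f = \<zero>"
  shows "\<pi> (f [^]\<^bsub>FA.T\<^esub> p) = pmap M (\<pi> f)"
  unfolding \<pi>_def Q_frob[OF f]
  using M.pmap_add_central[OF S_closed[OF order_refl f(1)] Q_Z[OF f(1)]] pmap_S[OF order_refl f(1)] by simp

lemma S_PZ:
  assumes f: "f \<in> carrier FA.T" and z: "\<And>i. i < r \<Longrightarrow> a i 1 f = \<zero>"
  shows "S r f \<in> M.PZ"
  unfolding S_def
proof (rule subspace_finsum[OF PZ_subspace])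
  fix i assume "i \<in> {..<r}"
  hence i: "i < r" by simp
  have "(\<Oplus>\<^bsub>M\<^esub>j\<in>{..<n i}. a i (p ^ Suc j) f \<odot>\<^bsub>M\<^esub> X i (Suc j)) \<in> M.PZ" (is "?s \<in> _")
    by (rule subspace_finsum[OF PZ_subspace])
      (use subspaceD(4)[OF PZ_subspace] M.pmap_PZ X_closed[OF i] a_closed'[OF i f] X_Suc in auto)
  moreover have "Pc i f = ?s"
    unfolding Pc_split[OF i f] z[OF i] using x_closed[OF i] calculation subspaceD(1)[OF PZ_subspace] by auto
  ultimately show "Pc i f \<in> M.PZ" by simp
qed simp

text \<open>A product of augmentation-zero elements has no linear coefficients, so its components
  involve only p-th powers, and the correction lies in \<open>Z\<close>.\<close>

lemma \<pi>_mult_PZ: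
  assumes f: "f \<in> carrier FA.T" "\<epsilon> f = \<zero>" and g: "g \<in> carrier FA.T" "\<epsilon> g = \<zero>"
  shows "\<pi> (f \<otimes>\<^bsub>FA.T\<^esub> g) \<in> M.PZ"
  unfolding \<pi>_def
proof (rule subspaceD(3)[OF PZ_subspace S_PZ M.Z_PZ[OF Q_Z]])
  show fg: "f \<otimes>\<^bsub>FA.T\<^esub> g \<in> carrier FA.T" "f \<otimes>\<^bsub>FA.T\<^esub> g \<in> carrier FA.T" using FA.T_mult_closed f g by auto
  show "a i 1 (f \<otimes>\<^bsub>FA.T\<^esub> g) = \<zero>" if "i < r" for i
    using a_1_mult[OF that f(1) g(1)] f g a_closed'[OF that] by simp
qed

lemma \<pi>_one: "\<pi> \<one>\<^bsub>FA.T\<^esub> = \<zero>\<^bsub>M\<^esub>"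
proof -
  have "Pc i \<one>\<^bsub>FA.T\<^esub> = \<zero>\<^bsub>M\<^esub>" if i: "i < r" for i
    unfolding Pc_def using p_pos X_closed[OF i]
    by (intro M.M.add.finprod_one_eqI) (simp add: a_one[OF i])
  hence "S r \<one>\<^bsub>FA.T\<^esub> = \<zero>\<^bsub>M\<^esub>" unfolding S_def by (intro M.M.add.finprod_one_eqI) simp
  moreover have "Q.E \<one>\<^bsub>FA.T\<^esub> = \<zero>\<^bsub>M\<^esub>" by (simp add: FA.T_simps(2) Q.E_sd qz_def)
  ultimately show ?thesis unfolding \<pi>_def by simp
qed

definition NN :: "('b list \<Rightarrow> 'k) set" where
  "NN = {R \<in> carrier FA.T. \<epsilon> R = \<zero> \<and> (\<forall>i<r. \<forall>k<p ^ n i. a i k R = \<zero>) \<and> \<pi> R = \<zero>\<^bsub>M\<^esub>}"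

text \<open>Because the lower coefficients vanish, multiplication by \<open>u\<close> acts on the
  coefficients up to the critical degree, and hence on \<open>\<pi>\<close>, as multiplication by
  the augmentation of \<open>u\<close>.\<close>

lemma NN_mult:
  assumes R: "R \<in> NN" and u: "u \<in> carrier FA.T"
  shows "u \<otimes>\<^bsub>FA.T\<^esub> R \<in> NN" "R \<otimes>\<^bsub>FA.T\<^esub> u \<in> NN"
proof -
  have R': "R \<in> carrier FA.T" "\<epsilon> R = \<zero>" "\<pi> R = \<zero>\<^bsub>M\<^esub>" and low: "\<And>i k. \<lbrakk>i < r; k < p ^ n i\<rbrakk> \<Longrightarrow> a i k R = \<zero>"
    using R unfolding NN_def by auto
  have e: "\<epsilon> u \<in> carrier F" using \<epsilon>_closed u .
  have lt1: "1 < p ^ n i" if "i < r" for i using n_pos[OF that] p_gt_1 by (intro one_less_power)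
  have a1R: "a i 1 R = \<zero>" if "i < r" for i using low[OF that lt1[OF that]] .
  \<comment> \<open>In the convolution every term with l > 0 contains a coefficient of
    \<open>R\<close> below the critical degree, even when k is that degree.\<close>
  have au: "a i k (u \<otimes>\<^bsub>FA.T\<^esub> R) = \<epsilon> u \<otimes> a i k R" if i: "i < r" and k: "k \<le> p ^ n i" for i k
  proof -
    have "a i k (u \<otimes>\<^bsub>FA.T\<^esub> R) = (\<Oplus>l\<in>{..k}. a i l u \<otimes> a i (k - l) R)" by (rule a_mult[OF i u R'(1)])
    also have "\<dots> = (\<Oplus>l\<in>{..k}. if 0 = l then \<epsilon> u \<otimes> a i k R else \<zero>)"
    proof (intro finsum_cong' refl)
      show "(\<lambda>l. if 0 = l then \<epsilon> u \<otimes> a i k R else \<zero>) \<in> {..k} \<rightarrow> carrier F"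
        using m_closed[OF e a_closed'[OF i R'(1)]] by simp
      fix l assume l: "l \<in> {..k}"
      show "a i l u \<otimes> a i (k - l) R = (if 0 = l then \<epsilon> u \<otimes> a i k R else \<zero>)"
        using low[OF i, of "k - l"] l k a_closed'[OF i u, of l] a_0[OF i u] by (cases "l = 0") auto
    qed
    also have "\<dots> = \<epsilon> u \<otimes> a i k R"
      using finsum_singleton[of 0 "{..k}" "\<lambda>_. \<epsilon> u \<otimes> a i k R"] e a_closed'[OF i R'(1)] by simp
    finally show ?thesis .
  qed
  have uR: "u \<otimes>\<^bsub>FA.T\<^esub> R \<in> carrier FA.T" "R \<otimes>\<^bsub>FA.T\<^esub> u \<in> carrier FA.T" using u R' FA.T_mult_closed by auto
  have Peq: "Pc i (u \<otimes>\<^bsub>FA.T\<^esub> R) = \<epsilon> u \<odot>\<^bsub>M\<^esub> Pc i R" if i: "i < r" for i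
  proof -
    have "Pc i (u \<otimes>\<^bsub>FA.T\<^esub> R) = (\<Oplus>\<^bsub>M\<^esub>j\<in>{..<Suc (n i)}. \<epsilon> u \<odot>\<^bsub>M\<^esub> (a i (p ^ j) R \<odot>\<^bsub>M\<^esub> X i j))"
      unfolding Pc_def
    proof (intro M.M.finsum_cong' refl funcsetI)
      show "\<epsilon> u \<odot>\<^bsub>M\<^esub> (a i (p ^ j) R \<odot>\<^bsub>M\<^esub> X i j) \<in> carrier M" for j using e Pc_term[OF i R'(1)] by simp
      fix j assume "j \<in> {..<Suc (n i)}"
      hence "p ^ j \<le> p ^ n i" using p_gt_1 by simp
      thus "a i (p ^ j) (u \<otimes>\<^bsub>FA.T\<^esub> R) \<odot>\<^bsub>M\<^esub> X i j = \<epsilon> u \<odot>\<^bsub>M\<^esub> (a i (p ^ j) R \<odot>\<^bsub>M\<^esub> X i j)"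
        using au[OF i] e a_closed'[OF i R'(1)] X_closed[OF i] by (simp add: M.smult_assoc1)
    qed
    also have "\<dots> = \<epsilon> u \<odot>\<^bsub>M\<^esub> Pc i R" unfolding Pc_def using Pc_term[OF i R'(1)] e by (intro M.finsum_smult[symmetric]) auto
    finally show ?thesis .
  qed
  have Seq: "S r (u \<otimes>\<^bsub>FA.T\<^esub> R) = \<epsilon> u \<odot>\<^bsub>M\<^esub> S r R"
  proof -
    have "S r (u \<otimes>\<^bsub>FA.T\<^esub> R) = (\<Oplus>\<^bsub>M\<^esub>i\<in>{..<r}. \<epsilon> u \<odot>\<^bsub>M\<^esub> Pc i R)"
      unfolding S_def using Peq e Pc_closed[OF _ R'(1)] by (intro M.M.finsum_cong') auto
    also have "\<dots> = \<epsilon> u \<odot>\<^bsub>M\<^esub> S r R" unfolding S_def using Pc_closed[OF _ R'(1)] e by (intro M.finsum_smult[symmetric]) auto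
    finally show ?thesis .
  qed
  have Qc: "Q.E R \<in> carrier M" "Q.E u \<in> carrier M" "S r R \<in> carrier M" using Q.E_closed S_closed R' u by auto
  \<comment> \<open>Degree 1 lies below the critical degree because \<open>n i\<close> is positive,
    so \<open>R\<close> has no linear part.\<close>
  have B0: "B r u R = \<zero>\<^bsub>M\<^esub>" "B r R u = \<zero>\<^bsub>M\<^esub>"
    by (intro B_linear_part_right B_linear_part_left order_refl u R'(1) a1R; assumption)+
  have Q1: "Q.E (u \<otimes>\<^bsub>FA.T\<^esub> R) = \<epsilon> u \<odot>\<^bsub>M\<^esub> Q.E R" "Q.E (R \<otimes>\<^bsub>FA.T\<^esub> u) = \<epsilon> u \<odot>\<^bsub>M\<^esub> Q.E R"
    using Q_mult[OF u R'(1)] Q_mult[OF R'(1) u] Qc e R'(2) B0 by simp_all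
  have "\<pi> (u \<otimes>\<^bsub>FA.T\<^esub> R) = \<epsilon> u \<odot>\<^bsub>M\<^esub> \<pi> R"
    unfolding \<pi>_def Seq Q1 using Qc e by (simp add: M.smult_r_distr)
  hence p1: "\<pi> (u \<otimes>\<^bsub>FA.T\<^esub> R) = \<zero>\<^bsub>M\<^esub>" using R'(3) e by simp
  have p2: "\<pi> (R \<otimes>\<^bsub>FA.T\<^esub> u) = \<zero>\<^bsub>M\<^esub>"
    using p1 unfolding \<pi>_def S_swap[OF order_refl R'(1) u] Q1 .
  have l1: "a i k (u \<otimes>\<^bsub>FA.T\<^esub> R) = \<zero>" if "i < r" "k < p ^ n i" for i k
    using au[OF that(1), of k] that low e by simp
  show "u \<otimes>\<^bsub>FA.T\<^esub> R \<in> NN"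
    unfolding NN_def using uR p1 l1 R' \<epsilon>_mult[OF u R'(1)] e by simp
  show "R \<otimes>\<^bsub>FA.T\<^esub> u \<in> NN"
    unfolding NN_def using uR p2 l1 a_comm'[OF _ R'(1) u] R' \<epsilon>_mult[OF R'(1) u] e by simp
qed

lemma NN_ideal: "ideal NN FA.T"
proof (rule idealI)
  show "ring FA.T" by (rule FA.T_ring)
  show "subgroup NN (add_monoid FA.T)"
  proof (unfold_locales; simp?)
    show "NN \<subseteq> carrier FA.T" unfolding NN_def by auto
    have "\<pi> \<zero>\<^bsub>FA.T\<^esub> = \<zero>\<^bsub>M\<^esub>"
      using \<pi>_smult[of \<zero> "\<zero>\<^bsub>FA.T\<^esub>"] \<pi>_closed[of "\<zero>\<^bsub>FA.T\<^esub>"] by simp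
    thus zero: "\<zero>\<^bsub>FA.T\<^esub> \<in> NN" unfolding NN_def by (simp add: a_zero \<epsilon>_zero)
    show "f \<oplus>\<^bsub>FA.T\<^esub> g \<in> NN" if "f \<in> NN" "g \<in> NN" for f g
      using that unfolding NN_def by (auto simp: a_add \<pi>_add \<epsilon>_add FA.T_add_closed)
    fix f assume f: "f \<in> NN"
    hence fT: "f \<in> carrier FA.T" unfolding NN_def by auto
    have "inv\<^bsub>add_monoid FA.T\<^esub> f = \<ominus>\<^bsub>FA.T\<^esub> f" by (simp add: a_inv_def)
    also have "\<dots> = (\<ominus> \<one>) \<odot>\<^bsub>FA.T\<^esub> f" using fT FA.T.smult_minus_1 by simp
    finally show "inv\<^bsub>add_monoid FA.T\<^esub> f \<in> NN"
      using f unfolding NN_def by (auto simp: a_smult \<pi>_smult \<epsilon>_smult FA.T_smult_closed)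
  qed
qed (use NN_mult in auto)

end

section \<open>Restricted enveloping algebras\<close>

abbreviation env_ideal where
  "env_ideal F L \<equiv> Idl\<^bsub>free_algebra F (carrier L)\<^esub> (restricted_enveloping_relations F L)"

context free_alg
begin

lemma eval_Nil:
  "\<lbrakk>f \<in> carrier T; g \<in> carrier T\<rbrakk> \<Longrightarrow> (f \<otimes>\<^bsub>T\<^esub> g) [] = f [] \<otimes> g []"
  "(f \<oplus>\<^bsub>T\<^esub> g) [] = f [] \<oplus> g []" "(c \<odot>\<^bsub>T\<^esub> f) [] = c \<otimes> f []" "\<one>\<^bsub>T\<^esub> [] = \<one>" "\<zero>\<^bsub>T\<^esub> [] = \<zero>"
  "free_gen F x [] = \<zero>" "sd c w [] = (if w = [] then c else \<zero>)"
  by (simp_all add: T_simps T_val sd_def free_gen_def)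

lemma T_minus_smult: "f \<in> carrier T \<Longrightarrow> \<ominus>\<^bsub>T\<^esub> f = (\<ominus> \<one>) \<odot>\<^bsub>T\<^esub> f"
  using T.smult_minus_1 by simp

lemma eval_Nil_minus: "\<lbrakk>f \<in> carrier T; g \<in> carrier T\<rbrakk> \<Longrightarrow> (f \<ominus>\<^bsub>T\<^esub> g) [] = f [] \<ominus> g []"
  using T_val[of f "[]"] T_val[of g "[]"]
  by (simp add: a_minus_def T_minus_smult eval_Nil l_minus)

lemma eval_Nil_pow: "f \<in> carrier T \<Longrightarrow> (f [^]\<^bsub>T\<^esub> (n::nat)) [] = f [] [^] n"
  by (induction n) (simp_all add: eval_Nil)

lemma gen_closed: "x \<in> X \<Longrightarrow> free_gen F x \<in> carrier T"
  by (simp add: free_gen_sd sd_closed)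

lemma sd_Nil: "c \<in> carrier F \<Longrightarrow> sd c [] = c \<odot>\<^bsub>T\<^esub> \<one>\<^bsub>T\<^esub>"
  by (auto simp: T_simps sd_def)

lemma sd_Cons: "c \<in> carrier F \<Longrightarrow> sd c (x # w) = free_gen F x \<otimes>\<^bsub>T\<^esub> sd c w"
  by (simp add: free_gen_sd sd_mult)

lemma T_idealI:
  assumes sub: "N \<subseteq> carrier T" and z: "\<zero>\<^bsub>T\<^esub> \<in> N"
    and add: "\<And>f g. \<lbrakk>f \<in> N; g \<in> N\<rbrakk> \<Longrightarrow> f \<oplus>\<^bsub>T\<^esub> g \<in> N"
    and mult: "\<And>f u. \<lbrakk>f \<in> N; u \<in> carrier T\<rbrakk> \<Longrightarrow> u \<otimes>\<^bsub>T\<^esub> f \<in> N"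
      "\<And>f u. \<lbrakk>f \<in> N; u \<in> carrier T\<rbrakk> \<Longrightarrow> f \<otimes>\<^bsub>T\<^esub> u \<in> N"
  shows "ideal N T"
proof (rule idealI)
  show "ring T" by (rule T_ring)
  show "subgroup N (add_monoid T)"
  proof (rule T.add.subgroupI)
    show "N \<noteq> {}" using z by auto
    fix f assume f: "f \<in> N"
    hence "f \<in> carrier T" using sub by auto
    hence "\<ominus>\<^bsub>T\<^esub> f = (\<ominus>\<^bsub>T\<^esub> \<one>\<^bsub>T\<^esub>) \<otimes>\<^bsub>T\<^esub> f" by (simp add: T.l_minus)
    thus "\<ominus>\<^bsub>T\<^esub> f \<in> N" using mult(1)[OF f] by simp
  qed (use sub add in auto)
qed (use mult in auto)

lemma ideal_smult:
  assumes "ideal N T" "f \<in> N" "c \<in> carrier F" shows "c \<odot>\<^bsub>T\<^esub> f \<in> N"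
proof -
  interpret N: ideal N T by fact
  have f: "f \<in> carrier T" using assms(2) by (rule N.Icarr)
  have "c \<odot>\<^bsub>T\<^esub> f = (c \<odot>\<^bsub>T\<^esub> \<one>\<^bsub>T\<^esub>) \<otimes>\<^bsub>T\<^esub> f" using f assms(3) by (simp add: T_smult_l)
  thus ?thesis using N.I_l_closed[OF assms(2)] assms(3) by simp
qed

lemma ideal_coset_eq:
  assumes "ideal N T" "f \<in> carrier T" "g \<in> carrier T"
  shows "N +>\<^bsub>T\<^esub> f = N +>\<^bsub>T\<^esub> g \<longleftrightarrow> f \<ominus>\<^bsub>T\<^esub> g \<in> N"
  using T.quotient_eq_iff_same_a_r_cos[OF assms] by simp

end

text \<open>The generating set of the relation ideal as four membership conditions, the form in
  which they are verified and used.\<close>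

definition env_relation_families where
  "env_relation_families F L N \<longleftrightarrow> (let T = free_algebra F (carrier L); \<iota> = free_gen F in
     (\<forall>x\<in>carrier L. \<forall>y\<in>carrier L. \<iota> (x \<oplus>\<^bsub>L\<^esub> y) \<ominus>\<^bsub>T\<^esub> (\<iota> x \<oplus>\<^bsub>T\<^esub> \<iota> y) \<in> N) \<and>
     (\<forall>c\<in>carrier F. \<forall>x\<in>carrier L. \<iota> (c \<odot>\<^bsub>L\<^esub> x) \<ominus>\<^bsub>T\<^esub> (c \<odot>\<^bsub>T\<^esub> \<iota> x) \<in> N) \<and>
     (\<forall>x\<in>carrier L. \<forall>y\<in>carrier L. (\<iota> x \<otimes>\<^bsub>T\<^esub> \<iota> y \<ominus>\<^bsub>T\<^esub> \<iota> y \<otimes>\<^bsub>T\<^esub> \<iota> x) \<ominus>\<^bsub>T\<^esub> \<iota> (x \<otimes>\<^bsub>L\<^esub> y) \<in> N) \<and>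
     (\<forall>x\<in>carrier L. \<iota> x [^]\<^bsub>T\<^esub> ring_char F \<ominus>\<^bsub>T\<^esub> \<iota> (pmap L x) \<in> N))"

lemma env_relation_families_iff:
  "env_relation_families F L N \<longleftrightarrow> restricted_enveloping_relations F L \<subseteq> N"
proof -
  have 1: "{f x y |x y. x \<in> A \<and> y \<in> B} \<subseteq> N \<longleftrightarrow> (\<forall>x\<in>A. \<forall>y\<in>B. f x y \<in> N)" for f :: "'x \<Rightarrow> 'y \<Rightarrow> 'z" and A B N by blast
  have 2: "{f x |x. x \<in> A} \<subseteq> N \<longleftrightarrow> (\<forall>x\<in>A. f x \<in> N)" for f :: "'x \<Rightarrow> 'z" and A N by blast
  show ?thesis
    unfolding env_relation_families_def restricted_enveloping_relations_def Let_def
    by (simp only: Un_subset_iff 1 2 conj_assoc)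
qed

context restricted_lie_algebra
begin

lemma FA: "free_alg F" ..

lemma env_relations_carrier: "restricted_enveloping_relations F L \<subseteq> carrier (free_algebra F (carrier L))"
proof -
  interpret FA: free_alg F "carrier L" by (rule FA)
  show ?thesis
    unfolding env_relation_families_iff[symmetric] env_relation_families_def Let_def
    by (auto intro!: FA.T.minus_closed FA.T.a_closed FA.T_add_closed FA.T_smult_closed FA.T_mult_closed FA.gen_closed
        FA.T.nat_pow_closed bracket_closed pmap_closed)
qed

lemma env_ideal: "ideal (env_ideal F L) (free_algebra F (carrier L))"
proof -
  interpret FA: free_alg F "carrier L" by (rule FA)
  show ?thesis by (rule FA.T.genideal_ideal[OF env_relations_carrier])
qed

lemma env_ideal_families: "env_relation_families F L (env_ideal F L)"
proof -
  interpret FA: free_alg F "carrier L" by (rule FA)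
  show ?thesis unfolding env_relation_families_iff by (rule FA.T.genideal_self[OF env_relations_carrier])
qed

lemma env_ideal_le:
  assumes "ideal N (free_algebra F (carrier L))" "env_relation_families F L N"
  shows "env_ideal F L \<subseteq> N"
proof -
  interpret FA: free_alg F "carrier L" by (rule FA)
  show ?thesis using FA.T.genideal_minimal[OF assms(1)] assms(2) unfolding env_relation_families_iff .
qed

end

lemma env_simps:
  fixes L :: "('k, 'a, 'm) restricted_lie_scheme"
  shows "carrier (restricted_enveloping_algebra F L) = (\<lambda>f. env_ideal F L +>\<^bsub>free_algebra F (carrier L)\<^esub> f) ` carrier (free_algebra F (carrier L))"
    "monoid.mult (restricted_enveloping_algebra F L) = monoid.mult (free_algebra F (carrier L) Quot env_ideal F L)"
    "ring.add (restricted_enveloping_algebra F L) = ring.add (free_algebra F (carrier L) Quot env_ideal F L)"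
    "monoid.one (restricted_enveloping_algebra F L) = monoid.one (free_algebra F (carrier L) Quot env_ideal F L)"
    "module.smult (restricted_enveloping_algebra F L) c U = (\<Union>f\<in>U. env_ideal F L +>\<^bsub>free_algebra F (carrier L)\<^esub> (c \<odot>\<^bsub>free_algebra F (carrier L)\<^esub> f))"
  unfolding restricted_enveloping_algebra_def quot_module_def Let_def
  by (auto simp: ring.defs module.defs FactRing_def A_RCOSETS_def')

text \<open>Two elements of the free algebras are related when their classes correspond. A relation
  needs no choice of lifts and is symmetric, so both directions of the comparison use the same
  object. The last clause encodes well-definedness and injectivity.\<close>

definition alg_rel where
  "alg_rel F L H R \<longleftrightarrow> (let T = free_algebra F (carrier L); T' = free_algebra F (carrier H) in
     (\<forall>f g. R f g \<longrightarrow> f \<in> carrier T \<and> g \<in> carrier T') \<and>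
     (\<forall>f\<in>carrier T. \<exists>g. R f g) \<and> (\<forall>g\<in>carrier T'. \<exists>f. R f g) \<and>
     (\<forall>f g f' g'. R f g \<and> R f' g' \<longrightarrow> R (f \<oplus>\<^bsub>T\<^esub> f') (g \<oplus>\<^bsub>T'\<^esub> g') \<and> R (f \<otimes>\<^bsub>T\<^esub> f') (g \<otimes>\<^bsub>T'\<^esub> g')) \<and>
     (\<forall>c\<in>carrier F. \<forall>f g. R f g \<longrightarrow> R (c \<odot>\<^bsub>T\<^esub> f) (c \<odot>\<^bsub>T'\<^esub> g)) \<and>
     R \<one>\<^bsub>T\<^esub> \<one>\<^bsub>T'\<^esub> \<and>
     (\<forall>f g. R f g \<longrightarrow> (f \<in> env_ideal F L \<longleftrightarrow> g \<in> env_ideal F H)))"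

lemma alg_rel_sym: "alg_rel F L H R \<Longrightarrow> alg_rel F H L (\<lambda>g f. R f g)"
  unfolding alg_rel_def Let_def by (elim conjE, intro conjI) blast+

lemma alg_rel_exists:
  assumes L: "restricted_lie_algebra F L" and H: "restricted_lie_algebra F H"
    and iso: "\<phi> \<in> algebra_iso F (restricted_enveloping_algebra F L) (restricted_enveloping_algebra F H)"
  shows "\<exists>R. alg_rel F L H R"
proof -
  interpret L: restricted_lie_algebra F L by (rule L)
  interpret H: restricted_lie_algebra F H by (rule H)
  interpret A: free_alg F "carrier L" by (rule L.FA)
  interpret B: free_alg F "carrier H" by (rule H.FA)
  interpret I: ideal "env_ideal F L" A.T by (rule L.env_ideal)
  interpret J: ideal "env_ideal F H" B.T by (rule H.env_ideal)
  let ?I = "env_ideal F L" and ?J = "env_ideal F H"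
  let ?u = "restricted_enveloping_algebra F L" and ?v = "restricted_enveloping_algebra F H"
  define R where "R f g \<longleftrightarrow> f \<in> carrier A.T \<and> g \<in> carrier B.T \<and> \<phi> (?I +>\<^bsub>A.T\<^esub> f) = ?J +>\<^bsub>B.T\<^esub> g" for f g
  have ri: "\<phi> \<in> ring_iso ?u ?v" and mh: "\<phi> \<in> module_hom F ?u ?v"
    using iso unfolding algebra_iso_def by auto
  have bij: "bij_betw \<phi> (carrier ?u) (carrier ?v)" using ring_iso_memE(5)[OF ri] .
  have uc: "?I +>\<^bsub>A.T\<^esub> f \<in> carrier ?u" if "f \<in> carrier A.T" for f
    using that unfolding env_simps(1) by blast
  note hA = ring_hom_mult[OF I.rcos_ring_hom] ring_hom_add[OF I.rcos_ring_hom] ring_hom_one[OF I.rcos_ring_hom]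
  note hB = ring_hom_mult[OF J.rcos_ring_hom] ring_hom_add[OF J.rcos_ring_hom] ring_hom_one[OF J.rcos_ring_hom]
  have ex1: "\<exists>g. R f g" if f: "f \<in> carrier A.T" for f
  proof -
    have "\<phi> (?I +>\<^bsub>A.T\<^esub> f) \<in> carrier ?v" using bij_betwE[OF bij] uc[OF f] by blast
    then obtain g where "g \<in> carrier B.T" "\<phi> (?I +>\<^bsub>A.T\<^esub> f) = ?J +>\<^bsub>B.T\<^esub> g" unfolding env_simps(1) by blast
    thus ?thesis unfolding R_def using f by blast
  qed
  have ex2: "\<exists>f. R f g" if g: "g \<in> carrier B.T" for g
  proof -
    have "?J +>\<^bsub>B.T\<^esub> g \<in> carrier ?v" using g unfolding env_simps(1) by blast
    then obtain U where U: "U \<in> carrier ?u" "?J +>\<^bsub>B.T\<^esub> g = \<phi> U"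
      unfolding bij_betw_imp_surj_on[OF bij, symmetric] by (rule imageE)
    then obtain f where "f \<in> carrier A.T" "U = ?I +>\<^bsub>A.T\<^esub> f" unfolding env_simps(1) by (elim imageE)
    thus ?thesis unfolding R_def using g U(2) by (intro exI[of _ f]) simp
  qed
  have add: "R (f \<oplus>\<^bsub>A.T\<^esub> f') (g \<oplus>\<^bsub>B.T\<^esub> g')" and mult: "R (f \<otimes>\<^bsub>A.T\<^esub> f') (g \<otimes>\<^bsub>B.T\<^esub> g')"
    if fg: "R f g" "R f' g'" for f g f' g'
  proof -
    have c: "f \<in> carrier A.T" "f' \<in> carrier A.T" "g \<in> carrier B.T" "g' \<in> carrier B.T"
      and e: "\<phi> (?I +>\<^bsub>A.T\<^esub> f) = ?J +>\<^bsub>B.T\<^esub> g" "\<phi> (?I +>\<^bsub>A.T\<^esub> f') = ?J +>\<^bsub>B.T\<^esub> g'"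
      using fg unfolding R_def by auto
    show "R (f \<oplus>\<^bsub>A.T\<^esub> f') (g \<oplus>\<^bsub>B.T\<^esub> g')"
      unfolding R_def hA(2)[OF c(1,2)] hB(2)[OF c(3,4)]
      using A.T_add_closed[OF c(1,2)] B.T_add_closed[OF c(3,4)]
        ring_iso_memE(3)[OF ri uc[OF c(1)] uc[OF c(2)]] e
      unfolding env_simps by simp
    show "R (f \<otimes>\<^bsub>A.T\<^esub> f') (g \<otimes>\<^bsub>B.T\<^esub> g')"
      unfolding R_def hA(1)[OF c(1,2)] hB(1)[OF c(3,4)]
      using A.T_mult_closed[OF c(1,2)] B.T_mult_closed[OF c(3,4)]
        ring_iso_memE(2)[OF ri uc[OF c(1)] uc[OF c(2)]] e
      unfolding env_simps by simp
  qed
  \<comment> \<open>Scalar multiplication of a coset is a union over its elements; it collapses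
    because the ideal is stable under scalars.\<close>
  have smultA: "c \<odot>\<^bsub>?u\<^esub> (?I +>\<^bsub>A.T\<^esub> f) = ?I +>\<^bsub>A.T\<^esub> (c \<odot>\<^bsub>A.T\<^esub> f)"
    if f: "f \<in> carrier A.T" and c: "c \<in> carrier F" for c f
  proof -
    have "?I +>\<^bsub>A.T\<^esub> (c \<odot>\<^bsub>A.T\<^esub> g) = ?I +>\<^bsub>A.T\<^esub> (c \<odot>\<^bsub>A.T\<^esub> f)" if g: "g \<in> ?I +>\<^bsub>A.T\<^esub> f" for g
    proof -
      have gc: "g \<in> carrier A.T" using I.a_elemrcos_carrier[OF f g] .
      have "g \<ominus>\<^bsub>A.T\<^esub> f \<in> ?I" using I.a_rcos_module[OF f gc] g by (simp add: a_minus_def)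
      hence "c \<odot>\<^bsub>A.T\<^esub> (g \<ominus>\<^bsub>A.T\<^esub> f) \<in> ?I" using A.ideal_smult[OF L.env_ideal _ c] by blast
      moreover have "c \<odot>\<^bsub>A.T\<^esub> (g \<ominus>\<^bsub>A.T\<^esub> f) = c \<odot>\<^bsub>A.T\<^esub> g \<ominus>\<^bsub>A.T\<^esub> c \<odot>\<^bsub>A.T\<^esub> f"
        using c f gc by (simp add: a_minus_def A.T.smult_r_distr A.T.smult_r_minus)
      ultimately show ?thesis
        using A.ideal_coset_eq[OF L.env_ideal] f gc c A.T_smult_closed by simp
    qed
    moreover have "f \<in> ?I +>\<^bsub>A.T\<^esub> f" using I.a_rcos_self[OF f] .
    ultimately show ?thesis unfolding env_simps(5) by blast
  qed
  have smultB: "c \<odot>\<^bsub>?v\<^esub> (?J +>\<^bsub>B.T\<^esub> f) = ?J +>\<^bsub>B.T\<^esub> (c \<odot>\<^bsub>B.T\<^esub> f)"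
    if f: "f \<in> carrier B.T" and c: "c \<in> carrier F" for c f
  proof -
    have "?J +>\<^bsub>B.T\<^esub> (c \<odot>\<^bsub>B.T\<^esub> g) = ?J +>\<^bsub>B.T\<^esub> (c \<odot>\<^bsub>B.T\<^esub> f)" if g: "g \<in> ?J +>\<^bsub>B.T\<^esub> f" for g
    proof -
      have gc: "g \<in> carrier B.T" using J.a_elemrcos_carrier[OF f g] .
      have "g \<ominus>\<^bsub>B.T\<^esub> f \<in> ?J" using J.a_rcos_module[OF f gc] g by (simp add: a_minus_def)
      hence "c \<odot>\<^bsub>B.T\<^esub> (g \<ominus>\<^bsub>B.T\<^esub> f) \<in> ?J" using B.ideal_smult[OF H.env_ideal _ c] by blast
      moreover have "c \<odot>\<^bsub>B.T\<^esub> (g \<ominus>\<^bsub>B.T\<^esub> f) = c \<odot>\<^bsub>B.T\<^esub> g \<ominus>\<^bsub>B.T\<^esub> c \<odot>\<^bsub>B.T\<^esub> f"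
        using c f gc by (simp add: a_minus_def B.T.smult_r_distr B.T.smult_r_minus)
      ultimately show ?thesis
        using B.ideal_coset_eq[OF H.env_ideal] f gc c B.T_smult_closed by simp
    qed
    moreover have "f \<in> ?J +>\<^bsub>B.T\<^esub> f" using J.a_rcos_self[OF f] .
    ultimately show ?thesis unfolding env_simps(5) by blast
  qed
  have smult: "R (c \<odot>\<^bsub>A.T\<^esub> f) (c \<odot>\<^bsub>B.T\<^esub> g)" if c: "c \<in> carrier F" and fg: "R f g" for c f g
  proof -
    have c': "f \<in> carrier A.T" "g \<in> carrier B.T"
      and e: "\<phi> (?I +>\<^bsub>A.T\<^esub> f) = ?J +>\<^bsub>B.T\<^esub> g" using fg unfolding R_def by auto
    have "\<phi> (?I +>\<^bsub>A.T\<^esub> (c \<odot>\<^bsub>A.T\<^esub> f)) = c \<odot>\<^bsub>?v\<^esub> \<phi> (?I +>\<^bsub>A.T\<^esub> f)"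
      unfolding smultA[OF c'(1) c, symmetric] by (rule module_hom_smult[OF mh c uc[OF c'(1)]])
    also have "\<dots> = ?J +>\<^bsub>B.T\<^esub> (c \<odot>\<^bsub>B.T\<^esub> g)" unfolding e by (rule smultB[OF c'(2) c])
    finally show ?thesis unfolding R_def using A.T_smult_closed[OF c c'(1)] B.T_smult_closed[OF c c'(2)] by simp
  qed
  have one: "R \<one>\<^bsub>A.T\<^esub> \<one>\<^bsub>B.T\<^esub>"
    unfolding R_def hA(3) hB(3) using ring_iso_memE(4)[OF ri] unfolding env_simps by simp
  have zero: "R \<zero>\<^bsub>A.T\<^esub> \<zero>\<^bsub>B.T\<^esub>"
    using smult[OF L.R.zero_closed one] unfolding A.T.smult_l_null[OF A.T.one_closed] B.T.smult_l_null[OF B.T.one_closed] .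
  have eqA: "?I +>\<^bsub>A.T\<^esub> f = ?I +>\<^bsub>A.T\<^esub> \<zero>\<^bsub>A.T\<^esub> \<longleftrightarrow> f \<in> ?I" if "f \<in> carrier A.T" for f
    using A.ideal_coset_eq[OF L.env_ideal that A.T.zero_closed] that by simp
  have eqB: "?J +>\<^bsub>B.T\<^esub> f = ?J +>\<^bsub>B.T\<^esub> \<zero>\<^bsub>B.T\<^esub> \<longleftrightarrow> f \<in> ?J" if "f \<in> carrier B.T" for f
    using B.ideal_coset_eq[OF H.env_ideal that B.T.zero_closed] that by simp
  have mem: "f \<in> ?I \<longleftrightarrow> g \<in> ?J" if fg: "R f g" for f g
  proof -
    have c': "f \<in> carrier A.T" "g \<in> carrier B.T"
      and e: "\<phi> (?I +>\<^bsub>A.T\<^esub> f) = ?J +>\<^bsub>B.T\<^esub> g" using fg unfolding R_def by auto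
    have e0: "\<phi> (?I +>\<^bsub>A.T\<^esub> \<zero>\<^bsub>A.T\<^esub>) = ?J +>\<^bsub>B.T\<^esub> \<zero>\<^bsub>B.T\<^esub>" using zero unfolding R_def by auto
    have "?I +>\<^bsub>A.T\<^esub> f = ?I +>\<^bsub>A.T\<^esub> \<zero>\<^bsub>A.T\<^esub> \<longleftrightarrow> ?J +>\<^bsub>B.T\<^esub> g = ?J +>\<^bsub>B.T\<^esub> \<zero>\<^bsub>B.T\<^esub>"
      unfolding e[symmetric] e0[symmetric]
      using inj_on_eq_iff[OF bij_betw_imp_inj_on[OF bij] uc[OF c'(1)] uc[OF A.T.zero_closed]] by simp
    thus ?thesis using eqA[OF c'(1)] eqB[OF c'(2)] by simp
  qed
  have "R f g \<Longrightarrow> f \<in> carrier A.T \<and> g \<in> carrier B.T" for f g unfolding R_def by auto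
  note cl = this
  have "alg_rel F L H R"
    unfolding alg_rel_def Let_def
  proof (intro conjI allI ballI impI)
    fix f g assume fg: "R f g"
    show "f \<in> carrier A.T" "g \<in> carrier B.T" using cl[OF fg] by simp_all
    show "f \<in> ?I \<longleftrightarrow> g \<in> ?J" by (rule mem[OF fg])
    show "R (c \<odot>\<^bsub>A.T\<^esub> f) (c \<odot>\<^bsub>B.T\<^esub> g)" if "c \<in> carrier F" for c by (rule smult[OF that fg])
  next
    fix f g f' g' assume fg: "R f g \<and> R f' g'"
    show "R (f \<oplus>\<^bsub>A.T\<^esub> f') (g \<oplus>\<^bsub>B.T\<^esub> g')" by (rule add[OF conjunct1[OF fg] conjunct2[OF fg]])
    show "R (f \<otimes>\<^bsub>A.T\<^esub> f') (g \<otimes>\<^bsub>B.T\<^esub> g')" by (rule mult[OF conjunct1[OF fg] conjunct2[OF fg]])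
  qed (rule ex1 ex2 one; assumption)+
  thus ?thesis by (rule exI[of "alg_rel F L H" R])
qed

locale env_pair = perfect_char_p F p + L: restricted_lie_algebra F L + H: restricted_lie_algebra F H
  for F :: "('k, 'c) ring_scheme" (structure) and p :: nat
    and L :: "('k, 'a, 'm) restricted_lie_scheme" and H :: "('k, 'b, 'n) restricted_lie_scheme" +
  fixes R :: "('a list \<Rightarrow> 'k) \<Rightarrow> ('b list \<Rightarrow> 'k) \<Rightarrow> bool"
  assumes R: "alg_rel F L H R"
begin

sublocale A: free_alg F "carrier L" ..
sublocale B: free_alg F "carrier H" ..
sublocale I: ideal "env_ideal F L" A.T by (rule L.env_ideal)
sublocale J: ideal "env_ideal F H" B.T by (rule H.env_ideal)

lemma RD:
  shows R_carrier: "R f g \<Longrightarrow> f \<in> carrier A.T" "R f g \<Longrightarrow> g \<in> carrier B.T"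
    and R_ex: "f \<in> carrier A.T \<Longrightarrow> \<exists>g. R f g"
    and R_ex': "g \<in> carrier B.T \<Longrightarrow> \<exists>f. R f g"
    and R_add: "\<lbrakk>R f g; R f' g'\<rbrakk> \<Longrightarrow> R (f \<oplus>\<^bsub>A.T\<^esub> f') (g \<oplus>\<^bsub>B.T\<^esub> g')"
    and R_mult: "\<lbrakk>R f g; R f' g'\<rbrakk> \<Longrightarrow> R (f \<otimes>\<^bsub>A.T\<^esub> f') (g \<otimes>\<^bsub>B.T\<^esub> g')"
    and R_smult: "\<lbrakk>c \<in> carrier F; R f g\<rbrakk> \<Longrightarrow> R (c \<odot>\<^bsub>A.T\<^esub> f) (c \<odot>\<^bsub>B.T\<^esub> g)"
    and R_one: "R \<one>\<^bsub>A.T\<^esub> \<one>\<^bsub>B.T\<^esub>"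
    and R_mem: "R f g \<Longrightarrow> f \<in> env_ideal F L \<longleftrightarrow> g \<in> env_ideal F H"
proof -
  note D1 = R[unfolded alg_rel_def Let_def]
  note D2 = D1[THEN conjunct2] note D3 = D2[THEN conjunct2] note D4 = D3[THEN conjunct2]
  note D5 = D4[THEN conjunct2] note D6 = D5[THEN conjunct2] note D7 = D6[THEN conjunct2]
  show "R f g \<Longrightarrow> f \<in> carrier A.T" "R f g \<Longrightarrow> g \<in> carrier B.T" using D1[THEN conjunct1] by blast+
  show "f \<in> carrier A.T \<Longrightarrow> \<exists>g. R f g" using D2[THEN conjunct1] by blast
  show "g \<in> carrier B.T \<Longrightarrow> \<exists>f. R f g" using D3[THEN conjunct1] by blast
  show "\<lbrakk>R f g; R f' g'\<rbrakk> \<Longrightarrow> R (f \<oplus>\<^bsub>A.T\<^esub> f') (g \<oplus>\<^bsub>B.T\<^esub> g')"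
    "\<lbrakk>R f g; R f' g'\<rbrakk> \<Longrightarrow> R (f \<otimes>\<^bsub>A.T\<^esub> f') (g \<otimes>\<^bsub>B.T\<^esub> g')" using D4[THEN conjunct1] by blast+
  show "\<lbrakk>c \<in> carrier F; R f g\<rbrakk> \<Longrightarrow> R (c \<odot>\<^bsub>A.T\<^esub> f) (c \<odot>\<^bsub>B.T\<^esub> g)" using D5[THEN conjunct1] by blast
  show "R \<one>\<^bsub>A.T\<^esub> \<one>\<^bsub>B.T\<^esub>" by (rule D6[THEN conjunct1])
  show "R f g \<Longrightarrow> f \<in> env_ideal F L \<longleftrightarrow> g \<in> env_ideal F H" using D7 by blast
qed

lemma R_minus: assumes "R f g" "R f' g'" shows "R (f \<ominus>\<^bsub>A.T\<^esub> f') (g \<ominus>\<^bsub>B.T\<^esub> g')"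
proof -
  have "R (f \<oplus>\<^bsub>A.T\<^esub> (\<ominus> \<one>) \<odot>\<^bsub>A.T\<^esub> f') (g \<oplus>\<^bsub>B.T\<^esub> (\<ominus> \<one>) \<odot>\<^bsub>B.T\<^esub> g')"
    by (intro R_add R_smult assms) simp
  thus ?thesis using R_carrier[OF assms(2)] by (simp add: a_minus_def A.T_minus_smult B.T_minus_smult)
qed

lemma R_pow: "R f g \<Longrightarrow> R (f [^]\<^bsub>A.T\<^esub> (n::nat)) (g [^]\<^bsub>B.T\<^esub> n)"
  by (induction n) (auto intro: R_one R_mult)

lemma R_cong:
  assumes "R f g" "R f' g'" "f \<ominus>\<^bsub>A.T\<^esub> f' \<in> env_ideal F L"
  shows "g \<ominus>\<^bsub>B.T\<^esub> g' \<in> env_ideal F H"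
  using R_mem[OF R_minus[OF assms(1,2)]] assms(3) by simp

lemma R_unique: "\<lbrakk>R f g; R f g'\<rbrakk> \<Longrightarrow> g \<ominus>\<^bsub>B.T\<^esub> g' \<in> env_ideal F H"
  using R_cong[of f g f g'] R_carrier by (simp add: a_minus_def A.T.r_neg)

text \<open>A choice of partner, respecting the operations only modulo the relation ideal. It is
  used through maps that kill that ideal, or through the relation \<open>R\<close> itself.\<close>

definition \<rho> :: "('a list \<Rightarrow> 'k) \<Rightarrow> ('b list \<Rightarrow> 'k)" where "\<rho> f = (SOME g. R f g)"

lemma \<rho>: "f \<in> carrier A.T \<Longrightarrow> R f (\<rho> f)"
  unfolding \<rho>_def using someI_ex[OF R_ex] by blast

lemma \<rho>_closed: "f \<in> carrier A.T \<Longrightarrow> \<rho> f \<in> carrier B.T"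
  using \<rho> R_carrier by blast

end

text \<open>Only additivity of \<open>\<kappa>\<close> is required, so one set of transfer lemmas
  serves the augmentation, a commutative quotient ring, a linear functional and the
  retraction.\<close>

locale env_map = env_pair F p L H R + N: abelian_group N
  for F :: "('k, 'c) ring_scheme" (structure) and p :: nat
    and L :: "('k, 'a, 'm) restricted_lie_scheme" and H :: "('k, 'b, 'n) restricted_lie_scheme"
    and R :: "('a list \<Rightarrow> 'k) \<Rightarrow> ('b list \<Rightarrow> 'k) \<Rightarrow> bool" and N :: "('r, 's) ring_scheme" +
  fixes \<kappa> :: "('b list \<Rightarrow> 'k) \<Rightarrow> 'r"
  assumes \<kappa>_closed: "g \<in> carrier B.T \<Longrightarrow> \<kappa> g \<in> carrier N"
    and \<kappa>_add: "\<lbrakk>g \<in> carrier B.T; h \<in> carrier B.T\<rbrakk> \<Longrightarrow> \<kappa> (g \<oplus>\<^bsub>B.T\<^esub> h) = \<kappa> g \<oplus>\<^bsub>N\<^esub> \<kappa> h"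
    and \<kappa>_kill: "g \<in> env_ideal F H \<Longrightarrow> \<kappa> g = \<zero>\<^bsub>N\<^esub>"
begin

lemma \<kappa>_cong:
  assumes "g \<in> carrier B.T" "h \<in> carrier B.T" "g \<ominus>\<^bsub>B.T\<^esub> h \<in> env_ideal F H" shows "\<kappa> g = \<kappa> h"
proof -
  have "g = (g \<ominus>\<^bsub>B.T\<^esub> h) \<oplus>\<^bsub>B.T\<^esub> h" using assms(1,2) by (simp add: a_minus_def B.T.a_assoc B.T.l_neg)
  hence "\<kappa> g = \<kappa> (g \<ominus>\<^bsub>B.T\<^esub> h) \<oplus>\<^bsub>N\<^esub> \<kappa> h" using \<kappa>_add[of "g \<ominus>\<^bsub>B.T\<^esub> h" h] assms(1,2) by simp
  thus ?thesis using \<kappa>_kill[OF assms(3)] \<kappa>_closed[OF assms(2)] by simp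
qed

lemma \<kappa>_R: "R f g \<Longrightarrow> \<kappa> (\<rho> f) = \<kappa> g"
  using R_unique[OF \<rho>[OF R_carrier(1)]] R_carrier \<rho>_closed by (intro \<kappa>_cong) blast+

lemma \<kappa>\<rho>_cong: "\<lbrakk>f \<in> carrier A.T; f' \<in> carrier A.T; f \<ominus>\<^bsub>A.T\<^esub> f' \<in> env_ideal F L\<rbrakk> \<Longrightarrow> \<kappa> (\<rho> f) = \<kappa> (\<rho> f')"
  using R_cong[OF \<rho> \<rho>] \<rho>_closed by (intro \<kappa>_cong) blast+

lemma \<kappa>\<rho>_add: "\<lbrakk>f \<in> carrier A.T; f' \<in> carrier A.T\<rbrakk> \<Longrightarrow> \<kappa> (\<rho> (f \<oplus>\<^bsub>A.T\<^esub> f')) = \<kappa> (\<rho> f) \<oplus>\<^bsub>N\<^esub> \<kappa> (\<rho> f')"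
  using \<kappa>_R[OF R_add[OF \<rho> \<rho>]] \<kappa>_add \<rho>_closed by simp

lemma \<kappa>\<rho>_mult: "\<lbrakk>f \<in> carrier A.T; f' \<in> carrier A.T\<rbrakk> \<Longrightarrow> \<kappa> (\<rho> (f \<otimes>\<^bsub>A.T\<^esub> f')) = \<kappa> (\<rho> f \<otimes>\<^bsub>B.T\<^esub> \<rho> f')"
  using \<kappa>_R[OF R_mult[OF \<rho> \<rho>]] .

lemma \<kappa>\<rho>_pow: "f \<in> carrier A.T \<Longrightarrow> \<kappa> (\<rho> (f [^]\<^bsub>A.T\<^esub> (n::nat))) = \<kappa> (\<rho> f [^]\<^bsub>B.T\<^esub> n)"
  using \<kappa>_R[OF R_pow[OF \<rho>]] .

lemma \<kappa>\<rho>_smult: "\<lbrakk>c \<in> carrier F; f \<in> carrier A.T\<rbrakk> \<Longrightarrow> \<kappa> (\<rho> (c \<odot>\<^bsub>A.T\<^esub> f)) = \<kappa> (c \<odot>\<^bsub>B.T\<^esub> \<rho> f)"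
  using \<kappa>_R[OF R_smult[OF _ \<rho>]] .

lemma \<kappa>\<rho>_one: "\<kappa> (\<rho> \<one>\<^bsub>A.T\<^esub>) = \<kappa> \<one>\<^bsub>B.T\<^esub>"
  using \<kappa>_R[OF R_one] .

lemma \<kappa>_minus: "\<lbrakk>g \<in> carrier B.T; h \<in> carrier B.T\<rbrakk> \<Longrightarrow> \<kappa> (g \<ominus>\<^bsub>B.T\<^esub> h) = \<kappa> g \<ominus>\<^bsub>N\<^esub> \<kappa> h"
proof -
  assume gh: "g \<in> carrier B.T" "h \<in> carrier B.T"
  have "\<kappa> (g \<ominus>\<^bsub>B.T\<^esub> h) \<oplus>\<^bsub>N\<^esub> \<kappa> h = \<kappa> g"
    using \<kappa>_add[of "g \<ominus>\<^bsub>B.T\<^esub> h" h] gh by (simp add: a_minus_def B.T.a_assoc B.T.l_neg)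
  thus ?thesis using \<kappa>_closed gh
    by (metis B.T.minus_closed N.minus_eq N.add.inv_solve_right)
qed

definition \<chi> :: "'a \<Rightarrow> 'r" where "\<chi> x = \<kappa> (\<rho> (free_gen F x))"

lemma \<chi>_closed: "x \<in> carrier L \<Longrightarrow> \<chi> x \<in> carrier N"
  unfolding \<chi>_def using \<kappa>_closed \<rho>_closed A.gen_closed by simp

lemma \<chi>_simps:
  shows \<chi>_add: "\<lbrakk>x \<in> carrier L; y \<in> carrier L\<rbrakk> \<Longrightarrow> \<chi> (x \<oplus>\<^bsub>L\<^esub> y) = \<chi> x \<oplus>\<^bsub>N\<^esub> \<chi> y"
    and \<chi>_smult: "\<lbrakk>c \<in> carrier F; x \<in> carrier L\<rbrakk> \<Longrightarrow> \<chi> (c \<odot>\<^bsub>L\<^esub> x) = \<kappa> (c \<odot>\<^bsub>B.T\<^esub> \<rho> (free_gen F x))"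
    and \<chi>_bracket: "\<lbrakk>x \<in> carrier L; y \<in> carrier L\<rbrakk> \<Longrightarrow> \<chi> (x \<otimes>\<^bsub>L\<^esub> y) =
      \<kappa> (\<rho> (free_gen F x) \<otimes>\<^bsub>B.T\<^esub> \<rho> (free_gen F y)) \<ominus>\<^bsub>N\<^esub> \<kappa> (\<rho> (free_gen F y) \<otimes>\<^bsub>B.T\<^esub> \<rho> (free_gen F x))"
    and \<chi>_pmap: "x \<in> carrier L \<Longrightarrow> \<chi> (pmap L x) = \<kappa> (\<rho> (free_gen F x) [^]\<^bsub>B.T\<^esub> p)"
proof -
  note fam = L.env_ideal_families[unfolded env_relation_families_def Let_def char_eq]
  show "\<lbrakk>x \<in> carrier L; y \<in> carrier L\<rbrakk> \<Longrightarrow> \<chi> (x \<oplus>\<^bsub>L\<^esub> y) = \<chi> x \<oplus>\<^bsub>N\<^esub> \<chi> y"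
    unfolding \<chi>_def using fam A.gen_closed L.M.a_closed A.T_add_closed
      \<kappa>\<rho>_cong[of "free_gen F (x \<oplus>\<^bsub>L\<^esub> y)" "free_gen F x \<oplus>\<^bsub>A.T\<^esub> free_gen F y"]
    by (simp add: \<kappa>\<rho>_add)
  show "\<lbrakk>c \<in> carrier F; x \<in> carrier L\<rbrakk> \<Longrightarrow> \<chi> (c \<odot>\<^bsub>L\<^esub> x) = \<kappa> (c \<odot>\<^bsub>B.T\<^esub> \<rho> (free_gen F x))"
    unfolding \<chi>_def using fam A.gen_closed L.smult_closed A.T_smult_closed
      \<kappa>\<rho>_cong[of "free_gen F (c \<odot>\<^bsub>L\<^esub> x)" "c \<odot>\<^bsub>A.T\<^esub> free_gen F x"]
    by (simp add: \<kappa>\<rho>_smult)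
  show "x \<in> carrier L \<Longrightarrow> \<chi> (pmap L x) = \<kappa> (\<rho> (free_gen F x) [^]\<^bsub>B.T\<^esub> p)"
  proof -
    assume x: "x \<in> carrier L"
    have c: "free_gen F x [^]\<^bsub>A.T\<^esub> p \<in> carrier A.T" "free_gen F (pmap L x) \<in> carrier A.T"
      using A.gen_closed x L.pmap_closed by simp_all
    have "\<kappa> (\<rho> (free_gen F x [^]\<^bsub>A.T\<^esub> p)) = \<kappa> (\<rho> (free_gen F (pmap L x)))"
      using fam x by (intro \<kappa>\<rho>_cong c) blast
    thus "\<chi> (pmap L x) = \<kappa> (\<rho> (free_gen F x) [^]\<^bsub>B.T\<^esub> p)"
      unfolding \<chi>_def using \<kappa>\<rho>_pow[OF A.gen_closed[OF x], of p] by simp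
  qed
  show "\<lbrakk>x \<in> carrier L; y \<in> carrier L\<rbrakk> \<Longrightarrow> \<chi> (x \<otimes>\<^bsub>L\<^esub> y) =
      \<kappa> (\<rho> (free_gen F x) \<otimes>\<^bsub>B.T\<^esub> \<rho> (free_gen F y)) \<ominus>\<^bsub>N\<^esub> \<kappa> (\<rho> (free_gen F y) \<otimes>\<^bsub>B.T\<^esub> \<rho> (free_gen F x))"
  proof -
    assume xy: "x \<in> carrier L" "y \<in> carrier L"
    let ?a = "free_gen F x" and ?b = "free_gen F y"
    have c: "?a \<in> carrier A.T" "?b \<in> carrier A.T" using A.gen_closed xy by auto
    have m: "R (?a \<otimes>\<^bsub>A.T\<^esub> ?b \<ominus>\<^bsub>A.T\<^esub> ?b \<otimes>\<^bsub>A.T\<^esub> ?a) (\<rho> ?a \<otimes>\<^bsub>B.T\<^esub> \<rho> ?b \<ominus>\<^bsub>B.T\<^esub> \<rho> ?b \<otimes>\<^bsub>B.T\<^esub> \<rho> ?a)"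
      by (intro R_minus R_mult \<rho> c)
    have g: "free_gen F (x \<otimes>\<^bsub>L\<^esub> y) \<in> carrier A.T" using A.gen_closed L.bracket_closed xy by simp
    have "\<kappa> (\<rho> (?a \<otimes>\<^bsub>A.T\<^esub> ?b \<ominus>\<^bsub>A.T\<^esub> ?b \<otimes>\<^bsub>A.T\<^esub> ?a)) = \<kappa> (\<rho> (free_gen F (x \<otimes>\<^bsub>L\<^esub> y)))"
      using fam xy by (intro \<kappa>\<rho>_cong g R_carrier(1)[OF m]) blast
    thus ?thesis unfolding \<chi>_def \<kappa>_R[OF m]
      using \<kappa>_minus B.T_mult_closed \<rho>_closed c by simp
  qed
qed

lemma \<chi>_zero: "\<chi> \<zero>\<^bsub>L\<^esub> = \<zero>\<^bsub>N\<^esub>"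
proof -
  have "\<chi> \<zero>\<^bsub>L\<^esub> \<oplus>\<^bsub>N\<^esub> \<chi> \<zero>\<^bsub>L\<^esub> = \<chi> \<zero>\<^bsub>L\<^esub>" using \<chi>_add[of "\<zero>\<^bsub>L\<^esub>" "\<zero>\<^bsub>L\<^esub>"] by simp
  thus ?thesis using \<chi>_closed[of "\<zero>\<^bsub>L\<^esub>"] by (simp add: N.add.l_cancel_one)
qed

end

section \<open>Preservation of the augmentation\<close>

context restricted_lie_algebra
begin

text \<open>Thus to kill Q it is enough that the zeros form a restricted subalgebra containing all
  brackets.\<close>

lemma QQ_le:
  assumes K: "restricted_subalgebra F L K" and br: "\<And>x y. \<lbrakk>x \<in> carrier L; y \<in> carrier L\<rbrakk> \<Longrightarrow> x \<otimes> y \<in> K"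
  shows "QQ \<subseteq> K"
proof -
  note D = restricted_subalgebraD[OF K]
  have g: "\<gamma>2 \<subseteq> K" unfolding \<gamma>2_eq using br by (intro subspace_span_le[OF vs D(1)]) auto
  moreover have "P2 \<subseteq> K" using P2_le[OF K] g D(3) by auto
  ultimately show ?thesis using subspaceD(3)[OF D(1)] unfolding set_add_def' by auto
qed

text \<open>The exponent is uniform, and it is the same \<open>s\<close> that will be carried over
  to \<open>H\<close>.\<close>

definition nilQ :: "nat \<Rightarrow> bool" where
  "nilQ s \<longleftrightarrow> (\<forall>x\<in>carrier L. (pmap L ^^ s) x \<in> QQ)"

lemma pmap_pow_closed: "x \<in> carrier L \<Longrightarrow> (pmap L ^^ s) x \<in> carrier L"
  by (induction s) (auto simp: pmap_closed)

end

context env_pair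
begin

lemma eps_kill: "g \<in> env_ideal F H \<Longrightarrow> g [] = \<zero>"
proof -
  assume g: "g \<in> env_ideal F H"
  let ?N = "{g \<in> carrier B.T. g [] = \<zero>}"
  have "ideal ?N B.T"
    by (rule B.T_idealI) (auto simp: B.eval_Nil B.T_val)
  moreover have "env_relation_families F H ?N"
    unfolding env_relation_families_def Let_def
    using H.bracket_closed H.pmap_closed p_pos
    by (auto simp: B.eval_Nil_minus B.eval_Nil B.eval_Nil_pow B.gen_closed B.T_add_closed B.T_smult_closed
        B.T_mult_closed char_eq nat_pow_zero)
  ultimately show ?thesis using H.env_ideal_le g by blast
qed

text \<open>The augmentation of the image of \<open>x\<close> is a commutative character: it kills
  brackets and turns the p-map into the p-th power of \<open>F\<close>. So it kills Q, its values
  are nilpotent, and a field has no nilpotents.\<close>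

lemma eps_preserved:
  assumes nil: "L.nilQ s" and R: "R f g"
  shows "g [] = f []"
proof -
  interpret E: env_map F p L H R F "\<lambda>g. g []"
    by unfold_locales (auto simp: B.T_val B.eval_Nil eps_kill)
  have c: "free_gen F x \<in> carrier A.T" "\<rho> (free_gen F x) \<in> carrier B.T" if "x \<in> carrier L" for x
    using that A.gen_closed \<rho>_closed by auto
  have sm: "E.\<chi> (c \<odot>\<^bsub>L\<^esub> x) = c \<otimes> E.\<chi> x" if "c \<in> carrier F" "x \<in> carrier L" for c x
    using E.\<chi>_smult[OF that] unfolding E.\<chi>_def by (simp add: B.eval_Nil)
  have br: "E.\<chi> (x \<otimes>\<^bsub>L\<^esub> y) = \<zero>" if "x \<in> carrier L" "y \<in> carrier L" for x y
    using E.\<chi>_bracket[OF that] c that B.T_val by (simp add: B.eval_Nil m_comm a_minus_def r_neg)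
  have pm: "E.\<chi> (pmap L x) = E.\<chi> x [^] p" if "x \<in> carrier L" for x
    using E.\<chi>_pmap[OF that] c that unfolding E.\<chi>_def by (simp add: B.eval_Nil_pow)
  let ?K = "{x \<in> carrier L. E.\<chi> x = \<zero>}"
  have "restricted_subalgebra F L ?K"
    unfolding restricted_subalgebra_def subspace_iff[OF L.vs]
    using E.\<chi>_add sm br pm E.\<chi>_zero L.bracket_closed L.pmap_closed by auto
  hence Q: "L.QQ \<subseteq> ?K" using br L.bracket_closed by (intro L.QQ_le) auto
  have \<chi>0: "E.\<chi> x = \<zero>" if x: "x \<in> carrier L" for x
  proof -
    have pw: "E.\<chi> ((pmap L ^^ k) x) = E.\<chi> x [^] (p ^ k)" for k
    proof (induction k)
      case (Suc k)
      thus ?case using pm L.pmap_pow_closed[OF x] E.\<chi>_closed[OF x] by (simp add: nat_pow_pow mult.commute)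
    qed (use E.\<chi>_closed[OF x] in simp)
    \<comment> \<open>The \<open>s\<close>-fold p-th power lies in Q, which is inside the zero
      set.\<close>
    have "E.\<chi> ((pmap L ^^ s) x) = \<zero>" using nil x Q unfolding L.nilQ_def by auto
    thus ?thesis using pw[of s] pow_eq_zero[OF E.\<chi>_closed[OF x]] by simp
  qed
  have "\<rho> f [] = f []" if "f \<in> carrier A.T" for f
    using that
  proof (induction f rule: A.T_induct)
    case zero
    show ?case using E.\<kappa>\<rho>_smult[of \<zero> "\<one>\<^bsub>A.T\<^esub>"] \<rho>_closed[of "\<one>\<^bsub>A.T\<^esub>"] by (simp add: B.eval_Nil A.eval_Nil B.T_val)
  next
    case (sd d w)
    show ?case
    proof (cases w)
      case Nil
      have "\<rho> \<one>\<^bsub>A.T\<^esub> [] = \<one>" using E.\<kappa>\<rho>_one by (simp add: B.eval_Nil)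
      thus ?thesis unfolding Nil A.sd_Nil[OF sd(1)]
        using E.\<kappa>\<rho>_smult[OF sd(1), of "\<one>\<^bsub>A.T\<^esub>"] sd(1) by (simp add: B.eval_Nil A.eval_Nil)
    next
      case (Cons x v)
      hence xv: "x \<in> carrier L" "A.sd d v \<in> carrier A.T" using sd A.sd_closed by auto
      have "\<rho> (A.sd d w) [] = \<rho> (free_gen F x) [] \<otimes> \<rho> (A.sd d v) []"
        unfolding Cons A.sd_Cons[OF sd(1)]
        using E.\<kappa>\<rho>_mult[OF c(1)[OF xv(1)] xv(2)] c(2)[OF xv(1)] \<rho>_closed[OF xv(2)] by (simp add: B.eval_Nil)
      thus ?thesis using \<chi>0[OF xv(1)] B.T_val[OF \<rho>_closed[OF xv(2)]] Cons
        unfolding E.\<chi>_def by (simp add: A.eval_Nil)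
    qed
  next
    case (add f g)
    thus ?case using E.\<kappa>\<rho>_add by (simp add: A.eval_Nil)
  qed
  thus ?thesis using E.\<kappa>_R[OF R] R_carrier[OF R] by simp
qed

end

section \<open>The abelian quotient of the target\<close>

lemma sum_powers_split:
  fixes p :: nat
  shows "sum_list (map (\<lambda>e. p ^ e) es) =
    length (filter (\<lambda>e. e = 0) es) + p * sum_list (map (\<lambda>e. p ^ (e - 1)) (filter (\<lambda>e. e \<noteq> 0) es))"
proof (induction es)
  case (Cons e es)
  thus ?case by (cases e) (auto simp: algebra_simps)
qed simp

text \<open>Carrying in base p. The summands 1 together with the added 1 number a multiple p t of p;
  dividing by p turns them into t ones and lowers the other exponents. Each carry costs at least one
  summand, so \<open>N\<close> carries need \<open>N\<close> summands.\<close>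

lemma sum_powers_carry:
  fixes p :: nat
  assumes p: "p > 1" and d: "p ^ N dvd sum_list (map (\<lambda>e. p ^ e) es) + 1"
  shows "N \<le> length es"
  using d
proof (induction N arbitrary: es)
  case (Suc N)
  let ?k = "sum_list (map (\<lambda>e. p ^ e) es)"
  let ?z = "length (filter (\<lambda>e. e = 0) es)" and ?ps = "filter (\<lambda>e. e \<noteq> 0) es"
  let ?k' = "sum_list (map (\<lambda>e. p ^ (e - 1)) ?ps)"
  have len: "?z + length ?ps = length es" by (rule sum_length_filter_compl)
  have k: "?k + 1 = (?z + 1) + p * ?k'" using sum_powers_split[of p es] by simp
  have "p dvd ?k + 1" using Suc.prems by (meson dvd_power dvd_trans zero_less_Suc)
  hence "p dvd ?z + 1" unfolding k using dvd_add_left_iff[OF dvd_triv_left[of p ?k']] by blast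
  then obtain t where t: "?z + 1 = p * t" by (auto elim: dvdE)
  have t0: "t > 0" using t by (cases t) auto
  have "?k + 1 = p * (t + ?k')" unfolding k t by (simp add: algebra_simps)
  hence "p * p ^ N dvd p * (t + ?k')" using Suc.prems by simp
  hence "p ^ N dvd t + ?k'" using p by simp
  \<comment> \<open>One of the t carried ones becomes the added 1 of the smaller instance, so only
    \<open>t - 1\<close> are kept as summands.\<close>
  moreover have "sum_list (map (\<lambda>e. p ^ e) (replicate (t - 1) 0 @ map (\<lambda>e. e - 1) ?ps)) + 1 = t + ?k'"
    using t0 by (simp add: sum_list_replicate comp_def)
  ultimately have "N \<le> length (replicate (t - 1) (0::nat) @ map (\<lambda>e. e - 1) ?ps)"
    by (intro Suc.IH) simp
  hence "N \<le> t - 1 + length ?ps" by simp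
  \<comment> \<open>The loss in length is p t - t, which is at least one.\<close>
  moreover have "2 * t \<le> p * t" using p by simp
  ultimately show ?case using t t0 len by linarith
qed simp

text \<open>A separation result for an abelian quotient with no nilpotency or finiteness at hand, so
  no truncation degree is available and the degree p^N must vary.\<close>

locale abelian_detection = frob_space F p A \<phi> + H: restricted_lie_algebra F H
  for F :: "('k, 'c) ring_scheme" (structure) and p :: nat
    and A :: "('k, 'a, 'm) module_scheme" and \<phi> :: "'a \<Rightarrow> 'a"
    and H :: "('k, 'b, 'n) restricted_lie_scheme" +
  fixes q :: "'b \<Rightarrow> 'a" and l :: "'a \<Rightarrow> 'k"
  assumes q_closed: "h \<in> carrier H \<Longrightarrow> q h \<in> carrier A"
    and q_add: "\<lbrakk>h \<in> carrier H; h' \<in> carrier H\<rbrakk> \<Longrightarrow> q (h \<oplus>\<^bsub>H\<^esub> h') = q h \<oplus>\<^bsub>A\<^esub> q h'"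
    and q_smult: "\<lbrakk>c \<in> carrier F; h \<in> carrier H\<rbrakk> \<Longrightarrow> q (c \<odot>\<^bsub>H\<^esub> h) = c \<odot>\<^bsub>A\<^esub> q h"
    and q_bracket: "\<lbrakk>h \<in> carrier H; h' \<in> carrier H\<rbrakk> \<Longrightarrow> q (h \<otimes>\<^bsub>H\<^esub> h') = \<zero>\<^bsub>A\<^esub>"
    and q_pmap: "h \<in> carrier H \<Longrightarrow> q (pmap H h) = \<phi> (q h)"
    and l: "lin_functional F A l"
begin

sublocale B: free_alg F "carrier H" ..

sublocale U: UP_char_p F "UP F" p
  by unfold_locales

text \<open>With length \<open>Suc N\<close> the top degree is \<open>p ^ N\<close>, and its
  coefficient is \<open>l (q h)\<close> without any root.\<close>

definition \<theta> :: "nat \<Rightarrow> 'b \<Rightarrow> nat \<Rightarrow> 'k" where "\<theta> N h = (\<lambda>k. addc l (Suc N) k (q h))"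

lemma addc_l: "lin_functional F A (addc l n k)"
  by (rule addc_functional[OF l])

lemma \<theta>_closed: assumes h: "h \<in> carrier H" shows "\<theta> N h \<in> carrier (UP F)"
proof -
  have "\<theta> N h k = \<zero>" if "k \<ge> p ^ Suc N" for k
    unfolding \<theta>_def
  proof (rule addc_eq_zero)
    fix j assume "j < Suc N"
    hence "p ^ j < p ^ Suc N" using p_gt_1 by (intro power_strict_increasing)
    thus "k \<noteq> p ^ j" using that by simp
  qed
  hence "bound \<zero> (p ^ Suc N) (\<theta> N h)" by (intro bound.intro) simp
  thus ?thesis using lin_functionalD(1)[OF addc_l q_closed[OF h]]
    unfolding UP_def up_def \<theta>_def by auto
qed

lemma coeff_\<theta>: "h \<in> carrier H \<Longrightarrow> coeff (UP F) (\<theta> N h) k = addc l (Suc N) k (q h)"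
  using \<theta>_closed[of h N] unfolding UP_def \<theta>_def by simp

definition \<Theta> :: "nat \<Rightarrow> ('b list \<Rightarrow> 'k) \<Rightarrow> nat \<Rightarrow> 'k" where
  "\<Theta> N = word_ext F (UP F) (word_ext_algebra.wprod (UP F) (\<theta> N))"

lemma \<Theta>_simps:
  shows \<Theta>_closed: "f \<in> carrier B.T \<Longrightarrow> \<Theta> N f \<in> carrier (UP F)"
    and \<Theta>_add: "\<lbrakk>f \<in> carrier B.T; g \<in> carrier B.T\<rbrakk> \<Longrightarrow> \<Theta> N (f \<oplus>\<^bsub>B.T\<^esub> g) = \<Theta> N f \<oplus>\<^bsub>UP F\<^esub> \<Theta> N g"
    and \<Theta>_mult: "\<lbrakk>f \<in> carrier B.T; g \<in> carrier B.T\<rbrakk> \<Longrightarrow> \<Theta> N (f \<otimes>\<^bsub>B.T\<^esub> g) = \<Theta> N f \<otimes>\<^bsub>UP F\<^esub> \<Theta> N g"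
    and \<Theta>_smult: "\<lbrakk>d \<in> carrier F; f \<in> carrier B.T\<rbrakk> \<Longrightarrow> \<Theta> N (d \<odot>\<^bsub>B.T\<^esub> f) = d \<odot>\<^bsub>UP F\<^esub> \<Theta> N f"
    and \<Theta>_gen: "h \<in> carrier H \<Longrightarrow> \<Theta> N (free_gen F h) = \<theta> N h"
    and \<Theta>_one: "\<Theta> N \<one>\<^bsub>B.T\<^esub> = \<one>\<^bsub>UP F\<^esub>"
    and \<Theta>_zero: "\<Theta> N \<zero>\<^bsub>B.T\<^esub> = \<zero>\<^bsub>UP F\<^esub>"
    and \<Theta>_sd: "\<lbrakk>d \<in> carrier F; w \<in> lists (carrier H)\<rbrakk> \<Longrightarrow> \<Theta> N (B.sd d w) = d \<odot>\<^bsub>UP F\<^esub> word_ext_algebra.wprod (UP F) (\<theta> N) w"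
    and wprod_closed: "w \<in> lists (carrier H) \<Longrightarrow> word_ext_algebra.wprod (UP F) (\<theta> N) w \<in> carrier (UP F)"
    and wprod_Nil: "word_ext_algebra.wprod (UP F) (\<theta> N) [] = \<one>\<^bsub>UP F\<^esub>"
    and wprod_Cons: "word_ext_algebra.wprod (UP F) (\<theta> N) (h # w) = \<theta> N h \<otimes>\<^bsub>UP F\<^esub> word_ext_algebra.wprod (UP F) (\<theta> N) w"
proof -
  interpret W: word_ext_algebra F "carrier H" "UP F" "\<theta> N" by unfold_locales (rule \<theta>_closed)
  show "f \<in> carrier B.T \<Longrightarrow> \<Theta> N f \<in> carrier (UP F)"
    "\<lbrakk>f \<in> carrier B.T; g \<in> carrier B.T\<rbrakk> \<Longrightarrow> \<Theta> N (f \<oplus>\<^bsub>B.T\<^esub> g) = \<Theta> N f \<oplus>\<^bsub>UP F\<^esub> \<Theta> N g"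
    "\<lbrakk>f \<in> carrier B.T; g \<in> carrier B.T\<rbrakk> \<Longrightarrow> \<Theta> N (f \<otimes>\<^bsub>B.T\<^esub> g) = \<Theta> N f \<otimes>\<^bsub>UP F\<^esub> \<Theta> N g"
    "\<lbrakk>d \<in> carrier F; f \<in> carrier B.T\<rbrakk> \<Longrightarrow> \<Theta> N (d \<odot>\<^bsub>B.T\<^esub> f) = d \<odot>\<^bsub>UP F\<^esub> \<Theta> N f"
    "h \<in> carrier H \<Longrightarrow> \<Theta> N (free_gen F h) = \<theta> N h"
    "\<Theta> N \<one>\<^bsub>B.T\<^esub> = \<one>\<^bsub>UP F\<^esub>" "\<Theta> N \<zero>\<^bsub>B.T\<^esub> = \<zero>\<^bsub>UP F\<^esub>"
    "\<lbrakk>d \<in> carrier F; w \<in> lists (carrier H)\<rbrakk> \<Longrightarrow> \<Theta> N (B.sd d w) = d \<odot>\<^bsub>UP F\<^esub> word_ext_algebra.wprod (UP F) (\<theta> N) w"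
    unfolding \<Theta>_def by (simp_all add: W.E_closed W.E_add W.E_mult W.E_smult W.E_gen W.E_one W.E_zero W.E_sd)
  show "w \<in> lists (carrier H) \<Longrightarrow> word_ext_algebra.wprod (UP F) (\<theta> N) w \<in> carrier (UP F)"
    "word_ext_algebra.wprod (UP F) (\<theta> N) [] = \<one>\<^bsub>UP F\<^esub>"
    "word_ext_algebra.wprod (UP F) (\<theta> N) (h # w) = \<theta> N h \<otimes>\<^bsub>UP F\<^esub> word_ext_algebra.wprod (UP F) (\<theta> N) w"
    by (simp_all add: W.wprod_closed)
qed

lemma \<Theta>_minus: "\<lbrakk>f \<in> carrier B.T; g \<in> carrier B.T\<rbrakk> \<Longrightarrow> \<Theta> N (f \<ominus>\<^bsub>B.T\<^esub> g) = \<Theta> N f \<ominus>\<^bsub>UP F\<^esub> \<Theta> N g"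
  using U.smult_minus_1[OF \<Theta>_closed, of g N]
  by (simp add: a_minus_def B.T_minus_smult \<Theta>_add \<Theta>_smult)

lemma \<Theta>_pow: "f \<in> carrier B.T \<Longrightarrow> \<Theta> N (f [^]\<^bsub>B.T\<^esub> (m::nat)) = \<Theta> N f [^]\<^bsub>UP F\<^esub> m"
  by (induction m) (simp_all add: \<Theta>_one \<Theta>_mult)

text \<open>Each factor is an additive polynomial, so the degrees in a product are sums of as many
  powers of p as there are factors.\<close>

lemma coeff_wprod:
  assumes w: "w \<in> lists (carrier H)" and nz: "coeff (UP F) (word_ext_algebra.wprod (UP F) (\<theta> N) w) k \<noteq> \<zero>"
  shows "\<exists>es. length es = length w \<and> k = sum_list (map (\<lambda>e. p ^ e) es)"
  using assms
proof (induction w arbitrary: k rule: list.induct)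
  case Nil
  hence "k = 0" unfolding wprod_Nil by (auto split: if_splits)
  thus ?case by simp
next
  case (Cons h w)
  have hw: "h \<in> carrier H" "w \<in> lists (carrier H)" using Cons.prems by auto
  let ?W = "word_ext_algebra.wprod (UP F) (\<theta> N) w"
  have c: "coeff (UP F) (\<theta> N h) i \<in> carrier F" "coeff (UP F) ?W i \<in> carrier F" for i
    using U.coeff_closed[OF \<theta>_closed[OF hw(1)]] U.coeff_closed[OF wprod_closed[OF hw(2)]] by auto
  have "coeff (UP F) (\<theta> N h \<otimes>\<^bsub>UP F\<^esub> ?W) k = (\<Oplus>i\<in>{..k}. coeff (UP F) (\<theta> N h) i \<otimes> coeff (UP F) ?W (k - i))"
    using U.coeff_mult[OF \<theta>_closed[OF hw(1)] wprod_closed[OF hw(2)]] .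
  hence "\<exists>i\<le>k. coeff (UP F) (\<theta> N h) i \<otimes> coeff (UP F) ?W (k - i) \<noteq> \<zero>"
    using Cons.prems(2) add.finprod_one_eqI[of "{..k}" "\<lambda>i. coeff (UP F) (\<theta> N h) i \<otimes> coeff (UP F) ?W (k - i)"]
    unfolding wprod_Cons by auto
  then obtain i where i: "i \<le> k" "coeff (UP F) (\<theta> N h) i \<noteq> \<zero>" "coeff (UP F) ?W (k - i) \<noteq> \<zero>"
    using c by (metis l_null r_null)
  obtain es where es: "length es = length w" "k - i = sum_list (map (\<lambda>e. p ^ e) es)"
    using Cons.IH[OF hw(2) i(3)] by auto
  obtain j where "i = p ^ j" using i(2) addc_eq_zero[of "Suc N" i l "q h"] unfolding coeff_\<theta>[OF hw(1)] by blast
  hence "length (j # es) = length (h # w) \<and> k = sum_list (map (\<lambda>e. p ^ e) (j # es))" using es i(1) by simp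
  thus ?case by blast
qed

text \<open>If \<open>p ^ N - 1\<close> is a sum of powers of p, one for each letter of the word,
  then adding 1 gives a multiple of \<open>p ^ N\<close>, so \<open>N\<close> is at most the word
  length.\<close>

lemma eventually_low:
  assumes f: "f \<in> carrier B.T"
  shows "\<exists>N0. \<forall>N\<ge>N0. coeff (UP F) (\<Theta> N f) (p ^ N - 1) = \<zero>"
  using f
proof (induction f rule: B.T_induct)
  case zero show ?case by (simp add: \<Theta>_zero)
next
  case (sd d w)
  show ?case
  proof (intro exI[of _ "Suc (length w)"] allI impI)
    fix N assume N: "Suc (length w) \<le> N"
    have "coeff (UP F) (word_ext_algebra.wprod (UP F) (\<theta> N) w) (p ^ N - 1) = \<zero>"
    proof (rule ccontr)
      assume "\<not> ?thesis"
      then obtain es where es: "length es = length w" "p ^ N - 1 = sum_list (map (\<lambda>e. p ^ e) es)"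
        using coeff_wprod[OF sd(2)] by blast
      have "p ^ N - 1 + 1 = p ^ N" using p_pos by simp
      hence "N \<le> length es" using es(2) by (intro sum_powers_carry[OF p_gt_1]) simp
      thus False using es(1) N by simp
    qed
    thus "coeff (UP F) (\<Theta> N (B.sd d w)) (p ^ N - 1) = \<zero>"
      using sd wprod_closed[OF sd(2)] by (simp add: \<Theta>_sd)
  qed
next
  case (add f g)
  then obtain N1 N2 where N: "\<forall>N\<ge>N1. coeff (UP F) (\<Theta> N f) (p ^ N - 1) = \<zero>"
    "\<forall>N\<ge>N2. coeff (UP F) (\<Theta> N g) (p ^ N - 1) = \<zero>" by auto
  show ?case using N add by (intro exI[of _ "max N1 N2"]) (simp add: \<Theta>_add \<Theta>_closed)
qed

text \<open>In degrees up to \<open>p\<^sup>N\<close> the map \<open>\<Theta> N\<close> respects the relations up to a multiple of \<open>t\<close>.  So for a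
  relation \<open>f\<close> the coefficient of \<open>u f v\<close> in degree \<open>p\<^sup>N\<close> only involves a coefficient in degree
  \<open>p\<^sup>N - 1\<close>, which vanishes for large \<open>N\<close>, as \<open>p\<^sup>N - 1\<close> is not a sum of few powers of \<open>p\<close>.\<close>

definition KK :: "('b list \<Rightarrow> 'k) set" where
  "KK = {f \<in> carrier B.T. \<forall>u\<in>carrier B.T. \<forall>v\<in>carrier B.T.
     \<exists>N0. \<forall>N\<ge>N0. coeff (UP F) (\<Theta> N (u \<otimes>\<^bsub>B.T\<^esub> f \<otimes>\<^bsub>B.T\<^esub> v)) (p ^ N) = \<zero>}"

lemma KKD: "\<lbrakk>f \<in> KK; u \<in> carrier B.T; v \<in> carrier B.T\<rbrakk> \<Longrightarrow>
    \<exists>N0. \<forall>N\<ge>N0. coeff (UP F) (\<Theta> N (u \<otimes>\<^bsub>B.T\<^esub> f \<otimes>\<^bsub>B.T\<^esub> v)) (p ^ N) = \<zero>"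
  unfolding KK_def by simp

lemma KK_ideal: "ideal KK B.T"
proof (rule B.T_idealI)
  show "KK \<subseteq> carrier B.T" unfolding KK_def by auto
  show "\<zero>\<^bsub>B.T\<^esub> \<in> KK" unfolding KK_def by (simp add: \<Theta>_zero)
  fix f assume f: "f \<in> KK"
  hence fT: "f \<in> carrier B.T" unfolding KK_def by auto
  show "f \<oplus>\<^bsub>B.T\<^esub> g \<in> KK" if g: "g \<in> KK" for g
  proof -
    have gT: "g \<in> carrier B.T" using g unfolding KK_def by auto
    have "\<exists>N0. \<forall>N\<ge>N0. coeff (UP F) (\<Theta> N (u \<otimes>\<^bsub>B.T\<^esub> (f \<oplus>\<^bsub>B.T\<^esub> g) \<otimes>\<^bsub>B.T\<^esub> v)) (p ^ N) = \<zero>"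
      if uv: "u \<in> carrier B.T" "v \<in> carrier B.T" for u v
    proof -
      obtain N1 N2 where N: "\<forall>N\<ge>N1. coeff (UP F) (\<Theta> N (u \<otimes>\<^bsub>B.T\<^esub> f \<otimes>\<^bsub>B.T\<^esub> v)) (p ^ N) = \<zero>"
        "\<forall>N\<ge>N2. coeff (UP F) (\<Theta> N (u \<otimes>\<^bsub>B.T\<^esub> g \<otimes>\<^bsub>B.T\<^esub> v)) (p ^ N) = \<zero>"
        using f g uv unfolding KK_def by blast
      have cl: "u \<otimes>\<^bsub>B.T\<^esub> f \<otimes>\<^bsub>B.T\<^esub> v \<in> carrier B.T" "u \<otimes>\<^bsub>B.T\<^esub> g \<otimes>\<^bsub>B.T\<^esub> v \<in> carrier B.T" using uv fT gT by simp_all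
      have "u \<otimes>\<^bsub>B.T\<^esub> (f \<oplus>\<^bsub>B.T\<^esub> g) \<otimes>\<^bsub>B.T\<^esub> v = u \<otimes>\<^bsub>B.T\<^esub> f \<otimes>\<^bsub>B.T\<^esub> v \<oplus>\<^bsub>B.T\<^esub> u \<otimes>\<^bsub>B.T\<^esub> g \<otimes>\<^bsub>B.T\<^esub> v"
        using uv fT gT by (simp add: B.T.r_distr B.T.l_distr)
      thus ?thesis using N cl by (intro exI[of _ "max N1 N2"]) (simp add: \<Theta>_add \<Theta>_closed)
    qed
    thus ?thesis unfolding KK_def using fT gT by simp
  qed
  fix w assume w: "w \<in> carrier B.T"
  show "w \<otimes>\<^bsub>B.T\<^esub> f \<in> KK"
  proof -
    have "\<exists>N0. \<forall>N\<ge>N0. coeff (UP F) (\<Theta> N (u \<otimes>\<^bsub>B.T\<^esub> (w \<otimes>\<^bsub>B.T\<^esub> f) \<otimes>\<^bsub>B.T\<^esub> v)) (p ^ N) = \<zero>"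
      if uv: "u \<in> carrier B.T" "v \<in> carrier B.T" for u v
    proof -
      have "u \<otimes>\<^bsub>B.T\<^esub> (w \<otimes>\<^bsub>B.T\<^esub> f) \<otimes>\<^bsub>B.T\<^esub> v = (u \<otimes>\<^bsub>B.T\<^esub> w) \<otimes>\<^bsub>B.T\<^esub> f \<otimes>\<^bsub>B.T\<^esub> v"
        using uv w fT by (simp add: B.T.m_assoc)
      thus ?thesis using KKD[OF f B.T.m_closed[OF uv(1) w] uv(2)] by simp
    qed
    thus ?thesis unfolding KK_def using fT w by simp
  qed
  show "f \<otimes>\<^bsub>B.T\<^esub> w \<in> KK"
  proof -
    have "\<exists>N0. \<forall>N\<ge>N0. coeff (UP F) (\<Theta> N (u \<otimes>\<^bsub>B.T\<^esub> (f \<otimes>\<^bsub>B.T\<^esub> w) \<otimes>\<^bsub>B.T\<^esub> v)) (p ^ N) = \<zero>"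
      if uv: "u \<in> carrier B.T" "v \<in> carrier B.T" for u v
    proof -
      have "u \<otimes>\<^bsub>B.T\<^esub> (f \<otimes>\<^bsub>B.T\<^esub> w) \<otimes>\<^bsub>B.T\<^esub> v = u \<otimes>\<^bsub>B.T\<^esub> f \<otimes>\<^bsub>B.T\<^esub> (w \<otimes>\<^bsub>B.T\<^esub> v)"
        using uv w fT by (simp add: B.T.m_assoc)
      thus ?thesis using KKD[OF f uv(1) B.T.m_closed[OF w uv(2)]] by simp
    qed
    thus ?thesis unfolding KK_def using fT w by simp
  qed
qed

lemma KK_vanish:
  assumes f: "f \<in> carrier B.T" and z: "\<And>N. \<Theta> N f = \<zero>\<^bsub>UP F\<^esub>" shows "f \<in> KK"
  unfolding KK_def using f z by (auto simp: \<Theta>_mult \<Theta>_closed)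

lemma KK_commutator:
  assumes "f \<in> carrier B.T" "g \<in> carrier B.T"
  shows "f \<otimes>\<^bsub>B.T\<^esub> g \<ominus>\<^bsub>B.T\<^esub> g \<otimes>\<^bsub>B.T\<^esub> f \<in> KK"
proof (rule KK_vanish)
  show "\<Theta> N (f \<otimes>\<^bsub>B.T\<^esub> g \<ominus>\<^bsub>B.T\<^esub> g \<otimes>\<^bsub>B.T\<^esub> f) = \<zero>\<^bsub>UP F\<^esub>" for N
    using assms \<Theta>_closed U.P.m_comm[of "\<Theta> N f" "\<Theta> N g"] by (simp add: \<Theta>_minus \<Theta>_mult)
qed (use assms in simp)

lemma \<theta>_eqI:
  assumes "f \<in> carrier (UP F)" "g \<in> carrier (UP F)" "\<And>k. coeff (UP F) f k = coeff (UP F) g k" shows "f = g"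
  using U.up_eqI[OF assms(3) assms(1,2)] .

lemma KK_families: "env_relation_families F H KK"
  unfolding env_relation_families_def Let_def
proof (intro conjI ballI)
  fix h h' assume h: "h \<in> carrier H" "h' \<in> carrier H"
  note g = B.gen_closed[OF h(1)] B.gen_closed[OF h(2)]
  note cl = \<theta>_closed[OF h(1)] \<theta>_closed[OF h(2)]
  show "free_gen F (h \<oplus>\<^bsub>H\<^esub> h') \<ominus>\<^bsub>B.T\<^esub> (free_gen F h \<oplus>\<^bsub>B.T\<^esub> free_gen F h') \<in> KK"
  proof (rule KK_vanish)
    have hh: "h \<oplus>\<^bsub>H\<^esub> h' \<in> carrier H" using h by simp
    have "\<theta> N (h \<oplus>\<^bsub>H\<^esub> h') = \<theta> N h \<oplus>\<^bsub>UP F\<^esub> \<theta> N h'" for N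
      using h hh cl lin_functionalD(2)[OF addc_l q_closed q_closed]
      by (intro \<theta>_eqI \<theta>_closed) (simp_all add: coeff_\<theta> q_add)
    thus "\<Theta> N (free_gen F (h \<oplus>\<^bsub>H\<^esub> h') \<ominus>\<^bsub>B.T\<^esub> (free_gen F h \<oplus>\<^bsub>B.T\<^esub> free_gen F h')) = \<zero>\<^bsub>UP F\<^esub>" for N
      using h hh g cl B.gen_closed[OF hh] \<theta>_closed[OF hh] by (simp add: \<Theta>_minus \<Theta>_add \<Theta>_gen)
  qed (use h g B.gen_closed in simp)
  show "free_gen F h \<otimes>\<^bsub>B.T\<^esub> free_gen F h' \<ominus>\<^bsub>B.T\<^esub> free_gen F h' \<otimes>\<^bsub>B.T\<^esub> free_gen F h \<ominus>\<^bsub>B.T\<^esub> free_gen F (h \<otimes>\<^bsub>H\<^esub> h') \<in> KK"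
  proof (rule KK_vanish)
    have hh: "h \<otimes>\<^bsub>H\<^esub> h' \<in> carrier H" using h H.bracket_closed by simp
    have z: "addc l n k \<zero>\<^bsub>A\<^esub> = \<zero>" for n k
      using lin_functionalD(3)[OF addc_l, of \<zero> "\<zero>\<^bsub>A\<^esub>" n k] lin_functionalD(1)[OF addc_l, of "\<zero>\<^bsub>A\<^esub>" n k] by simp
    have "\<theta> N (h \<otimes>\<^bsub>H\<^esub> h') = \<zero>\<^bsub>UP F\<^esub>" for N
      by (intro \<theta>_eqI \<theta>_closed hh) (simp_all add: coeff_\<theta>[OF hh] q_bracket[OF h] z)
    thus "\<Theta> N (free_gen F h \<otimes>\<^bsub>B.T\<^esub> free_gen F h' \<ominus>\<^bsub>B.T\<^esub> free_gen F h' \<otimes>\<^bsub>B.T\<^esub> free_gen F h \<ominus>\<^bsub>B.T\<^esub> free_gen F (h \<otimes>\<^bsub>H\<^esub> h')) = \<zero>\<^bsub>UP F\<^esub>" for N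
      using h hh g cl B.gen_closed[OF hh] U.P.m_comm[OF cl[of N]]
      by (simp add: \<Theta>_minus \<Theta>_mult \<Theta>_gen)
  qed (use h g B.gen_closed H.bracket_closed in simp)
next
  fix c h assume c: "c \<in> carrier F" and h: "h \<in> carrier H"
  note g = B.gen_closed[OF h] and cl = \<theta>_closed[OF h]
  show "free_gen F (c \<odot>\<^bsub>H\<^esub> h) \<ominus>\<^bsub>B.T\<^esub> c \<odot>\<^bsub>B.T\<^esub> free_gen F h \<in> KK"
  proof (rule KK_vanish)
    have hh: "c \<odot>\<^bsub>H\<^esub> h \<in> carrier H" using h c by simp
    have "\<theta> N (c \<odot>\<^bsub>H\<^esub> h) = c \<odot>\<^bsub>UP F\<^esub> \<theta> N h" for N
      using h c cl lin_functionalD(3)[OF addc_l c q_closed[OF h]]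
      by (intro \<theta>_eqI \<theta>_closed hh) (simp_all add: coeff_\<theta> hh q_smult)
    thus "\<Theta> N (free_gen F (c \<odot>\<^bsub>H\<^esub> h) \<ominus>\<^bsub>B.T\<^esub> c \<odot>\<^bsub>B.T\<^esub> free_gen F h) = \<zero>\<^bsub>UP F\<^esub>" for N
      using h c hh g cl B.gen_closed[OF hh] by (simp add: \<Theta>_minus \<Theta>_smult \<Theta>_gen)
  qed (use h c g B.gen_closed in simp)
next
  fix h assume h: "h \<in> carrier H"
  note g = B.gen_closed[OF h] and cl = \<theta>_closed[OF h]
  have hh: "pmap H h \<in> carrier H" using h H.pmap_closed by simp
  let ?D = "free_gen F h [^]\<^bsub>B.T\<^esub> p \<ominus>\<^bsub>B.T\<^esub> free_gen F (pmap H h)"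
  have D: "?D \<in> carrier B.T" using g B.gen_closed[OF hh] by simp
  \<comment> \<open>In degree 1 the coefficient of the polynomial of \<open>pmap H h\<close> is a
    root of the value of \<open>l\<close> on the \<open>Suc N\<close>-fold iterate of
    \<open>\<phi>\<close>, about which nothing is known; in all other degrees up to
    \<open>p ^ N\<close> the two sides cancel.\<close>
  have \<Theta>D: "coeff (UP F) (\<Theta> N ?D) k = \<zero>" if k: "k \<le> p ^ N" "k \<noteq> 1" for N k
  proof -
    have "p ^ N < p ^ Suc N" using p_gt_1 by (intro power_strict_increasing) auto
    hence "k < p ^ Suc N" by (rule le_less_trans[OF k(1)])
    hence "coeff (UP F) (\<theta> N (pmap H h)) k = (if p dvd k then addc l (Suc N) (k div p) (q h) [^] p else \<zero>)"
      unfolding coeff_\<theta>[OF hh] q_pmap[OF h] using k by (intro addc_\<phi>[OF l] q_closed h) auto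
    also have "\<dots> = coeff (UP F) (\<theta> N h [^]\<^bsub>UP F\<^esub> p) k"
      unfolding U.coeff_frob[OF cl] coeff_\<theta>[OF h] ..
    finally have e: "coeff (UP F) (\<theta> N (pmap H h)) k = coeff (UP F) (\<theta> N h [^]\<^bsub>UP F\<^esub> p) k" .
    have "\<Theta> N ?D = \<theta> N h [^]\<^bsub>UP F\<^esub> p \<ominus>\<^bsub>UP F\<^esub> \<theta> N (pmap H h)"
      using g B.gen_closed[OF hh] h hh by (simp add: \<Theta>_minus \<Theta>_pow \<Theta>_gen)
    hence "coeff (UP F) (\<Theta> N ?D) k = coeff (UP F) (\<theta> N h [^]\<^bsub>UP F\<^esub> p) k \<ominus> coeff (UP F) (\<theta> N (pmap H h)) k"
      using cl \<theta>_closed[OF hh] by (simp add: U.coeff_minus)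
    thus ?thesis unfolding e using U.coeff_closed[OF U.P.nat_pow_closed[OF cl]] by (simp add: a_minus_def r_neg)
  qed
  have "?D \<in> KK"
    unfolding KK_def
  proof (intro CollectI conjI ballI D)
    fix u v assume uv: "u \<in> carrier B.T" "v \<in> carrier B.T"
    have uvT: "u \<otimes>\<^bsub>B.T\<^esub> v \<in> carrier B.T" using uv by simp
    obtain N0 where N0: "\<forall>N\<ge>N0. coeff (UP F) (\<Theta> N (u \<otimes>\<^bsub>B.T\<^esub> v)) (p ^ N - 1) = \<zero>" using eventually_low[OF uvT] by auto
    show "\<exists>N0. \<forall>N\<ge>N0. coeff (UP F) (\<Theta> N (u \<otimes>\<^bsub>B.T\<^esub> ?D \<otimes>\<^bsub>B.T\<^esub> v)) (p ^ N) = \<zero>"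
    proof (intro exI[of _ N0] allI impI)
      fix N assume N: "N0 \<le> N"
      let ?W = "\<Theta> N (u \<otimes>\<^bsub>B.T\<^esub> v)" and ?E = "\<Theta> N ?D"
      have WE: "?W \<in> carrier (UP F)" "?E \<in> carrier (UP F)" using \<Theta>_closed uvT D by auto
      have "\<Theta> N (u \<otimes>\<^bsub>B.T\<^esub> ?D \<otimes>\<^bsub>B.T\<^esub> v) = \<Theta> N u \<otimes>\<^bsub>UP F\<^esub> ?E \<otimes>\<^bsub>UP F\<^esub> \<Theta> N v"
        using uv D by (simp add: \<Theta>_mult)
      also have "\<dots> = ?W \<otimes>\<^bsub>UP F\<^esub> ?E"
        using uv \<Theta>_closed WE(2) by (simp add: \<Theta>_mult U.P.m_ac)
      finally have "coeff (UP F) (\<Theta> N (u \<otimes>\<^bsub>B.T\<^esub> ?D \<otimes>\<^bsub>B.T\<^esub> v)) (p ^ N) =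
          (\<Oplus>i\<in>{..p ^ N}. coeff (UP F) ?W i \<otimes> coeff (UP F) ?E (p ^ N - i))"
        using U.coeff_mult[OF WE] by simp
      also have "\<dots> = \<zero>"
      proof (rule add.finprod_one_eqI)
        fix i assume "i \<in> {..p ^ N}"
        hence i: "i \<le> p ^ N" by simp
        show "coeff (UP F) ?W i \<otimes> coeff (UP F) ?E (p ^ N - i) = \<zero>"
        proof (cases "p ^ N - i = 1")
          case True
          hence "i = p ^ N - 1" using i by linarith
          thus ?thesis using N0 N U.coeff_closed[OF WE(2)] by simp
        next
          case False
          thus ?thesis using \<Theta>D[of "p ^ N - i" N] U.coeff_closed[OF WE(1)] by simp
        qed
      qed
      finally show "coeff (UP F) (\<Theta> N (u \<otimes>\<^bsub>B.T\<^esub> ?D \<otimes>\<^bsub>B.T\<^esub> v)) (p ^ N) = \<zero>" .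
    qed
  qed
  thus "free_gen F h [^]\<^bsub>B.T\<^esub> ring_char F \<ominus>\<^bsub>B.T\<^esub> free_gen F (pmap H h) \<in> KK" by (simp add: char_eq)
qed

lemma coeff_frob_iter:
  assumes g: "g \<in> carrier (UP F)"
  shows "s \<le> N \<Longrightarrow> coeff (UP F) (g [^]\<^bsub>UP F\<^esub> (p ^ s)) (p ^ N) = coeff (UP F) g (p ^ (N - s)) [^] (p ^ s)"
proof (induction s arbitrary: N)
  case 0 thus ?case using g U.coeff_closed by simp
next
  case (Suc s)
  obtain N' where N': "N = Suc N'" using Suc.prems by (cases N) auto
  have "g [^]\<^bsub>UP F\<^esub> (p ^ Suc s) = (g [^]\<^bsub>UP F\<^esub> (p ^ s)) [^]\<^bsub>UP F\<^esub> p"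
    using g by (simp add: U.P.nat_pow_pow mult.commute)
  hence "coeff (UP F) (g [^]\<^bsub>UP F\<^esub> (p ^ Suc s)) (p ^ N) = coeff (UP F) (g [^]\<^bsub>UP F\<^esub> (p ^ s)) (p ^ N') [^] p"
    using U.coeff_frob[of "g [^]\<^bsub>UP F\<^esub> (p ^ s)" "p ^ N"] g p_pos N' by simp
  also have "\<dots> = (coeff (UP F) g (p ^ (N' - s)) [^] (p ^ s)) [^] p" using Suc N' by simp
  also have "\<dots> = coeff (UP F) g (p ^ (N - Suc s)) [^] (p ^ Suc s)"
    using g U.coeff_closed N' by (simp add: nat_pow_pow mult.commute)
  finally show ?case .
qed

text \<open>The \<open>p ^ s\<close>-th power of a generator has at degree \<open>p ^ N\<close> the
  coefficient \<open>l ((\<phi> ^^ s) (q h))\<close> for every large \<open>N\<close>. Membership in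
  \<open>KK\<close>, tested with both cofactors equal to one, makes it vanish.\<close>

lemma detection:
  assumes h: "h \<in> carrier H" and K: "free_gen F h [^]\<^bsub>B.T\<^esub> (p ^ s) \<in> KK"
  shows "l ((\<phi> ^^ s) (q h)) = \<zero>"
proof -
  note g = B.gen_closed[OF h]
  let ?f = "free_gen F h [^]\<^bsub>B.T\<^esub> (p ^ s)"
  have fT: "?f \<in> carrier B.T" using g by simp
  obtain N0 where N0: "\<forall>N\<ge>N0. coeff (UP F) (\<Theta> N (\<one>\<^bsub>B.T\<^esub> \<otimes>\<^bsub>B.T\<^esub> ?f \<otimes>\<^bsub>B.T\<^esub> \<one>\<^bsub>B.T\<^esub>)) (p ^ N) = \<zero>"
    using K B.T.one_closed unfolding KK_def by blast
  define N where "N = max N0 s"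
  have N: "N \<ge> N0" "s \<le> N" unfolding N_def by auto
  have lc: "l ((\<phi> ^^ s) (q h)) \<in> carrier F" using lin_functionalD(1)[OF l] \<phi>_pow_closed q_closed[OF h] by blast
  have "\<zero> = coeff (UP F) (\<Theta> N ?f) (p ^ N)" using N0 N(1) fT by simp
  also have "\<dots> = coeff (UP F) (\<theta> N h) (p ^ (N - s)) [^] (p ^ s)"
    unfolding \<Theta>_pow[OF g] \<Theta>_gen[OF h] by (rule coeff_frob_iter[OF \<theta>_closed[OF h] N(2)])
  \<comment> \<open>The root taken \<open>s\<close> times at degree \<open>p ^ (N - s)\<close> is
    undone by the power \<open>p ^ s\<close>.\<close>
  also have "coeff (UP F) (\<theta> N h) (p ^ (N - s)) = (frt ^^ s) (l ((\<phi> ^^ s) (q h)))"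
    unfolding coeff_\<theta>[OF h] using addc_pow[of "N - s" "Suc N" l "q h"] N(2) by simp
  also have "\<dots> [^] (p ^ s) = l ((\<phi> ^^ s) (q h))" by (rule frt_iter_frt[OF lc])
  finally show ?thesis by simp
qed

end

section \<open>Transfer of nilpotency to the target\<close>

context restricted_lie_algebra
begin

abbreviation "AA \<equiv> quot_lie L QQ"
abbreviation "qQ \<equiv> \<lambda>x. QQ +>\<^bsub>L\<^esub> x"

lemma QQ_subspace: "subspace F QQ L"
  using QQ_ideal unfolding restricted_ideal_def lie_ideal_def by auto

lemma \<gamma>2_QQ: "x \<in> \<gamma>2 \<Longrightarrow> x \<in> QQ"
proof -
  assume x: "x \<in> \<gamma>2"
  have "x = \<zero> \<oplus> x" using x \<gamma>2_carrier by auto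
  moreover have "\<zero> \<in> P2" using subspaceD(2)[OF restricted_subalgebraD(1)[OF P2_subalgebra]] .
  ultimately show ?thesis unfolding set_add_iff using x by blast
qed

lemma qQ:
  shows qQ_hom: "qQ \<in> restricted_lie_hom F L AA"
    and AA: "restricted_lie_algebra F AA"
    and AA_carrier: "carrier AA = qQ ` carrier L"
    and qQ_zero: "x \<in> carrier L \<Longrightarrow> qQ x = \<zero>\<^bsub>AA\<^esub> \<longleftrightarrow> x \<in> QQ"
    and qQ_bracket: "\<lbrakk>x \<in> carrier L; y \<in> carrier L\<rbrakk> \<Longrightarrow> qQ (x \<otimes> y) = \<zero>\<^bsub>AA\<^esub>"
  using quot_lie[OF QQ_ideal] \<gamma>2_QQ bracket_in_\<gamma>2 bracket_closed by auto

lemma AA_frob_space: assumes "perfect_char_p F p'" shows "frob_space F p' AA (pmap AA)"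
proof -
  interpret P: perfect_char_p F p' by fact
  interpret A: restricted_lie_algebra F AA by (rule AA)
  note h = restricted_lie_homD[OF qQ_hom]
  show ?thesis
  proof unfold_locales
    show "pmap AA x \<in> carrier AA" if "x \<in> carrier AA" for x using A.pmap_closed that .
    show "pmap AA (c \<odot>\<^bsub>AA\<^esub> x) = c [^]\<^bsub>F\<^esub> p' \<odot>\<^bsub>AA\<^esub> pmap AA x" if "c \<in> carrier F" "x \<in> carrier AA" for c x
      using A.pmap_smult[OF that] by (simp add: P.char_eq)
    fix x y assume xy: "x \<in> carrier AA" "y \<in> carrier AA"
    then obtain a b where ab: "a \<in> carrier L" "b \<in> carrier L" "x = qQ a" "y = qQ b" unfolding AA_carrier by auto
    have "y \<otimes>\<^bsub>AA\<^esub> x = \<zero>\<^bsub>AA\<^esub>" unfolding ab using h(4)[OF ab(2,1)] qQ_bracket[OF ab(2,1)] by simp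
    thus "pmap AA (x \<oplus>\<^bsub>AA\<^esub> y) = pmap AA x \<oplus>\<^bsub>AA\<^esub> pmap AA y" by (rule A.pmap_add_commuting[OF xy])
  qed
qed

lemma qQ_pow: "x \<in> carrier L \<Longrightarrow> (pmap AA ^^ s) (qQ x) = qQ ((pmap L ^^ s) x)"
  by (induction s) (auto simp: restricted_lie_homD(5)[OF qQ_hom, symmetric] pmap_pow_closed)

end

context env_pair
begin

text \<open>If some p^s-th power survived in \<open>H/Q\<close>, a functional would detect it and
  give a commutative quotient of \<open>u(H)\<close> in which the p^s-th power of a generator is
  nonzero. But there the power map is a ring homomorphism that kills the images of all generators of
  \<open>u(L)\<close>, hence everything of augmentation zero.\<close>

lemma nilQ_transfer:
  assumes nil: "L.nilQ s" shows "H.nilQ s"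
  unfolding H.nilQ_def
proof (rule ballI, rule ccontr)
  fix h assume h: "h \<in> carrier H" and nQ: "(pmap H ^^ s) h \<notin> H.QQ"
  interpret A: frob_space F p H.AA "pmap H.AA" by (rule H.AA_frob_space) unfold_locales
  let ?v = "H.qQ ((pmap H ^^ s) h)"
  note qh = restricted_lie_homD[OF H.qQ_hom]
  have v: "?v \<in> carrier H.AA" "?v \<noteq> \<zero>\<^bsub>H.AA\<^esub>"
    using qh(1) H.pmap_pow_closed[OF h] H.qQ_zero nQ by auto
  have vsA: "vectorspace F H.AA" ..
  have "subspace F {\<zero>\<^bsub>H.AA\<^esub>} H.AA" unfolding subspace_iff[OF vsA] by simp
  then obtain l where l: "lin_functional F H.AA l" "l ?v = \<one>"
    using A.A.separating_functional[of "{\<zero>\<^bsub>H.AA\<^esub>}" ?v] v by auto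
  interpret D: abelian_detection F p H.AA "pmap H.AA" H H.qQ l
    by unfold_locales (use qh H.qQ_bracket l(1) in auto)
  interpret K: ideal D.KK B.T by (rule D.KK_ideal)
  have JK: "env_ideal F H \<subseteq> D.KK" by (rule H.env_ideal_le[OF D.KK_ideal D.KK_families])
  \<comment> \<open>Commutative because \<open>KK\<close> contains all commutators, and an image of
    \<open>u(H)\<close> because it contains the relations.\<close>
  let ?B = "B.T Quot D.KK"
  have Bring: "ring ?B" by (rule K.quotient_is_ring)
  note kh = ring_hom_mult[OF K.rcos_ring_hom] ring_hom_add[OF K.rcos_ring_hom] ring_hom_one[OF K.rcos_ring_hom]
    ring_hom_closed[OF K.rcos_ring_hom]
  define \<kappa> where "\<kappa> g = D.KK +>\<^bsub>B.T\<^esub> g" for g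
  have Bc: "carrier ?B = \<kappa> ` carrier B.T" unfolding FactRing_def A_RCOSETS_def' \<kappa>_def by auto
  have comm: "X \<otimes>\<^bsub>?B\<^esub> Y = Y \<otimes>\<^bsub>?B\<^esub> X" if XY: "X \<in> carrier ?B" "Y \<in> carrier ?B" for X Y
  proof -
    obtain f g where fg: "f \<in> carrier B.T" "g \<in> carrier B.T" "X = \<kappa> f" "Y = \<kappa> g" using XY unfolding Bc by auto
    have "\<kappa> (f \<otimes>\<^bsub>B.T\<^esub> g) = \<kappa> (g \<otimes>\<^bsub>B.T\<^esub> f)"
      unfolding \<kappa>_def using B.ideal_coset_eq[OF D.KK_ideal] D.KK_commutator[OF fg(1,2)] fg by simp
    thus ?thesis unfolding fg \<kappa>_def using kh(1) fg(1,2) by metis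
  qed
  interpret Q: cring ?B
    using Bring comm by (intro cring.intro comm_monoid.intro comm_monoid_axioms.intro ring.is_monoid) auto
  have kc: "\<kappa> g \<in> carrier ?B" if "g \<in> carrier B.T" for g using that unfolding Bc by auto
  have kadd: "\<kappa> (f \<oplus>\<^bsub>B.T\<^esub> g) = \<kappa> f \<oplus>\<^bsub>?B\<^esub> \<kappa> g" and kmult: "\<kappa> (f \<otimes>\<^bsub>B.T\<^esub> g) = \<kappa> f \<otimes>\<^bsub>?B\<^esub> \<kappa> g"
    if "f \<in> carrier B.T" "g \<in> carrier B.T" for f g
    using kh(1,2)[OF that] unfolding \<kappa>_def by auto
  have kone: "\<kappa> \<one>\<^bsub>B.T\<^esub> = \<one>\<^bsub>?B\<^esub>" using kh(3) unfolding \<kappa>_def .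
  have kpow: "\<kappa> (f [^]\<^bsub>B.T\<^esub> (m::nat)) = \<kappa> f [^]\<^bsub>?B\<^esub> m" if "f \<in> carrier B.T" for f m
    using that by (induction m) (simp_all add: kone kmult)
  have kzero: "\<kappa> g = \<zero>\<^bsub>?B\<^esub> \<longleftrightarrow> g \<in> D.KK" if g: "g \<in> carrier B.T" for g
  proof -
    have "\<zero>\<^bsub>?B\<^esub> = D.KK" by (simp add: FactRing_def)
    moreover have "D.KK +>\<^bsub>B.T\<^esub> \<zero>\<^bsub>B.T\<^esub> = D.KK" using B.T.a_coset_add_zero[OF K.a_subset] .
    ultimately show ?thesis using B.ideal_coset_eq[OF D.KK_ideal g B.T.zero_closed] g unfolding \<kappa>_def by simp
  qed
  have charB: "[p] \<cdot>\<^bsub>?B\<^esub> \<one>\<^bsub>?B\<^esub> = \<zero>\<^bsub>?B\<^esub>"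
  proof -
    have 1: "[m] \<cdot>\<^bsub>B.T\<^esub> \<one>\<^bsub>B.T\<^esub> = ([m] \<cdot> \<one>) \<odot>\<^bsub>B.T\<^esub> \<one>\<^bsub>B.T\<^esub>" for m :: nat
      by (induction m) (simp_all add: B.T.smult_l_distr)
    have 2: "\<kappa> ([m] \<cdot>\<^bsub>B.T\<^esub> \<one>\<^bsub>B.T\<^esub>) = [m] \<cdot>\<^bsub>?B\<^esub> \<one>\<^bsub>?B\<^esub>" for m :: nat
      using kzero[of "\<zero>\<^bsub>B.T\<^esub>"] K.zero_closed by (induction m) (simp_all add: kone kadd)
    show ?thesis using 2[of p] 1[of p] char_p kzero[of "\<zero>\<^bsub>B.T\<^esub>"] K.zero_closed by simp
  qed
  interpret Q: char_p_cring ?B p using prime_p charB by unfold_locales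
  interpret E: env_map F p L H R ?B \<kappa>
  proof unfold_locales
    show "\<kappa> g = \<zero>\<^bsub>?B\<^esub>" if "g \<in> env_ideal F H" for g
      using that JK kzero[OF J.Icarr[OF that]] by auto
  qed (use kc kadd in auto)
  have rc: "\<rho> (free_gen F x) \<in> carrier B.T" if "x \<in> carrier L" for x using \<rho>_closed A.gen_closed that by simp
  have ksm: "\<kappa> (c \<odot>\<^bsub>B.T\<^esub> g) = \<kappa> (c \<odot>\<^bsub>B.T\<^esub> \<one>\<^bsub>B.T\<^esub>) \<otimes>\<^bsub>?B\<^esub> \<kappa> g" if "c \<in> carrier F" "g \<in> carrier B.T" for c g
    using kmult[of "c \<odot>\<^bsub>B.T\<^esub> \<one>\<^bsub>B.T\<^esub>" g] that B.T_smult_l[of c "\<one>\<^bsub>B.T\<^esub>" g] by simp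
  have br: "E.\<chi> (x \<otimes>\<^bsub>L\<^esub> y) = \<zero>\<^bsub>?B\<^esub>" if xy: "x \<in> carrier L" "y \<in> carrier L" for x y
    using E.\<chi>_bracket[OF xy] rc xy kmult kc Q.m_comm[OF kc[OF rc[OF xy(1)]] kc[OF rc[OF xy(2)]]] by simp
  have pm: "E.\<chi> (pmap L x) = E.\<chi> x [^]\<^bsub>?B\<^esub> p" if "x \<in> carrier L" for x
    using E.\<chi>_pmap[OF that] kpow rc that unfolding E.\<chi>_def by simp
  let ?K = "{x \<in> carrier L. E.\<chi> x = \<zero>\<^bsub>?B\<^esub>}"
  have "restricted_subalgebra F L ?K"
    unfolding restricted_subalgebra_def subspace_iff[OF L.vs]
  proof (intro conjI ballI)
    show "c \<odot>\<^bsub>L\<^esub> x \<in> ?K" if c: "c \<in> carrier F" and x: "x \<in> ?K" for c x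
    proof -
      have "\<kappa> (\<rho> (free_gen F x)) = \<zero>\<^bsub>?B\<^esub>" using x unfolding E.\<chi>_def by simp
      hence "E.\<chi> (c \<odot>\<^bsub>L\<^esub> x) = \<zero>\<^bsub>?B\<^esub>"
        using E.\<chi>_smult[OF c, of x] ksm[OF c rc[of x]] x kc[of "c \<odot>\<^bsub>B.T\<^esub> \<one>\<^bsub>B.T\<^esub>"] c by simp
      thus ?thesis using c x by simp
    qed
    show "pmap L x \<in> ?K" if "x \<in> ?K" for x using pm[of x] that L.pmap_closed[of x] Q.frob_zero by simp
  qed (auto simp: E.\<chi>_zero E.\<chi>_add br L.bracket_closed)
  hence Qle: "L.QQ \<subseteq> ?K" using br L.bracket_closed by (intro L.QQ_le) auto
  have \<chi>0: "E.\<chi> x [^]\<^bsub>?B\<^esub> (p ^ s) = \<zero>\<^bsub>?B\<^esub>" if x: "x \<in> carrier L" for x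
  proof -
    have "E.\<chi> ((pmap L ^^ k) x) = E.\<chi> x [^]\<^bsub>?B\<^esub> (p ^ k)" for k
    proof (induction k)
      case (Suc k)
      thus ?case using pm L.pmap_pow_closed[OF x] E.\<chi>_closed[OF x] by (simp add: Q.nat_pow_pow mult.commute)
    qed (use E.\<chi>_closed[OF x] in simp)
    moreover have "E.\<chi> ((pmap L ^^ s) x) = \<zero>\<^bsub>?B\<^esub>" using nil x Qle unfolding L.nilQ_def by auto
    ultimately show ?thesis by simp
  qed
  define b where "b f = \<kappa> (\<rho> f) [^]\<^bsub>?B\<^esub> (p ^ s)" for f
  have krc: "\<kappa> (\<rho> f) \<in> carrier ?B" if "f \<in> carrier A.T" for f using kc \<rho>_closed that by simp
  have ps: "p ^ s \<noteq> 0" using p_pos by simp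
  have kr0: "\<kappa> (\<rho> \<zero>\<^bsub>A.T\<^esub>) = \<zero>\<^bsub>?B\<^esub>"
    using E.\<kappa>\<rho>_add[of "\<zero>\<^bsub>A.T\<^esub>" "\<zero>\<^bsub>A.T\<^esub>"] krc[of "\<zero>\<^bsub>A.T\<^esub>"] by (simp add: Q.add.l_cancel_one')
  have bz: "b \<zero>\<^bsub>A.T\<^esub> = \<zero>\<^bsub>?B\<^esub>"
    unfolding b_def kr0 using Q.nat_pow_zero[OF ps] .
  have badd: "b (f \<oplus>\<^bsub>A.T\<^esub> g) = b f \<oplus>\<^bsub>?B\<^esub> b g" if "f \<in> carrier A.T" "g \<in> carrier A.T" for f g
    unfolding b_def using E.\<kappa>\<rho>_add[OF that] Q.frob_iter_add krc that by simp
  \<comment> \<open>Additivity and multiplicativity of the power map reduce this to words, and a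
    nonempty word has a factor whose power vanishes. So only the augmentation is left.\<close>
  have bb: "b f = b (A.sd (f []) [])" if "f \<in> carrier A.T" for f
    using that
  proof (induction f rule: A.T_induct)
    case zero
    have "A.sd \<zero> [] = \<zero>\<^bsub>A.T\<^esub>" by (auto simp: A.sd_def A.T_simps)
    thus ?case by (simp add: A.eval_Nil)
  next
    case (sd d w)
    show ?case
    proof (cases w)
      case Nil thus ?thesis by (simp add: A.eval_Nil)
    next
      case (Cons x u)
      hence xu: "x \<in> carrier L" "A.sd d u \<in> carrier A.T" using sd A.sd_closed by auto
      have "\<kappa> (\<rho> (A.sd d w)) = E.\<chi> x \<otimes>\<^bsub>?B\<^esub> \<kappa> (\<rho> (A.sd d u))"
        unfolding Cons A.sd_Cons[OF sd(1)] E.\<chi>_def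
        using E.\<kappa>\<rho>_mult[OF A.gen_closed[OF xu(1)] xu(2)] kmult rc[OF xu(1)] \<rho>_closed[OF xu(2)] by simp
      hence "b (A.sd d w) = \<zero>\<^bsub>?B\<^esub>"
        unfolding b_def using Q.nat_pow_distrib[OF E.\<chi>_closed[OF xu(1)] krc[OF xu(2)]] \<chi>0[OF xu(1)] krc[OF xu(2)] by simp
      moreover have "A.sd \<zero> [] = \<zero>\<^bsub>A.T\<^esub>" by (auto simp: A.sd_def A.T_simps)
      ultimately show ?thesis using Cons bz by (simp add: A.eval_Nil)
    qed
  next
    case (add f g)
    have "A.sd ((f \<oplus>\<^bsub>A.T\<^esub> g) []) [] = A.sd (f []) [] \<oplus>\<^bsub>A.T\<^esub> A.sd (g []) []"
      by (auto simp: A.sd_def A.T_simps)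
    thus ?case using add badd A.sd_closed A.T_val by simp
  qed
  obtain f where f: "R f (free_gen F h)" using R_ex' B.gen_closed[OF h] by blast
  have "f [] = \<zero>" using eps_preserved[OF nil f] by (simp add: B.eval_Nil)
  moreover have "A.sd \<zero> [] = \<zero>\<^bsub>A.T\<^esub>" by (auto simp: A.sd_def A.T_simps)
  ultimately have "b f = \<zero>\<^bsub>?B\<^esub>" using bb[OF R_carrier(1)[OF f]] bz by simp
  hence "\<kappa> (free_gen F h) [^]\<^bsub>?B\<^esub> (p ^ s) = \<zero>\<^bsub>?B\<^esub>" unfolding b_def E.\<kappa>_R[OF f] .
  hence "\<kappa> (free_gen F h [^]\<^bsub>B.T\<^esub> (p ^ s)) = \<zero>\<^bsub>?B\<^esub>" using kpow[OF B.gen_closed[OF h]] by simp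
  hence "free_gen F h [^]\<^bsub>B.T\<^esub> (p ^ s) \<in> D.KK" using kzero B.gen_closed[OF h] by simp
  hence "l ((pmap H.AA ^^ s) (H.qQ h)) = \<zero>" by (rule D.detection[OF h])
  thus False using l(2) H.qQ_pow[OF h] by simp
qed

end

section \<open>Generators of the abelian quotient\<close>

text \<open>\<open>H/Q\<close> modulo its p-th powers is the part of the augmentation ideal seen by
  linear parts. A functional on it extends to a map on \<open>u(H)\<close> that is a derivation
  along a character, so it is determined on \<open>u(L)\<close> by its values on a finite spanning
  set of \<open>L\<close>.\<close>

lemma (in env_pair) AA_generated:
  assumes G0: "finite G0" "G0 \<subseteq> carrier L" "LinearCombinations.module.span F L G0 = carrier L"
  shows "\<exists>G. finite G \<and> G \<subseteq> carrier H.AA \<and>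
    (\<forall>a\<in>carrier H.AA. \<exists>b\<in>carrier H.AA. a \<ominus>\<^bsub>H.AA\<^esub> pmap H.AA b \<in> LinearCombinations.module.span F H.AA G)"
proof -
  interpret AF: frob_space F p H.AA "pmap H.AA" by (rule H.AA_frob_space) unfold_locales
  note qh = restricted_lie_homD[OF H.qQ_hom]
  have vsA: "vectorspace F H.AA" ..
  \<comment> \<open>Extended linearly, this takes the linear part of an element, with values in
    \<open>H/Q\<close>.\<close>
  let ?v = "\<lambda>w. case w of [h] \<Rightarrow> H.qQ h | _ \<Rightarrow> \<zero>\<^bsub>H.AA\<^esub>"
  interpret lin: word_ext_module F "carrier H" H.AA ?v
    using qh(1) by unfold_locales (auto split: list.split)
  have lin_gen: "lin.E (free_gen F h) = H.qQ h" if "h \<in> carrier H" for h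
    unfolding B.free_gen_sd using that qh(1) by (simp add: lin.E_sd)
  have lin_mult: "lin.E (f \<otimes>\<^bsub>B.T\<^esub> g) = f [] \<odot>\<^bsub>H.AA\<^esub> lin.E g \<oplus>\<^bsub>H.AA\<^esub> g [] \<odot>\<^bsub>H.AA\<^esub> lin.E f"
    if f: "f \<in> carrier B.T" and g: "g \<in> carrier B.T" for f g
    using f
  proof (induction f rule: B.T_induct)
    case zero
    show ?case using g lin.E_closed[OF g] B.T_val[OF g] by (simp add: lin.E_zero B.eval_Nil)
  next
    case (sd d u)
    note du = this
    have sdu: "B.sd d u \<in> carrier B.T" using B.sd_closed du by auto
    show ?case using g
    proof (induction g rule: B.T_induct)
      case zero
      show ?case using sdu lin.E_closed[OF sdu] B.T_val[OF sdu] du(1) by (simp add: lin.E_zero B.eval_Nil AF.A.smult_r_null)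
    next
      case (sd d' v)
      have vc: "?v u \<in> carrier H.AA" "?v v \<in> carrier H.AA" using lin.v_closed du sd by auto
      have "?v (u @ v) = (if u = [] then ?v v else if v = [] then ?v u else \<zero>\<^bsub>H.AA\<^esub>)"
        by (auto split: list.split simp: append_eq_Cons_conv)
      moreover have "d' \<odot>\<^bsub>H.AA\<^esub> (d \<odot>\<^bsub>H.AA\<^esub> y) = (d \<otimes> d') \<odot>\<^bsub>H.AA\<^esub> y" if "y \<in> carrier H.AA" for y
        using du(1) sd(1) that by (simp add: AF.A.smult_assoc1[symmetric] m_comm)
      ultimately show ?case using du sd vc
        by (cases "u = []"; cases "v = []")
          (simp_all add: B.sd_mult lin.E_sd B.eval_Nil AF.A.smult_assoc1 AF.A.smult_r_null AF.A.smult_l_null)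
    next
      case (add g1 g2)
      note cl = lin.E_closed[OF sdu] lin.E_closed[OF add(1)] lin.E_closed[OF add(2)]
        B.T_val[OF sdu, of "[]"] B.T_val[OF add(1), of "[]"] B.T_val[OF add(2), of "[]"]
      have "lin.E (B.sd d u \<otimes>\<^bsub>B.T\<^esub> (g1 \<oplus>\<^bsub>B.T\<^esub> g2)) = lin.E (B.sd d u \<otimes>\<^bsub>B.T\<^esub> g1) \<oplus>\<^bsub>H.AA\<^esub> lin.E (B.sd d u \<otimes>\<^bsub>B.T\<^esub> g2)"
        using add(1,2) sdu by (simp add: B.T_r_distr lin.E_add B.T_mult_closed)
      thus ?case using add cl
        by (simp add: lin.E_add B.eval_Nil(2) AF.A.smult_l_distr AF.A.smult_r_distr AF.A.M.a_ac)
    qed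
  next
    case (add f1 f2)
    note cl = lin.E_closed[OF g] lin.E_closed[OF add(1)] lin.E_closed[OF add(2)]
      B.T_val[OF g, of "[]"] B.T_val[OF add(1), of "[]"] B.T_val[OF add(2), of "[]"]
    have "lin.E ((f1 \<oplus>\<^bsub>B.T\<^esub> f2) \<otimes>\<^bsub>B.T\<^esub> g) = lin.E (f1 \<otimes>\<^bsub>B.T\<^esub> g) \<oplus>\<^bsub>H.AA\<^esub> lin.E (f2 \<otimes>\<^bsub>B.T\<^esub> g)"
      using add(1,2) g by (simp add: B.T_l_distr lin.E_add B.T_mult_closed)
    thus ?case using add cl
      by (simp add: lin.E_add B.eval_Nil(2) AF.A.smult_l_distr AF.A.smult_r_distr AF.A.M.a_ac)
  qed
  define G where "G = (\<lambda>x. lin.E (\<rho> (free_gen F x))) ` G0"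
  have Gc: "G \<subseteq> carrier H.AA" unfolding G_def using G0(2) lin.E_closed \<rho>_closed A.gen_closed by auto
  \<comment> \<open>A subspace because scalars have p-th roots; it is to be shown that it is
    everything.\<close>
  define W where "W = {w \<oplus>\<^bsub>H.AA\<^esub> pmap H.AA b | w b. w \<in> AF.A.span G \<and> b \<in> carrier H.AA}"
  note sp = subspaceD[OF AF.A.span_is_subspace[OF Gc]]
  have W: "subspace F W H.AA"
    unfolding subspace_iff[OF vsA]
  proof (intro conjI ballI)
    show "W \<subseteq> carrier H.AA" unfolding W_def using sp(1) AF.\<phi>_closed by auto
    have "\<zero>\<^bsub>H.AA\<^esub> = \<zero>\<^bsub>H.AA\<^esub> \<oplus>\<^bsub>H.AA\<^esub> pmap H.AA \<zero>\<^bsub>H.AA\<^esub>" using AF.\<phi>_zero by simp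
    thus "\<zero>\<^bsub>H.AA\<^esub> \<in> W" unfolding W_def using sp(2) AF.A.M.zero_closed by blast
    fix y assume "y \<in> W"
    then obtain w b where y: "w \<in> AF.A.span G" "b \<in> carrier H.AA" "y = w \<oplus>\<^bsub>H.AA\<^esub> pmap H.AA b" unfolding W_def by auto
    have wc: "w \<in> carrier H.AA" using y sp(1) by auto
    show "c \<odot>\<^bsub>H.AA\<^esub> y \<in> W" if c: "c \<in> carrier F" for c
    proof -
      have "c \<odot>\<^bsub>H.AA\<^esub> y = c \<odot>\<^bsub>H.AA\<^esub> w \<oplus>\<^bsub>H.AA\<^esub> pmap H.AA (frt c \<odot>\<^bsub>H.AA\<^esub> b)"
        using y wc c frt[OF c] AF.\<phi>_smult[of "frt c" b] AF.\<phi>_closed by (simp add: AF.A.smult_r_distr)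
      thus ?thesis unfolding W_def using sp(4)[OF c y(1)] y(2) frt[OF c] AF.A.smult_closed by blast
    qed
    fix z assume "z \<in> W"
    then obtain w' b' where z: "w' \<in> AF.A.span G" "b' \<in> carrier H.AA" "z = w' \<oplus>\<^bsub>H.AA\<^esub> pmap H.AA b'" unfolding W_def by auto
    have wc': "w' \<in> carrier H.AA" using z sp(1) by auto
    have "y \<oplus>\<^bsub>H.AA\<^esub> z = (w \<oplus>\<^bsub>H.AA\<^esub> w') \<oplus>\<^bsub>H.AA\<^esub> pmap H.AA (b \<oplus>\<^bsub>H.AA\<^esub> b')"
      using y z wc wc' AF.\<phi>_closed by (simp add: AF.\<phi>_add AF.A.M.a_ac)
    thus "y \<oplus>\<^bsub>H.AA\<^esub> z \<in> W" unfolding W_def using sp(3)[OF y(1) z(1)] y(2) z(2) AF.A.M.a_closed by blast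
  qed
  have GW: "w \<in> W" if "w \<in> AF.A.span G" for w
  proof -
    have "w = w \<oplus>\<^bsub>H.AA\<^esub> pmap H.AA \<zero>\<^bsub>H.AA\<^esub>" using AF.\<phi>_zero sp(1) that by auto
    thus ?thesis unfolding W_def using that AF.A.M.zero_closed by blast
  qed
  have \<phi>W: "pmap H.AA b \<in> W" if "b \<in> carrier H.AA" for b
  proof -
    have "pmap H.AA b = \<zero>\<^bsub>H.AA\<^esub> \<oplus>\<^bsub>H.AA\<^esub> pmap H.AA b" using AF.\<phi>_closed that by simp
    thus ?thesis unfolding W_def using that sp(2) by blast
  qed
  have all: "a \<in> W" if a: "a \<in> carrier H.AA" for a
  proof (rule ccontr)
    assume "a \<notin> W"
    then obtain l where l: "lin_functional F H.AA l" and lW: "\<forall>x\<in>W. l x = \<zero>" and la: "l a = \<one>"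
      using AF.A.separating_functional[OF W a] by auto
    note lD = lin_functionalD[OF l]
    let ?\<kappa> = "\<lambda>g. l (lin.E g)"
    have \<kappa>_mult: "?\<kappa> (f \<otimes>\<^bsub>B.T\<^esub> g) = f [] \<otimes> ?\<kappa> g \<oplus> g [] \<otimes> ?\<kappa> f" if "f \<in> carrier B.T" "g \<in> carrier B.T" for f g
      unfolding lin_mult[OF that] using lin.E_closed that B.T_val lD by simp
    have \<kappa>_minus: "?\<kappa> (f \<ominus>\<^bsub>B.T\<^esub> g) = ?\<kappa> f \<ominus> ?\<kappa> g" if "f \<in> carrier B.T" "g \<in> carrier B.T" for f g
      using that lin.E_closed lD B.T_smult_closed[of "\<ominus> \<one>" g]
      by (simp add: a_minus_def B.T_minus_smult lin.E_add lin.E_smult l_minus)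
    \<comment> \<open>Augmentation zero is included: the derivation rule then makes the set absorb
      products.\<close>
    let ?N = "{g \<in> carrier B.T. g [] = \<zero> \<and> ?\<kappa> g = \<zero>}"
    have lz: "l \<zero>\<^bsub>H.AA\<^esub> = \<zero>" using lW subspaceD(2)[OF W] by auto
    have "ideal ?N B.T"
    proof (rule B.T_idealI)
      fix f u assume f: "f \<in> ?N" and u: "u \<in> carrier B.T"
      show "u \<otimes>\<^bsub>B.T\<^esub> f \<in> ?N" "f \<otimes>\<^bsub>B.T\<^esub> u \<in> ?N"
        using f u \<kappa>_mult B.T_val lD(1)[OF lin.E_closed[OF u]] by (auto simp: B.eval_Nil)
    qed (auto simp: B.eval_Nil lin.E_zero lz lin.E_add lD lin.E_closed)
    moreover have "env_relation_families F H ?N"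
    proof -
      have kg: "?\<kappa> (free_gen F h) = l (H.qQ h)" if "h \<in> carrier H" for h using lin_gen that by simp
      have gp: "?\<kappa> (free_gen F h [^]\<^bsub>B.T\<^esub> p) = \<zero>" "(free_gen F h [^]\<^bsub>B.T\<^esub> p) [] = \<zero>" if h: "h \<in> carrier H" for h
      proof -
        obtain m where m: "p = Suc (Suc m)" using p_gt_1 by (metis One_nat_def less_imp_Suc_add add_Suc_right plus_1_eq_Suc)
        have g: "free_gen F h \<in> carrier B.T" using B.gen_closed h .
        have g': "free_gen F h [^]\<^bsub>B.T\<^esub> Suc m \<in> carrier B.T" by (rule B.T.nat_pow_closed[OF g])
        have e: "(free_gen F h [^]\<^bsub>B.T\<^esub> Suc m) [] = \<zero>" using g by (simp add: B.eval_Nil B.T_val)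
        have "free_gen F h [^]\<^bsub>B.T\<^esub> p = (free_gen F h [^]\<^bsub>B.T\<^esub> Suc m) \<otimes>\<^bsub>B.T\<^esub> free_gen F h" unfolding m by simp
        thus "?\<kappa> (free_gen F h [^]\<^bsub>B.T\<^esub> p) = \<zero>"
          using \<kappa>_mult[OF g' g] e lD(1)[OF lin.E_closed[OF g]] lD(1)[OF lin.E_closed[OF g']] by (simp add: B.eval_Nil)
        show "(free_gen F h [^]\<^bsub>B.T\<^esub> p) [] = \<zero>"
          using g p_pos by (simp add: B.eval_Nil_pow B.eval_Nil nat_pow_zero)
      qed
      show ?thesis
        unfolding env_relation_families_def Let_def char_eq
      proof (intro conjI ballI CollectI)
        fix h h' assume h: "h \<in> carrier H" "h' \<in> carrier H"
        note g = B.gen_closed[OF h(1)] B.gen_closed[OF h(2)] B.gen_closed[OF H.M.a_closed[OF h]] B.gen_closed[OF H.bracket_closed[OF h]]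
        note q = qh(1)[OF h(1)] qh(1)[OF h(2)]
        show "free_gen F (h \<oplus>\<^bsub>H\<^esub> h') \<ominus>\<^bsub>B.T\<^esub> (free_gen F h \<oplus>\<^bsub>B.T\<^esub> free_gen F h') \<in> carrier B.T" using g by simp
        show "(free_gen F (h \<oplus>\<^bsub>H\<^esub> h') \<ominus>\<^bsub>B.T\<^esub> (free_gen F h \<oplus>\<^bsub>B.T\<^esub> free_gen F h')) [] = \<zero>"
          using g by (simp add: B.eval_Nil_minus B.eval_Nil)
        show "?\<kappa> (free_gen F (h \<oplus>\<^bsub>H\<^esub> h') \<ominus>\<^bsub>B.T\<^esub> (free_gen F h \<oplus>\<^bsub>B.T\<^esub> free_gen F h')) = \<zero>"
          using g h q qh(2) by (simp add: \<kappa>_minus lin.E_add lin_gen lD)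
        let ?D = "free_gen F h \<otimes>\<^bsub>B.T\<^esub> free_gen F h' \<ominus>\<^bsub>B.T\<^esub> free_gen F h' \<otimes>\<^bsub>B.T\<^esub> free_gen F h \<ominus>\<^bsub>B.T\<^esub> free_gen F (h \<otimes>\<^bsub>H\<^esub> h')"
        show "?D \<in> carrier B.T" using g by simp
        show "?D [] = \<zero>" using g by (simp add: B.eval_Nil_minus B.eval_Nil)
        have "?\<kappa> (free_gen F (h \<otimes>\<^bsub>H\<^esub> h')) = \<zero>"
          using lin_gen[OF H.bracket_closed[OF h]] H.qQ_bracket[OF h] lz by simp
        thus "?\<kappa> ?D = \<zero>" using g q h lD(1)[OF q(1)] lD(1)[OF q(2)] by (simp add: \<kappa>_minus \<kappa>_mult B.eval_Nil lin_gen)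
      next
        fix c h assume c: "c \<in> carrier F" and h: "h \<in> carrier H"
        note g = B.gen_closed[OF h] B.gen_closed[OF H.smult_closed[OF c h]]
        show "free_gen F (c \<odot>\<^bsub>H\<^esub> h) \<ominus>\<^bsub>B.T\<^esub> c \<odot>\<^bsub>B.T\<^esub> free_gen F h \<in> carrier B.T" using g c by simp
        show "(free_gen F (c \<odot>\<^bsub>H\<^esub> h) \<ominus>\<^bsub>B.T\<^esub> c \<odot>\<^bsub>B.T\<^esub> free_gen F h) [] = \<zero>"
          using g c by (simp add: B.eval_Nil_minus B.eval_Nil)
        show "?\<kappa> (free_gen F (c \<odot>\<^bsub>H\<^esub> h) \<ominus>\<^bsub>B.T\<^esub> c \<odot>\<^bsub>B.T\<^esub> free_gen F h) = \<zero>"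
          using g c h qh(1)[OF h] qh(3)[OF c h] by (simp add: \<kappa>_minus lin.E_smult lin_gen lD)
      next
        fix h assume h: "h \<in> carrier H"
        note g = B.gen_closed[OF h] B.gen_closed[OF H.pmap_closed[OF h]]
        show "free_gen F h [^]\<^bsub>B.T\<^esub> p \<ominus>\<^bsub>B.T\<^esub> free_gen F (pmap H h) \<in> carrier B.T" using g by simp
        show "(free_gen F h [^]\<^bsub>B.T\<^esub> p \<ominus>\<^bsub>B.T\<^esub> free_gen F (pmap H h)) [] = \<zero>"
          using g gp[OF h] by (simp add: B.eval_Nil_minus B.eval_Nil)
        \<comment> \<open>This is why \<open>W\<close> contains the image of the p-map: the other
          half of the relation is a product and has no linear part.\<close>
        have "?\<kappa> (free_gen F (pmap H h)) = \<zero>"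
          using lin_gen[OF H.pmap_closed[OF h]] qh(5)[OF h] lW \<phi>W qh(1)[OF h] by simp
        thus "?\<kappa> (free_gen F h [^]\<^bsub>B.T\<^esub> p \<ominus>\<^bsub>B.T\<^esub> free_gen F (pmap H h)) = \<zero>"
          using g gp[OF h] by (simp add: \<kappa>_minus)
      qed
    qed
    ultimately have kill: "env_ideal F H \<subseteq> ?N" by (rule H.env_ideal_le)
    interpret E: env_map F p L H R F ?\<kappa>
      by unfold_locales (use kill lD lin.E_closed lin.E_add in auto)
    have \<chi>_sm: "E.\<chi> (c \<odot>\<^bsub>L\<^esub> x) = c \<otimes> E.\<chi> x" if "c \<in> carrier F" "x \<in> carrier L" for c x
      using E.\<chi>_smult[OF that] that \<rho>_closed A.gen_closed lin.E_closed
      unfolding E.\<chi>_def by (simp add: lin.E_smult lD)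
    let ?K = "{x \<in> carrier L. E.\<chi> x = \<zero>}"
    have K: "subspace F ?K L" unfolding subspace_iff[OF L.vs] by (auto simp: E.\<chi>_zero E.\<chi>_add \<chi>_sm)
    have GK: "G0 \<subseteq> ?K"
    proof
      fix x assume x: "x \<in> G0"
      have "lin.E (\<rho> (free_gen F x)) \<in> AF.A.span G"
        using AF.A.in_own_span[OF Gc] x unfolding G_def by blast
      hence "E.\<chi> x = \<zero>" unfolding E.\<chi>_def using lW GW by blast
      thus "x \<in> ?K" using x G0(2) by auto
    qed
    have "carrier L \<subseteq> ?K" using subspace_span_le[OF L.vs K GK] unfolding G0(3) .
    hence \<chi>0: "E.\<chi> x = \<zero>" if "x \<in> carrier L" for x using that by auto
    \<comment> \<open>The functional vanishes on the images of the letters; by the derivation rule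
      it then vanishes on all words.\<close>
    have "?\<kappa> (\<rho> f) = \<zero>" if "f \<in> carrier A.T" for f
      using that
    proof (induction f rule: A.T_induct)
      case zero
      have "?\<kappa> (\<rho> \<zero>\<^bsub>A.T\<^esub>) = ?\<kappa> (\<zero> \<odot>\<^bsub>B.T\<^esub> \<rho> \<one>\<^bsub>A.T\<^esub>)"
        using E.\<kappa>\<rho>_smult[OF zero_closed A.T.one_closed] unfolding A.T.smult_l_null[OF A.T.one_closed] .
      also have "\<dots> = \<zero>" unfolding B.T.smult_l_null[OF \<rho>_closed[OF A.T.one_closed]] lin.E_zero by (rule lz)
      finally show ?case .
    next
      case (sd d w)
      from sd(2) show ?case
      proof (induction w rule: list.induct)
        case Nil
        have "?\<kappa> \<one>\<^bsub>B.T\<^esub> = \<zero>" unfolding B.T_simps(2) using lz by (simp add: lin.E_sd)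
        hence k1: "?\<kappa> (\<rho> \<one>\<^bsub>A.T\<^esub>) = \<zero>" using E.\<kappa>\<rho>_one by (rule trans[rotated])
        have "?\<kappa> (\<rho> (d \<odot>\<^bsub>A.T\<^esub> \<one>\<^bsub>A.T\<^esub>)) = ?\<kappa> (d \<odot>\<^bsub>B.T\<^esub> \<rho> \<one>\<^bsub>A.T\<^esub>)"
          by (rule E.\<kappa>\<rho>_smult[OF sd(1) A.T.one_closed])
        also have "\<dots> = d \<otimes> ?\<kappa> (\<rho> \<one>\<^bsub>A.T\<^esub>)"
          unfolding lin.E_smult[OF sd(1) \<rho>_closed[OF A.T.one_closed]]
          by (rule lD(3)[OF sd(1) lin.E_closed[OF \<rho>_closed[OF A.T.one_closed]]])
        finally show ?case unfolding A.sd_Nil[OF sd(1)] k1 using sd(1) by simp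
      next
        case (Cons x u)
        hence xu: "x \<in> carrier L" "A.sd d u \<in> carrier A.T" "u \<in> lists (carrier L)" using sd(1) A.sd_closed by auto
        have g: "free_gen F x \<in> carrier A.T" using A.gen_closed xu(1) .
        have "?\<kappa> (\<rho> (A.sd d (x # u))) = ?\<kappa> (\<rho> (free_gen F x) \<otimes>\<^bsub>B.T\<^esub> \<rho> (A.sd d u))"
          unfolding A.sd_Cons[OF sd(1)] by (rule E.\<kappa>\<rho>_mult[OF g xu(2)])
        also have "\<dots> = \<zero>"
          using \<kappa>_mult[OF \<rho>_closed[OF g] \<rho>_closed[OF xu(2)]] \<chi>0[OF xu(1)] Cons.IH xu(3) B.T_val[OF \<rho>_closed[OF g]]
            B.T_val[OF \<rho>_closed[OF xu(2)]]
          unfolding E.\<chi>_def by simp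
        finally show ?case .
      qed
    next
      case (add f g) thus ?case using E.\<kappa>\<rho>_add by simp
    qed
    moreover obtain h where h: "h \<in> carrier H" "a = H.qQ h" using a unfolding H.AA_carrier by auto
    moreover obtain f where f: "R f (free_gen F h)" using R_ex' B.gen_closed[OF h(1)] by blast
    ultimately have "l a = \<zero>" using E.\<kappa>_R[OF f] R_carrier(1)[OF f] lin_gen[OF h(1)] by simp
    thus False using la by simp
  qed
  have "\<exists>b\<in>carrier H.AA. a \<ominus>\<^bsub>H.AA\<^esub> pmap H.AA b \<in> AF.A.span G" if a: "a \<in> carrier H.AA" for a
  proof -
    obtain w b where wb: "w \<in> AF.A.span G" "b \<in> carrier H.AA" "a = w \<oplus>\<^bsub>H.AA\<^esub> pmap H.AA b"
      using all[OF a] unfolding W_def by auto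
    have "w \<in> carrier H.AA" using wb sp(1) by auto
    hence "a \<ominus>\<^bsub>H.AA\<^esub> pmap H.AA b = w"
      using wb AF.\<phi>_closed[OF wb(2)] by (simp add: a_minus_def AF.A.M.a_assoc AF.A.M.r_neg)
    thus ?thesis using wb(1,2) by (intro bexI[of _ b]) simp_all
  qed
  thus ?thesis using G0(1) Gc unfolding G_def by (intro exI[of _ G]) (auto simp: G_def)
qed

text \<open>For the reverse comparison the target is \<open>L\<close>, whose quotient is
  finite-dimensional, so \<open>b = \<zero>\<close> serves.\<close>

lemma (in restricted_lie_algebra) AA_generated_self:
  assumes G0: "finite G0" "G0 \<subseteq> carrier L" "span G0 = carrier L"
  shows "\<exists>G. finite G \<and> G \<subseteq> carrier AA \<and>
    (\<forall>a\<in>carrier AA. \<exists>b\<in>carrier AA. a \<ominus>\<^bsub>AA\<^esub> pmap AA b \<in> LinearCombinations.module.span F AA G)"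
proof (intro exI[of _ "qQ ` G0"] conjI ballI)
  interpret A: restricted_lie_algebra F AA by (rule AA)
  note qh = restricted_lie_homD[OF qQ_hom]
  show "finite (qQ ` G0)" using G0 by simp
  show sub: "qQ ` G0 \<subseteq> carrier AA" using G0(2) qh(1) by auto
  fix a assume "a \<in> carrier AA"
  then obtain x where x: "x \<in> carrier L" "a = qQ x" unfolding AA_carrier by auto
  note sp = subspaceD[OF A.span_is_subspace[OF sub]]
  let ?K = "{x \<in> carrier L. qQ x \<in> A.span (qQ ` G0)}"
  have z: "qQ \<zero> = \<zero>\<^bsub>AA\<^esub>" using qQ_zero[of \<zero>] subspaceD(2)[OF QQ_subspace] by simp
  have K: "subspace F ?K L"
    unfolding subspace_iff[OF vs] using sp z qh(2,3) by auto
  have GK: "G0 \<subseteq> ?K" using G0(2) A.in_own_span[OF sub] by auto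
  have "carrier L \<subseteq> ?K" using subspace_span_le[OF vs K GK] unfolding G0(3) .
  hence "a \<in> A.span (qQ ` G0)" using x by auto
  thus "\<exists>b\<in>carrier AA. a \<ominus>\<^bsub>AA\<^esub> pmap AA b \<in> A.span (qQ ` G0)"
    using sp(1) by (intro bexI[of _ "\<zero>\<^bsub>AA\<^esub>"]) (auto simp: A.pmap_zero)
qed

section \<open>The comparison homomorphism\<close>

context restricted_lie_algebra
begin

abbreviation "MM \<equiv> quot_lie L JJ"
abbreviation "qJ \<equiv> \<lambda>x. JJ +>\<^bsub>L\<^esub> x"

lemma \<gamma>3_JJ: "x \<in> \<gamma>3 \<Longrightarrow> x \<in> JJ"
proof -
  assume x: "x \<in> \<gamma>3"
  have "x = \<zero> \<oplus> x" using x \<gamma>3_le \<gamma>2_carrier by auto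
  moreover have "\<zero> \<in> P2" using subspaceD(2)[OF restricted_subalgebraD(1)[OF P2_subalgebra]] .
  ultimately show ?thesis unfolding set_add_iff using x by blast
qed

lemma P2_JJ: "x \<in> P2 \<Longrightarrow> x \<in> JJ"
proof -
  assume x: "x \<in> P2"
  have "x = x \<oplus> \<zero>" using x P2_carrier by auto
  thus ?thesis unfolding set_add_iff using x subspaceD(2)[OF \<gamma>3_subspace] by blast
qed

lemma JJ_subspace: "subspace F JJ L"
  using JJ_ideal unfolding restricted_ideal_def lie_ideal_def by auto

lemma qJ:
  shows qJ_hom: "qJ \<in> restricted_lie_hom F L MM"
    and MM: "restricted_lie_algebra F MM"
    and MM_carrier: "carrier MM = qJ ` carrier L"
    and qJ_zero: "x \<in> carrier L \<Longrightarrow> qJ x = \<zero>\<^bsub>MM\<^esub> \<longleftrightarrow> x \<in> JJ"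
  using quot_lie[OF JJ_ideal] by auto

text \<open>The p-th powers of \<open>\<gamma>2\<close> and the brackets of \<open>\<gamma>2\<close>
  with \<open>L\<close> both lie in J.\<close>

lemma MM_class2: "class2_lie F MM (qJ ` \<gamma>2)"
proof -
  interpret M: restricted_lie_algebra F MM by (rule MM)
  note h = restricted_lie_homD[OF qJ_hom]
  note V = subspaceD[OF \<gamma>2_subspace]
  have z: "qJ \<zero> = \<zero>\<^bsub>MM\<^esub>" using qJ_zero[of \<zero>] subspaceD(2)[OF JJ_subspace] by simp
  have sub: "subspace F (qJ ` \<gamma>2) MM"
  proof -
    have 1: "qJ ` \<gamma>2 \<subseteq> carrier MM" using h(1) V(1) by auto
    have 2: "\<zero>\<^bsub>MM\<^esub> \<in> qJ ` \<gamma>2" using z[symmetric] V(2) by (rule image_eqI)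
    have 3: "c \<odot>\<^bsub>MM\<^esub> u \<in> qJ ` \<gamma>2" if c: "c \<in> carrier F" and u: "u \<in> qJ ` \<gamma>2" for c u
    proof -
      obtain a where a: "a \<in> \<gamma>2" "u = qJ a" using u by (elim imageE)
      show ?thesis using h(3)[OF c subsetD[OF V(1) a(1)]] V(4)[OF c a(1)] unfolding a(2) by (metis image_eqI)
    qed
    have 4: "u \<oplus>\<^bsub>MM\<^esub> v \<in> qJ ` \<gamma>2" if u: "u \<in> qJ ` \<gamma>2" and v: "v \<in> qJ ` \<gamma>2" for u v
    proof -
      obtain a b where a: "a \<in> \<gamma>2" "u = qJ a" and b: "b \<in> \<gamma>2" "v = qJ b" using u v by (elim imageE)
      show ?thesis using h(2)[OF subsetD[OF V(1) a(1)] subsetD[OF V(1) b(1)]] V(3)[OF a(1) b(1)]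
        unfolding a(2) b(2) by (metis image_eqI)
    qed
    show ?thesis unfolding subspace_iff[OF M.vs] using 1 2 3 4 by simp
  qed
  show ?thesis
  proof (intro class2_lie.intro class2_lie_axioms.intro MM sub)
    fix w assume "w \<in> qJ ` \<gamma>2"
    then obtain a where a: "a \<in> \<gamma>2" "w = qJ a" by auto
    hence aL: "a \<in> carrier L" using V(1) by auto
    show "pmap MM w = \<zero>\<^bsub>MM\<^esub>"
      using h(5)[OF aL] qJ_zero[OF pmap_closed[OF aL]] P2_JJ[OF pmap_in_P2[OF a(1)]] a(2) by simp
    fix x assume "x \<in> carrier MM"
    then obtain b where b: "b \<in> carrier L" "x = qJ b" unfolding MM_carrier by auto
    show "w \<otimes>\<^bsub>MM\<^esub> x = \<zero>\<^bsub>MM\<^esub>"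
      using h(4)[OF aL b(1)] qJ_zero[OF bracket_closed[OF aL b(1)]] \<gamma>3_JJ[OF bracket_in_\<gamma>3[OF a(1) b(1)]] a(2) b(2) by simp
  next
    fix x y assume "x \<in> carrier MM" "y \<in> carrier MM"
    then obtain a b where ab: "a \<in> carrier L" "x = qJ a" "b \<in> carrier L" "y = qJ b" unfolding MM_carrier by auto
    show "x \<otimes>\<^bsub>MM\<^esub> y \<in> qJ ` \<gamma>2"
      using h(4)[OF ab(1,3)] bracket_in_\<gamma>2[OF ab(1,3)] ab by (metis image_eqI)
  qed
qed

text \<open>The \<open>P2\<close> part of Q dies in the quotient by J, so membership in Q becomes
  membership in \<open>Z\<close>.\<close>

lemma qJ_QQ: assumes "u \<in> QQ" shows "qJ u \<in> qJ ` \<gamma>2"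
proof -
  interpret M: restricted_lie_algebra F MM by (rule MM)
  note h = restricted_lie_homD[OF qJ_hom]
  obtain a g where ag: "a \<in> P2" "g \<in> \<gamma>2" "u = a \<oplus> g" using assms unfolding set_add_iff by auto
  hence c: "a \<in> carrier L" "g \<in> carrier L" using P2_carrier \<gamma>2_carrier by auto
  have "qJ u = \<zero>\<^bsub>MM\<^esub> \<oplus>\<^bsub>MM\<^esub> qJ g" using h(2)[OF c] qJ_zero[OF c(1)] P2_JJ[OF ag(1)] ag(3) by simp
  thus ?thesis using h(1)[OF c(2)] ag(2) by simp
qed

lemma qJ_pow: "x \<in> carrier L \<Longrightarrow> (pmap MM ^^ s) (qJ x) = qJ ((pmap L ^^ s) x)"
  by (induction s) (auto simp: restricted_lie_homD(5)[OF qJ_hom, symmetric] pmap_pow_closed)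

end

lemma restricted_lie_hom_finsum:
  assumes "restricted_lie_algebra F L" "restricted_lie_algebra F M" "h \<in> restricted_lie_hom F L M"
    and "finite I" "\<And>i. i \<in> I \<Longrightarrow> f i \<in> carrier L"
  shows "h (finsum L f I) = finsum M (\<lambda>i. h (f i)) I"
proof -
  interpret L: restricted_lie_algebra F L by fact
  interpret M: restricted_lie_algebra F M by fact
  note h = restricted_lie_homD[OF assms(3)]
  show ?thesis using assms(4,5)
  proof (induction I rule: finite_induct)
    case empty
    have "h \<zero>\<^bsub>L\<^esub> = \<zero>\<^bsub>M\<^esub>" using h(3)[of "\<zero>\<^bsub>F\<^esub>" "\<zero>\<^bsub>L\<^esub>"] h(1)[of "\<zero>\<^bsub>L\<^esub>"] by simp
    thus ?case by simp
  next
    case (insert a I)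
    have *: "f \<in> I \<rightarrow> carrier L" "f a \<in> carrier L" "(\<lambda>i. h (f i)) \<in> I \<rightarrow> carrier M" "h (f a) \<in> carrier M"
      using insert.prems h(1) by auto
    show ?case using insert * by (simp add: h(2))
  qed
qed

lemma (in lie_retraction) NN_families: "env_relation_families F H NN"
proof -
  have aR: "a i k (f \<ominus>\<^bsub>FA.T\<^esub> g) = a i k f \<ominus> a i k g"
    if "i < r" "f \<in> carrier FA.T" "g \<in> carrier FA.T" for i k f g
    using that a_closed'[OF that(1)] by (simp add: a_minus_def FA.T_minus_smult a_add a_smult l_minus)
  have \<pi>R: "\<pi> (f \<ominus>\<^bsub>FA.T\<^esub> g) = \<pi> f \<ominus>\<^bsub>M\<^esub> \<pi> g"
    if "f \<in> carrier FA.T" "g \<in> carrier FA.T" for f g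
    using that \<pi>_closed M.smult_minus_1[of "\<pi> g"] by (simp add: a_minus_def FA.T_minus_smult \<pi>_add \<pi>_smult)
  have \<epsilon>R: "\<epsilon> (f \<ominus>\<^bsub>FA.T\<^esub> g) = \<epsilon> f \<ominus> \<epsilon> g" if "f \<in> carrier FA.T" "g \<in> carrier FA.T" for f g
    unfolding \<epsilon>_def using FA.eval_Nil_minus[OF that] .
  have \<epsilon>g: "\<epsilon> (free_gen F h) = \<zero>" for h unfolding \<epsilon>_def by (simp add: FA.eval_Nil)
  note qh = restricted_lie_homD[OF q]
  show ?thesis
    unfolding env_relation_families_def Let_def char_eq NN_def
  proof (intro conjI ballI CollectI allI impI)
    fix h h' assume h: "h \<in> carrier H" "h' \<in> carrier H"
    note g = gen_closed[OF h(1)] gen_closed[OF h(2)] gen_closed[OF H.M.a_closed[OF h]] gen_closed[OF H.bracket_closed[OF h]]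
    let ?D = "free_gen F (h \<oplus>\<^bsub>H\<^esub> h') \<ominus>\<^bsub>FA.T\<^esub> (free_gen F h \<oplus>\<^bsub>FA.T\<^esub> free_gen F h')"
    show "?D \<in> carrier FA.T" using g by simp
    show "\<epsilon> ?D = \<zero>" using g by (simp add: \<epsilon>R \<epsilon>_add \<epsilon>g)
    show "a i k ?D = \<zero>" if "i < r" for i k
      using g h lin_functionalD(2)[OF c_functional[OF that, of k] h] lin_functionalD(1)[OF c_functional[OF that, of k]]
      by (simp add: aR[OF that] a_add[OF that] a_gen[OF that])
    show "\<pi> ?D = \<zero>\<^bsub>M\<^esub>" using g h qh(1,2) by (simp add: \<pi>R \<pi>_add \<pi>_gen)
    let ?E = "free_gen F h \<otimes>\<^bsub>FA.T\<^esub> free_gen F h' \<ominus>\<^bsub>FA.T\<^esub> free_gen F h' \<otimes>\<^bsub>FA.T\<^esub> free_gen F h \<ominus>\<^bsub>FA.T\<^esub> free_gen F (h \<otimes>\<^bsub>H\<^esub> h')"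
    show "?E \<in> carrier FA.T" using g by simp
    show "\<epsilon> ?E = \<zero>" using g by (simp add: \<epsilon>R \<epsilon>_mult \<epsilon>g)
    show "a i k ?E = \<zero>" if "i < r" for i k
    proof -
      note m = FA.T_mult_closed[OF g(1,2)] FA.T_mult_closed[OF g(2,1)]
      show ?thesis
        unfolding aR[OF that FA.T.minus_closed[OF m] g(4)] aR[OF that m] a_comm'[OF that g(1,2)]
          a_gen[OF that H.bracket_closed[OF h]] c_bracket[OF that h]
        using a_closed'[OF that m(2), of k] by (simp add: a_minus_def r_neg)
    qed
    show "\<pi> ?E = \<zero>\<^bsub>M\<^esub>"
    proof -
      have "\<pi> ?E = \<pi> (free_gen F h) \<otimes>\<^bsub>M\<^esub> \<pi> (free_gen F h') \<ominus>\<^bsub>M\<^esub> \<pi> (free_gen F (h \<otimes>\<^bsub>H\<^esub> h'))"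
        using \<pi>_commutator[OF g(1) \<epsilon>g g(2) \<epsilon>g] g by (simp add: \<pi>R)
      thus ?thesis using h qh(1,4) M.bracket_closed by (simp add: \<pi>_gen H.bracket_closed)
    qed
  next
    fix d h assume d: "d \<in> carrier F" and h: "h \<in> carrier H"
    note g = gen_closed[OF h] gen_closed[OF H.smult_closed[OF d h]]
    let ?D = "free_gen F (d \<odot>\<^bsub>H\<^esub> h) \<ominus>\<^bsub>FA.T\<^esub> d \<odot>\<^bsub>FA.T\<^esub> free_gen F h"
    show "?D \<in> carrier FA.T" using g d by simp
    show "\<epsilon> ?D = \<zero>" using g d by (simp add: \<epsilon>R \<epsilon>_smult \<epsilon>g)
    show "a i k ?D = \<zero>" if "i < r" for i k
      using g d h lin_functionalD(3)[OF c_functional[OF that, of k] d h] lin_functionalD(1)[OF c_functional[OF that, of k] h]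
      by (simp add: aR[OF that] a_smult[OF that] a_gen[OF that])
    show "\<pi> ?D = \<zero>\<^bsub>M\<^esub>" using g d h qh(1,3) by (simp add: \<pi>R \<pi>_smult \<pi>_gen)
  next
    fix h assume h: "h \<in> carrier H"
    note g = gen_closed[OF h] gen_closed[OF H.pmap_closed[OF h]]
    let ?D = "free_gen F h [^]\<^bsub>FA.T\<^esub> p \<ominus>\<^bsub>FA.T\<^esub> free_gen F (pmap H h)"
    show "?D \<in> carrier FA.T" using g by simp
    show "\<epsilon> ?D = \<zero>"
      using g p_pos FA.eval_Nil_pow[OF g(1), of p] by (simp add: \<epsilon>R \<epsilon>g) (simp add: \<epsilon>_def FA.eval_Nil nat_pow_zero)
    \<comment> \<open>Only below the critical degree: there the coordinates of the p-th power of
      \<open>h\<close> are the Frobenius coefficients.\<close>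
    show "a i k ?D = \<zero>" if i: "i < r" and k: "k < p ^ n i" for i k
    proof -
      have e: "a i k (free_gen F h [^]\<^bsub>FA.T\<^esub> p) = c i k (pmap H h)"
        unfolding a_frob[OF i g(1)] c_pmap[OF i k h] a_gen[OF i h] ..
      have "c i k (pmap H h) \<in> carrier F"
        using lin_functionalD(1)[OF c_functional[OF i, of k] H.pmap_closed[OF h]] .
      thus ?thesis unfolding aR[OF i T_pow_closed[OF g(1)] g(2)] e a_gen[OF i H.pmap_closed[OF h]]
        by (simp add: a_minus_def r_neg)
    qed
    show "\<pi> ?D = \<zero>\<^bsub>M\<^esub>"
      using g h \<pi>_frob[OF g(1) \<epsilon>g] qh(1,5) M.pmap_closed by (simp add: \<pi>R \<pi>_gen H.pmap_closed)
  qed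
qed

lemma (in lie_retraction) \<pi>_kill: "f \<in> env_ideal F H \<Longrightarrow> \<pi> f = \<zero>\<^bsub>M\<^esub>"
  using H.env_ideal_le[OF NN_ideal NN_families] unfolding NN_def by auto

text \<open>The Jordan data live on the quotient by Q. The coordinates are pulled back, the
  generators are lifted to \<open>L\<close> and pushed to the quotient by J; identities modulo Q
  become identities modulo \<open>Z\<close>.\<close>

lemma (in restricted_lie_algebra) retraction_exists:
  assumes P: "perfect_char_p F p'" and nil: "nilQ s"
    and G: "finite G" "G \<subseteq> carrier AA"
      "\<forall>a\<in>carrier AA. \<exists>b\<in>carrier AA. a \<ominus>\<^bsub>AA\<^esub> pmap AA b \<in> LinearCombinations.module.span F AA G"
  shows "\<exists>r x n c. lie_retraction F p' L MM (qJ ` \<gamma>2) qJ r x n c"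
proof -
  interpret P: perfect_char_p F p' by (rule P)
  interpret AF: frob_space F p' AA "pmap AA" by (rule AA_frob_space[OF P])
  interpret AR: restricted_lie_algebra F AA by (rule AA)
  note fc = M.finsum_closed
  interpret M: class2_lie F MM "qJ ` \<gamma>2" by (rule MM_class2)
  note qh = restricted_lie_homD[OF qQ_hom] and jh = restricted_lie_homD[OF qJ_hom]
  have nilA: "(pmap AA ^^ s) a = \<zero>\<^bsub>AA\<^esub>" if aA: "a \<in> carrier AA" for a
  proof -
    obtain x where x: "x \<in> carrier L" "a = qQ x" using aA unfolding AA_carrier by (elim imageE)
    have "(pmap L ^^ s) x \<in> QQ" using nil x(1) unfolding nilQ_def by blast
    thus ?thesis unfolding x(2) qQ_pow[OF x(1)] qQ_zero[OF pmap_pow_closed[OF x(1)]] .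
  qed
  interpret AG: frob_space_generated F p' AA "pmap AA" s G
    using nilA G by unfold_locales auto
  obtain r x n c where jd: "AF.jordan_data (\<lambda>a. a) r x n c" using AG.jordan_exists by blast
  have jx: "x i \<in> carrier AA" "n i > 0" "(pmap AA ^^ n i) (x i) = \<zero>\<^bsub>AA\<^esub>" "lin_functional F AA (c i k)"
    "(\<And>j. j < n i \<Longrightarrow> k \<noteq> p' ^ j) \<Longrightarrow> c i k a = \<zero>\<^bsub>F\<^esub>"
    "\<lbrakk>k < p' ^ n i; a \<in> carrier AA\<rbrakk> \<Longrightarrow> c i k (pmap AA a) = (if p' dvd k then c i (k div p') a [^]\<^bsub>F\<^esub> p' else \<zero>\<^bsub>F\<^esub>)"
    if "i < r" for i k a
    using jd that unfolding AF.jordan_data_def by auto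
  have rep: "a = (\<Oplus>\<^bsub>AA\<^esub>i\<in>{..<r}. \<Oplus>\<^bsub>AA\<^esub>j\<in>{..<n i}. c i (p' ^ j) a \<odot>\<^bsub>AA\<^esub> (pmap AA ^^ j) (x i))"
    if "a \<in> carrier AA" for a
    using jd that unfolding AF.jordan_data_def by auto
  have "\<forall>i. \<exists>y. i < r \<longrightarrow> y \<in> carrier L \<and> x i = qQ y" using jx(1) unfolding AA_carrier by blast
  then obtain y where y: "\<And>i. i < r \<Longrightarrow> y i \<in> carrier L" "\<And>i. i < r \<Longrightarrow> x i = qQ (y i)" by metis
  have "lie_retraction F p' L MM (qJ ` \<gamma>2) qJ r (\<lambda>i. qJ (y i)) n (\<lambda>i k h. c i k (qQ h))"
  proof unfold_locales
    show "qJ \<in> restricted_lie_hom F L MM" by (rule qJ_hom)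
    show "qJ (y i) \<in> carrier MM" if "i < r" for i using jh(1) y(1) that by auto
    show "0 < n i" if "i < r" for i using jx(2) that .
    show "(pmap MM ^^ n i) (qJ (y i)) \<in> qJ ` \<gamma>2" if i: "i < r" for i
    proof -
      have "qQ ((pmap L ^^ n i) (y i)) = \<zero>\<^bsub>AA\<^esub>" using jx(3)[OF i] qQ_pow[OF y(1)[OF i]] y(2)[OF i] by simp
      hence "(pmap L ^^ n i) (y i) \<in> QQ" using qQ_zero pmap_pow_closed y(1)[OF i] by simp
      thus ?thesis unfolding qJ_pow[OF y(1)[OF i]] by (rule qJ_QQ)
    qed
    show "lin_functional F L (\<lambda>h. c i k (qQ h))" if "i < r" for i k
      using lin_functionalD[OF jx(4)[OF that, of k]] qh(1,2,3) unfolding lin_functional_def by auto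
    show "c i k (qQ h) = \<zero>\<^bsub>F\<^esub>" if "i < r" "\<And>j. j < n i \<Longrightarrow> k \<noteq> p' ^ j" for i k h
      using jx(5)[OF that] .
    show "c i k (qQ (h \<otimes> h')) = \<zero>\<^bsub>F\<^esub>" if "i < r" "h \<in> carrier L" "h' \<in> carrier L" for i k h h'
      unfolding qQ_bracket[OF that(2,3)]
      using lin_functionalD(3)[OF jx(4)[OF that(1)], of "\<zero>\<^bsub>F\<^esub>" "\<zero>\<^bsub>AA\<^esub>" k] lin_functionalD(1)[OF jx(4)[OF that(1)], of "\<zero>\<^bsub>AA\<^esub>" k] by simp
    show "c i k (qQ (pmap L h)) = (if p' dvd k then c i (k div p') (qQ h) [^]\<^bsub>F\<^esub> p' else \<zero>\<^bsub>F\<^esub>)"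
      if "i < r" "k < p' ^ n i" "h \<in> carrier L" for i k h
      using jx(6)[OF that(1,2) qh(1)[OF that(3)]] qh(5)[OF that(3)] by simp
    fix h assume h: "h \<in> carrier L"
    let ?t = "\<lambda>i j. c i (p' ^ j) (qQ h) \<odot> (pmap L ^^ j) (y i)"
    have cc: "c i k (qQ h) \<in> carrier F" if "i < r" for i k
      using lin_functionalD(1)[OF jx(4)[OF that] qh(1)[OF h]] .
    have tc: "?t i j \<in> carrier L" if "i < r" for i j using cc[OF that] pmap_pow_closed y(1)[OF that] by simp
    have sc: "(\<Oplus>j\<in>{..<n i}. ?t i j) \<in> carrier L" if "i < r" for i by (rule fc) (use tc[OF that] in auto)
    \<comment> \<open>The cyclic expansion of the class of \<open>h\<close>, formed with lifted
      generators in \<open>L\<close>; it differs from \<open>h\<close> by an element of Q.\<close>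
    let ?s = "\<Oplus>i\<in>{..<r}. \<Oplus>j\<in>{..<n i}. ?t i j"
    have ssc: "?s \<in> carrier L" by (rule fc) (use sc in auto)
    have Qs: "qQ ?s = qQ h"
    proof -
      have "qQ ?s = (\<Oplus>\<^bsub>AA\<^esub>i\<in>{..<r}. qQ (\<Oplus>j\<in>{..<n i}. ?t i j))"
        by (rule restricted_lie_hom_finsum[OF restricted_lie_algebra_axioms AA qQ_hom]) (use sc in auto)
      also have "\<dots> = (\<Oplus>\<^bsub>AA\<^esub>i\<in>{..<r}. \<Oplus>\<^bsub>AA\<^esub>j\<in>{..<n i}. c i (p' ^ j) (qQ h) \<odot>\<^bsub>AA\<^esub> (pmap AA ^^ j) (x i))"
      proof (rule AF.A.M.finsum_cong'[OF refl])
        show e: "qQ (\<Oplus>j\<in>{..<n i}. ?t i j) = (\<Oplus>\<^bsub>AA\<^esub>j\<in>{..<n i}. c i (p' ^ j) (qQ h) \<odot>\<^bsub>AA\<^esub> (pmap AA ^^ j) (x i))"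
          if "i \<in> {..<r}" for i
        proof -
          have i: "i < r" using that by simp
          have "qQ (\<Oplus>j\<in>{..<n i}. ?t i j) = (\<Oplus>\<^bsub>AA\<^esub>j\<in>{..<n i}. qQ (?t i j))"
            by (rule restricted_lie_hom_finsum[OF restricted_lie_algebra_axioms AA qQ_hom]) (use tc[OF i] in auto)
          thus ?thesis using qh(3)[OF cc[OF i] pmap_pow_closed[OF y(1)[OF i]]] y(2)[OF i] qQ_pow[OF y(1)[OF i]] by simp
        qed
        show "(\<lambda>i. \<Oplus>\<^bsub>AA\<^esub>j\<in>{..<n i}. c i (p' ^ j) (qQ h) \<odot>\<^bsub>AA\<^esub> (pmap AA ^^ j) (x i)) \<in> {..<r} \<rightarrow> carrier AA"
          using e[symmetric] qh(1)[OF sc] by auto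
      qed
      finally show ?thesis using rep[OF qh(1)[OF h]] by simp
    qed
    have "h \<ominus> ?s \<in> QQ"
      using coset_eq_iff[OF QQ_subspace h ssc] Qs by simp
    hence "qJ (h \<ominus> ?s) \<in> qJ ` \<gamma>2" by (rule qJ_QQ)
    moreover have "qJ (h \<ominus> ?s) = qJ h \<ominus>\<^bsub>MM\<^esub> qJ ?s"
    proof -
      have "qJ (\<ominus> ?s) = \<ominus>\<^bsub>MM\<^esub> qJ ?s"
        using jh(3)[of "\<ominus>\<^bsub>F\<^esub> \<one>\<^bsub>F\<^esub>" ?s] ssc jh(1)[OF ssc] by (simp add: smult_minus_1 M.smult_minus_1)
      thus ?thesis using jh(2)[OF h, of "\<ominus> ?s"] ssc by (simp add: a_minus_def)
    qed
    moreover have "qJ ?s = (\<Oplus>\<^bsub>MM\<^esub>i\<in>{..<r}. \<Oplus>\<^bsub>MM\<^esub>j\<in>{..<n i}. c i (p' ^ j) (qQ h) \<odot>\<^bsub>MM\<^esub> (pmap MM ^^ j) (qJ (y i)))"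
    proof -
      have "qJ ?s = (\<Oplus>\<^bsub>MM\<^esub>i\<in>{..<r}. qJ (\<Oplus>j\<in>{..<n i}. ?t i j))"
        by (rule restricted_lie_hom_finsum[OF restricted_lie_algebra_axioms MM qJ_hom]) (use sc in auto)
      also have "\<dots> = (\<Oplus>\<^bsub>MM\<^esub>i\<in>{..<r}. \<Oplus>\<^bsub>MM\<^esub>j\<in>{..<n i}. c i (p' ^ j) (qQ h) \<odot>\<^bsub>MM\<^esub> (pmap MM ^^ j) (qJ (y i)))"
      proof (rule M.M.finsum_cong'[OF refl])
        show e: "qJ (\<Oplus>j\<in>{..<n i}. ?t i j) = (\<Oplus>\<^bsub>MM\<^esub>j\<in>{..<n i}. c i (p' ^ j) (qQ h) \<odot>\<^bsub>MM\<^esub> (pmap MM ^^ j) (qJ (y i)))"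
          if "i \<in> {..<r}" for i
        proof -
          have i: "i < r" using that by simp
          have "qJ (\<Oplus>j\<in>{..<n i}. ?t i j) = (\<Oplus>\<^bsub>MM\<^esub>j\<in>{..<n i}. qJ (?t i j))"
            by (rule restricted_lie_hom_finsum[OF restricted_lie_algebra_axioms MM qJ_hom]) (use tc[OF i] in auto)
          thus ?thesis using jh(3)[OF cc[OF i] pmap_pow_closed[OF y(1)[OF i]]] qJ_pow[OF y(1)[OF i]] by simp
        qed
        show "(\<lambda>i. \<Oplus>\<^bsub>MM\<^esub>j\<in>{..<n i}. c i (p' ^ j) (qQ h) \<odot>\<^bsub>MM\<^esub> (pmap MM ^^ j) (qJ (y i))) \<in> {..<r} \<rightarrow> carrier MM"
          using e[symmetric] jh(1)[OF sc] by auto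
      qed
      finally show ?thesis .
    qed
    ultimately show "qJ h \<ominus>\<^bsub>MM\<^esub> (\<Oplus>\<^bsub>MM\<^esub>i\<in>{..<r}. \<Oplus>\<^bsub>MM\<^esub>j\<in>{..<n i}. c i (p' ^ j) (qQ h) \<odot>\<^bsub>MM\<^esub> (pmap MM ^^ j) (qJ (y i))) \<in> qJ ` \<gamma>2"
      by simp
  qed
  thus ?thesis by blast
qed

text \<open>The errors do not accumulate: the next p-th power kills the previous central error and
  creates at most one new bracket.\<close>

lemma (in class2_lie) pmap_pow_add:
  assumes "x \<in> carrier M" "y \<in> carrier M"
  shows "\<exists>z\<in>Z. (pmap M ^^ k) (x \<oplus> y) = (pmap M ^^ k) x \<oplus> (pmap M ^^ k) y \<oplus> z"
proof (induction k)
  case 0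
  show ?case using assms subspaceD(2)[OF Z_subspace] by (intro bexI[of _ \<zero>]) auto
next
  case (Suc k)
  then obtain z where z: "z \<in> Z" "(pmap M ^^ k) (x \<oplus> y) = (pmap M ^^ k) x \<oplus> (pmap M ^^ k) y \<oplus> z" by auto
  have c: "(pmap M ^^ k) x \<in> carrier M" "(pmap M ^^ k) y \<in> carrier M" using pmap_pow_closed assms by auto
  let ?z = "if p = 2 then (pmap M ^^ k) y \<otimes> (pmap M ^^ k) x else \<zero>"
  have "?z \<in> Z" using bracket_Z[OF c(2,1)] subspaceD(2)[OF Z_subspace] by simp
  moreover have "(pmap M ^^ Suc k) (x \<oplus> y) = (pmap M ^^ Suc k) x \<oplus> (pmap M ^^ Suc k) y \<oplus> ?z"
    using z pmap_add_central[of "(pmap M ^^ k) x \<oplus> (pmap M ^^ k) y" z] c pmap_class2[OF c] by simp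
  ultimately show ?case by blast
qed

lemma (in class2_lie) pmap_pow_Z: "z \<in> Z \<Longrightarrow> (pmap M ^^ k) z \<in> Z"
  using subspaceD(2)[OF Z_subspace] by (induction k) (auto simp: pmap_Z)

text \<open>Brackets go to \<open>Z\<close>, so brackets with \<open>\<gamma>2\<close> and p-th
  powers of \<open>\<gamma>2\<close> go to zero. The kernel is a restricted subalgebra, hence
  contains all of \<open>P2\<close>.\<close>

lemma (in class2_lie) hom_kills_JJ:
  assumes L: "restricted_lie_algebra F L" and h: "h \<in> restricted_lie_hom F L M"
    and x: "x \<in> p_power_subalgebra F L (lower_central F L 2) <+>\<^bsub>L\<^esub> lower_central F L 3"
  shows "h x = \<zero>"
proof -
  interpret L: restricted_lie_algebra F L by (rule L)
  note h = restricted_lie_homD[OF h]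
  note Zs = subspaceD[OF Z_subspace]
  have h0: "h \<zero>\<^bsub>L\<^esub> = \<zero>" using h(3)[of "\<zero>\<^bsub>F\<^esub>" "\<zero>\<^bsub>L\<^esub>"] h(1)[of "\<zero>\<^bsub>L\<^esub>"] by simp
  have "subspace F {x \<in> carrier L. h x \<in> Z} L"
    unfolding subspace_iff[OF L.vs] using h0 Zs(2,3,4) h(2,3) by auto
  hence "L.\<gamma>2 \<subseteq> {x \<in> carrier L. h x \<in> Z}"
    unfolding L.\<gamma>2_eq using L.bracket_closed h(1,4) bracket_Z by (intro subspace_span_le[OF L.vs]) auto
  hence g2: "h y \<in> Z" if "y \<in> L.\<gamma>2" for y using that by auto
  let ?K = "{x \<in> carrier L. h x = \<zero>}"
  have K: "subspace F ?K L"
    unfolding subspace_iff[OF L.vs] using h0 h(2,3) by auto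
  have g3: "L.\<gamma>3 \<subseteq> ?K"
    unfolding L.\<gamma>3_eq
  proof (intro subspace_span_le[OF L.vs K] subsetI)
    fix u assume "u \<in> {a \<otimes>\<^bsub>L\<^esub> b | a b. a \<in> L.\<gamma>2 \<and> b \<in> carrier L}"
    then obtain a b where ab: "a \<in> L.\<gamma>2" "b \<in> carrier L" "u = a \<otimes>\<^bsub>L\<^esub> b" by auto
    have a: "a \<in> carrier L" using ab(1) L.\<gamma>2_carrier by auto
    show "u \<in> ?K" using h(4)[OF a ab(2)] Z_central[OF g2[OF ab(1)] h(1)[OF ab(2)]] L.bracket_closed[OF a ab(2)] ab(3) by simp
  qed
  have "restricted_subalgebra F L ?K"
    unfolding restricted_subalgebra_def using K L.bracket_closed L.pmap_closed h(4,5) by auto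
  moreover have "pmap L y \<in> ?K" if "y \<in> L.\<gamma>2" for y
  proof -
    have y: "y \<in> carrier L" using that L.\<gamma>2_carrier by auto
    show ?thesis using h(5)[OF y] pmap_Z[OF g2[OF that]] L.pmap_closed[OF y] by simp
  qed
  ultimately have P: "L.P2 \<subseteq> ?K" by (rule L.P2_le)
  obtain a b where ab: "a \<in> L.P2" "b \<in> L.\<gamma>3" "x = a \<oplus>\<^bsub>L\<^esub> b" using x unfolding L.set_add_iff by auto
  have "a \<in> ?K" "b \<in> ?K" using ab(1,2) P g3 by blast+
  thus ?thesis unfolding ab(3) using h(2)[of a b] by simp
qed

text \<open>Surjectivity takes two rounds. Iterating the approximation by p-th powers uses the
  nilpotency of \<open>H/Q\<close> to leave only central errors, and central errors disappear under
  brackets, so the image contains all brackets and with them \<open>Z\<close>.\<close>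

lemma (in env_pair) comparison_exists:
  assumes nil: "L.nilQ s"
    and G: "finite G" "G \<subseteq> carrier H.AA"
      "\<forall>a\<in>carrier H.AA. \<exists>b\<in>carrier H.AA. a \<ominus>\<^bsub>H.AA\<^esub> pmap H.AA b \<in> LinearCombinations.module.span F H.AA G"
  shows "\<exists>\<psi>\<in>restricted_lie_hom F L H.MM. \<psi> ` carrier L = carrier H.MM"
proof -
  have nilH: "H.nilQ s" by (rule nilQ_transfer[OF nil])
  obtain r x n c where lr: "lie_retraction F p H H.MM (H.qJ ` H.\<gamma>2) H.qJ r x n c"
    using H.retraction_exists[OF perfect_char_p_axioms nilH G] by blast
  interpret Re: lie_retraction F p H H.MM "H.qJ ` H.\<gamma>2" H.qJ r x n c by (rule lr)
  let ?Z = "H.qJ ` H.\<gamma>2"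
  note jh = restricted_lie_homD[OF H.qJ_hom]
  interpret E: env_map F p L H R H.MM Re.\<pi>
    by unfold_locales (auto simp: Re.\<pi>_closed Re.\<pi>_add Re.\<pi>_kill)
  have rc: "\<rho> (free_gen F y) \<in> carrier B.T" if "y \<in> carrier L" for y
    using that A.gen_closed \<rho>_closed by simp
  have e\<rho>: "Re.\<epsilon> (\<rho> f) = f []" if "f \<in> carrier A.T" for f
    using eps_preserved[OF nil \<rho>[OF that]] unfolding Re.\<epsilon>_def .
  have e0: "Re.\<epsilon> (\<rho> (free_gen F y)) = \<zero>" if "y \<in> carrier L" for y
    using e\<rho>[OF A.gen_closed[OF that]] by (simp add: A.eval_Nil)
  have hom_pmap: "E.\<chi> (pmap L y) = pmap H.MM (E.\<chi> y)" if y: "y \<in> carrier L" for y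
    using E.\<chi>_pmap[OF y] Re.\<pi>_frob[OF rc[OF y] e0[OF y]] unfolding E.\<chi>_def by simp
  have hom_smult: "E.\<chi> (d \<odot>\<^bsub>L\<^esub> y) = d \<odot>\<^bsub>H.MM\<^esub> E.\<chi> y" if d: "d \<in> carrier F" and y: "y \<in> carrier L" for d y
    using E.\<chi>_smult[OF d y] Re.\<pi>_smult[OF d rc[OF y]] unfolding E.\<chi>_def by simp
  have hom_bracket: "E.\<chi> (y \<otimes>\<^bsub>L\<^esub> y') = E.\<chi> y \<otimes>\<^bsub>H.MM\<^esub> E.\<chi> y'" if y: "y \<in> carrier L" and y': "y' \<in> carrier L" for y y'
    using E.\<chi>_bracket[OF y y'] Re.\<pi>_commutator[OF rc[OF y] e0[OF y] rc[OF y'] e0[OF y']] unfolding E.\<chi>_def by simp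
  have hom: "E.\<chi> \<in> restricted_lie_hom F L H.MM"
    unfolding restricted_lie_hom_def module_hom_def
    by (simp add: hom_pmap hom_smult hom_bracket E.\<chi>_add E.\<chi>_closed Pi_I)
  note \<chi> = restricted_lie_homD[OF hom]
  note Zs = subspaceD[OF Re.M.Z_subspace] and PZs = subspaceD[OF Re.PZ_subspace]
  \<comment> \<open>Words of length at least two are products of augmentation-zero elements and land
    in \<open>PZ\<close>; single letters give values of \<open>\<chi>\<close>, the empty word gives
    zero.\<close>
  have cover_\<rho>: "\<exists>y\<in>carrier L. \<exists>u\<in>Re.M.PZ. Re.\<pi> (\<rho> f) = E.\<chi> y \<oplus>\<^bsub>H.MM\<^esub> u" if "f \<in> carrier A.T" for f
    using that
  proof (induction f rule: A.T_induct)
    case zero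
    have "Re.\<pi> (\<rho> \<zero>\<^bsub>A.T\<^esub>) = Re.\<pi> (\<zero> \<odot>\<^bsub>B.T\<^esub> \<rho> \<one>\<^bsub>A.T\<^esub>)"
      using E.\<kappa>\<rho>_smult[OF zero_closed A.T.one_closed] unfolding A.T.smult_l_null[OF A.T.one_closed] .
    also have "\<dots> = \<zero>\<^bsub>H.MM\<^esub>"
      unfolding Re.\<pi>_smult[OF zero_closed \<rho>_closed[OF A.T.one_closed]]
      by (rule Re.M.smult_l_null[OF Re.\<pi>_closed[OF \<rho>_closed[OF A.T.one_closed]]])
    finally have "Re.\<pi> (\<rho> \<zero>\<^bsub>A.T\<^esub>) = \<zero>\<^bsub>H.MM\<^esub>" .
    hence "Re.\<pi> (\<rho> \<zero>\<^bsub>A.T\<^esub>) = E.\<chi> \<zero>\<^bsub>L\<^esub> \<oplus>\<^bsub>H.MM\<^esub> \<zero>\<^bsub>H.MM\<^esub>" by (simp add: E.\<chi>_zero)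
    thus ?case using PZs(2) L.M.zero_closed by blast
  next
    case (sd d w)
    consider "w = []" | y where "w = [y]" | y y' v where "w = y # y' # v" by (metis list.exhaust)
    thus ?case
    proof cases
      case 1
      have "Re.\<pi> (\<rho> (A.sd d w)) = d \<odot>\<^bsub>H.MM\<^esub> Re.\<pi> (\<rho> \<one>\<^bsub>A.T\<^esub>)"
        unfolding 1 A.sd_Nil[OF sd(1)]
        using E.\<kappa>\<rho>_smult[OF sd(1), of "\<one>\<^bsub>A.T\<^esub>"] Re.\<pi>_smult[OF sd(1) \<rho>_closed[of "\<one>\<^bsub>A.T\<^esub>"]] by simp
      also have "\<dots> = E.\<chi> \<zero>\<^bsub>L\<^esub> \<oplus>\<^bsub>H.MM\<^esub> \<zero>\<^bsub>H.MM\<^esub>"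
        using sd(1) by (simp add: E.\<kappa>\<rho>_one Re.\<pi>_one E.\<chi>_zero)
      finally show ?thesis using PZs(2) L.M.zero_closed by blast
    next
      case 2
      have y: "y \<in> carrier L" using sd(2) 2 by simp
      have "A.sd d w = d \<odot>\<^bsub>A.T\<^esub> free_gen F y"
        unfolding 2 A.sd_Cons[OF sd(1)] A.sd_Nil[OF sd(1)] using A.gen_closed[OF y] sd(1) by (simp add: A.T_smult_r)
      hence "Re.\<pi> (\<rho> (A.sd d w)) = d \<odot>\<^bsub>H.MM\<^esub> E.\<chi> y"
        using E.\<kappa>\<rho>_smult[OF sd(1) A.gen_closed[OF y]] Re.\<pi>_smult[OF sd(1) rc[OF y]] unfolding E.\<chi>_def by simp
      hence "Re.\<pi> (\<rho> (A.sd d w)) = E.\<chi> (d \<odot>\<^bsub>L\<^esub> y) \<oplus>\<^bsub>H.MM\<^esub> \<zero>\<^bsub>H.MM\<^esub>"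
        using \<chi>(3)[OF sd(1) y] \<chi>(1)[OF y] sd(1) by simp
      thus ?thesis using PZs(2) L.smult_closed[OF sd(1) y] by blast
    next
      case 3
      have y: "y \<in> carrier L" "A.sd d (y' # v) \<in> carrier A.T" using sd 3 A.sd_closed by auto
      have "Re.\<epsilon> (\<rho> (A.sd d (y' # v))) = \<zero>" unfolding e\<rho>[OF y(2)] by (simp add: A.eval_Nil)
      hence "Re.\<pi> (\<rho> (free_gen F y) \<otimes>\<^bsub>B.T\<^esub> \<rho> (A.sd d (y' # v))) \<in> Re.M.PZ"
        by (intro Re.\<pi>_mult_PZ rc e0 \<rho>_closed y)
      moreover have "Re.\<pi> (\<rho> (A.sd d w)) = Re.\<pi> (\<rho> (free_gen F y) \<otimes>\<^bsub>B.T\<^esub> \<rho> (A.sd d (y' # v)))"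
        unfolding 3 A.sd_Cons[OF sd(1), of y] by (rule E.\<kappa>\<rho>_mult[OF A.gen_closed[OF y(1)] y(2)])
      ultimately have *: "Re.\<pi> (\<rho> (A.sd d w)) \<in> Re.M.PZ" by simp
      hence "Re.\<pi> (\<rho> (A.sd d w)) = E.\<chi> \<zero>\<^bsub>L\<^esub> \<oplus>\<^bsub>H.MM\<^esub> Re.\<pi> (\<rho> (A.sd d w))"
        using PZs(1) by (auto simp: E.\<chi>_zero)
      thus ?thesis using * L.M.zero_closed by blast
    qed
  next
    case (add f g)
    then obtain y u y' u' where yu: "y \<in> carrier L" "u \<in> Re.M.PZ" "Re.\<pi> (\<rho> f) = E.\<chi> y \<oplus>\<^bsub>H.MM\<^esub> u"
      "y' \<in> carrier L" "u' \<in> Re.M.PZ" "Re.\<pi> (\<rho> g) = E.\<chi> y' \<oplus>\<^bsub>H.MM\<^esub> u'" by metis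
    have uc: "u \<in> carrier H.MM" "u' \<in> carrier H.MM" using yu PZs(1) by auto
    have "Re.\<pi> (\<rho> (f \<oplus>\<^bsub>A.T\<^esub> g)) = E.\<chi> (y \<oplus>\<^bsub>L\<^esub> y') \<oplus>\<^bsub>H.MM\<^esub> (u \<oplus>\<^bsub>H.MM\<^esub> u')"
      using E.\<kappa>\<rho>_add[OF add(1,2)] yu uc \<chi>(1)[OF yu(1)] \<chi>(1)[OF yu(4)] by (simp add: \<chi>(2) Re.M.M.a_ac)
    thus ?case using PZs(3)[OF yu(2,5)] L.M.a_closed[OF yu(1,4)] by blast
  qed
  have cover: "\<exists>y\<in>carrier L. \<exists>m'\<in>carrier H.MM. \<exists>z\<in>?Z. m = E.\<chi> y \<oplus>\<^bsub>H.MM\<^esub> (pmap H.MM m' \<oplus>\<^bsub>H.MM\<^esub> z)"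
    if m: "m \<in> carrier H.MM" for m
  proof -
    obtain h where h: "h \<in> carrier H" "m = H.qJ h" using m unfolding H.MM_carrier by auto
    obtain f where f: "R f (free_gen F h)" using R_ex'[OF B.gen_closed[OF h(1)]] by blast
    have "m = Re.\<pi> (\<rho> f)" using E.\<kappa>_R[OF f] Re.\<pi>_gen[OF h(1)] h(2) by simp
    thus ?thesis using cover_\<rho>[OF R_carrier(1)[OF f]] unfolding Re.M.PZ_def by blast
  qed
  \<comment> \<open>The approximation is substituted into its own p-th power term. The iterated
    p-map is additive modulo \<open>Z\<close>, and it commutes with \<open>\<chi>\<close>, so the
    new main term is again a value of \<open>\<chi>\<close>.\<close>
  have iter: "\<exists>y\<in>carrier L. \<exists>m'\<in>carrier H.MM. \<exists>z\<in>?Z. m = E.\<chi> y \<oplus>\<^bsub>H.MM\<^esub> ((pmap H.MM ^^ k) m' \<oplus>\<^bsub>H.MM\<^esub> z)"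
    if m: "m \<in> carrier H.MM" for m k
  proof (induction k)
    case 0
    have "m = E.\<chi> \<zero>\<^bsub>L\<^esub> \<oplus>\<^bsub>H.MM\<^esub> ((pmap H.MM ^^ 0) m \<oplus>\<^bsub>H.MM\<^esub> \<zero>\<^bsub>H.MM\<^esub>)" using m by (simp add: E.\<chi>_zero)
    thus ?case using m Zs(2) L.M.zero_closed by blast
  next
    case (Suc k)
    then obtain y m' z where 1: "y \<in> carrier L" "m' \<in> carrier H.MM" "z \<in> ?Z"
      "m = E.\<chi> y \<oplus>\<^bsub>H.MM\<^esub> ((pmap H.MM ^^ k) m' \<oplus>\<^bsub>H.MM\<^esub> z)" by blast
    obtain y' m'' z' where 2: "y' \<in> carrier L" "m'' \<in> carrier H.MM" "z' \<in> ?Z"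
      "m' = E.\<chi> y' \<oplus>\<^bsub>H.MM\<^esub> (pmap H.MM m'' \<oplus>\<^bsub>H.MM\<^esub> z')" using cover[OF 1(2)] by blast
    note c = \<chi>(1)[OF 1(1)] \<chi>(1)[OF 2(1)] Re.M.pmap_closed[OF 2(2)] Re.M.Z_carrier[OF 1(3)] Re.M.Z_carrier[OF 2(3)]
    obtain z1 where z1: "z1 \<in> ?Z" "(pmap H.MM ^^ k) m' = (pmap H.MM ^^ k) (E.\<chi> y') \<oplus>\<^bsub>H.MM\<^esub> (pmap H.MM ^^ k) (pmap H.MM m'' \<oplus>\<^bsub>H.MM\<^esub> z') \<oplus>\<^bsub>H.MM\<^esub> z1"
      using Re.M.pmap_pow_add[OF c(2) Re.M.M.a_closed[OF c(3,5)], of k] unfolding 2(4) by blast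
    obtain z2 where z2: "z2 \<in> ?Z" "(pmap H.MM ^^ k) (pmap H.MM m'' \<oplus>\<^bsub>H.MM\<^esub> z') = (pmap H.MM ^^ k) (pmap H.MM m'') \<oplus>\<^bsub>H.MM\<^esub> (pmap H.MM ^^ k) z' \<oplus>\<^bsub>H.MM\<^esub> z2"
      using Re.M.pmap_pow_add[OF c(3,5), of k] by blast
    have z3: "(pmap H.MM ^^ k) z' \<in> ?Z" by (rule Re.M.pmap_pow_Z[OF 2(3)])
    have pc: "(pmap L ^^ k) y' \<in> carrier L" by (rule L.pmap_pow_closed[OF 2(1)])
    have \<chi>p: "(pmap H.MM ^^ k) (E.\<chi> y') = E.\<chi> ((pmap L ^^ k) y')"
      by (induction k) (simp_all add: \<chi>(5) L.pmap_pow_closed 2(1))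
    have sw: "(pmap H.MM ^^ k) (pmap H.MM m'') = (pmap H.MM ^^ Suc k) m''" by (simp add: funpow_swap1)
    note c' = Re.M.pmap_pow_closed[OF 2(2), of "Suc k"] Re.M.Z_carrier[OF z1(1)] Re.M.Z_carrier[OF z2(1)] Re.M.Z_carrier[OF z3] \<chi>(1)[OF pc]
    have "m = E.\<chi> (y \<oplus>\<^bsub>L\<^esub> (pmap L ^^ k) y') \<oplus>\<^bsub>H.MM\<^esub>
        ((pmap H.MM ^^ Suc k) m'' \<oplus>\<^bsub>H.MM\<^esub> ((pmap H.MM ^^ k) z' \<oplus>\<^bsub>H.MM\<^esub> z2 \<oplus>\<^bsub>H.MM\<^esub> z1 \<oplus>\<^bsub>H.MM\<^esub> z))"
      unfolding 1(4) z1(2) z2(2) \<chi>p sw \<chi>(2)[OF 1(1) pc] using c c' by (simp add: Re.M.M.a_ac del: funpow.simps)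
    moreover have "(pmap H.MM ^^ k) z' \<oplus>\<^bsub>H.MM\<^esub> z2 \<oplus>\<^bsub>H.MM\<^esub> z1 \<oplus>\<^bsub>H.MM\<^esub> z \<in> ?Z"
      by (intro Zs(3) z3 z2(1) z1(1) 1(3))
    ultimately show ?case using 2(2) L.M.a_closed[OF 1(1) pc] by blast
  qed
  \<comment> \<open>At k = \<open>s\<close> the remaining power comes from Q and therefore lies in
    \<open>Z\<close>.\<close>
  have SZ: "\<exists>y\<in>carrier L. \<exists>z\<in>?Z. m = E.\<chi> y \<oplus>\<^bsub>H.MM\<^esub> z" if m: "m \<in> carrier H.MM" for m
  proof -
    obtain y m' z where 1: "y \<in> carrier L" "m' \<in> carrier H.MM" "z \<in> ?Z"
      "m = E.\<chi> y \<oplus>\<^bsub>H.MM\<^esub> ((pmap H.MM ^^ s) m' \<oplus>\<^bsub>H.MM\<^esub> z)" using iter[OF m, of s] by blast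
    obtain h where h: "h \<in> carrier H" "m' = H.qJ h" using 1(2) unfolding H.MM_carrier by auto
    have "(pmap H.MM ^^ s) m' \<in> ?Z"
      unfolding h(2) H.qJ_pow[OF h(1)] using nilH h(1) unfolding H.nilQ_def by (intro H.qJ_QQ) blast
    thus ?thesis using 1 Zs(3) by blast
  qed
  let ?S = "E.\<chi> ` carrier L"
  let ?V = "{h \<in> carrier H. H.qJ h \<in> ?S}"
  have "subspace F ?V H"
    unfolding subspace_iff[OF H.vs]
  proof (intro conjI ballI)
    have "H.qJ \<zero>\<^bsub>H\<^esub> = \<zero>\<^bsub>H.MM\<^esub>" using jh(3)[of \<zero> "\<zero>\<^bsub>H\<^esub>"] jh(1)[of "\<zero>\<^bsub>H\<^esub>"] by simp
    thus "\<zero>\<^bsub>H\<^esub> \<in> ?V" using E.\<chi>_zero by (auto intro: image_eqI[of _ _ "\<zero>\<^bsub>L\<^esub>"])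
    fix a assume "a \<in> ?V"
    then obtain y where a: "a \<in> carrier H" "y \<in> carrier L" "H.qJ a = E.\<chi> y" by auto
    show "d \<odot>\<^bsub>H\<^esub> a \<in> ?V" if "d \<in> carrier F" for d
      using a that jh(3)[OF that a(1)] \<chi>(3)[OF that a(2)] by (auto intro!: image_eqI[of _ _ "d \<odot>\<^bsub>L\<^esub> y"])
    fix b assume "b \<in> ?V"
    then obtain y' where b: "b \<in> carrier H" "y' \<in> carrier L" "H.qJ b = E.\<chi> y'" by auto
    show "a \<oplus>\<^bsub>H\<^esub> b \<in> ?V"
      using a b jh(2)[OF a(1) b(1)] \<chi>(2)[OF a(2) b(2)] by (auto intro!: image_eqI[of _ _ "y \<oplus>\<^bsub>L\<^esub> y'"])
  qed auto
  \<comment> \<open>Modulo \<open>Z\<close> both factors are values of \<open>\<chi>\<close>; the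
    central parts drop out, so the bracket is a value of \<open>\<chi>\<close> exactly.\<close>
  moreover have "{a \<otimes>\<^bsub>H\<^esub> b | a b. a \<in> carrier H \<and> b \<in> carrier H} \<subseteq> ?V"
  proof
    fix u assume "u \<in> {a \<otimes>\<^bsub>H\<^esub> b | a b. a \<in> carrier H \<and> b \<in> carrier H}"
    then obtain a b where ab: "a \<in> carrier H" "b \<in> carrier H" "u = a \<otimes>\<^bsub>H\<^esub> b" by auto
    obtain y z where 1: "y \<in> carrier L" "z \<in> ?Z" "H.qJ a = E.\<chi> y \<oplus>\<^bsub>H.MM\<^esub> z" using SZ[OF jh(1)[OF ab(1)]] by blast
    obtain y' z' where 2: "y' \<in> carrier L" "z' \<in> ?Z" "H.qJ b = E.\<chi> y' \<oplus>\<^bsub>H.MM\<^esub> z'" using SZ[OF jh(1)[OF ab(2)]] by blast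
    note c = \<chi>(1)[OF 1(1)] \<chi>(1)[OF 2(1)] Re.M.Z_carrier[OF 1(2)] Re.M.Z_carrier[OF 2(2)]
    have "H.qJ u = E.\<chi> (y \<otimes>\<^bsub>L\<^esub> y')"
      unfolding ab(3) jh(4)[OF ab(1,2)] 1(3) 2(3) \<chi>(4)[OF 1(1) 2(1)]
      using c Re.M.bracket_closed[OF c(1,2)]
      by (simp add: Re.M.bracket_add_left Re.M.bracket_add_right Re.M.Z_central[OF 1(2)] Re.M.Z_central'[OF 2(2)])
    thus "u \<in> ?V" using ab H.bracket_closed L.bracket_closed[OF 1(1) 2(1)] by auto
  qed
  ultimately have "H.\<gamma>2 \<subseteq> ?V" unfolding H.\<gamma>2_eq by (rule subspace_span_le[OF H.vs])
  hence ZS: "z \<in> ?S" if "z \<in> ?Z" for z using that by auto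
  have "carrier H.MM \<subseteq> ?S"
  proof
    fix m assume "m \<in> carrier H.MM"
    then obtain y z where 1: "y \<in> carrier L" "z \<in> ?Z" "m = E.\<chi> y \<oplus>\<^bsub>H.MM\<^esub> z" using SZ by blast
    obtain y' where 2: "y' \<in> carrier L" "z = E.\<chi> y'" using ZS[OF 1(2)] by auto
    show "m \<in> ?S" using 1 2 \<chi>(2)[OF 1(1) 2(1)] by (auto intro: image_eqI[of _ _ "y \<oplus>\<^bsub>L\<^esub> y'"])
  qed
  thus ?thesis using hom \<chi>(1) by (intro bexI[of _ E.\<chi>]) auto
qed

text \<open>On the quotient by Q the iterated p-map is semilinear, so an exponent that works on a
  finite spanning set works everywhere.\<close>

lemma (in restricted_lie_algebra) nilQ_exists:
  assumes P: "perfect_char_p F p'" and G0: "finite G0" "G0 \<subseteq> carrier L" "span G0 = carrier L"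
    and nil: "p_nilpotent L"
  shows "\<exists>s. nilQ s"
proof -
  interpret AF: frob_space F p' AA "pmap AA" by (rule AA_frob_space[OF P])
  note qh = restricted_lie_homD[OF qQ_hom]
  have "\<forall>g\<in>G0. \<exists>t. (pmap L ^^ t) g = \<zero>" using nil G0(2) unfolding p_nilpotent_def by auto
  then obtain t where t: "\<And>g. g \<in> G0 \<Longrightarrow> (pmap L ^^ t g) g = \<zero>" by metis
  \<comment> \<open>The sum dominates every individual exponent.\<close>
  define s where "s = sum t G0"
  have z: "(pmap L ^^ k) \<zero> = \<zero>" for k by (induction k) simp_all
  have s: "(pmap L ^^ s) g = \<zero>" if g: "g \<in> G0" for g
  proof -
    have "s = (s - t g) + t g" unfolding s_def using member_le_sum[OF g, of t] G0(1) by simp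
    thus ?thesis using t[OF g] z by (metis comp_apply funpow_add)
  qed
  have q0: "qQ \<zero> = \<zero>\<^bsub>AA\<^esub>" using qQ_zero[of \<zero>] subspaceD(2)[OF QQ_subspace] by simp
  let ?K = "{x \<in> carrier L. (pmap AA ^^ s) (qQ x) = \<zero>\<^bsub>AA\<^esub>}"
  have K: "subspace F ?K L"
    unfolding subspace_iff[OF vs] using q0 qh(1,2,3) AF.\<phi>_pow_add AF.\<phi>_pow_smult by auto
  have GK: "G0 \<subseteq> ?K" using G0(2) s q0 by (auto simp: qQ_pow)
  have "carrier L \<subseteq> ?K" using subspace_span_le[OF vs K GK] unfolding G0(3) .
  hence "(pmap L ^^ s) x \<in> QQ" if "x \<in> carrier L" for x
    using that qQ_pow[OF that, of s] qQ_zero[OF pmap_pow_closed[OF that, of s]] by auto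
  thus ?thesis unfolding nilQ_def by blast
qed

section \<open>Surjections in both directions\<close>

text \<open>A nonzero kernel vector can be exchanged into a basis. The images of the remaining
  vectors, one fewer than the dimension of \<open>V\<close>, would still span
  \<open>W\<close>.\<close>

lemma (in linear_map) surj_dim_le_imp_inj:
  assumes fd: "V.fin_dim" and surj: "T ` carrier V = carrier W" and dim: "V.dim \<le> W.dim"
  shows "inj_on T (carrier V)"
proof -
  have vsV: "vectorspace K V" and vsW: "vectorspace K W" ..
  have lin: "T (x \<oplus>\<^bsub>V\<^esub> y) = T x \<oplus>\<^bsub>W\<^esub> T y" "T (c \<odot>\<^bsub>V\<^esub> x) = c \<odot>\<^bsub>W\<^esub> T x" "T x \<in> carrier W"
    if "x \<in> carrier V" "y \<in> carrier V" "c \<in> carrier K" for x y c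
    using that by auto
  have T0: "T \<zero>\<^bsub>V\<^esub> = \<zero>\<^bsub>W\<^esub>" by simp
  have ker0: "v = \<zero>\<^bsub>V\<^esub>" if v: "v \<in> carrier V" and Tv: "T v = \<zero>\<^bsub>W\<^esub>" for v
  proof (rule ccontr)
    assume nz: "v \<noteq> \<zero>\<^bsub>V\<^esub>"
    obtain B where B: "finite B" "V.basis B" using V.finite_basis_exists[OF fd] by blast
    have Bc: "B \<subseteq> carrier V" "LinearCombinations.module.span K V B = carrier V" using B(2) unfolding V.basis_def by auto
    have e: "V.module.lin_indpt {}" unfolding V.module.lin_dep_def by auto
    have "V.module.lin_indpt ({} \<union> {v})"
      using V.lin_dep_iff_in_span[of "{}" v] e v nz V.span_empty by auto
    then obtain C where C: "finite C" "C \<subseteq> carrier V" "int (card C) \<le> int (card B) - int (card {v})"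
        "LinearCombinations.module.span K V ({v} \<union> C) = LinearCombinations.module.span K V B"
      using V.replacement[of "{v}" B] B(1) Bc v by auto
    have TC: "T ` C \<subseteq> carrier W" using C(2) by auto
    note sp = subspaceD[OF W.span_is_subspace[OF TC]]
    let ?K = "{x \<in> carrier V. T x \<in> LinearCombinations.module.span K W (T ` C)}"
    have K: "subspace K ?K V"
      unfolding subspace_iff[OF vsV] using sp T0 by auto
    have GK: "{v} \<union> C \<subseteq> ?K" using v Tv sp(2) C(2) W.module.in_own_span[OF TC] by auto
    have "carrier V \<subseteq> ?K" using subspace_span_le[OF vsV K GK] unfolding C(4) Bc(2) .
    hence "T ` carrier V \<subseteq> LinearCombinations.module.span K W (T ` C)" by auto
    hence "LinearCombinations.module.span K W (T ` C) = carrier W"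
      unfolding surj by (rule subset_antisym[OF sp(1)])
    hence "W.dim \<le> card (T ` C)" using C(1) TC by (intro W.gen_ge_dim) auto
    moreover have "card (T ` C) \<le> card C" using C(1) by (rule card_image_le)
    moreover have "V.dim = card B" using V.dim_basis B by auto
    ultimately show False using C(3) dim by simp
  qed
  show ?thesis
  proof (rule Ke0_imp_inj)
    show "carrier (V.vs kerT) = {\<zero>\<^bsub>V\<^esub>}" unfolding ker_def using ker0 T0 by auto
  qed
qed

lemma linear_mapI:
  assumes "restricted_lie_algebra F L" "restricted_lie_algebra F M" "h \<in> restricted_lie_hom F L M"
  shows "linear_map F L M h"
proof -
  interpret L: restricted_lie_algebra F L by fact
  interpret M: restricted_lie_algebra F M by fact
  show ?thesis
    using assms(3) unfolding restricted_lie_hom_def by unfold_locales auto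
qed

lemma fin_dim_image:
  assumes "restricted_lie_algebra F L" "restricted_lie_algebra F M" "h \<in> restricted_lie_hom F L M"
    and "h ` carrier L = carrier M" "vectorspace.fin_dim F L"
  shows "vectorspace.fin_dim F M" "vectorspace.dim F M \<le> vectorspace.dim F L"
proof -
  interpret T: linear_map F L M h using linear_mapI assms(1-3) .
  show "vectorspace.fin_dim F M" using T.rank_nullity_main(2)[OF assms(5,4)] .
  show "vectorspace.dim F M \<le> vectorspace.dim F L"
    using T.rank_nullity_main(1)[OF assms(5)] T.surj_imp_imT_carrier[OF assms(4)] by simp
qed

text \<open>A homomorphism that kills \<open>S\<close> is constant on cosets, and the induced map
  has the same image.\<close>

lemma (in restricted_lie_algebra) quot_lie_lift:
  assumes S: "restricted_ideal S" and M: "restricted_lie_algebra F M"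
    and h: "h \<in> restricted_lie_hom F L M" and k: "\<And>x. x \<in> S \<Longrightarrow> h x = \<zero>\<^bsub>M\<^esub>"
  shows "\<exists>g\<in>restricted_lie_hom F (quot_lie L S) M. g ` carrier (quot_lie L S) = h ` carrier L"
proof -
  interpret N: restricted_lie_algebra F M by (rule M)
  let ?q = "\<lambda>x. S +>\<^bsub>L\<^esub> x" and ?N = "quot_lie L S"
  note q = restricted_lie_homD[OF quot_lie(1)[OF S]] and cN = quot_lie(3)[OF S] and h = restricted_lie_homD[OF h]
  have S': "subspace F S L" using S unfolding restricted_ideal_def lie_ideal_def by auto
  define g where "g X = h (SOME x. x \<in> carrier L \<and> ?q x = X)" for X
  have gq: "g (?q x) = h x" if x: "x \<in> carrier L" for x
  proof -
    let ?y = "SOME y. y \<in> carrier L \<and> ?q y = ?q x"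
    have y: "?y \<in> carrier L" "?q ?y = ?q x" using someI[of "\<lambda>y. y \<in> carrier L \<and> ?q y = ?q x" x] x by auto
    have "?y \<ominus> x \<in> S" using coset_eq_iff[OF S' y(1) x] y(2) by simp
    hence "h (?y \<ominus> x) = \<zero>\<^bsub>M\<^esub>" by (rule k)
    hence "h ((?y \<ominus> x) \<oplus> x) = h x" using h(2)[of "?y \<ominus> x" x] h(1)[OF x] y x by simp
    moreover have "(?y \<ominus> x) \<oplus> x = ?y" using y(1) x by (simp add: a_minus_def M.a_assoc M.l_neg)
    ultimately show ?thesis unfolding g_def by simp
  qed
  have "g \<in> restricted_lie_hom F ?N M"
    unfolding restricted_lie_hom_def module_hom_def cN
    by (auto simp: gq h q(2-5)[symmetric] M.a_closed smult_closed bracket_closed pmap_closed)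
  moreover have "g ` carrier ?N = h ` carrier L" unfolding cN image_image using gq by auto
  ultimately show ?thesis by blast
qed

theorem mainTheorem1:
  fixes F :: "'k ring"
    and L :: "('k, 'a) restricted_lie"
    and H :: "('k, 'b) restricted_lie"
    and p :: nat
  assumes "perfect_field F"
    and "ring_char F = p" and "p > 0"
    and "restricted_lie_algebra F L"
    and "vectorspace.fin_dim F L"
    and "p_nilpotent L"
    and "restricted_lie_algebra F H"
    and "algebra_iso F (restricted_enveloping_algebra F L)
           (restricted_enveloping_algebra F H) \<noteq> {}"
  shows "restricted_lie_iso F
           (quot_lie L (p_power_subalgebra F L (lower_central F L 2)
              <+>\<^bsub>L\<^esub> lower_central F L 3))
           (quot_lie H (p_power_subalgebra F H (lower_central F H 2)
              <+>\<^bsub>H\<^esub> lower_central F H 3)) \<noteq> {}"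
proof -
  interpret L: restricted_lie_algebra F L by fact
  interpret H: restricted_lie_algebra F H by fact
  interpret LM: class2_lie F L.MM "L.qJ ` L.\<gamma>2" by (rule L.MM_class2)
  interpret HM: class2_lie F H.MM "H.qJ ` H.\<gamma>2" by (rule H.MM_class2)
  have P: "perfect_char_p F p"
    using assms(1-3) unfolding perfect_field_def perfect_char_p_def perfect_char_p_axioms_def by auto
  obtain R where R: "alg_rel F L H R" using alg_rel_exists[OF assms(4,7)] assms(8) by blast
  have LH: "env_pair F p L H R" 
    by (intro env_pair.intro env_pair_axioms.intro P R assms(4,7))
  have HL: "env_pair F p H L (\<lambda>g f. R f g)"
    by (intro env_pair.intro env_pair_axioms.intro P alg_rel_sym[OF R] assms(4,7))
  obtain G0 where G0: "finite G0" "G0 \<subseteq> carrier L" "L.span G0 = carrier L"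
    using assms(5) unfolding L.fin_dim_def by auto
  obtain s where s: "L.nilQ s" using L.nilQ_exists[OF P G0 assms(6)] by blast
  \<comment> \<open>The reverse comparison starts from \<open>H\<close>, whose nilpotency modulo Q
    is not assumed but inherited.\<close>
  have sH: "H.nilQ s" by (rule env_pair.nilQ_transfer[OF LH s])
  obtain \<psi> where \<psi>: "\<psi> \<in> restricted_lie_hom F L H.MM" "\<psi> ` carrier L = carrier H.MM"
    using env_pair.AA_generated[OF LH G0] env_pair.comparison_exists[OF LH s] by meson
  obtain \<psi>' where \<psi>': "\<psi>' \<in> restricted_lie_hom F H L.MM" "\<psi>' ` carrier H = carrier L.MM"
    using L.AA_generated_self[OF G0] env_pair.comparison_exists[OF HL sH] by meson
  obtain g where g: "g \<in> restricted_lie_hom F L.MM H.MM" "g ` carrier L.MM = carrier H.MM"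
    using L.quot_lie_lift[OF L.JJ_ideal H.MM \<psi>(1) HM.hom_kills_JJ[OF assms(4) \<psi>(1)]] \<psi>(2) by auto
  obtain g' where g': "g' \<in> restricted_lie_hom F H.MM L.MM" "g' ` carrier H.MM = carrier L.MM"
    using H.quot_lie_lift[OF H.JJ_ideal L.MM \<psi>'(1) LM.hom_kills_JJ[OF assms(7) \<psi>'(1)]] \<psi>'(2) by auto
  have fdL: "vectorspace.fin_dim F L.MM"
    using fin_dim_image(1)[OF assms(4) L.MM L.qJ_hom] L.MM_carrier assms(5) by simp
  \<comment> \<open>Finite dimension of \<open>H/J\<close> is inherited through the surjection; the
    opposite surjection then bounds the dimension of \<open>L/J\<close>.\<close>
  have fdH: "vectorspace.fin_dim F H.MM" by (rule fin_dim_image(1)[OF L.MM H.MM g fdL])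
  have dim: "vectorspace.dim F L.MM \<le> vectorspace.dim F H.MM" by (rule fin_dim_image(2)[OF H.MM L.MM g' fdH])
  interpret T: linear_map F L.MM H.MM g by (rule linear_mapI[OF L.MM H.MM g(1)])
  have "bij_betw g (carrier L.MM) (carrier H.MM)"
    unfolding bij_betw_def using T.surj_dim_le_imp_inj[OF fdL g(2) dim] g(2) by simp
  hence "g \<in> restricted_lie_iso F L.MM H.MM"
    using g(1) unfolding restricted_lie_iso_def restricted_lie_hom_def by simp
  thus ?thesis by blast
qed

end
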